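(* Let $\mathfrak g=B_2$, $\alpha^*=-\frac\gamma2\omega_2^\vee$ and $\alpha_2=-\gamma\omega_1^\vee$, where $(\omega_1^\vee,\omega_2^\vee)$ is the basis dual to the simple roots $(e_1,e_2)$. Let $\alpha_1,\alpha_3\in\mathbb C^2$ be such that, for some non-negative integers $n_1,n_2$, the neutrality condition $\alpha^*+\alpha_1+\alpha_2+\alpha_3-2Q=-\gamma(n_1e_1+n_2e_2)$ holds, and assume that the correlation function $\langle V_{\alpha^*}(z)V_{\alpha_1}(0)V_{\alpha_2}(1)V_{\alpha_3}(\infty)\rangle_\gamma$ is well-defined. Then it is a solution of a Fuchsian differential equation of order $4$: setting $$\mathcal H(z)=|z|^{\langle\alpha^*,\alpha_1\rangle}|z-1|^{\langle\alpha^*,\alpha_2\rangle}\langle V_{\alpha^*}(z)V_{\alpha_1}(0)V_{\alpha_2}(1)V_{\alpha_3}(\infty)\rangle_\gamma,$$ one has $\mathcal D(\boldsymbol\alpha,z)\mathcal H(z)=0$ for $z\in\mathbb C\setminus\{0,1\}$, where for some coefficients $A_k,B_k,\tilde A_k,\tilde B_k$ ($1\le k\le4$) independent of $z$ (explicit in terms of $\gamma$ and $\boldsymbol\alpha$), $\mathcal D(\boldsymbol\alpha,z)$ is the Fuchsian differential operator $$\mathcal D(\boldsymbol\alpha,z)=z^2\prod_{k=1}^4(z\partial_z+A_k)+\prod_{k=1}^4(z\partial_z+B_k-1)-z\left(\prod_{k=1}^4(z\partial_z+\tilde A_k)+\prod_{k=1}^4(z\partial_z+\tilde B_k-1)\r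ight).$$
   Context: Root data for $B_2$: $\langle e_1,e_1\rangle=2$, $\langle e_2,e_2\rangle=1$, $\langle e_1,e_2\rangle=-1$; $\omega_1^\vee=e_1+e_2$, $\omega_2^\vee=e_1+2e_2$; fundamental weights $\omega_1=\omega_1^\vee$, $\omega_2=\frac12\omega_2^\vee$. $\langle\cdot,\cdot\rangle$ is extended bilinearly to $\mathbb C^2$. For the coupling constant $\gamma\in\mathbb C\setminus\{0\}$, $Q=\gamma(\omega_1+\omega_2)+\frac2\gamma(\omega_1^\vee+\omega_2^\vee)$. Under the neutrality condition, with $n=n_1+n_2$ and $e_{x_j}=e_1$ for $j\le n_1$, $e_{x_j}=e_2$ for $n_1<j\le n$, the correlation function (with $V_{\alpha_3}(\infty)$ meaning the limit $\lim_{w\to\infty}|w|^{4\Delta_{\alpha_3}}\langle\cdots V_{\alpha_3}(w)\rangle_\gamma$, $\Delta_\alpha=\langle\frac\alpha2,Q-\frac\alpha2\rangle$) is the Dotsenko–Fateev type integral $$\langle V_{\alpha^*}(z)V_{\alpha_1}(0)V_{\alpha_2}(1)V_{\alpha_3}(\infty)\rangle_\gamma=|z|^{-\langle\alpha^*,\alpha_1\rangle}|z-1|^{-\langle\alpha^*,\alpha_2\rangle}\int_{\mathbb C^n}\prod_{j=1}^n|x_j-z|^{-\langle\alpha^*,\gamma e_{x_j}\rangle}|x_j|^{-\langle\alpha_1,\gamma e_{x_j}\rangle}|x_j-1|^{-\langle\alpha_2,\gamma e_{x_j}\rangle}\prod_{i<j}|x_i-x_j|^{-\langle\gamma e_{x_i},\gamma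 e_{x_j}\rangle}\,d^2x_1\cdots d^2x_n,$$ and it is well-defined when this integral is absolutely convergent. $\partial_z$ is the holomorphic (Wirtinger) derivative. "Fuchsian" means that all singular points ($0,1,\infty$) are regular singular points. *)

theory Defs
  imports "HOL-Complex_Analysis.Complex_Analysis"
begin

section \<open>Root data of type B2\<close>

text \<open>The simple roots are realised in the standard coordinates of \<open>\<complex>\<^sup>2\<close>, in which the
  bilinear (not sesquilinear) extension of the scalar product is the plain dot product.\<close>

definition form :: "complex^2 \<Rightarrow> complex^2 \<Rightarrow> complex" where
  "form u v = (\<Sum>i\<in>UNIV. u $ i * v $ i)"

definition root1 :: "complex^2" where "root1 = vector [1, -1]"
definition root2 :: "complex^2" where "root2 = vector [0, 1]"

definition coweight1 :: "complex^2" where "coweight1 = root1 + root2"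
definition coweight2 :: "complex^2" where "coweight2 = root1 + 2 *s root2"

definition weight1 :: "complex^2" where "weight1 = coweight1"
definition weight2 :: "complex^2" where "weight2 = (1/2) *s coweight2"

lemma form_roots:
  "form root1 root1 = 2" "form root2 root2 = 1" "form root1 root2 = -1" "form root2 root1 = -1"
  by (simp_all add: form_def root1_def root2_def sum_2)

lemma form_coweights_roots:
  "form coweight1 root1 = 1" "form coweight1 root2 = 0"
  "form coweight2 root1 = 0" "form coweight2 root2 = 1"
  by (simp_all add: form_def coweight1_def coweight2_def root1_def root2_def sum_2)

definition background_charge :: "complex \<Rightarrow> complex^2" where
  "background_charge \<gamma> = \<gamma> *s (weight1 + weight2) + (2 / \<gamma>) *s (coweight1 + coweight2)"

section \<open>The correlation function as a Dotsenko--Fateev integral\<close>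

text \<open>\<open>\<bar>x\<bar>\<^sup>s\<close> for a complex exponent \<open>s\<close>; the base is a nonnegative real number, so the principal
  branch is the intended value. At \<open>x = 0\<close> the value is \<open>0\<close>.\<close>

definition abs_powr :: "complex \<Rightarrow> complex \<Rightarrow> complex" where
  "abs_powr x s = complex_of_real (cmod x) powr s"

text \<open>The integration variables are indexed from \<open>0\<close>: the first \<open>n1\<close> of them carry \<open>root1\<close>, the
  remaining ones \<open>root2\<close>.\<close>

definition screening_root :: "nat \<Rightarrow> nat \<Rightarrow> complex^2" where
  "screening_root n1 j = (if j < n1 then root1 else root2)"

definition DF_integrand ::
  "complex \<Rightarrow> complex^2 \<Rightarrow> complex^2 \<Rightarrow> complex^2 \<Rightarrow> nat \<Rightarrow> nat \<Rightarrow> complex \<Rightarrow> (nat \<Rightarrow> complex) \<Rightarrow> complex"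
where
  "DF_integrand \<gamma> \<alpha>s \<alpha>1 \<alpha>2 n1 n2 z x =
     (\<Prod>j<n1 + n2. abs_powr (x j - z) (- form \<alpha>s (\<gamma> *s screening_root n1 j)) *
                   abs_powr (x j) (- form \<alpha>1 (\<gamma> *s screening_root n1 j)) *
                   abs_powr (x j - 1) (- form \<alpha>2 (\<gamma> *s screening_root n1 j))) *
     (\<Prod>j<n1 + n2. \<Prod>i<j. abs_powr (x i - x j)
        (- form (\<gamma> *s screening_root n1 i) (\<gamma> *s screening_root n1 j)))"

definition DF_measure :: "nat \<Rightarrow> (nat \<Rightarrow> complex) measure" where
  "DF_measure n = (\<Pi>\<^sub>M j\<in>{..<n}. lborel)"

text \<open>Integrability in the Bochner sense is absolute convergence of the integral.\<close>

definition correlation_well_defined ::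
  "complex \<Rightarrow> complex^2 \<Rightarrow> complex^2 \<Rightarrow> complex^2 \<Rightarrow> nat \<Rightarrow> nat \<Rightarrow> complex \<Rightarrow> bool"
where
  "correlation_well_defined \<gamma> \<alpha>s \<alpha>1 \<alpha>2 n1 n2 z \<longleftrightarrow>
     integrable (DF_measure (n1 + n2)) (DF_integrand \<gamma> \<alpha>s \<alpha>1 \<alpha>2 n1 n2 z)"

text \<open>The correlation function with insertions \<open>\<alpha>s\<close> at \<open>z\<close>, \<open>\<alpha>1\<close> at \<open>0\<close>, \<open>\<alpha>2\<close> at \<open>1\<close> and a charge
  at infinity. The latter is determined by the others and \<open>n1\<close>, \<open>n2\<close> through the neutrality
  condition, and does not enter the integral otherwise.\<close>

definition correlation ::
  "complex \<Rightarrow> complex^2 \<Rightarrow> complex^2 \<Rightarrow> complex^2 \<Rightarrow> nat \<Rightarrow> nat \<Rightarrow> complex \<Rightarrow> complex"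
where
  "correlation \<gamma> \<alpha>s \<alpha>1 \<alpha>2 n1 n2 z =
     abs_powr z (- form \<alpha>s \<alpha>1) * abs_powr (z - 1) (- form \<alpha>s \<alpha>2) *
     (\<integral>x. DF_integrand \<gamma> \<alpha>s \<alpha>1 \<alpha>2 n1 n2 z x \<partial>DF_measure (n1 + n2))"

definition reduced_correlation ::
  "complex \<Rightarrow> complex^2 \<Rightarrow> complex^2 \<Rightarrow> complex^2 \<Rightarrow> nat \<Rightarrow> nat \<Rightarrow> complex \<Rightarrow> complex"
where
  "reduced_correlation \<gamma> \<alpha>s \<alpha>1 \<alpha>2 n1 n2 z =
     abs_powr z (form \<alpha>s \<alpha>1) * abs_powr (z - 1) (form \<alpha>s \<alpha>2) *
     correlation \<gamma> \<alpha>s \<alpha>1 \<alpha>2 n1 n2 z"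

section \<open>Differential operators\<close>

text \<open>The Wirtinger derivative \<open>(\<partial>\<^sub>x - \<i> \<partial>\<^sub>y) / 2\<close>. Its value is only meaningful where the function
  is real differentiable.\<close>

definition wirtinger :: "(complex \<Rightarrow> complex) \<Rightarrow> complex \<Rightarrow> complex" where
  "wirtinger f z =
     (frechet_derivative f (at z) 1 - \<i> * frechet_derivative f (at z) \<i>) / 2"

definition euler_op :: "complex \<Rightarrow> (complex \<Rightarrow> complex) \<Rightarrow> complex \<Rightarrow> complex" where
  "euler_op c f = (\<lambda>z. z * wirtinger f z + c * f z)"

definition euler_prod :: "(nat \<Rightarrow> complex) \<Rightarrow> (complex \<Rightarrow> complex) \<Rightarrow> complex \<Rightarrow> complex" where
  "euler_prod a = euler_op (a 1) \<circ> euler_op (a 2) \<circ> euler_op (a 3) \<circ> euler_op (a 4)"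

definition BPZ_operator ::
  "(nat \<Rightarrow> complex) \<Rightarrow> (nat \<Rightarrow> complex) \<Rightarrow> (nat \<Rightarrow> complex) \<Rightarrow> (nat \<Rightarrow> complex) \<Rightarrow>
   (complex \<Rightarrow> complex) \<Rightarrow> complex \<Rightarrow> complex"
where
  "BPZ_operator A B At Bt f = (\<lambda>z.
     z\<^sup>2 * euler_prod A f z + euler_prod (\<lambda>k. B k - 1) f z
     - z * (euler_prod At f z + euler_prod (\<lambda>k. Bt k - 1) f z))"

text \<open>Near \<open>a\<close> the operator has the form
  \<open>c(z) (\<partial>\<^sup>m + p\<^bsub>m-1\<^esub>(z) \<partial>\<^bsup>m-1\<^esup> + \<dots> + p\<^sub>0(z))\<close> with \<open>p\<^sub>i\<close> having a pole of order at most \<open>m - i\<close>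
  at \<open>a\<close>, i.e. \<open>a\<close> is an ordinary or a regular singular point of an operator of order \<open>m\<close>. Testing
  against holomorphic functions determines the coefficients.\<close>

definition at_most_regular_singular ::
  "nat \<Rightarrow> ((complex \<Rightarrow> complex) \<Rightarrow> complex \<Rightarrow> complex) \<Rightarrow> complex \<Rightarrow> bool"
where
  "at_most_regular_singular m D a \<longleftrightarrow>
     (\<exists>r>0. \<exists>c q. c holomorphic_on (ball a r - {a}) \<and> (\<forall>z\<in>ball a r - {a}. c z \<noteq> 0) \<and>
        (\<forall>i<m. q i holomorphic_on ball a r) \<and>
        (\<forall>f. f holomorphic_on (ball a r - {a}) \<longrightarrow>
          (\<forall>z\<in>ball a r - {a}.
             D f z = c z * ((deriv ^^ m) f z +
                            (\<Sum>i<m. q i z / (z - a) ^ (m - i) * (deriv ^^ i) f z)))))"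

text \<open>The operator in the coordinate \<open>w = 1/z\<close> at infinity.\<close>

definition op_at_infinity ::
  "((complex \<Rightarrow> complex) \<Rightarrow> complex \<Rightarrow> complex) \<Rightarrow> (complex \<Rightarrow> complex) \<Rightarrow> complex \<Rightarrow> complex"
where
  "op_at_infinity D g = (\<lambda>w. D (\<lambda>z. g (1 / z)) (1 / w))"

definition fuchsian :: "nat \<Rightarrow> ((complex \<Rightarrow> complex) \<Rightarrow> complex \<Rightarrow> complex) \<Rightarrow> bool" where
  "fuchsian m D \<longleftrightarrow>
     (\<forall>a. at_most_regular_singular m D a) \<and> at_most_regular_singular m (op_at_infinity D) 0"

end

theory Submission
 imports Defs "HOL-Combinatorics.Stirling" "HOL-Computational_Algebra.Fundamental_Theorem_Algebra"
begin

text \<open>The function \<open>H\<close> is an integral of products of powers \<open>\<bar>u - v\<bar>\<close>. Inserting into it forests of factors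
\<open>u / (u - v)\<close> gives a finite family of functions, the brackets. Integrating by parts along the dilation of
a subset of the points expresses the Euler operator on one bracket through others, and the partial
fraction identities between the factors close this system: eliminating all brackets but \<open>H\<close> leaves
an equation of order four. The brackets may diverge at the given exponents, so the real parts of all
exponents are first multiplied by a small \<open>s > 0\<close>; absolute convergence at \<open>s = 1\<close> is then
inherited by all forests. The resulting equation is holomorphic in \<open>s\<close> (after moving the points
near \<open>z\<close> along with \<open>z\<close>) and is continued back to \<open>s = 1\<close>.\<close>

text \<open>The order is four because the charge at \<open>z\<close> is - \<gamma> times
  \<open>weight2\<close>, the highest weight of the spin representation. Its other weights are
  reached by subtracting \<open>root2\<close>, \<open>root1\<close>, \<open>root2\<close> in turn,
  and the brackets \<open>F1\<close>, \<open>F2\<close>, \<open>F3\<close> hang paths with these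
  labels on \<open>z\<close>. The exponents belonging to these charges make the surplus terms of
  each integration by parts cancel when two variables of the same kind are exchanged. The point 1 is
  the obstacle. A path from \<open>z\<close> to 1 is no forest: it joins two fixed points and so has
  one edge more than it has variables. A partial fraction identity rewrites it as z / (z - 1) times
  a sum of forests. This is used for two brackets, \<open>K2\<close> and \<open>K3\<close>, hence
  the degree two of the operator in z and its leading coefficient z^4 (z - 1)^2. The contraction of
  the real parts is real-linear in the exponents. All exponents between two points are real
  multiples of a single number h, so their ratios and the cancellations resting on them survive for
  every s. No integration by parts is performed at s = 1; only the integrability and smoothness of
  the original integral are used there.\<close>

type_synonym conf = "nat \<Rightarrow> complex"

type_synonym pairing = "nat \<Rightarrow> nat \<Rightarrow> complex"

type_synonym graph = "(nat \<times> nat) list"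

abbreviation lnc :: "complex \<Rightarrow> real" where "lnc w \<equiv> ln (cmod w)"

lemmas integrable_add' = Bochner_Integration.integrable_add

section \<open>Functions holomorphic in two variables\<close>

lemma norm_deriv_le:
 assumes "f holomorphic_on ball w r" "continuous_on (cball w r) f" "r > 0"
  "\<And>u. u \<in> cball w r \<Longrightarrow> norm (f u) \<le> C"
 shows "norm (deriv f w) \<le> C / r"
 using Cauchy_inequality[of f w r C 1] assms by (auto simp: dist_norm)

text \<open>Compactness of a closed disc makes \<open>G\<close> at parameters near \<open>t0\<close>
  uniformly close to \<open>G\<close> at \<open>t0\<close>. Cauchy's estimate turns this into
  closeness of derivatives, and continuity in \<open>w\<close> at the fixed \<open>t0\<close>
  completes the argument.\<close>

lemma continuous_on_deriv_param:
 fixes G :: "complex \<Rightarrow> complex \<Rightarrow> complex"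
 assumes U: "open U" and G: "continuous_on (U \<times> T) (\<lambda>(w, t). G w t)"
  and hol: "\<And>t. t \<in> T \<Longrightarrow> (\<lambda>w. G w t) holomorphic_on U"
 shows "continuous_on (U \<times> T) (\<lambda>(w, t). deriv (\<lambda>w. G w t) w)"
 unfolding continuous_on_iff
proof (intro ballI allI impI, clarify)
 fix w0 t0 and e :: real assume w0: "w0 \<in> U" and t0: "t0 \<in> T" and e: "e > 0"
 obtain q where q: "q > 0" "cball w0 q \<subseteq> U" using U w0 open_contains_cball by blast
 define r where "r = q / 2"
 have r: "r > 0" "cball w0 (2 * r) \<subseteq> U" using q by (auto simp: r_def)
 have cont: "continuous_on (T \<times> cball w0 (2 * r)) (\<lambda>(t, w). G w t)"
  using continuous_on_compose2[OF G, of "T \<times> cball w0 (2 * r)" "\<lambda>(t, w). (w, t)"] r(2)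
  by (fastforce simp: split_beta intro!: continuous_intros)
 obtain X where X: "t0 \<in> X" "open X"
  "\<forall>t \<in> X \<inter> T. \<forall>w \<in> cball w0 (2 * r). dist (G w t) (G w t0) \<le> e * r / 4"
  using continuous_on_prod_compactE[OF cont compact_cball t0, of "e * r / 4"] e r(1) by auto
 have cd: "continuous_on U (deriv (\<lambda>w. G w t0))"
  using holomorphic_on_imp_continuous_on holomorphic_deriv[OF hol[OF t0] U] by blast
 obtain d where d: "d > 0" "\<And>w. w \<in> U \<Longrightarrow> dist w w0 < d \<Longrightarrow> dist (deriv (\<lambda>w. G w t0) w) (deriv (\<lambda>w. G w t0) w0) < e / 2"
  using cd[unfolded continuous_on_iff] w0 e by (metis half_gt_zero)
 obtain d' where d': "d' > 0" "ball t0 d' \<subseteq> X" using X open_contains_ball by blast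
 show "\<exists>d>0. \<forall>x'\<in>U \<times> T. dist x' (w0, t0) < d \<longrightarrow>
     dist (case x' of (w, t) \<Rightarrow> deriv (\<lambda>w. G w t) w) (deriv (\<lambda>w. G w t0) w0) < e"
 proof (intro exI[of _ "min (min d d') r"] conjI ballI impI, use d d' r in simp, clarify)
  fix w t assume w: "w \<in> U" and t: "t \<in> T" and D: "dist (w, t) (w0, t0) < min (min d d') r"
  have dw: "dist w w0 < min (min d d') r" and dt: "dist t t0 < min (min d d') r"
   using D dist_fst_le[of "(w,t)" "(w0,t0)"] dist_snd_le[of "(w,t)" "(w0,t0)"] by auto
  have tX: "t \<in> X" using dt d' by (auto simp: dist_commute)
  have sub: "cball w r \<subseteq> cball w0 (2 * r)"
  proof
   fix u assume "u \<in> cball w r"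
   then show "u \<in> cball w0 (2 * r)" using dw dist_triangle[of w0 u w] by (auto simp: dist_commute)
  qed
  have hd: "(\<lambda>w. G w t - G w t0) holomorphic_on U" using hol t t0 by (intro holomorphic_intros) auto
  have "norm (deriv (\<lambda>w. G w t - G w t0) w) \<le> (e * r / 4) / r"
  proof (rule norm_deriv_le)
   show "(\<lambda>w. G w t - G w t0) holomorphic_on ball w r"
    using hd sub r(2) ball_subset_cball by (metis holomorphic_on_subset subset_trans)
   show "continuous_on (cball w r) (\<lambda>w. G w t - G w t0)"
    using hd sub r(2) by (meson continuous_on_subset holomorphic_on_imp_continuous_on subset_trans)
   show "norm (G u t - G u t0) \<le> e * r / 4" if "u \<in> cball w r" for u
    using X(3) tX t that sub by (auto simp: dist_norm)
  qed (rule r(1))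
  moreover have "deriv (\<lambda>w. G w t - G w t0) w = deriv (\<lambda>w. G w t) w - deriv (\<lambda>w. G w t0) w"
   by (intro deriv_diff holomorphic_on_imp_differentiable_at[OF _ U w] hol t t0)
  ultimately have "dist (deriv (\<lambda>w. G w t) w) (deriv (\<lambda>w. G w t0) w) \<le> e / 4"
   using r(1) by (simp add: dist_norm)
  moreover have "dist (deriv (\<lambda>w. G w t0) w) (deriv (\<lambda>w. G w t0) w0) < e / 2" using d(2) w dw by auto
  ultimately show "dist (deriv (\<lambda>w. G w t) w) (deriv (\<lambda>w. G w t0) w0) < e"
   using dist_triangle[of "deriv (\<lambda>w. G w t) w" "deriv (\<lambda>w. G w t0) w0" "deriv (\<lambda>w. G w t0) w"] e by linarith
 qed
qed

text \<open>Joint continuity with separate holomorphy amounts to holomorphy in two variables. In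
  this form it passes through parameter integrals and derivatives by one-variable theorems
  alone.\<close>

definition biholo :: "(complex \<Rightarrow> complex \<Rightarrow> complex) \<Rightarrow> complex set \<Rightarrow> complex set \<Rightarrow> bool" where
 "biholo G U T \<longleftrightarrow> continuous_on (U \<times> T) (\<lambda>(w, t). G w t) \<and>
   (\<forall>t\<in>T. (\<lambda>w. G w t) holomorphic_on U) \<and> (\<forall>w\<in>U. G w holomorphic_on T)"

lemma biholoD:
 assumes "biholo G U T"
 shows "continuous_on (U \<times> T) (\<lambda>(w, t). G w t)" "\<And>t. t \<in> T \<Longrightarrow> (\<lambda>w. G w t) holomorphic_on U"
  "\<And>w. w \<in> U \<Longrightarrow> G w holomorphic_on T"
 using assms by (auto simp: biholo_def)

lemma biholo_swap: "biholo G U T \<Longrightarrow> biholo (\<lambda>t w. G w t) T U"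
 unfolding biholo_def
 by (auto intro!: continuous_on_compose2[of "U \<times> T" "\<lambda>(w, t). G w t" "T \<times> U" "\<lambda>(t, w). (w, t)", unfolded split_beta fst_conv snd_conv]
   continuous_intros simp: split_beta)

lemma biholo_mono: "biholo G U T \<Longrightarrow> U' \<subseteq> U \<Longrightarrow> T' \<subseteq> T \<Longrightarrow> biholo G U' T'"
 unfolding biholo_def by (meson Sigma_mono continuous_on_subset holomorphic_on_subset subsetD)

lemma biholo_deriv:
 assumes "biholo G U T" "open U" "open T"
 shows "biholo (\<lambda>w t. deriv (\<lambda>w. G w t) w) U T"
 unfolding biholo_def
proof (intro conjI ballI)
 note G = biholoD[OF assms(1)]
 show "continuous_on (U \<times> T) (\<lambda>(w, t). deriv (\<lambda>w. G w t) w)"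
  using continuous_on_deriv_param[OF assms(2) G(1) G(2)] by blast
 show "deriv (\<lambda>w. G w t) holomorphic_on U" if "t \<in> T" for t
  using G(2)[OF that] assms(2) by (rule holomorphic_deriv)
 fix w assume w: "w \<in> U"
 obtain r where r: "r > 0" "cball w r \<subseteq> U" using assms(2) w open_contains_cball by blast
 have "(\<lambda>t. deriv (\<lambda>w. G w t) w) holomorphic_on ball t0 q" if q: "q > 0" "ball t0 q \<subseteq> T" for t0 q
 proof -
  define c where "c = circlepath w r"
  \<comment> \<open>Cauchy's formula for the derivative, written over the parameter of the circle.
    The kernel and the velocity of the circle, collected in \<open>k\<close>, do not involve
    \<open>t\<close>, so differentiation in \<open>t\<close> goes under the integral.\<close>
  define k where "k \<theta> = vector_derivative c (at \<theta>) / (c \<theta> - w)^2 / (2 * pi * \<i>)" for \<theta> :: real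
  have cin: "c \<theta> \<in> U" "c \<theta> \<noteq> w" for \<theta>
   using r by (auto simp: c_def circlepath intro!: subsetD[OF r(2)]) (simp add: dist_norm norm_mult)
  have eq: "deriv (\<lambda>w. G w t) w = integral (cbox 0 1) (\<lambda>\<theta>. G (c \<theta>) t * k \<theta>)" if "t \<in> ball t0 q" for t
  proof -
   have h: "(\<lambda>w. G w t) holomorphic_on U" using G(2) that q by blast
   have "((\<lambda>u. G u t / (u - w) ^ 2) has_contour_integral (2 * pi * \<i> * deriv (\<lambda>w. G w t) w)) c"
   proof -
    have "(\<lambda>w. G w t) holomorphic_on ball w r"
     using h r(2) ball_subset_cball by (metis holomorphic_on_subset subset_trans)
    from Cauchy_has_contour_integral_higher_derivative_circlepath
      [OF continuous_on_subset[OF holomorphic_on_imp_continuous_on[OF h] r(2)] this, of w 1]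
    show ?thesis using r(1) unfolding c_def by (simp add: power2_eq_square)
   qed
   then have "contour_integral c (\<lambda>u. G u t / (u - w) ^ 2) = 2 * pi * \<i> * deriv (\<lambda>w. G w t) w"
    by (rule contour_integral_unique)
   then have "integral {0..1} (\<lambda>\<theta>. G (c \<theta>) t / (c \<theta> - w)^2 * vector_derivative c (at \<theta>)) = 2 * pi * \<i> * deriv (\<lambda>w. G w t) w"
    unfolding contour_integral_integral by simp
   moreover have "(\<lambda>\<theta>. G (c \<theta>) t * k \<theta>) = (\<lambda>\<theta>. (G (c \<theta>) t / (c \<theta> - w)^2 * vector_derivative c (at \<theta>)) / (2 * pi * \<i>))"
    by (auto simp: k_def fun_eq_iff)
   ultimately show ?thesis by (simp only: box_real integral_divide) simp
  qed
  have contc: "continuous_on UNIV c" unfolding c_def circlepath_def part_circlepath_def linepath_def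
   by (intro continuous_intros)
  have contk: "continuous_on UNIV k"
   unfolding k_def c_def vector_derivative_circlepath using cin[unfolded c_def]
   by (intro continuous_intros contc[unfolded c_def]) auto
  have "(\<lambda>t. integral (cbox 0 1) (\<lambda>\<theta>. G (c \<theta>) t * k \<theta>)) holomorphic_on ball t0 q"
  proof (rule leibniz_rule_holomorphic)
   show "((\<lambda>t. G (c \<theta>) t * k \<theta>) has_field_derivative deriv (G (c \<theta>)) t * k \<theta>) (at t within ball t0 q)"
    if "t \<in> ball t0 q" for t \<theta>
   proof -
    have "(G (c \<theta>) has_field_derivative deriv (G (c \<theta>)) t) (at t)"
     using G(3)[OF cin(1)] assms(3) that q(2) holomorphic_derivI by blast
    then show ?thesis by (auto intro!: derivative_eq_intros intro: has_field_derivative_at_within)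
   qed
   show "(\<lambda>\<theta>. G (c \<theta>) t * k \<theta>) integrable_on cbox 0 1" if "t \<in> ball t0 q" for t
   proof (intro integrable_continuous continuous_intros)
    have "continuous_on U (\<lambda>w. G w t)" using G(2) that q holomorphic_on_imp_continuous_on by blast
    then show "continuous_on (cbox 0 1) (\<lambda>\<theta>. G (c \<theta>) t)"
     by (rule continuous_on_compose2) (use cin contc in \<open>auto intro: continuous_on_subset\<close>)
    show "continuous_on (cbox 0 1) k" using contk continuous_on_subset by blast
   qed
   have "continuous_on (T \<times> U) (\<lambda>(t, w). deriv (\<lambda>t. G w t) t)"
    using biholo_swap[OF assms(1)] assms(3) by (intro continuous_on_deriv_param) (auto simp: biholo_def)
   have csnd: "continuous_on (ball t0 q \<times> cbox 0 1) (\<lambda>x. c (snd x))"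
    by (rule continuous_on_compose2[OF contc]) (auto intro!: continuous_intros)
   from \<open>continuous_on (T \<times> U) _\<close> continuous_on_compose2[of "T \<times> U" "\<lambda>(t, w). deriv (\<lambda>t. G w t) t", of "ball t0 q \<times> cbox 0 1" "\<lambda>x. (fst x, c (snd x))"]
   have "continuous_on (ball t0 q \<times> cbox 0 1) (\<lambda>x. deriv (G (c (snd x))) (fst x))"
    using cin q csnd continuous_on_Pair[OF continuous_on_fst[OF continuous_on_id] csnd]
    by (fastforce simp: split_beta)
   then show "continuous_on (ball t0 q \<times> cbox 0 1) (\<lambda>(t, \<theta>). deriv (G (c \<theta>)) t * k \<theta>)"
    unfolding split_beta by (intro continuous_intros continuous_on_compose2[OF contk continuous_on_snd]) auto
  qed simp
  then show ?thesis using eq by (subst holomorphic_cong) auto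
 qed
 then show "(\<lambda>t. deriv (\<lambda>w. G w t) w) holomorphic_on T"
  by (meson assms(3) at_within_open centre_in_ball field_differentiable_at_within holomorphic_onI
    holomorphic_on_imp_differentiable_at open_ball open_contains_ball_eq)
qed

lemma biholo_higher_deriv:
 assumes "biholo G U T" "open U" "open T"
 shows "biholo (\<lambda>w t. (deriv ^^ k) (\<lambda>w. G w t) w) U T"
proof (induction k)
 case (Suc k)
 from biholo_deriv[OF this assms(2,3)] show ?case by simp
qed (use assms in simp)

lemma biholo_has_derivative:
 assumes "biholo G U T" "open U" "open T" "w \<in> U" "t \<in> T"
 shows "((\<lambda>(w, t). G w t) has_derivative (\<lambda>(a, b). deriv (\<lambda>w. G w t) w * a + deriv (G w) t * b)) (at (w, t))"
proof -
 note G = biholoD[OF assms(1)]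
 obtain q where q: "q > 0" "ball t q \<subseteq> T" using assms open_contains_ball by blast
 have c2: "continuous_on (T \<times> U) (\<lambda>(t, w). deriv (\<lambda>t. G w t) t)"
  using biholo_swap[OF assms(1)] assms(3) by (intro continuous_on_deriv_param) (auto simp: biholo_def)
 have c2': "continuous_on (U \<times> ball t q) (\<lambda>(w, t). blinfun_mult_right (deriv (G w) t))"
 proof -
  have "continuous_on (U \<times> ball t q) (\<lambda>x. (snd x, fst x))" by (intro continuous_intros)
  then have "continuous_on (U \<times> ball t q) (\<lambda>x. deriv (G (fst x)) (snd x))"
   using continuous_on_compose2[OF c2, of "U \<times> ball t q" "\<lambda>x. (snd x, fst x)"] q by (fastforce simp: split_beta)
  then show ?thesis
   unfolding split_beta by (rule bounded_linear.continuous_on[OF bounded_linear_blinfun_mult_right])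
 qed
 have "((\<lambda>(w, t). G w t) has_derivative
   (\<lambda>(a, b). deriv (\<lambda>w. G w t) w * a + blinfun_apply (blinfun_mult_right (deriv (G w) t)) b)) (at (w, t) within U \<times> ball t q)"
 proof (rule has_derivative_partialsI)
  show "((\<lambda>w. G w t) has_derivative (*) (deriv (\<lambda>w. G w t) w)) (at w within U)"
   using holomorphic_derivI[OF G(2)[OF assms(5)] assms(2,4)] has_field_derivative_def has_derivative_at_withinI by blast
  show "(G x has_derivative blinfun_apply (blinfun_mult_right (deriv (G x) y))) (at y within ball t q)"
   if "x \<in> U" "y \<in> ball t q" for x y
   using holomorphic_derivI[OF G(3)[OF that(1)] assms(3), of y] that(2) q
   by (auto simp: has_field_derivative_def blinfun_mult_right.rep_eq intro: has_derivative_at_withinI)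
  show "continuous (at (w, t) within U \<times> ball t q) (\<lambda>(x, y). blinfun_mult_right (deriv (G x) y))"
   using c2' assms q by (simp add: continuous_on_eq_continuous_within)
 qed (use q in simp_all)
 moreover have "at (w, t) within U \<times> ball t q = at (w, t)"
  by (rule at_within_open) (use assms q in \<open>simp_all add: open_Times\<close>)
 ultimately show ?thesis by (simp add: blinfun_mult_right.rep_eq)
qed

lemma wirtinger_eqI:
 assumes "(f has_derivative (\<lambda>h. a * h + b * cnj h)) (at z)"
 shows "wirtinger f z = a"
 using frechet_derivative_at[OF assms, symmetric] by (simp add: wirtinger_def algebra_simps)

text \<open>Once a function of \<open>w\<close> is written as \<open>G w (cnj w)\<close> with
  independent arguments, its holomorphic and antiholomorphic derivatives are the two partial
  derivatives of \<open>G\<close>. Wirtinger derivatives of every order thus become complex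
  derivatives in the first argument.\<close>

lemma polarized_derivative:
 assumes G: "biholo G (ball 0 r) (ball 0 r)" and f: "\<And>w. w \<in> ball 0 r \<Longrightarrow> f (z0 + w) = G w (cnj w)"
  and w: "w \<in> ball 0 r"
 shows "(f has_derivative (\<lambda>h. deriv (\<lambda>u. G u (cnj w)) w * h + deriv (G w) (cnj w) * cnj h)) (at (z0 + w))"
proof -
 have cw: "cnj w \<in> ball 0 r" using w by (auto simp: dist_norm)
 have "((\<lambda>(w, t). G w t) \<circ> (\<lambda>z. (z - z0, cnj (z - z0))) has_derivative
   (\<lambda>(a, b). deriv (\<lambda>u. G u (cnj w)) w * a + deriv (G w) (cnj w) * b) \<circ> (\<lambda>h. (h, cnj h))) (at (z0 + w))"
  by (rule diff_chain_at, (rule derivative_eq_intros bounded_linear.has_derivative[OF bounded_linear_cnj] refl)+)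
   (use biholo_has_derivative[OF G _ _ w cw] in simp_all)
 then have "((\<lambda>z. G (z - z0) (cnj (z - z0))) has_derivative
   (\<lambda>h. deriv (\<lambda>u. G u (cnj w)) w * h + deriv (G w) (cnj w) * cnj h)) (at (z0 + w))"
  by (simp add: o_def)
 then show ?thesis
  by (rule has_derivative_transform_within_open[of _ _ _ _ "ball z0 r"])
   (use w f[of "_ - z0"] in \<open>auto simp: dist_norm norm_minus_commute\<close>)
qed

lemma polarized_wirtinger_power:
 assumes G: "biholo G (ball 0 r) (ball 0 r)" and f: "\<And>w. w \<in> ball 0 r \<Longrightarrow> f (z0 + w) = G w (cnj w)"
  and w: "w \<in> ball 0 r"
 shows "(wirtinger ^^ k) f (z0 + w) = (deriv ^^ k) (\<lambda>u. G u (cnj w)) w"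
 using w
proof (induction k arbitrary: w)
 case (Suc k)
 show ?case
  using wirtinger_eqI[OF polarized_derivative[OF biholo_higher_deriv[OF G] Suc.IH Suc.prems]] by simp
qed (use f in simp)

lemma polarized_wirtinger_differentiable:
 assumes G: "biholo G (ball 0 r) (ball 0 r)" and f: "\<And>w. w \<in> ball 0 r \<Longrightarrow> f (z0 + w) = G w (cnj w)"
  and w: "w \<in> ball 0 r"
 shows "(wirtinger ^^ k) f differentiable (at (z0 + w))"
 using polarized_derivative[OF biholo_higher_deriv[OF G, of k] polarized_wirtinger_power[OF G f] w]
 by (auto simp: differentiable_def)

section \<open>Integrals depending on parameters\<close>

lemma continuous_on_param_integral:
 fixes g :: "'s::metric_space \<Rightarrow> 'a \<Rightarrow> complex"
 assumes "\<And>x. x \<in> space M \<Longrightarrow> continuous_on S (\<lambda>s. g s x)"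
  and "\<And>s. s \<in> S \<Longrightarrow> g s \<in> borel_measurable M"
  and "\<And>s x. s \<in> S \<Longrightarrow> x \<in> space M \<Longrightarrow> norm (g s x) \<le> B x" and "integrable M B"
 shows "continuous_on S (\<lambda>s. \<integral>x. g s x \<partial>M)"
 unfolding continuous_on_sequentially comp_def
proof (intro allI ballI impI, elim conjE)
 fix u a assume a: "a \<in> S" and u: "\<forall>n. u n \<in> S" "u \<longlonglongrightarrow> a"
 show "(\<lambda>n. \<integral>x. g (u n) x \<partial>M) \<longlonglongrightarrow> (\<integral>x. g a x \<partial>M)"
 proof (rule integral_dominated_convergence[where w=B])
  show "AE x in M. (\<lambda>n. g (u n) x) \<longlonglongrightarrow> g a x"
   using assms(1) a u by (auto simp: continuous_on_sequentially comp_def)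
 qed (use assms a u in auto)
qed

text \<open>Cauchy's estimate on discs of radius \<open>r\<close> bounds the difference quotients at
  \<open>w\<close> by \<open>B x / r\<close>, so a bound on the integrand alone lets dominated
  convergence act on them.\<close>

lemma holomorphic_on_param_integral:
 assumes U: "open U" and hol: "\<And>x. x \<in> space M \<Longrightarrow> (\<lambda>w. g w x) holomorphic_on U"
  and meas: "\<And>w. w \<in> U \<Longrightarrow> g w \<in> borel_measurable M"
  and bound: "\<And>w x. w \<in> U \<Longrightarrow> x \<in> space M \<Longrightarrow> norm (g w x) \<le> B x" and B: "integrable M B"
 shows "(\<lambda>w. \<integral>x. g w x \<partial>M) holomorphic_on U"
 unfolding holomorphic_on_open[OF U]
proof
 fix w assume w: "w \<in> U"
 obtain q where q: "q > 0" "cball w q \<subseteq> U" using U w open_contains_cball by blast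
 define r where "r = q / 2"
 have r: "r > 0" "\<And>v. v \<in> cball w r \<Longrightarrow> cball v r \<subseteq> U" "cball w r \<subseteq> U"
 proof -
  show "r > 0" using q by (simp add: r_def)
  show "cball v r \<subseteq> U" if "v \<in> cball w r" for v
  proof
   fix u assume "u \<in> cball v r"
   then have "u \<in> cball w q" using that dist_triangle[of w u v] by (auto simp: r_def)
   then show "u \<in> U" using q by blast
  qed
  show "cball w r \<subseteq> U" using q by (auto simp: r_def)
 qed
 have int: "integrable M (g v)" if "v \<in> U" for v
  by (rule Bochner_Integration.integrable_bound[OF B]) (use that meas in \<open>auto intro!: AE_I2 order_trans[OF bound]\<close>)
 have lip: "norm (g v x - g w x) \<le> B x / r * norm (v - w)" if "v \<in> cball w r" "x \<in> space M" for v x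
 proof (rule field_differentiable_bound[of "cball w r" "\<lambda>w. g w x" "deriv (\<lambda>w. g w x)"])
  show "((\<lambda>w. g w x) has_field_derivative deriv (\<lambda>w. g w x) y) (at y within cball w r)" if "y \<in> cball w r" for y
   using holomorphic_derivI[OF hol[OF \<open>x \<in> space M\<close>] U] r(3) that has_field_derivative_at_within by blast
  show "norm (deriv (\<lambda>w. g w x) y) \<le> B x / r" if "y \<in> cball w r" for y
  proof (rule norm_deriv_le)
   have "(\<lambda>w. g w x) holomorphic_on cball y r"
    using hol[OF \<open>x \<in> space M\<close>] r(2)[OF that] holomorphic_on_subset by blast
   then show "continuous_on (cball y r) (\<lambda>w. g w x)" "(\<lambda>w. g w x) holomorphic_on ball y r"
    using holomorphic_on_imp_continuous_on holomorphic_on_subset ball_subset_cball by blast+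
   show "norm (g u x) \<le> B x" if "u \<in> cball y r" for u
    using bound r(2)[OF \<open>y \<in> cball w r\<close>] that \<open>x \<in> space M\<close> by blast
  qed (rule r(1))
 qed (use that r in auto)
 define D where "D x = deriv (\<lambda>w. g w x) w" for x
 have lim: "(\<lambda>n. (g (u n) x - g w x) / (u n - w)) \<longlonglongrightarrow> D x"
  if "x \<in> space M" "\<forall>n. u n \<noteq> w" "u \<longlonglongrightarrow> w" for x and u :: conf
  using holomorphic_derivI[OF hol[OF that(1)] U w] that
  unfolding has_field_derivative_iff D_def tendsto_at_iff_sequentially comp_def by auto
 have seq: "(\<lambda>n. ((\<integral>x. g (u n) x \<partial>M) - (\<integral>x. g w x \<partial>M)) / (u n - w)) \<longlonglongrightarrow> (\<integral>x. D x \<partial>M)"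
  if u: "\<forall>n. u n \<noteq> w" "u \<longlonglongrightarrow> w" for u
 proof -
  obtain n0 where n0: "\<And>n. n \<ge> n0 \<Longrightarrow> u n \<in> cball w r"
   using u(2) r(1) unfolding lim_sequentially by (metis dist_commute less_imp_le mem_cball)
  define u' where "u' n = u (n + n0)" for n
  have u': "\<forall>n. u' n \<noteq> w" "u' \<longlonglongrightarrow> w" "\<And>n. u' n \<in> cball w r"
   using u(1) n0 LIMSEQ_ignore_initial_segment[OF u(2), of n0] by (simp_all add: u'_def[abs_def])
  then have u'U: "u' n \<in> U" for n using r(3) by blast
  have "(\<lambda>n. \<integral>x. (g (u' n) x - g w x) / (u' n - w) \<partial>M) \<longlonglongrightarrow> (\<integral>x. D x \<partial>M)"
  proof (rule integral_dominated_convergence[where w="\<lambda>x. B x / r"])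
   show m: "(\<lambda>x. (g (u' n) x - g w x) / (u' n - w)) \<in> borel_measurable M" for n
    using meas[OF u'U] meas[OF w] by measurable
   show "D \<in> borel_measurable M"
    by (rule borel_measurable_LIMSEQ_metric[OF m lim[OF _ u'(1,2)]])
   show "AE x in M. norm ((g (u' n) x - g w x) / (u' n - w)) \<le> B x / r" for n
    using lip[OF u'(3)] u'(1) by (auto simp: norm_divide divide_le_eq)
  qed (use lim[OF _ u'(1,2)] B in auto)
  also have "(\<lambda>n. \<integral>x. (g (u' n) x - g w x) / (u' n - w) \<partial>M) = (\<lambda>n. ((\<integral>x. g (u' n) x \<partial>M) - (\<integral>x. g w x \<partial>M)) / (u' n - w))"
   by (rule ext) (simp add: int u'U w Bochner_Integration.integral_diff)
  finally show ?thesis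
   unfolding u'_def by (rule LIMSEQ_offset[where k=n0])
 qed
 show "\<exists>f'. ((\<lambda>w. \<integral>x. g w x \<partial>M) has_field_derivative f') (at w)"
  unfolding has_field_derivative_iff tendsto_at_iff_sequentially comp_def
  using seq by (intro exI[of _ "\<integral>x. D x \<partial>M"]) auto
qed

lemma biholo_param_integral:
 assumes "open U" "open T" and bih: "\<And>x. x \<in> space M \<Longrightarrow> biholo (\<lambda>w t. g w t x) U T"
  and meas: "\<And>w t. w \<in> U \<Longrightarrow> t \<in> T \<Longrightarrow> g w t \<in> borel_measurable M"
  and bound: "\<And>w t x. w \<in> U \<Longrightarrow> t \<in> T \<Longrightarrow> x \<in> space M \<Longrightarrow> norm (g w t x) \<le> B x" and B: "integrable M B"
 shows "biholo (\<lambda>w t. \<integral>x. g w t x \<partial>M) U T"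
 unfolding biholo_def
proof (intro conjI ballI)
 show "continuous_on (U \<times> T) (\<lambda>(w, t). \<integral>x. g w t x \<partial>M)"
  using continuous_on_param_integral[of M "U \<times> T" "\<lambda>(w, t). g w t" B] bih meas bound B
  by (auto simp: split_beta biholo_def)
 show "(\<lambda>w. \<integral>x. g w t x \<partial>M) holomorphic_on U" if "t \<in> T" for t
  by (rule holomorphic_on_param_integral[where B=B]) (use assms that in \<open>auto simp: biholo_def\<close>)
 show "(\<lambda>t. \<integral>x. g w t x \<partial>M) holomorphic_on T" if "w \<in> U" for w
  by (rule holomorphic_on_param_integral[where B=B]) (use assms that in \<open>auto simp: biholo_def\<close>)
qed

section \<open>Transformations of product measures\<close>

text \<open>On boxes the integral of a product density factorises, which reduces a coordinatewise
  change of variables to one coordinate. It serves for logarithms of moduli, their rescaling, the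
  cutoff translation and the dilation of some of the points.\<close>

lemma distr_density_PiM:
 assumes I: "finite I" and M: "sigma_finite_measure M" and N: "sigma_finite_measure N"
  and J: "\<And>i. i \<in> I \<Longrightarrow> J i \<in> borel_measurable M"
  and T: "\<And>i. i \<in> I \<Longrightarrow> T i \<in> measurable M N"
  and eq: "\<And>i. i \<in> I \<Longrightarrow> distr (density M (J i)) N (T i) = N"
 shows "distr (density (PiM I (\<lambda>_. M)) (\<lambda>x. \<Prod>i\<in>I. J i (x i))) (PiM I (\<lambda>_. N)) (\<lambda>x. \<lambda>i\<in>I. T i (x i)) = PiM I (\<lambda>_. N)"
proof -
 interpret M: product_sigma_finite "\<lambda>_. M" using M by (simp add: product_sigma_finite_def)
 interpret N: product_sigma_finite "\<lambda>_. N" using N by (simp add: product_sigma_finite_def)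
 note [measurable] = T J
 have comp: "(\<lambda>x. x i) \<in> measurable (PiM I (\<lambda>_. M)) M" if "i \<in> I" for i
  using that by (rule measurable_component_singleton)
 have Tm: "(\<lambda>x. \<lambda>i\<in>I. T i (x i)) \<in> measurable (PiM I (\<lambda>_. M)) (PiM I (\<lambda>_. N))"
  by (intro measurable_restrict measurable_compose[OF comp T])
 have Jm: "(\<lambda>x. \<Prod>i\<in>I. J i (x i)) \<in> borel_measurable (PiM I (\<lambda>_. M))"
  by (intro borel_measurable_prod_ennreal measurable_compose[OF comp J])
 show ?thesis
 proof (rule N.PiM_eqI[OF I])
  fix A assume A: "\<And>i. i \<in> I \<Longrightarrow> A i \<in> sets N"
  then have PA: "Pi\<^sub>E I A \<in> sets (PiM I (\<lambda>_. N))" using I by (intro sets_PiM_I_finite) auto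
  have "emeasure (distr (density (PiM I (\<lambda>_. M)) (\<lambda>x. \<Prod>i\<in>I. J i (x i))) (PiM I (\<lambda>_. N)) (\<lambda>x. \<lambda>i\<in>I. T i (x i))) (Pi\<^sub>E I A)
    = emeasure (density (PiM I (\<lambda>_. M)) (\<lambda>x. \<Prod>i\<in>I. J i (x i))) ((\<lambda>x. \<lambda>i\<in>I. T i (x i)) -` Pi\<^sub>E I A \<inter> space (PiM I (\<lambda>_. M)))"
   using Tm PA by (subst emeasure_distr) auto
  also have "\<dots> = (\<integral>\<^sup>+x. (\<Prod>i\<in>I. J i (x i)) * indicator ((\<lambda>x. \<lambda>i\<in>I. T i (x i)) -` Pi\<^sub>E I A \<inter> space (PiM I (\<lambda>_. M))) x \<partial>PiM I (\<lambda>_. M))"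
   using Jm measurable_sets[OF Tm PA] by (subst emeasure_density) auto
  also have "\<dots> = (\<integral>\<^sup>+x. (\<Prod>i\<in>I. J i (x i) * indicator (T i -` A i \<inter> space M) (x i)) \<partial>PiM I (\<lambda>_. M))"
  proof (rule nn_integral_cong)
   fix x assume x: "x \<in> space (PiM I (\<lambda>_. M))"
   have "indicator ((\<lambda>x. \<lambda>i\<in>I. T i (x i)) -` Pi\<^sub>E I A \<inter> space (PiM I (\<lambda>_. M))) x = (\<Prod>i\<in>I. indicator (T i -` A i \<inter> space M) (x i) :: ennreal)"
   proof (cases "\<forall>i\<in>I. T i (x i) \<in> A i")
    case True
    then have "(\<Prod>i\<in>I. indicator (T i -` A i \<inter> space M) (x i) :: ennreal) = 1"
     using x by (intro prod.neutral) (auto simp: space_PiM PiE_iff)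
    then show ?thesis using True x by (auto simp: PiE_iff)
   next
    case False
    then obtain i where "i \<in> I" "T i (x i) \<notin> A i" by blast
    then have "(\<Prod>i\<in>I. indicator (T i -` A i \<inter> space M) (x i) :: ennreal) = 0"
     using I by (intro prod_zero) (auto intro!: bexI[of _ i])
    then show ?thesis using False by (auto simp: PiE_iff)
   qed
   then show "(\<Prod>i\<in>I. J i (x i)) * indicator ((\<lambda>x. \<lambda>i\<in>I. T i (x i)) -` Pi\<^sub>E I A \<inter> space (PiM I (\<lambda>_. M))) x
     = (\<Prod>i\<in>I. J i (x i) * indicator (T i -` A i \<inter> space M) (x i))"
    by (simp add: prod.distrib)
  qed
  also have "\<dots> = (\<Prod>i\<in>I. \<integral>\<^sup>+y. J i y * indicator (T i -` A i \<inter> space M) y \<partial>M)"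
   using I A T J by (intro M.product_nn_integral_prod) (auto intro!: borel_measurable_times_ennreal borel_measurable_indicator measurable_sets)
  also have "\<dots> = (\<Prod>i\<in>I. emeasure N (A i))"
  proof (rule prod.cong[OF refl])
   fix i assume i: "i \<in> I"
   have "emeasure N (A i) = emeasure (distr (density M (J i)) N (T i)) (A i)" using eq[OF i] by simp
   also have "\<dots> = emeasure (density M (J i)) (T i -` A i \<inter> space M)"
    using T[OF i] A[OF i] by (subst emeasure_distr) auto
   also have "\<dots> = (\<integral>\<^sup>+y. J i y * indicator (T i -` A i \<inter> space M) y \<partial>M)"
    using J[OF i] measurable_sets[OF T[OF i] A[OF i]] by (subst emeasure_density) auto
   finally show "(\<integral>\<^sup>+y. J i y * indicator (T i -` A i \<inter> space M) y \<partial>M) = emeasure N (A i)" by simp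
  qed
  finally show "emeasure (distr (density (PiM I (\<lambda>_. M)) (\<lambda>x. \<Prod>i\<in>I. J i (x i))) (PiM I (\<lambda>_. N)) (\<lambda>x. \<lambda>i\<in>I. T i (x i))) (Pi\<^sub>E I A) = (\<Prod>i\<in>I. emeasure N (A i))" .
 qed simp
qed

section \<open>Change of variables in the complex plane\<close>

lemma distr_lborel_complex_of_vec:
 "distr lborel lborel (\<lambda>v :: real^2. Complex (v $ 1) (v $ 2)) = lborel"
proof -
 have m: "(\<lambda>v :: real^2. Complex (v $ 1) (v $ 2)) \<in> measurable lborel lborel"
  by (simp add: Complex_eq)
 have B: "(Basis :: (real^2) set) = {axis 1 1, axis 2 1}"
  by (auto simp: Basis_vec_def) (metis exhaust_2)
 have ne: "axis 1 1 \<noteq> (axis 2 1 :: real^2)" by (simp add: axis_eq_axis)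
 have "lborel = distr lborel lborel (\<lambda>v :: real^2. Complex (v $ 1) (v $ 2))"
 proof (rule lborel_eqI)
  fix l u :: complex assume lu: "\<And>b. b \<in> Basis \<Longrightarrow> l \<bullet> b \<le> u \<bullet> b"
  have "(\<lambda>v :: real^2. Complex (v $ 1) (v $ 2)) -` box l u = box (vector [Re l, Im l]) (vector [Re u, Im u])"
   by (auto simp: box_def Basis_complex_def B inner_axis inner_complex_def)
  moreover have "Re l \<le> Re u" "Im l \<le> Im u"
   using lu[of 1] lu[of \<i>] by (simp_all add: Basis_complex_def inner_complex_def)
  ultimately show "emeasure (distr lborel lborel (\<lambda>v :: real^2. Complex (v $ 1) (v $ 2))) (box l u) = (\<Prod>b\<in>Basis. (u - l) \<bullet> b)"
   using m ne
   by (subst emeasure_distr) (auto simp: emeasure_lborel_box_eq B Basis_complex_def inner_axis inner_complex_def)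
 qed simp
 then show ?thesis by simp
qed

text \<open>As a real-linear map, h |-> a h + b cnj h has determinant |a|^2 - |b|^2. The
  substitution is carried out in the real plane and transported by the coordinate maps
  \<open>c\<close> and \<open>d\<close>.\<close>

lemma distr_lborel_change_of_variables:
 fixes g :: "complex \<Rightarrow> complex"
 assumes der: "\<And>x. (g has_derivative (\<lambda>h. a x * h + b x * cnj h)) (at x)" and bij: "bij g"
  and m: "(\<lambda>x. (cmod (a x))\<^sup>2 - (cmod (b x))\<^sup>2) \<in> borel_measurable borel"
 shows "distr (density lborel (\<lambda>x. ennreal \<bar>(cmod (a x))\<^sup>2 - (cmod (b x))\<^sup>2\<bar>)) lborel g = lborel"
proof -
 define J where "J x = \<bar>(cmod (a x))\<^sup>2 - (cmod (b x))\<^sup>2\<bar>" for x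
 have Jm[measurable]: "J \<in> borel_measurable borel" using m unfolding J_def by measurable
 have contg: "continuous_on UNIV g"
  using der by (meson continuous_at_imp_continuous_on has_derivative_continuous)
 have gm[measurable]: "g \<in> borel_measurable borel" using contg by (rule borel_measurable_continuous_onI)
 define c where "c = (\<lambda>v :: real^2. Complex (v $ 1) (v $ 2))"
 define d where "d z = (vector [Re z, Im z] :: real^2)" for z
 have cd[simp]: "c (d z) = z" "d (c v) = v" for z v
  by (auto simp: c_def d_def vec_eq_iff forall_2)
 have dX: "d ` X = c -` X" for X
 proof (intro equalityI subsetI)
  fix v assume "v \<in> c -` X"
  then have "d (c v) \<in> d ` X" by blast
  then show "v \<in> d ` X" by simp
 qed auto
 have lin_c: "bounded_linear c" unfolding c_def Complex_eq
  by (intro bounded_linear_add bounded_linear_of_real bounded_linear_const_mult bounded_linear_vec_nth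
    bounded_linear_compose[OF bounded_linear_of_real] bounded_linear_compose[OF bounded_linear_mult_right] )
 have lin_d: "bounded_linear d"
 proof (rule linear_conv_bounded_linear[THEN iffD1], rule linearI)
 qed (auto simp: d_def vec_eq_iff forall_2)
 have cm[measurable]: "c \<in> borel_measurable borel" by (intro borel_measurable_continuous_onI linear_continuous_on lin_c)
 have eqJ: "(\<integral>\<^sup>+x. ennreal (J x) * indicator (g -` B) x \<partial>lborel) = emeasure lborel B" if B: "B = box l u" for B l u
 proof -
  have [measurable]: "B \<in> sets borel" using B by simp
  define S where "S = d ` (g -` B)"
  have S: "S = c -` (g -` B)" unfolding S_def by (rule dX)
  have Sm: "S \<in> sets borel" unfolding S
   using measurable_sets[OF cm, of "g -` B"] measurable_sets[OF gm, of B] by simp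
  define f where "f = (\<lambda>v. d (g (c v)))"
  have fS: "f ` S = d ` B"
  proof -
   have "f ` S = d ` (g ` (g -` B))" unfolding f_def S_def image_image by simp
   also have "g ` (g -` B) = B" using bij by (simp add: bij_is_surj surj_image_vimage_eq)
   finally show ?thesis .
  qed
  have dB: "d ` B = box (d l) (d u)"
  proof -
   have bas: "(Basis :: (real^2) set) = {axis 1 1, axis 2 1}" by (auto simp: Basis_vec_def) (metis exhaust_2)
   have "v \<in> box (d l) (d u) \<longleftrightarrow> c v \<in> box l u" for v
    by (auto simp: box_def Basis_complex_def bas inner_axis d_def c_def inner_complex_def)
   then show ?thesis unfolding B dX by blast
  qed
  define D where "D v = (\<lambda>h. d (a (c v) * c h + b (c v) * cnj (c h)))" for v
  have derf: "(f has_derivative D v) (at v)" for v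
   unfolding f_def D_def
   using diff_chain_at[OF diff_chain_at[OF bounded_linear_imp_has_derivative[OF lin_c] der] bounded_linear_imp_has_derivative[OF lin_d]]
   by (simp add: o_def)
  have det: "\<bar>det (matrix (D v))\<bar> = J (c v)" for v
  proof -
   have c1: "c (axis 1 1) = 1" "c (axis 2 1) = \<i>" by (auto simp: c_def axis_def complex_eq_iff)
   show ?thesis
    unfolding det_2 matrix_def J_def
    by (simp add: D_def c1 d_def cmod_power2) (simp add: algebra_simps power2_eq_square)
  qed
  have lm: "f ` S \<in> lmeasurable" unfolding fS dB by simp
  have "((\<lambda>v. \<bar>det (matrix (D v))\<bar>) has_integral measure lebesgue (f ` S)) S"
  proof (rule has_measure_differentiable_image[THEN iffD1])
   show "S \<in> sets lebesgue" using Sm by simp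
   show "inj_on f S" unfolding f_def inj_on_def using bij cd by (metis bij_is_inj inj_eq)
  qed (use lm has_derivative_at_withinI[OF derf] in auto)
  then have "((\<lambda>v. J (c v) * indicator S v) has_integral measure lebesgue (f ` S)) UNIV"
  proof -
   have "(\<lambda>v. J (c v) * indicator S v) = (\<lambda>v. if v \<in> S then J (c v) else 0)" by auto
   then show ?thesis
    using \<open>((\<lambda>v. \<bar>det (matrix (D v))\<bar>) has_integral measure lebesgue (f ` S)) S\<close>
    by (simp only: has_integral_restrict_UNIV det)
  qed
  then have "(\<integral>\<^sup>+v. ennreal (J (c v) * indicator S v) \<partial>lborel) = measure lebesgue (f ` S)"
  proof (rule nn_integral_has_integral_lborel[rotated 2])
   show "(\<lambda>v. J (c v) * indicator S v) \<in> borel_measurable borel"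
    using Sm measurable_compose[OF cm Jm] by (intro borel_measurable_times borel_measurable_indicator) auto
  qed (simp add: J_def)
  also have "ennreal (measure lebesgue (f ` S)) = emeasure lborel (d ` B)"
   unfolding fS dB using emeasure_lborel_box_finite[of "d l" "d u"]
   by (simp add: emeasure_eq_ennreal_measure less_top)
  also have "(\<integral>\<^sup>+v. ennreal (J (c v) * indicator S v) \<partial>lborel) = (\<integral>\<^sup>+v. ennreal (J (c v)) * indicator (g -` B) (c v) \<partial>lborel)"
   by (intro nn_integral_cong) (auto simp: S indicator_def)
  also have "\<dots> = (\<integral>\<^sup>+x. ennreal (J x) * indicator (g -` B) x \<partial>distr lborel lborel c)"
   using measurable_sets[OF gm, of B] by (subst nn_integral_distr) auto
  also have "distr lborel lborel c = lborel" unfolding c_def by (rule distr_lborel_complex_of_vec)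
  finally have "(\<integral>\<^sup>+x. ennreal (J x) * indicator (g -` B) x \<partial>lborel) = emeasure lborel (d ` B)" .
  also have "d ` B = c -` B" by (rule dX)
  also have "emeasure lborel (c -` B) = emeasure (distr lborel lborel c) B"
   by (subst emeasure_distr) auto
  also have "distr lborel lborel c = lborel" unfolding c_def by (rule distr_lborel_complex_of_vec)
  finally show ?thesis .
 qed
 have "lborel = distr (density lborel (\<lambda>x. ennreal (J x))) lborel g"
 proof (rule lborel_eqI)
  fix l u :: complex assume lu: "\<And>b. b \<in> Basis \<Longrightarrow> l \<bullet> b \<le> u \<bullet> b"
  have "emeasure (distr (density lborel (\<lambda>x. ennreal (J x))) lborel g) (box l u) = (\<integral>\<^sup>+x. ennreal (J x) * indicator (g -` box l u) x \<partial>lborel)"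
   using measurable_sets[OF gm, of "box l u"] by (simp add: emeasure_distr emeasure_density)
  also have "\<dots> = emeasure lborel (box l u)" by (rule eqJ[OF refl])
  finally show "emeasure (distr (density lborel (\<lambda>x. ennreal (J x))) lborel g) (box l u) = (\<Prod>b\<in>Basis. (u - l) \<bullet> b)"
   using lu by (simp add: emeasure_lborel_box_eq)
 qed simp
 then show ?thesis by (simp add: J_def)
qed

lemma distr_lborel_mult_complex:
 assumes "c \<noteq> (0 :: complex)"
 shows "distr (density lborel (\<lambda>_. ennreal ((cmod c)\<^sup>2))) lborel (\<lambda>x. c * x) = lborel"
proof -
 have "bij (\<lambda>x. c * x)" using assms by (intro bij_betw_byWitness[where f'="\<lambda>x. x / c"]) auto
 then show ?thesis
  using distr_lborel_change_of_variables[of "\<lambda>x. c * x" "\<lambda>_. c" "\<lambda>_. 0"]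
  by (simp add: bounded_linear.has_derivative[OF bounded_linear_mult_right])
qed

lemma nn_integral_lborel_mult_complex:
 assumes "c \<noteq> (0 :: complex)" "f \<in> borel_measurable borel"
 shows "(\<integral>\<^sup>+x. f x \<partial>lborel) = (\<integral>\<^sup>+x. ennreal ((cmod c)\<^sup>2) * f (c * x) \<partial>lborel)"
 using assms
 by (subst distr_lborel_mult_complex[OF assms(1), symmetric])
  (simp add: nn_integral_distr nn_integral_density)

section \<open>Logarithmic polar coordinates on cones\<close>

abbreviation "cone_weight A c w \<equiv> indicator (A :: complex set) w * ennreal (c / (cmod w)\<^sup>2)"

abbreviation "log_density \<omega> w \<equiv> \<omega> (lnc w) / (cmod w)\<^sup>2"

abbreviation "near_density \<omega> p r w \<equiv> log_density \<omega> w * (cmod (w - p) / max (cmod w) r) powr (- 3/2)"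

abbreviation "log_mass \<omega> \<equiv> \<integral>\<^sup>+w. ennreal (log_density \<omega> w) \<partial>lborel"

abbreviation "near_mass \<omega> p r \<equiv> \<integral>\<^sup>+w. ennreal (near_density \<omega> p r w) \<partial>lborel"

abbreviation "slow K \<omega> \<equiv> \<forall>s t :: real. \<omega> s \<le> exp (K * \<bar>s - t\<bar>) * (\<omega> t :: real)"

text \<open>Only the modulus is kept. The formula holds because the left-hand side defines a
 translation-invariant measure on the line.\<close>

lemma nn_integral_cone_ln:
 fixes A :: "complex set" and g :: "real \<Rightarrow> ennreal"
 assumes A[measurable]: "A \<in> sets borel" and A0: "0 \<notin> A" and cone: "\<And>t w. t > 0 \<Longrightarrow> of_real t * w \<in> A \<longleftrightarrow> w \<in> A"
  and g[measurable]: "g \<in> borel_measurable borel"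
  and c_def: "c = (\<integral>\<^sup>+w. cone_weight A 1 w * indicator {0..<1} (- lnc w) \<partial>lborel)"
 shows "(\<integral>\<^sup>+w. cone_weight A 1 w * g (lnc w) \<partial>lborel) = c * (\<integral>\<^sup>+\<rho>. g \<rho> \<partial>lborel)"
proof -
 define m where "m w = cone_weight A 1 w" for w :: complex
 have mm[measurable]: "m \<in> borel_measurable borel" unfolding m_def by measurable
 have lnm[measurable]: "lnc \<in> borel_measurable borel" by measurable
 have inv: "(\<integral>\<^sup>+w. m w * f (lnc w) \<partial>lborel) = (\<integral>\<^sup>+w. m w * f (lnc w + y) \<partial>lborel)"
  if [measurable]: "f \<in> borel_measurable borel" for f :: "real \<Rightarrow> ennreal" and y
 proof -
  have "(\<integral>\<^sup>+w. m w * f (lnc w) \<partial>lborel)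
    = (\<integral>\<^sup>+w. ennreal ((cmod (of_real (exp y)))\<^sup>2) * (m (of_real (exp y) * w) * f (ln (cmod (of_real (exp y) * w)))) \<partial>lborel)"
   by (rule nn_integral_lborel_mult_complex) auto
  also have "\<dots> = (\<integral>\<^sup>+w. m w * f (lnc w + y) \<partial>lborel)"
  proof (rule nn_integral_cong)
   fix w :: complex
   show "ennreal ((cmod (of_real (exp y)))\<^sup>2) * (m (of_real (exp y) * w) * f (ln (cmod (of_real (exp y) * w)))) = m w * f (lnc w + y)"
   proof (cases "w \<in> A")
    case True
    then have w: "w \<noteq> 0" using A0 by auto
    have "ennreal ((exp y)\<^sup>2) * m (of_real (exp y) * w) = m w"
     using True cone[of "exp y" w] w
     by (simp add: m_def norm_mult power_mult_distrib ennreal_mult''[symmetric])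
    moreover have "ln (cmod (of_real (exp y) * w)) = lnc w + y" using w by (simp add: norm_mult ln_mult)
    ultimately show ?thesis by (simp add: mult.assoc[symmetric])
   next
    case False
    then show ?thesis using cone[of "exp y" w] by (simp add: m_def)
   qed
  qed
  finally show ?thesis .
 qed
 \<comment> \<open>Uniqueness of translation-invariant measures made concrete: the left side is
   averaged over shifts by y in the unit interval, and Fubini's theorem leaves the mass of one
   annulus as the constant.\<close>
 define K :: "real \<Rightarrow> ennreal" where "K = indicator {0..<1}"
 have Km[measurable]: "K \<in> borel_measurable borel" unfolding K_def by measurable
 have K1: "(\<integral>\<^sup>+y. K y \<partial>lborel) = 1" by (simp add: K_def)
 have shift: "(\<integral>\<^sup>+y. g (t + y) * K y \<partial>lborel) = (\<integral>\<^sup>+y. g y * K (y - t) \<partial>lborel)" for t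
  using nn_integral_real_affine[of "\<lambda>y. g y * K (y - t)" 1 t] by simp
 have "(\<integral>\<^sup>+w. m w * g (lnc w) \<partial>lborel) = (\<integral>\<^sup>+w. m w * g (lnc w) \<partial>lborel) * (\<integral>\<^sup>+y. K y \<partial>lborel)"
  by (simp add: K1)
 also have "\<dots> = (\<integral>\<^sup>+y. (\<integral>\<^sup>+w. m w * g (lnc w) \<partial>lborel) * K y \<partial>lborel)"
  by (simp add: nn_integral_cmult)
 also have "\<dots> = (\<integral>\<^sup>+y. (\<integral>\<^sup>+w. m w * g (lnc w + y) * K y \<partial>lborel) \<partial>lborel)"
  by (rule nn_integral_cong) (simp add: nn_integral_multc inv[OF g, symmetric])
 also have "\<dots> = (\<integral>\<^sup>+w. (\<integral>\<^sup>+y. m w * g (lnc w + y) * K y \<partial>lborel) \<partial>lborel)"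
  by (rule lborel_pair.Fubini') measurable
 also have "\<dots> = (\<integral>\<^sup>+w. m w * (\<integral>\<^sup>+y. g (lnc w + y) * K y \<partial>lborel) \<partial>lborel)"
  by (simp add: nn_integral_cmult mult.assoc)
 also have "\<dots> = (\<integral>\<^sup>+w. (\<integral>\<^sup>+y. m w * (g y * K (y - lnc w)) \<partial>lborel) \<partial>lborel)"
  unfolding shift by (simp add: nn_integral_cmult)
 also have "\<dots> = (\<integral>\<^sup>+y. (\<integral>\<^sup>+w. m w * (g y * K (y - lnc w)) \<partial>lborel) \<partial>lborel)"
  by (rule lborel_pair.Fubini') measurable
 also have "\<dots> = (\<integral>\<^sup>+y. g y * (\<integral>\<^sup>+w. m w * K (y - lnc w) \<partial>lborel) \<partial>lborel)"
  by (simp add: nn_integral_cmult[symmetric] mult_ac)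
 also have "\<dots> = (\<integral>\<^sup>+y. g y * c \<partial>lborel)"
 proof (rule nn_integral_cong)
  fix y :: real
  show "g y * (\<integral>\<^sup>+w. m w * K (y - lnc w) \<partial>lborel) = g y * c"
   using inv[of "\<lambda>t. K (y - t)" y] by (simp add: c_def m_def K_def)
 qed
 also have "\<dots> = c * (\<integral>\<^sup>+y. g y \<partial>lborel)" by (simp add: nn_integral_cmult mult.commute)
 finally show ?thesis by (simp add: m_def)
qed

lemma nn_integral_cone_annulus_finite:
 assumes "0 \<notin> A"
 shows "(\<integral>\<^sup>+w. cone_weight A 1 w * indicator {0..<1} (- lnc w) \<partial>lborel) < \<infinity>"
proof -
 have "(\<integral>\<^sup>+w. cone_weight A 1 w * indicator {0..<1} (- lnc w) \<partial>lborel) \<le>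
   (\<integral>\<^sup>+w. ennreal ((exp 1)\<^sup>2) * indicator (cball (0 :: complex) 1) w \<partial>lborel)"
 proof (rule nn_integral_mono)
  fix w :: complex
  show "cone_weight A 1 w * indicator {0..<1} (- lnc w) \<le> ennreal ((exp 1)\<^sup>2) * indicator (cball 0 1) w"
  proof (cases "w \<in> A \<and> - lnc w \<in> {0..<1}")
   case True
   then have w: "w \<noteq> 0" using assms by auto
   have l: "lnc w \<le> 0" "- 1 < lnc w" using True by auto
   have "cmod w \<le> 1" using l w by (metis ln_le_zero_iff zero_less_norm_iff)
   have "exp (-1) < cmod w" using l w by (metis exp_less_mono exp_ln zero_less_norm_iff)
   then have "1 / cmod w \<le> exp 1" using w by (simp add: exp_minus field_simps)
   then have "(1 / cmod w)\<^sup>2 \<le> (exp 1)\<^sup>2" by (intro power_mono) auto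
   then have "1 / (cmod w)\<^sup>2 \<le> (exp 1)\<^sup>2" by (simp add: power_divide)
   then show ?thesis using True \<open>cmod w \<le> 1\<close> by (simp add: ennreal_leI)
  qed (auto simp: indicator_def)
 qed
 also have "\<dots> < \<infinity>"
  using emeasure_lborel_cball_finite[of "0 :: complex" 1]
  by (subst nn_integral_cmult_indicator) (auto simp: ennreal_mult_less_top)
 finally show ?thesis .
qed

text \<open>Dividing by the mass of one annulus of the cone turns the proportionality of the two
  integrals into an equality of measures. The ball inside the cone makes that mass positive.\<close>

lemma distr_cone_ln:
 fixes A :: "complex set"
 assumes A[measurable]: "A \<in> sets borel" and A0: "0 \<notin> A" and cone: "\<And>t w. t > 0 \<Longrightarrow> of_real t * w \<in> A \<longleftrightarrow> w \<in> A"
  and opn: "ball p q \<subseteq> A" "q > 0"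
 obtains c where "c > 0" "distr (density lborel (\<lambda>w. cone_weight A c w)) lborel lnc = lborel"
proof -
 define c where "c = (\<integral>\<^sup>+w. cone_weight A 1 w * indicator {0..<1} (- lnc w) \<partial>lborel)"
 have p0: "p \<noteq> 0" using A0 opn centre_in_ball by blast
 have cfin: "c < \<infinity>" unfolding c_def by (rule nn_integral_cone_annulus_finite[OF A0])
 have "c > 0"
 proof -
  define t where "t = exp (-1/2) / cmod p"
  have t: "t > 0" using p0 by (simp add: t_def)
  define p' where "p' = of_real t * p"
  have cp: "cmod p' = exp (-1/2)" using p0 by (simp add: p'_def t_def norm_mult norm_divide)
  \<comment> \<open>The ball is moved radially until its centre has modulus exp (-1/2), and shrunk
    so that it stays in the annulus between exp (-1) and 1 that \<open>c\<close> measures.\<close>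
  define e where "e = min (t * q) (min (exp (-1/2) - exp (-1)) (1 - exp (-1/2)) )"
  have e: "e > 0" using t opn by (auto simp: e_def)
  have "(\<integral>\<^sup>+w. indicator (ball p' e) w \<partial>lborel) \<le> c"
   unfolding c_def
  proof (rule nn_integral_mono)
   fix w :: complex
   show "indicator (ball p' e) w \<le> cone_weight A 1 w * indicator {0..<1} (- lnc w)"
   proof (cases "w \<in> ball p' e")
    case True
    then have d: "cmod (w - p') < e" by (simp add: dist_norm norm_minus_commute)
    have "w / of_real t \<in> ball p q"
    proof -
     have "cmod (w / of_real t - p) = cmod (w - p') / t"
     proof -
      have "w / of_real t - p = (w - p') / of_real t" using t by (simp add: p'_def diff_divide_distrib)
      then show ?thesis using t by (simp add: norm_divide)
     qed
     also have "\<dots> < q" using d t by (auto simp: e_def field_simps)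
     finally show ?thesis by (simp add: dist_norm norm_minus_commute)
    qed
    then have "w / of_real t \<in> A" using opn by auto
    then have wA: "w \<in> A" using cone[OF t, of "w / of_real t"] t by simp
    have "\<bar>cmod w - cmod p'\<bar> < e" using d norm_triangle_ineq3[of w p'] by linarith
    then have b: "exp (-1) < cmod w" "cmod w < 1" unfolding cp e_def by linarith+
    have "cmod w > 0" using b(1) exp_gt_zero[of "-1::real"] by linarith
    have "-1 < lnc w" using b(1) \<open>cmod w > 0\<close> by (metis exp_gt_zero ln_exp ln_less_cancel_iff)
    moreover have "lnc w \<le> 0" using b(2) \<open>cmod w > 0\<close> by simp
    moreover have "1 \<le> 1 / (cmod w)\<^sup>2" using b(2) \<open>cmod w > 0\<close> by (simp add: power_le_one)
    then have "1 \<le> ennreal (1 / (cmod w)\<^sup>2)" by (metis ennreal_1 ennreal_leI)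
    ultimately show ?thesis using True wA by (simp add: indicator_def)
   qed simp
  qed
  moreover have "emeasure lborel (ball p' e) > 0"
   using content_ball_pos[OF e, of p'] by (simp add: Sigma_Algebra.measure_def enn2real_positive_iff)
  ultimately show ?thesis by simp
 qed
 define r where "r = enn2real c"
 have r: "r > 0" "c = ennreal r" using cfin \<open>c > 0\<close> by (auto simp: r_def enn2real_positive_iff)
 have "distr (density lborel (\<lambda>w. cone_weight A (1 / r) w)) lborel lnc = lborel"
 proof (rule measure_eqI)
  fix B assume "B \<in> sets (distr (density lborel (\<lambda>w. cone_weight A (1 / r) w)) lborel lnc)"
  then have B[measurable]: "B \<in> sets borel" by simp
  have lm: "lnc \<in> measurable (lborel :: complex measure) lborel" by measurable
  have "emeasure (distr (density lborel (\<lambda>w. cone_weight A (1 / r) w)) lborel lnc) B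
   = (\<integral>\<^sup>+w. cone_weight A (1 / r) w * indicator (lnc -` B) w \<partial>lborel)"
   using measurable_sets[OF lm, of B] by (simp add: emeasure_distr emeasure_density)
  also have "\<dots> = (\<integral>\<^sup>+w. ennreal (1 / r) * (cone_weight A 1 w * indicator B (lnc w)) \<partial>lborel)"
  proof (rule nn_integral_cong)
   fix w :: complex
   have "ennreal ((1 / r) / (cmod w)\<^sup>2) = ennreal (1 / r) * ennreal (1 / (cmod w)\<^sup>2)"
    using r by (simp add: ennreal_mult'[symmetric])
   then show "cone_weight A (1 / r) w * indicator (lnc -` B) w
    = ennreal (1 / r) * (cone_weight A 1 w * indicator B (lnc w))"
    by (simp add: indicator_def mult_ac)
  qed
  also have "\<dots> = ennreal (1 / r) * (c * (\<integral>\<^sup>+\<rho>. indicator B \<rho> \<partial>lborel))"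
   by (subst nn_integral_cmult, measurable, subst nn_integral_cone_ln[OF A A0 cone _ c_def]) auto
  also have "\<dots> = emeasure lborel B"
   using r by (simp add: mult.assoc[symmetric] ennreal_mult[symmetric])
  finally show "emeasure (distr (density lborel (\<lambda>w. cone_weight A (1 / r) w)) lborel lnc) B = emeasure lborel B" .
 qed simp
 then show ?thesis using that[of "1 / r"] r by simp
qed

section \<open>Products of powers of distances\<close>

text \<open>The points of a configuration: the variables carry the indices below \<open>n\<close>, the point \<open>z\<close>
 has index \<open>n\<close> and the point \<open>1\<close> has index \<open>n + 1\<close>. The origin is treated separately.\<close>

definition pt :: "nat \<Rightarrow> complex \<Rightarrow> conf \<Rightarrow> nat \<Rightarrow> complex" where
 "pt n z x v = (if v < n then x v else if v = n then z else 1)"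

definition prs :: "nat \<Rightarrow> (nat \<times> nat) set" where
 "prs n = {(u, v). u < v \<and> u < n \<and> v \<le> n + 1}"

abbreviation exp_size :: "nat \<Rightarrow> conf \<Rightarrow> pairing \<Rightarrow> real" where
 "exp_size n a e \<equiv> (\<Sum>j<n. cmod (a j - 1)) + (\<Sum>(u, v)\<in>prs n. cmod (e u v))"

text \<open>The shift by 1 separates off the scale-invariant density 1 / |x_j|^2 of each variable.
  The Jacobian of a dilation is absorbed by it, and only \<open>a j\<close> remains.\<close>

definition psi :: "nat \<Rightarrow> conf \<Rightarrow> pairing \<Rightarrow> complex \<Rightarrow> conf \<Rightarrow> complex" where
 "psi n a e z x = (\<Prod>j<n. abs_powr (x j) (2 * (a j - 1))) *
   (\<Prod>(u, v)\<in>prs n. abs_powr (pt n z x u - pt n z x v) (2 * e u v))"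

text \<open>This is p_u d/dp_u log (p_u - p_v), the term that arises when \<open>u\<close> is
  dilated while \<open>v\<close> stays fixed.\<close>

definition edge :: "nat \<Rightarrow> complex \<Rightarrow> conf \<Rightarrow> nat \<Rightarrow> nat \<Rightarrow> complex" where
 "edge n z x u v = pt n z x u / (pt n z x u - pt n z x v)"

definition ins :: "nat \<Rightarrow> graph \<Rightarrow> complex \<Rightarrow> conf \<Rightarrow> complex" where
 "ins n l z x = (\<Prod>(u, v)\<leftarrow>l. edge n z x u v)"

definition verts :: "graph \<Rightarrow> nat set" where
 "verts l = fst ` set l \<union> snd ` set l"

lemma finite_prs [simp]: "finite (prs n)"
 by (rule finite_subset[of _ "{..n} \<times> {..n + 1}"]) (auto simp: prs_def)

lemma ins_Nil [simp]: "ins n [] z x = 1"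
 and ins_Cons: "ins n ((u, v) # l) z x = edge n z x u v * ins n l z x"
 by (simp_all add: ins_def)

lemma verts_simps [simp]: "verts [] = {}" "verts ((u, v) # l) = insert u (insert v (verts l))"
 by (auto simp: verts_def)

lemma norm_abs_powr: "cmod (abs_powr x s) = cmod x powr Re s"
 by (simp add: abs_powr_def norm_powr_real_powr)

lemma abs_powr_measurable [measurable (raw)]:
 "f \<in> borel_measurable M \<Longrightarrow> (\<lambda>x. abs_powr (f x) s) \<in> borel_measurable M"
 unfolding abs_powr_def by measurable

abbreviation config :: "nat \<Rightarrow> conf measure" where
 "config n \<equiv> PiM {..<n} (\<lambda>_. lborel)"

abbreviation log_config :: "nat \<Rightarrow> (nat \<Rightarrow> real) measure" where
 "log_config n \<equiv> PiM {..<n} (\<lambda>_. lborel)"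

lemma pt_measurable [measurable]: "(\<lambda>x. pt n z x u) \<in> borel_measurable (config n)"
 by (cases "u < n") (auto simp: pt_def intro: measurable_component_singleton[of _ _ "\<lambda>_. lborel", simplified])

lemma coord_measurable: "u < n \<Longrightarrow> (\<lambda>x. x u) \<in> borel_measurable (config n)"
 using pt_measurable[of n 0 u] by (simp add: pt_def)

lemma psi_measurable [measurable]: "psi n a e z \<in> borel_measurable (config n)"
 unfolding psi_def split_beta
 by (intro borel_measurable_times borel_measurable_prod abs_powr_measurable borel_measurable_diff
   pt_measurable coord_measurable) auto

lemma edge_measurable [measurable]: "(\<lambda>x. edge n z x u v) \<in> borel_measurable (config n)"
 unfolding edge_def by (intro borel_measurable_divide borel_measurable_diff pt_measurable)

lemma ins_measurable [measurable]: "ins n l z \<in> borel_measurable (config n)"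
proof (induction l)
 case (Cons p l)
 then show ?case by (cases p) (simp add: ins_Cons[abs_def])
qed (simp add: ins_def[abs_def])

text \<open>The points \<open>z\<close> and 1 both get logarithmic modulus 0, even if |z| differs
  from 1. This costs a constant depending on z and makes \<open>lam\<close> homogeneous.\<close>

definition ext :: "nat \<Rightarrow> (nat \<Rightarrow> real) \<Rightarrow> nat \<Rightarrow> real" where
 "ext n \<rho> u = (if u < n then \<rho> u else 0)"

definition lnx :: "conf \<Rightarrow> nat \<Rightarrow> real" where
 "lnx x j = ln (cmod (x j))"

text \<open>The tropical limit of \<^term>\<open>psi\<close>: the logarithm of its modulus, multiplied by
 \<open>\<Prod>\<bar>x\<^sub>j\<bar>\<^sup>2\<close>, after replacing each distance by the larger of the two moduli.\<close>

definition lam :: "nat \<Rightarrow> (nat \<Rightarrow> real) \<Rightarrow> (nat \<Rightarrow> nat \<Rightarrow> real) \<Rightarrow> (nat \<Rightarrow> real) \<Rightarrow> real" where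
 "lam n A E \<rho> = (\<Sum>j<n. 2 * A j * \<rho> j) + (\<Sum>(u, v)\<in>prs n. 2 * E u v * max (ext n \<rho> u) (ext n \<rho> v))"

definition wt :: "nat \<Rightarrow> (nat \<Rightarrow> real) \<Rightarrow> (nat \<Rightarrow> nat \<Rightarrow> real) \<Rightarrow> conf \<Rightarrow> real" where
 "wt n A E x = exp (lam n A E (lnx x)) * (\<Prod>j<n. 1 / (cmod (x j))\<^sup>2)"

text \<open>A distance divided by its tropical value. The ratio is bounded above and becomes small
  only when two points are close on their own scale, so it carries exactly the singularities that
  the tropical weight does not see.\<close>

definition sep :: "nat \<Rightarrow> complex \<Rightarrow> conf \<Rightarrow> nat \<Rightarrow> nat \<Rightarrow> real" where
 "sep n z x u v = cmod (pt n z x u - pt n z x v) / exp (max (ext n (lnx x) u) (ext n (lnx x) v))"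

abbreviation "isep n z x u v \<equiv> sep n z x u v powr (- 3/2)"

abbreviation "sep_prod n z l x \<equiv> \<Prod>(u, v)\<leftarrow>l. isep n z x u v"

lemma sep_nonneg: "sep n z x u v \<ge> 0" by (simp add: sep_def)

lemma sep_commute: "sep n z x u v = sep n z x v u"
 by (simp add: sep_def norm_minus_commute max.commute)

text \<open>The fixed points sit at logarithmic modulus 0, so every maximum scales. Together with
  linearity in the coefficients this trades a contraction of the exponents for a rescaling of the
  logarithmic variables.\<close>

lemma lam_scale: "s \<ge> 0 \<Longrightarrow> lam n A E (\<lambda>j. s * \<rho> j) = s * lam n A E \<rho>"
proof -
 assume s: "s \<ge> 0"
 have "max (ext n (\<lambda>j. s * \<rho> j) u) (ext n (\<lambda>j. s * \<rho> j) v) = s * max (ext n \<rho> u) (ext n \<rho> v)" for u v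
  using s by (auto simp: ext_def max_def mult_le_cancel_left mult_le_0_iff zero_le_mult_iff)
 then show ?thesis by (simp add: lam_def sum_distrib_left algebra_simps split_beta)
qed

lemma lam_scale_coeff: "lam n (\<lambda>j. s * A j) (\<lambda>u v. s * E u v) \<rho> = s * lam n A E \<rho>"
 by (simp add: lam_def sum_distrib_left algebra_simps split_beta)

lemma lam_cong: "(\<And>j. j < n \<Longrightarrow> \<rho> j = \<rho>' j) \<Longrightarrow> lam n A E \<rho> = lam n A E \<rho>'"
 unfolding lam_def by (intro arg_cong2[where f="(+)"] sum.cong) (auto simp: ext_def)

lemma norm_psi:
 assumes "\<And>j. j < n \<Longrightarrow> x j \<noteq> 0"
 shows "cmod (psi n a e z x) = wt n (\<lambda>j. Re (a j)) (\<lambda>u v. Re (e u v)) x *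
   (\<Prod>(u, v)\<in>prs n. sep n z x u v powr (2 * Re (e u v)))"
proof -
 have 1: "cmod (x j) powr (2 * (Re (a j) - 1)) = exp (2 * Re (a j) * lnx x j) * (1 / (cmod (x j))\<^sup>2)" if "j < n" for j
 proof -
  have "cmod (x j) > 0" using assms[OF that] by simp
  moreover have "2 * (Re (a j) - 1) = 2 * Re (a j) - 2" by simp
  ultimately show ?thesis
   by (simp add: powr_diff lnx_def) (simp add: powr_def mult_ac)
 qed
 have 2: "cmod (pt n z x u - pt n z x v) powr (2 * E) =
   exp (2 * E * max (ext n (lnx x) u) (ext n (lnx x) v)) * sep n z x u v powr (2 * E)" for u v E
 proof -
  have "cmod (pt n z x u - pt n z x v) = sep n z x u v * exp (max (ext n (lnx x) u) (ext n (lnx x) v))"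
   by (simp add: sep_def)
  then show ?thesis by (simp add: powr_mult sep_nonneg exp_powr_real mult_ac)
 qed
 have "cmod (psi n a e z x) = (\<Prod>j<n. cmod (x j) powr (2 * (Re (a j) - 1))) *
   (\<Prod>(u, v)\<in>prs n. cmod (pt n z x u - pt n z x v) powr (2 * Re (e u v)))"
  by (simp add: psi_def norm_mult prod_norm[symmetric] norm_abs_powr split_beta)
 also have "(\<Prod>j<n. cmod (x j) powr (2 * (Re (a j) - 1))) = (\<Prod>j<n. exp (2 * Re (a j) * lnx x j) * (1 / (cmod (x j))\<^sup>2))"
  by (rule prod.cong) (use 1 in auto)
 also have "\<dots> = exp (\<Sum>j<n. 2 * Re (a j) * lnx x j) * (\<Prod>j<n. 1 / (cmod (x j))\<^sup>2)"
  by (simp only: prod.distrib exp_sum finite_lessThan)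
 also have "(\<Prod>(u, v)\<in>prs n. cmod (pt n z x u - pt n z x v) powr (2 * Re (e u v))) =
   exp (\<Sum>(u, v)\<in>prs n. 2 * Re (e u v) * max (ext n (lnx x) u) (ext n (lnx x) v)) * (\<Prod>(u, v)\<in>prs n. sep n z x u v powr (2 * Re (e u v)))"
  unfolding split_beta by (simp only: 2 prod.distrib exp_sum finite_prs)
 finally show ?thesis by (simp add: wt_def lam_def exp_add mult_ac)
qed

text \<open>The value of \<open>0 powr s\<close> is 0 for every s, also for s = 0. Hence
  \<open>psi\<close> vanishes at each coincidence whatever the exponents are, and identities between
  edges matter only for distinct points.\<close>

lemma psi_eq_0:
 assumes "j < n \<and> x j = 0 \<or> (u, v) \<in> prs n \<and> pt n z x u = pt n z x v"
 shows "psi n a e z x = 0"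
proof -
 have "abs_powr 0 s = 0" for s by (simp add: abs_powr_def)
 then have "(\<Prod>j<n. abs_powr (x j) (2 * (a j - 1))) = 0 \<or>
   (\<Prod>(u, v)\<in>prs n. abs_powr (pt n z x u - pt n z x v) (2 * e u v)) = 0"
  using assms by (auto simp: split_beta intro!: prod_zero bexI[of _ j] bexI[of _ "(u, v)"])
 then show ?thesis unfolding psi_def by auto
qed

section \<open>Integrability of the tropical weight\<close>

text \<open>Let t <= 1 be the quotient of the moduli. Then \<open>sgn u - t sgn v\<close> is at
  distance 1 - t from \<open>sgn u - sgn v\<close>, and its own length is at least 1 - t; so this
  length is at least \<delta> / 2.\<close>

lemma norm_diff_ge_of_directions:
 fixes u v :: complex
 assumes "u \<noteq> 0" "v \<noteq> 0" "cmod (sgn u - sgn v) \<ge> \<delta>"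
 shows "cmod (u - v) \<ge> \<delta> / 2 * max (cmod u) (cmod v)"
proof -
 have *: "cmod (u - v) \<ge> \<delta> / 2 * cmod u" if "cmod v \<le> cmod u" "u \<noteq> 0" "v \<noteq> 0" "cmod (sgn u - sgn v) \<ge> \<delta>" for u v :: complex
 proof -
  define t where "t = cmod v / cmod u"
  have t: "0 \<le> t" "t \<le> 1" using that by (auto simp: t_def)
  have uv: "u - v = cmod u * (sgn u - of_real t * sgn v)"
   using that by (simp add: t_def sgn_eq algebra_simps)
  have "\<delta> \<le> cmod (sgn u - of_real t * sgn v) + cmod (of_real t * sgn v - sgn v)"
   using that(4) norm_triangle_ineq[of "sgn u - of_real t * sgn v" "of_real t * sgn v - sgn v"] by simp
  moreover have "cmod (of_real t * sgn v - sgn v) = 1 - t"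
  proof -
   have "of_real t * sgn v - sgn v = of_real (t - 1) * sgn v" by (simp add: algebra_simps)
   then show ?thesis using t that by (simp only: norm_mult norm_of_real norm_sgn) simp
  qed
  moreover have "cmod (sgn u - of_real t * sgn v) \<ge> 1 - t"
   using norm_triangle_ineq2[of "sgn u" "of_real t * sgn v"] t that by (simp add: norm_mult norm_sgn)
  ultimately have "cmod (sgn u - of_real t * sgn v) \<ge> \<delta> / 2" by linarith
  moreover have "cmod (u - v) = cmod (sgn u - of_real t * sgn v) * cmod u" unfolding uv by (simp add: norm_mult mult.commute)
  ultimately show ?thesis using mult_right_mono[of "\<delta> / 2" "cmod (sgn u - of_real t * sgn v)" "cmod u"] by simp
 qed
 show ?thesis
 proof (cases "cmod v \<le> cmod u")
  case True
  then show ?thesis using *[of v u] assms by (simp add: max_def)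
 next
  case False
  then show ?thesis using *[of u v] assms by (simp add: max_def norm_minus_commute)
 qed
qed

lemma lam_measurable [measurable]: "lam n A E \<in> borel_measurable (log_config n)"
proof -
 have e: "(\<lambda>\<rho>. ext n \<rho> u) \<in> borel_measurable (log_config n)" for u
  by (cases "u < n") (auto simp: ext_def intro: measurable_component_singleton[of _ _ "\<lambda>_. lborel", simplified])
 have c: "(\<lambda>\<rho>. \<rho> j) \<in> borel_measurable (log_config n)" if "j < n" for j
  using e[of j] that by (simp add: ext_def)
 show ?thesis
  unfolding lam_def split_beta
  by (intro borel_measurable_add borel_measurable_sum borel_measurable_times borel_measurable_max e c) auto
qed

lemma lnx_measurable: "(\<lambda>x. \<lambda>j\<in>{..<n}. lnx x j) \<in> measurable (config n) (log_config n)"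
 unfolding lnx_def by measurable

lemma lam_lnx_measurable: "(\<lambda>x. lam n A E (lnx x)) \<in> borel_measurable (config n)"
proof -
 have "(\<lambda>x. lam n A E (lnx x)) = (\<lambda>x. lam n A E (\<lambda>j\<in>{..<n}. lnx x j))"
  by (rule ext, rule lam_cong) simp
 also have "\<dots> \<in> borel_measurable (config n)" by (rule measurable_compose[OF lnx_measurable lam_measurable])
 finally show ?thesis .
qed

lemma wt_measurable [measurable]: "wt n A E \<in> borel_measurable (config n)"
 unfolding wt_def
 by (intro borel_measurable_times borel_measurable_prod borel_measurable_divide borel_measurable_power
   borel_measurable_norm coord_measurable measurable_compose[OF lam_lnx_measurable borel_measurable_exp]) auto

lemma sep_measurable [measurable]: "(\<lambda>x. sep n z x u v) \<in> borel_measurable (config n)"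
proof -
 have e: "(\<lambda>x. ext n (lnx x) u) \<in> borel_measurable (config n)" for u
  by (cases "u < n") (auto simp: ext_def lnx_def)
 show ?thesis unfolding sep_def
  using e by measurable
qed

lemma sgn_measurable_complex: "(\<lambda>w :: complex. sgn w) \<in> borel_measurable borel"
 unfolding sgn_div_norm by measurable

abbreviation cone_prod :: "nat \<Rightarrow> (nat \<Rightarrow> complex set) \<Rightarrow> conf \<Rightarrow> ennreal" where
 "cone_prod n A x \<equiv> \<Prod>j<n. indicator (A j) (x j) * ennreal (1 / (cmod (x j))\<^sup>2)"

text \<open>On a product of cones the angles integrate out. With thin disjoint cones this bounds the
  tropical integral by that of \<open>psi\<close>; with the punctured plane it leads back from
  logarithmic variables to configurations.\<close>

lemma nn_integral_config_cones:
 fixes A :: "nat \<Rightarrow> complex set"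
 assumes A: "\<And>j. j < n \<Longrightarrow> A j \<in> sets borel" "\<And>j. j < n \<Longrightarrow> 0 \<notin> A j"
   "\<And>j t w. j < n \<Longrightarrow> t > 0 \<Longrightarrow> of_real t * w \<in> A j \<longleftrightarrow> w \<in> A j"
   "\<And>j. j < n \<Longrightarrow> \<exists>p q. q > 0 \<and> ball p q \<subseteq> A j"
 shows "\<exists>c>0. \<forall>f\<in>borel_measurable (log_config n).
    (\<integral>\<^sup>+\<rho>. f \<rho> \<partial>log_config n) =
    ennreal c * (\<integral>\<^sup>+x. cone_prod n A x * f (\<lambda>j\<in>{..<n}. lnx x j) \<partial>config n)"
proof -
 have "\<exists>c>0. distr (density lborel (\<lambda>w. cone_weight (A j) c w)) lborel lnc = lborel" if "j < n" for j
  using A(4)[OF that] distr_cone_ln[OF A(1-3)[OF that]] by metis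
 then obtain c where c: "\<And>j. j < n \<Longrightarrow> c j > 0"
  "\<And>j. j < n \<Longrightarrow> distr (density lborel (\<lambda>w. cone_weight (A j) (c j) w)) lborel lnc = lborel"
  by metis
 define C where "C = (\<Prod>j<n. c j)"
 have C: "C > 0" unfolding C_def by (rule prod_pos) (use c in auto)
 have Im: "(\<lambda>w. cone_weight (A j) (c j) w) \<in> borel_measurable lborel" if "j < n" for j
  using A(1)[OF that] by measurable
 have D: "distr (density (config n) (\<lambda>x. \<Prod>j<n. indicator (A j) (x j) * ennreal (c j / (cmod (x j))\<^sup>2)))
   (log_config n) (\<lambda>x. \<lambda>j\<in>{..<n}. ln (cmod (x j))) = log_config n"
  by (rule distr_density_PiM) (use c Im in \<open>auto intro: sigma_finite_lborel\<close>)
 have Jm: "(\<lambda>x. \<Prod>j<n. indicator (A j) (x j) * ennreal (c j / (cmod (x j))\<^sup>2)) \<in> borel_measurable (config n)"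
  by (intro borel_measurable_prod_ennreal measurable_compose[OF _ Im] measurable_component_singleton) auto
 show ?thesis
 proof (intro exI[of _ C] conjI ballI C)
  fix f :: "(nat \<Rightarrow> real) \<Rightarrow> ennreal" assume f[measurable]: "f \<in> borel_measurable (log_config n)"
  have lm: "(\<lambda>x. \<lambda>j\<in>{..<n}. ln (cmod (x j))) \<in> measurable (config n) (log_config n)"
   using lnx_measurable by (simp add: lnx_def)
  have "(\<integral>\<^sup>+\<rho>. f \<rho> \<partial>log_config n) = (\<integral>\<^sup>+x. (\<Prod>j<n. indicator (A j) (x j) * ennreal (c j / (cmod (x j))\<^sup>2)) * f (\<lambda>j\<in>{..<n}. ln (cmod (x j))) \<partial>config n)"
   by (subst D[symmetric], subst nn_integral_distr, use lm in simp, simp,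
     subst nn_integral_density[OF Jm]) (use measurable_compose[OF lm f] in simp_all)
  also have "\<dots> = (\<integral>\<^sup>+x. ennreal C * (cone_prod n A x * f (\<lambda>j\<in>{..<n}. lnx x j)) \<partial>config n)"
  proof (rule nn_integral_cong)
   fix x
   have "(\<Prod>j<n. indicator (A j) (x j) * ennreal (c j / (cmod (x j))\<^sup>2)) = (\<Prod>j<n. ennreal (c j) * (indicator (A j) (x j) * ennreal (1 / (cmod (x j))\<^sup>2)))"
   proof (rule prod.cong[OF refl])
    fix j assume "j \<in> {..<n}"
    then have "ennreal (c j / (cmod (x j))\<^sup>2) = ennreal (c j) * ennreal (1 / (cmod (x j))\<^sup>2)"
     using c(1)[of j] by (simp add: ennreal_mult'[symmetric])
    then show "indicator (A j) (x j) * ennreal (c j / (cmod (x j))\<^sup>2) = ennreal (c j) * (indicator (A j) (x j) * ennreal (1 / (cmod (x j))\<^sup>2))"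
     by (simp add: mult_ac)
   qed
   also have "\<dots> = ennreal C * cone_prod n A x"
    unfolding C_def prod.distrib by (subst prod_ennreal) (use c(1) in \<open>auto intro: less_imp_le\<close>)
   finally show "(\<Prod>j<n. indicator (A j) (x j) * ennreal (c j / (cmod (x j))\<^sup>2)) * f (\<lambda>j\<in>{..<n}. ln (cmod (x j)))
    = ennreal C * (cone_prod n A x * f (\<lambda>j\<in>{..<n}. lnx x j))"
    by (simp add: lnx_def mult.assoc)
  qed
  also have "\<dots> = ennreal C * (\<integral>\<^sup>+x. cone_prod n A x * f (\<lambda>j\<in>{..<n}. lnx x j) \<partial>config n)"
  proof (rule nn_integral_cmult)
   have im: "(\<lambda>w. cone_weight (A j) 1 w) \<in> borel_measurable lborel" if "j < n" for j
    using A(1)[OF that] by measurable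
   have "(\<lambda>x. cone_prod n A x) \<in> borel_measurable (config n)"
    by (intro borel_measurable_prod_ennreal measurable_compose[OF _ im] measurable_component_singleton) auto
   then show "(\<lambda>x. cone_prod n A x * f (\<lambda>j\<in>{..<n}. lnx x j)) \<in> borel_measurable (config n)"
    by (rule borel_measurable_times_ennreal[OF _ measurable_compose[OF lnx_measurable f]])
  qed
  finally show "(\<integral>\<^sup>+\<rho>. f \<rho> \<partial>log_config n) =
    ennreal C * (\<integral>\<^sup>+x. cone_prod n A x * f (\<lambda>j\<in>{..<n}. lnx x j) \<partial>config n)" .
 qed
qed

text \<open>On a product of disjoint cones all distances are comparable to the larger of the two moduli,
 so there \<^term>\<open>psi\<close> is comparable to its tropical limit, which depends on the moduli only.\<close>

lemma nn_integral_exp_lam_finite: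
 assumes int: "integrable (config n) (psi n a e z)" and z: "z \<noteq> 0"
 shows "(\<integral>\<^sup>+\<rho>. ennreal (exp (lam n (\<lambda>j. Re (a j)) (\<lambda>u v. Re (e u v)) \<rho>)) \<partial>log_config n) < \<infinity>"
proof -
 let ?a = "\<lambda>j. Re (a j)" and ?e = "\<lambda>u v. Re (e u v)" and ?p = "pt n z" and ?S = "sphere (0 :: complex) 1"
 have "infinite (?S - {1, sgn z})"
 proof -
  have "infinite (?S)"
  proof
   assume "finite (?S)"
   moreover have "connected (?S)" by (rule connected_sphere) simp
   ultimately have "?S = {} \<or> (\<exists>a. ?S = {a})"
    using connected_finite_iff_sing by blast
   moreover have "1 \<in> ?S" "-1 \<in> ?S" by auto
   ultimately show False by (metis empty_iff one_neq_neg_one singletonD)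
  qed
  then show ?thesis by simp
 qed
 \<comment> \<open>The directions of 1 and \<open>z\<close> are avoided, so that each variable is
   separated in direction from the other variables and from both fixed points.\<close>
 then obtain P where P: "finite P" "card P = n" "P \<subseteq> ?S - {1, sgn z}"
  using infinite_arbitrarily_large by blast
 then obtain p where "bij_betw p {..<n} P" using ex_bij_betw_nat_finite by (metis atLeast0LessThan)
 then have inj: "inj_on p {..<n}" and pim: "p ` {..<n} = P" by (auto simp: bij_betw_def)
 define dir where "dir u = (if u < n then p u else if u = n then sgn z else 1)" for u
 have pn: "p u \<in> sphere 0 1 - {1, sgn z}" if "u < n" for u using P(3) pim that by blast
 have pdir: "cmod (dir u) = 1" if "u \<le> n + 1" for u
  using pn[of u] z by (auto simp: dir_def norm_sgn)
 have dne: "dir u \<noteq> dir v" if "(u, v) \<in> prs n" for u v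
  using that pn[of u] pn[of v] inj by (auto simp: dir_def prs_def inj_on_def)
 \<comment> \<open>A third of the smallest separation: two of the three parts are used up by the
   widths of two cones, and one part is left.\<close>
 obtain \<delta> where \<delta>: "\<delta> > 0" "\<And>u v. (u, v) \<in> prs n \<Longrightarrow> cmod (dir u - dir v) \<ge> 3 * \<delta>"
 proof -
  define S where "S = insert 1 ((\<lambda>(u, v). cmod (dir u - dir v) / 3) ` prs n)"
  have S: "finite S" "S \<noteq> {}" "\<And>s. s \<in> S \<Longrightarrow> s > 0" using dne by (auto simp: S_def)
  show ?thesis
  proof (rule that[of "Min S"])
   show "Min S > 0" using S by simp
   fix u v assume "(u, v) \<in> prs n"
   then have "cmod (dir u - dir v) / 3 \<in> S" by (auto simp: S_def)
   then have "Min S \<le> cmod (dir u - dir v) / 3" by (rule Min_le[OF S(1)])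
   then show "cmod (dir u - dir v) \<ge> 3 * Min S" by simp
  qed
 qed
 define A where "A j = {w :: complex. w \<noteq> 0 \<and> cmod (sgn w - p j) < \<delta>}" for j
 have Am: "A j \<in> sets borel" for j
  unfolding A_def using sgn_measurable_complex by measurable
 have cone: "of_real t * w \<in> A j \<longleftrightarrow> w \<in> A j" if "t > 0" for t j w
  using that by (simp add: A_def sgn_mult sgn_of_real)
 have opn: "\<exists>r q. q > 0 \<and> ball r q \<subseteq> A j" if "j < n" for j
 proof -
  have "continuous_on (- {0}) (\<lambda>w :: complex. cmod (sgn w - p j))"
   by (intro continuous_intros) auto
  from open_Collect_less_Int[OF this continuous_on_const]
  obtain O' where "open O'" "O' \<inter> - {0} = {w \<in> - {0 :: complex}. cmod (sgn w - p j) < \<delta>}" by blast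
  then have "open {w \<in> - {0 :: complex}. cmod (sgn w - p j) < \<delta>}"
   by (metis open_Compl closed_singleton open_Int)
  moreover have "{w \<in> - {0 :: complex}. cmod (sgn w - p j) < \<delta>} = A j" by (auto simp: A_def)
  moreover have "p j \<in> A j"
  proof -
   have "p j \<noteq> 0" "sgn (p j) = p j" using pdir[of j] that by (auto simp: dir_def sgn_eq)
   then show ?thesis using \<delta> by (simp add: A_def)
  qed
  ultimately show ?thesis by (metis open_contains_ball)
 qed
 obtain c where c: "c > (0 :: real)"
  "\<And>f. f \<in> borel_measurable (log_config n) \<Longrightarrow>
    (\<integral>\<^sup>+\<rho>. f \<rho> \<partial>log_config n) =
    ennreal c * (\<integral>\<^sup>+x. cone_prod n A x * f (\<lambda>j\<in>{..<n}. lnx x j) \<partial>config n)"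
 proof -
  have "0 \<notin> A j" for j by (simp add: A_def)
  from nn_integral_config_cones[of n A, OF Am this cone opn] show ?thesis using that by blast
 qed
 let ?L = "\<lambda>x. cone_prod n A x * ennreal (exp (lam n ?a ?e (\<lambda>j\<in>{..<n}. lnx x j)))"
 \<comment> \<open>Compensates for \<open>ext\<close>, which replaces |z| by 1.\<close>
 define C where "C = max (cmod z) (1 / cmod z)"
 have C: "C \<ge> 1" "cmod z \<le> C" "1 / C \<le> cmod z"
 proof -
  show "C \<ge> 1" unfolding C_def le_max_iff_disj using z by (cases "cmod z \<ge> 1") auto
  show "cmod z \<le> C" by (simp add: C_def)
  have "1 / cmod z \<le> C" by (simp add: C_def)
  then show "1 / C \<le> cmod z" using z \<open>C \<ge> 1\<close> by (simp add: field_simps)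
 qed
 have sepb: "\<delta> / (2 * C) \<le> sep n z x u v \<and> sep n z x u v \<le> 2 * C"
  if x: "\<And>j. j < n \<Longrightarrow> x j \<in> A j" and uv: "(u, v) \<in> prs n" for x u v
 proof -
  have x0: "x j \<noteq> 0" if "j < n" for j using x[OF that] by (simp add: A_def)
  have dirx: "cmod (sgn (?p x w) - dir w) < \<delta>" "?p x w \<noteq> 0" if "w \<le> n + 1" for w
   using x[of w] \<delta>(1) z that by (auto simp: pt_def dir_def A_def)
  have ub: "u \<le> n + 1" "v \<le> n + 1" using uv by (auto simp: prs_def)
  have "3 * \<delta> \<le> cmod (dir u - dir v)" using \<delta>(2)[OF uv] .
  also have "\<dots> \<le> cmod (dir u - sgn (?p x u)) + cmod (sgn (?p x u) - sgn (?p x v)) + cmod (sgn (?p x v) - dir v)"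
   using norm_triangle_ineq[of "dir u - sgn (?p x u)" "sgn (?p x u) - sgn (?p x v)"]
    norm_triangle_ineq[of "dir u - sgn (?p x v)" "sgn (?p x v) - dir v"] by simp
  finally have "\<delta> \<le> cmod (sgn (?p x u) - sgn (?p x v))"
   using dirx(1)[OF ub(1)] dirx(1)[OF ub(2)] by (simp add: norm_minus_commute)
  then have l: "\<delta> / 2 * max (cmod (?p x u)) (cmod (?p x v)) \<le> cmod (?p x u - ?p x v)"
   by (rule norm_diff_ge_of_directions[OF dirx(2)[OF ub(1)] dirx(2)[OF ub(2)]])
  have e: "1 / C * exp (ext n (lnx x) w) \<le> cmod (?p x w)" "cmod (?p x w) \<le> C * exp (ext n (lnx x) w)" if "w \<le> n + 1" for w
   using x0[of w] C that by (auto simp: ext_def pt_def lnx_def divide_le_eq mult_le_cancel_right1 mult_le_cancel_right2)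
  define X where "X = exp (max (ext n (lnx x) u) (ext n (lnx x) v))"
  have X: "X = max (exp (ext n (lnx x) u)) (exp (ext n (lnx x) v))" "X > 0" by (auto simp: X_def max_def)
  have "1 / C * X \<le> max (cmod (?p x u)) (cmod (?p x v))"
   using e(1)[OF ub(1)] e(1)[OF ub(2)] unfolding X(1) by (auto simp: max_def)
  then have "\<delta> / 2 * (1 / C * X) \<le> \<delta> / 2 * max (cmod (?p x u)) (cmod (?p x v))"
   using \<delta>(1) by (intro mult_left_mono) auto
  moreover have "\<delta> / (2 * C) * X = \<delta> / 2 * (1 / C * X)" by simp
  ultimately have "\<delta> / (2 * C) * X \<le> cmod (?p x u - ?p x v)" using l by linarith
  moreover have "cmod (?p x u - ?p x v) \<le> 2 * C * X"
  proof -
   have "C * exp (ext n (lnx x) u) \<le> C * X" "C * exp (ext n (lnx x) v) \<le> C * X"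
    using C unfolding X(1) by (auto intro!: mult_left_mono)
   then show ?thesis
    using norm_triangle_ineq4[of "?p x u" "?p x v"] e(2)[OF ub(1)] e(2)[OF ub(2)] by linarith
  qed
  ultimately show ?thesis using X(2) by (simp add: sep_def X_def[symmetric] field_simps)
 qed
 define k where "k u v = min ((\<delta> / (2 * C)) powr (2 * Re (e u v))) ((2 * C) powr (2 * Re (e u v)))" for u v
 define K where "K = (\<Prod>(u, v)\<in>prs n. k u v)"
 have k: "k u v > 0" for u v using \<delta> C by (simp add: k_def)
 have K: "K > 0" unfolding K_def by (rule prod_pos) (use k in auto)
 have lower: "K * wt n ?a ?e x \<le> cmod (psi n a e z x)"
  if x: "\<And>j. j < n \<Longrightarrow> x j \<in> A j" for x
 proof -
  have "K \<le> (\<Prod>(u, v)\<in>prs n. sep n z x u v powr (2 * Re (e u v)))"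
   unfolding K_def
  proof (rule prod_mono, clarify)
   fix u v assume uv: "(u, v) \<in> prs n"
   have s: "\<delta> / (2 * C) \<le> sep n z x u v" "sep n z x u v \<le> 2 * C" using sepb[OF x uv] by auto
   have p: "\<delta> / (2 * C) > 0" using \<delta> C by simp
   have "k u v \<le> sep n z x u v powr (2 * Re (e u v))"
   proof (cases "Re (e u v) \<ge> 0")
    case True
    then have "(\<delta> / (2 * C)) powr (2 * Re (e u v)) \<le> sep n z x u v powr (2 * Re (e u v))"
     using s p by (intro powr_mono2) auto
    then show ?thesis by (simp add: k_def)
   next
    case False
    then have "(2 * C) powr (2 * Re (e u v)) \<le> sep n z x u v powr (2 * Re (e u v))"
     using s p by (intro powr_mono2') auto
    then show ?thesis by (simp add: k_def)
   qed
   then show "0 \<le> k u v \<and> k u v \<le> sep n z x u v powr (2 * Re (e u v))" using k[of u v] by simp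
  qed
  moreover have "x j \<noteq> 0" if "j < n" for j using x[OF that] by (simp add: A_def)
  moreover have "wt n ?a ?e x \<ge> 0" by (simp add: wt_def prod_nonneg)
  ultimately have "K * wt n ?a ?e x
    \<le> (\<Prod>(u, v)\<in>prs n. sep n z x u v powr (2 * Re (e u v))) * wt n ?a ?e x"
   and x0: "\<And>j. j < n \<Longrightarrow> x j \<noteq> 0"
   by (auto intro: mult_right_mono)
  then show ?thesis
   by (simp only: norm_psi[OF x0] mult.commute)
 qed
 have "(\<integral>\<^sup>+\<rho>. ennreal (exp (lam n ?a ?e \<rho>)) \<partial>log_config n)
   = ennreal c * (\<integral>\<^sup>+x. ?L x \<partial>config n)"
  by (rule c(2)) measurable
 also have "\<dots> \<le> ennreal c * (\<integral>\<^sup>+x. ennreal (1 / K) * ennreal (cmod (psi n a e z x)) \<partial>config n)"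
 proof (intro mult_left_mono nn_integral_mono)
  fix x assume "x \<in> space (config n)"
  show "?L x
    \<le> ennreal (1 / K) * ennreal (cmod (psi n a e z x))"
  proof (cases "\<forall>j<n. x j \<in> A j")
   case True
   have "cone_prod n A x = (\<Prod>j<n. ennreal (1 / (cmod (x j))\<^sup>2))"
    using True by (intro prod.cong) auto
   also have "\<dots> = ennreal (\<Prod>j<n. 1 / (cmod (x j))\<^sup>2)" by (rule prod_ennreal) simp
   finally have "?L x
    = ennreal (wt n ?a ?e x)"
    unfolding wt_def by (subst lam_cong[of n "\<lambda>j\<in>{..<n}. lnx x j" "lnx x"])
     (auto simp: ennreal_mult'[symmetric] prod_nonneg mult.commute)
   also have "\<dots> \<le> ennreal (1 / K * cmod (psi n a e z x))"
    using lower[of x] True K by (intro ennreal_leI) (auto simp: field_simps)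
   also have "\<dots> = ennreal (1 / K) * ennreal (cmod (psi n a e z x))" using K by (intro ennreal_mult) auto
   finally show ?thesis .
  next
   case False
   then obtain j where "j < n" "x j \<notin> A j" by blast
   then have "cone_prod n A x = 0"
    by (intro prod_zero) (auto intro!: bexI[of _ j])
   then show ?thesis by (simp only: mult_zero_left zero_le)
  qed
 qed simp
 also have "\<dots> = ennreal c * (ennreal (1 / K) * (\<integral>\<^sup>+x. ennreal (cmod (psi n a e z x)) \<partial>config n))"
  by (subst nn_integral_cmult) auto
 also have "\<dots> < \<infinity>" using int by (simp add: integrable_iff_bounded ennreal_mult_less_top)
 finally show ?thesis .
qed

text \<open>By homogeneity the substitution of \<open>s * \<rho>\<close> for \<open>\<rho>\<close>
  multiplies the exponent by s, so convergence of the tropical integral for one set of exponents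
  gives it for all positive multiples.\<close>

lemma nn_integral_wt_finite:
 assumes fin: "(\<integral>\<^sup>+\<rho>. ennreal (exp (lam n A E \<rho>)) \<partial>log_config n) < \<infinity>" and s: "s > 0"
 shows "(\<integral>\<^sup>+x. ennreal (wt n (\<lambda>j. s * A j) (\<lambda>u v. s * E u v) x) \<partial>config n) < \<infinity>"
proof -
 have D1: "distr (density lborel (\<lambda>_. ennreal s)) lborel (\<lambda>t. s * t) = (lborel :: real measure)"
 proof -
  have "lborel = density (distr lborel borel (\<lambda>t. s * t)) (\<lambda>_. ennreal s)"
   using lborel_real_affine[of s 0] s by simp
  also have "\<dots> = distr (density lborel (\<lambda>_. ennreal s)) borel (\<lambda>t. s * t)"
   by (subst density_distr) auto
  also have "\<dots> = distr (density lborel (\<lambda>_. ennreal s)) lborel (\<lambda>t. s * t)"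
   by (rule distr_cong) auto
  finally show ?thesis ..
 qed
 have Tm: "(\<lambda>\<rho>. \<lambda>j\<in>{..<n}. s * \<rho> j) \<in> measurable (log_config n) (log_config n)"
  by (rule measurable_restrict) (auto intro!: borel_measurable_times measurable_component_singleton[of _ _ "\<lambda>_. lborel", simplified])
 have D: "distr (density (log_config n) (\<lambda>\<rho>. \<Prod>j<n. ennreal s)) (log_config n) (\<lambda>\<rho>. \<lambda>j\<in>{..<n}. s * \<rho> j) = log_config n"
  by (rule distr_density_PiM[where T="\<lambda>_ t. s * t"]) (auto intro: sigma_finite_lborel D1)
 have "(\<integral>\<^sup>+\<rho>. ennreal (exp (lam n A E \<rho>)) \<partial>log_config n)
   = (\<integral>\<^sup>+\<rho>. (\<Prod>j<n. ennreal s) * ennreal (exp (lam n A E (\<lambda>j\<in>{..<n}. s * \<rho> j))) \<partial>log_config n)"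
  by (subst D[symmetric], subst nn_integral_distr, use Tm in simp, simp,
    subst nn_integral_density) (use measurable_compose[OF Tm] in \<open>auto intro!: measurable_compose[OF measurable_compose[OF Tm lam_measurable]]\<close>)
 also have "\<dots> = (\<integral>\<^sup>+\<rho>. (\<Prod>j<n. ennreal s) * ennreal (exp (s * lam n A E \<rho>)) \<partial>log_config n)"
 proof (rule nn_integral_cong)
  fix \<rho>
  have "lam n A E (\<lambda>j\<in>{..<n}. s * \<rho> j) = s * lam n A E \<rho>"
   using lam_cong[of n "\<lambda>j\<in>{..<n}. s * \<rho> j" "\<lambda>j. s * \<rho> j"] lam_scale[of s] s by simp
  then show "(\<Prod>j<n. ennreal s) * ennreal (exp (lam n A E (\<lambda>j\<in>{..<n}. s * \<rho> j))) = (\<Prod>j<n. ennreal s) * ennreal (exp (s * lam n A E \<rho>))" by simp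
 qed
 also have "\<dots> = (\<Prod>j<n. ennreal s) * (\<integral>\<^sup>+\<rho>. ennreal (exp (s * lam n A E \<rho>)) \<partial>log_config n)"
  by (rule nn_integral_cmult) measurable
 finally have eq: "(\<integral>\<^sup>+\<rho>. ennreal (exp (lam n A E \<rho>)) \<partial>log_config n) = \<dots>" .
 have fin2: "(\<integral>\<^sup>+\<rho>. ennreal (exp (s * lam n A E \<rho>)) \<partial>log_config n) < \<infinity>"
 proof (rule ccontr)
  assume "\<not> ?thesis"
  then have "(\<integral>\<^sup>+\<rho>. ennreal (exp (s * lam n A E \<rho>)) \<partial>log_config n) = \<infinity>" by (metis less_top infinity_ennreal_def)
  moreover have "(\<Prod>j<n. ennreal s) \<noteq> 0" using s by simp
  ultimately show False using eq fin by (simp add: ennreal_mult_eq_top_iff)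
 qed
 have cone: "of_real t * w \<in> - {0 :: complex} \<longleftrightarrow> w \<in> - {0}" if "t > 0" for t w using that by simp
 have b: "\<exists>p q. q > 0 \<and> ball p q \<subseteq> - {0 :: complex}"
  by (intro exI[of _ 1] exI[of _ "1 :: real"]) auto
 have m: "- {0 :: complex} \<in> sets borel" "0 \<notin> - {0 :: complex}" by auto
 obtain c where c: "c > (0 :: real)"
  "\<And>f. f \<in> borel_measurable (log_config n) \<Longrightarrow>
    (\<integral>\<^sup>+\<rho>. f \<rho> \<partial>log_config n) =
    ennreal c * (\<integral>\<^sup>+x. cone_prod n (\<lambda>_. - {0}) x * f (\<lambda>j\<in>{..<n}. lnx x j) \<partial>config n)"
  using nn_integral_config_cones[of n "\<lambda>_. - {0}", OF m cone b] by blast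
 have "ennreal c * (\<integral>\<^sup>+x. cone_prod n (\<lambda>_. - {0}) x * ennreal (exp (s * lam n A E (\<lambda>j\<in>{..<n}. lnx x j))) \<partial>config n) < \<infinity>"
  using fin2 by (subst (asm) c(2)) auto
 moreover have "cone_prod n (\<lambda>_. - {0}) x * ennreal (exp (s * lam n A E (\<lambda>j\<in>{..<n}. lnx x j)))
   = ennreal (wt n (\<lambda>j. s * A j) (\<lambda>u v. s * E u v) x)" for x
 proof -
  have "cone_weight (- {0}) 1 w = ennreal (1 / (cmod w)\<^sup>2)" for w
   by (cases "w = 0") auto
  then have "cone_prod n (\<lambda>_. - {0}) x = ennreal (\<Prod>j<n. 1 / (cmod (x j))\<^sup>2)"
   by (simp add: prod_ennreal)
  then show ?thesis
   unfolding wt_def lam_scale_coeff by (subst lam_cong[of n "\<lambda>j\<in>{..<n}. lnx x j" "lnx x"])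
    (auto simp: ennreal_mult'[symmetric] prod_nonneg mult.commute)
 qed
 ultimately show ?thesis using c(1) by (auto simp: ennreal_mult_less_top)
qed

section \<open>Simple poles along forests\<close>

text \<open>Against the scale-invariant measure the integrand is |w|^(1/2), so in logarithmic
  coordinates the integral is that of exp (\<rho> / 2) up to ln R.\<close>

lemma nn_integral_norm_powr_finite:
 assumes "R > 0"
 shows "(\<integral>\<^sup>+w. ennreal (cmod w powr (- 3/2)) * indicator (ball (0 :: complex) R) w \<partial>lborel) < \<infinity>"
proof -
 define c where "c = (\<integral>\<^sup>+w. cone_weight (- {0 :: complex}) 1 w * indicator {0..<1} (- lnc w) \<partial>lborel)"
 define g where "g \<rho> = ennreal (exp (\<rho> / 2)) * indicator {..ln R} \<rho>" for \<rho>
 have gm[measurable]: "g \<in> borel_measurable borel" unfolding g_def by measurable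
 have cone: "of_real t * w \<in> - {0 :: complex} \<longleftrightarrow> w \<in> - {0}" if "t > 0" for t w using that by simp
 have "(\<integral>\<^sup>+w. ennreal (cmod w powr (- 3/2)) * indicator (ball (0 :: complex) R) w \<partial>lborel)
   \<le> (\<integral>\<^sup>+w. cone_weight (- {0 :: complex}) 1 w * g (lnc w) \<partial>lborel)"
 proof (rule nn_integral_mono)
  fix w :: complex
  show "ennreal (cmod w powr (- 3/2)) * indicator (ball 0 R) w \<le> cone_weight (- {0}) 1 w * g (lnc w)"
  proof (cases "w \<noteq> 0 \<and> cmod w < R")
   case True
   have "cmod w powr (- 3/2) = 1 / (cmod w)\<^sup>2 * exp (lnc w / 2)"
   proof -
    have "exp (lnc w / 2) = cmod w powr (1/2)" using True by (simp add: powr_def)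
    moreover have "1 / (cmod w)\<^sup>2 = cmod w powr (-2)" using True by (simp add: powr_minus_divide)
    ultimately show ?thesis using True by (simp add: powr_add[symmetric])
   qed
   then have "ennreal (cmod w powr (- 3/2)) = ennreal (1 / (cmod w)\<^sup>2) * ennreal (exp (lnc w / 2))"
    by (simp add: ennreal_mult'[symmetric])
   moreover have "lnc w \<le> ln R" using True assms by simp
   ultimately show ?thesis using True by (simp add: g_def)
  qed (auto simp: indicator_def)
 qed
 also have "\<dots> = c * (\<integral>\<^sup>+\<rho>. g \<rho> \<partial>lborel)"
  by (rule nn_integral_cone_ln[OF _ _ cone gm c_def]) auto
 also have "(\<integral>\<^sup>+\<rho>. g \<rho> \<partial>lborel) = ennreal (2 * exp (ln R / 2))"
 proof -
  have "(\<integral>\<^sup>+\<rho>. ennreal (exp (\<rho> / 2)) * indicator {..ln R} \<rho> \<partial>lborel) = (\<integral>\<^sup>+\<rho>. ennreal (exp (- \<rho> / 2)) * indicator {- ln R..} \<rho> \<partial>lborel)"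
  proof -
   have "(\<integral>\<^sup>+\<rho>. ennreal (exp (\<rho> / 2)) * indicator {..ln R} \<rho> \<partial>lborel)
    = ennreal \<bar>-1\<bar> * (\<integral>\<^sup>+\<rho>. ennreal (exp ((0 + - 1 * \<rho>) / 2)) * indicator {..ln R} (0 + - 1 * \<rho>) \<partial>lborel)"
    by (rule nn_integral_real_affine) auto
   also have "\<dots> = (\<integral>\<^sup>+\<rho>. ennreal (exp (- \<rho> / 2)) * indicator {- ln R..} \<rho> \<partial>lborel)"
    by (simp, intro nn_integral_cong) (auto simp: indicator_def)
   finally show ?thesis .
  qed
  also have "\<dots> = ennreal (0 - (- 2 * exp (- (- ln R) / 2)))"
  proof (rule nn_integral_FTC_atLeast)
   show "((\<lambda>\<rho>. - 2 * exp (- \<rho> / 2)) has_real_derivative exp (- x / 2)) (at x)" for x :: real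
    by (auto intro!: derivative_eq_intros)
   have "((\<lambda>\<rho>::real. exp (- \<rho> / 2)) \<longlongrightarrow> 0) at_top"
   proof -
    have "filterlim (\<lambda>\<rho>::real. (1/2) * \<rho>) at_top at_top"
     by (rule filterlim_tendsto_pos_mult_at_top[OF tendsto_const _ filterlim_ident]) simp
    from tendsto_inverse_0_at_top[OF filterlim_compose[OF exp_at_top this]]
    show ?thesis by (simp add: exp_minus)
   qed
   then show "((\<lambda>\<rho>::real. - 2 * exp (- \<rho> / 2)) \<longlongrightarrow> 0) at_top"
    using tendsto_mult[OF tendsto_const[of "-2"]] by fastforce
  qed auto
  finally show ?thesis by (simp add: g_def)
 qed
 also have "c * \<dots> < \<infinity>"
  using nn_integral_cone_annulus_finite[of "- {0}"] by (simp add: c_def ennreal_mult_less_top)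
 finally show ?thesis .
qed

text \<open>A pole at \<open>p\<close> does not spoil integrability of a weight which varies slowly in the
 logarithmic scale; the constant is uniform in the position of the pole.\<close>

lemma leaf_estimate_unit:
 assumes K: "K \<ge> 0" and C: "C \<ge> 1"
 shows "\<exists>B::real. B > 0 \<and> (\<forall>\<omega> p. slow K \<omega> \<longrightarrow> (\<forall>s. \<omega> s \<ge> 0) \<longrightarrow> \<omega> \<in> borel_measurable borel \<longrightarrow>
   1 / C \<le> cmod p \<longrightarrow> cmod p \<le> C \<longrightarrow>
   near_mass \<omega> p 1
    \<le> ennreal B * log_mass \<omega>)"
proof -
 \<comment> \<open>Where |ln |w|| is at least \<open>T\<close>, the moduli of \<open>w\<close> and
   \<open>p\<close> differ by a factor of at least 2 and the pole is harmless. In the remaining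
   annulus \<open>\<omega>\<close> is comparable with \<open>\<omega> 0\<close>, which in turn is
   bounded by the mass near 1 through \<open>V\<close> and \<open>B3\<close>.\<close>
 define T where "T = ln (2 * C)"
 have T: "exp T = 2 * C" "T > 0" using C by (auto simp: T_def)
 define S where "S = (\<integral>\<^sup>+w. ennreal (cmod w powr (- 3/2)) * indicator (ball (0 :: complex) (exp T + C)) w \<partial>lborel)"
 have S: "S < \<infinity>" unfolding S_def by (rule nn_integral_norm_powr_finite) (use C T in auto)
 define V where "V = emeasure lborel (ball (1 :: complex) (1/2))"
 have V: "V > 0" "V < \<infinity>" unfolding V_def
  using content_ball_pos[of "1/2" "1::complex"] by (simp_all add: Sigma_Algebra.measure_def enn2real_positive_iff emeasure_lborel_ball_finite)
 define B1 where "B1 = (2 * C) powr (3/2)"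
 define B2 where "B2 = exp (K * T) * (exp T)\<^sup>2 * (exp T) powr (3/2)"
 define B3 where "B3 = exp K * (2 :: real)\<^sup>2"
 define B where "B = B1 + B2 * enn2real S * B3 / enn2real V"
 let ?b = "B2 * enn2real S * B3 / enn2real V"
 have pos: "B1 > 0" "B2 > 0" "B3 > 0" using C by (auto simp: B1_def B2_def B3_def)
 have Vr: "V = ennreal (enn2real V)" "enn2real V > 0" using V by (auto simp: enn2real_positive_iff)
 have Sr: "S = ennreal (enn2real S)" using S by auto
 have "B > 0" unfolding B_def using pos Vr(2) by (intro add_pos_nonneg) auto
 moreover have "near_mass \<omega> p 1
    \<le> ennreal B * log_mass \<omega>"
  if om: "\<And>s t. \<omega> s \<le> exp (K * \<bar>s - t\<bar>) * \<omega> t" "\<And>s. \<omega> s \<ge> 0" and m[measurable]: "\<omega> \<in> borel_measurable borel"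
   and p: "1 / C \<le> cmod p" "cmod p \<le> C" for \<omega> p
 proof -
  let ?N = "\<lambda>w. ennreal (near_density \<omega> p 1 w)" and ?M = "\<lambda>w. ennreal (log_density \<omega> w)"
  let ?q = "\<lambda>w. ennreal (cmod (w - p) powr (- 3/2)) * indicator (ball 0 (exp T + C)) (w - p)"
  define I where "I = log_mass \<omega>"
  have bm[measurable]: "(indicator (ball (0 :: complex) (exp T + C)) :: complex \<Rightarrow> ennreal) \<in> borel_measurable borel"
   by (rule borel_measurable_indicator) simp
  have im[measurable]: "(\<lambda>w. indicator (ball 0 (exp T + C)) (w - p) :: ennreal) \<in> borel_measurable borel"
   by (rule measurable_compose[of "\<lambda>w. w - p" borel borel, OF _ bm]) auto
  have "near_mass \<omega> p 1
   \<le> (\<integral>\<^sup>+w. ennreal B1 * ?M w + ennreal (B2 * \<omega> 0) * (?q w) \<partial>lborel)"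
  proof (rule nn_integral_mono)
   fix w :: complex
   define d where "d = cmod (w - p) / max (cmod w) 1"
   consider "w = 0" | "w \<noteq> 0" "\<bar>lnc w\<bar> < T" | "w \<noteq> 0" "\<bar>lnc w\<bar> \<ge> T" by linarith
   then show "?N w
    \<le> ennreal B1 * ?M w + ennreal (B2 * \<omega> 0) * (?q w)"
   proof cases
    case 2
    have w: "exp (- T) \<le> cmod w" "cmod w \<le> exp T"
     using 2 by (metis abs_le_iff exp_le_cancel_iff exp_ln less_imp_le minus_le_iff zero_less_norm_iff, metis abs_le_iff exp_le_cancel_iff exp_ln less_imp_le zero_less_norm_iff)
    have a: "\<omega> (lnc w) \<le> exp (K * T) * \<omega> 0"
    proof -
     have "exp (K * \<bar>lnc w - 0\<bar>) \<le> exp (K * T)" using 2 K by (simp add: mult_left_mono)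
     then show ?thesis using om(1)[of "lnc w" 0] om(2)[of 0] by (meson mult_right_mono order_trans)
    qed
    have b: "1 / (cmod w)\<^sup>2 \<le> (exp T)\<^sup>2"
    proof -
     have "1 / cmod w \<le> exp T" using w(1) 2(1) by (simp add: exp_minus field_simps)
     then have "(1 / cmod w)\<^sup>2 \<le> (exp T)\<^sup>2" by (intro power_mono) auto
     then show ?thesis by (simp add: power_divide)
    qed
    have c: "(cmod (w - p) / max (cmod w) 1) powr (- 3/2) \<le> (exp T) powr (3/2) * cmod (w - p) powr (- 3/2)"
    proof -
     have "(cmod (w - p) / max (cmod w) 1) powr (- 3/2) = max (cmod w) 1 powr (3/2) * cmod (w - p) powr (- 3/2)"
      by (simp add: powr_divide powr_minus_divide)
     also have "max (cmod w) 1 powr (3/2) \<le> (exp T) powr (3/2)"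
      using w(2) T(2) by (intro powr_mono2) auto
     finally show ?thesis by (simp add: mult_right_mono)
    qed
    have "\<omega> (lnc w) * (1 / (cmod w)\<^sup>2) * (cmod (w - p) / max (cmod w) 1) powr (- 3/2)
      \<le> (exp (K * T) * \<omega> 0) * (exp T)\<^sup>2 * ((exp T) powr (3/2) * cmod (w - p) powr (- 3/2))"
     by (intro mult_mono a b c) (use om(2) in auto)
    then have "near_density \<omega> p 1 w \<le> B2 * \<omega> 0 * cmod (w - p) powr (- 3/2)"
     by (simp add: B2_def mult_ac)
    then have "?N w \<le> ennreal (B2 * \<omega> 0) * ennreal (cmod (w - p) powr (- 3/2))"
     using pos om(2)[of 0] by (subst ennreal_mult[symmetric]) (auto intro: ennreal_leI)
    moreover have "w - p \<in> ball 0 (exp T + C)"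
    proof -
     have "cmod (w - p) \<le> cmod w + cmod p" by (rule norm_triangle_ineq4)
     moreover have "cmod w < exp T" using 2 by (metis abs_less_iff exp_less_cancel_iff exp_ln zero_less_norm_iff)
     ultimately show ?thesis using p by simp
    qed
    ultimately show ?thesis by (simp add: add_increasing)
   next
    case 3
    have "1 / (2 * C) \<le> cmod (w - p) / max (cmod w) 1"
    proof (cases "lnc w \<ge> T")
     case True
     then have "2 * C \<le> cmod w" using 3 T by (metis exp_le_cancel_iff exp_ln zero_less_norm_iff)
     then have "cmod (w - p) \<ge> cmod w / 2" "cmod w \<ge> 1" using norm_triangle_ineq2[of w p] p C by linarith+
     then have "cmod (w - p) / max (cmod w) 1 \<ge> 1 / 2" by (subst pos_le_divide_eq) linarith+
     moreover have "1 / (2 * C) \<le> 1 / 2" using C by (simp add: field_simps)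
     ultimately show ?thesis by linarith
    next
     case False
     then have "lnc w \<le> - T" using 3 by linarith
     then have "cmod w \<le> exp (- T)" using 3 by (metis exp_le_cancel_iff exp_ln zero_less_norm_iff)
     then have "cmod w \<le> 1 / (2 * C)" using T by (simp add: exp_minus field_simps)
     then have "cmod (w - p) \<ge> 1 / (2 * C)"
     proof -
      have "1 / C = 1 / (2 * C) + 1 / (2 * C)" using C by (simp add: field_simps)
      moreover have "cmod p - cmod w \<le> cmod (w - p)" using norm_triangle_ineq2[of p w] by (simp add: norm_minus_commute)
      ultimately show ?thesis using p(1) \<open>cmod w \<le> 1 / (2 * C)\<close> by linarith
     qed
     moreover have "cmod w \<le> 1" using \<open>cmod w \<le> exp (- T)\<close> T(2) by (metis exp_le_one_iff less_imp_le neg_le_0_iff_le order_trans)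
     ultimately show ?thesis by (simp add: max_def)
    qed
    then have "(cmod (w - p) / max (cmod w) 1) powr (- 3/2) \<le> (1 / (2 * C)) powr (- 3/2)"
     using C by (intro powr_mono2') auto
    also have "\<dots> = B1" using C by (simp add: B1_def powr_minus_divide powr_divide)
    finally have "near_density \<omega> p 1 w \<le> B1 * (log_density \<omega> w)"
     using om(2) by (subst mult.commute) (intro mult_right_mono, auto)
    then have "?N w \<le> ennreal B1 * ?M w"
     using pos om(2) by (subst ennreal_mult[symmetric]) (auto intro: ennreal_leI)
    then show ?thesis by (simp add: add_increasing2)
   qed simp
  qed
  also have "\<dots> = ennreal B1 * I + ennreal (B2 * \<omega> 0) * (\<integral>\<^sup>+w. ?q w \<partial>lborel)"
   unfolding I_def by (subst nn_integral_add) (auto simp: nn_integral_cmult)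
  also have "(\<integral>\<^sup>+w. ?q w \<partial>lborel) = S"
  proof -
   have "(\<integral>\<^sup>+w. ?q w \<partial>lborel)
    = (\<integral>\<^sup>+w. ennreal (cmod w powr (- 3/2)) * indicator (ball 0 (exp T + C)) w \<partial>distr lborel borel (\<lambda>w. w - p))"
    by (subst nn_integral_distr) auto
   also have "distr lborel borel (\<lambda>w. w - p) = lborel"
   proof -
    have "(\<lambda>w. w - p) = (+) (- p)" by (auto simp: fun_eq_iff)
    then show ?thesis using lborel_distr_plus[of "- p"] by simp
   qed
   finally show ?thesis by (simp add: S_def)
  qed
  also have "ennreal B1 * I + ennreal (B2 * \<omega> 0) * S \<le> ennreal B1 * I + ennreal (?b) * I"
  proof (rule add_left_mono)
   have "ennreal (\<omega> 0 / B3) * V \<le> I"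
   proof -
    have "ennreal (\<omega> 0 / B3) * V = (\<integral>\<^sup>+w. ennreal (\<omega> 0 / B3) * indicator (ball (1 :: complex) (1/2)) w \<partial>lborel)"
     by (simp add: nn_integral_cmult_indicator V_def)
    also have "\<dots> \<le> I" unfolding I_def
    proof (rule nn_integral_mono)
     fix w :: complex
     show "ennreal (\<omega> 0 / B3) * indicator (ball 1 (1/2)) w \<le> ?M w"
     proof (cases "w \<in> ball 1 (1/2)")
      case True
      then have "cmod (w - 1) < 1/2" by (simp add: dist_norm norm_minus_commute)
      then have w: "1/2 < cmod w" "cmod w < 3/2"
       using norm_triangle_ineq2[of 1 w] norm_triangle_ineq2[of w 1] by (auto simp: norm_minus_commute)
      have "exp (-1 :: real) \<le> 1/2"
       using exp_ge_add_one_self[of 1] by (simp add: exp_minus field_simps)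
      then have "-1 \<le> lnc w" using w by (subst ln_ge_iff) auto
      moreover have "cmod w \<le> exp 1" using w exp_ge_add_one_self[of 1] by linarith
      then have "lnc w \<le> ln (exp 1)" using w by (subst ln_le_cancel_iff) auto
      then have "lnc w \<le> 1" by simp
      ultimately have "\<bar>0 - lnc w\<bar> \<le> 1" by simp
      then have "exp (K * \<bar>0 - lnc w\<bar>) \<le> exp K" using K by (simp add: mult_left_le)
      then have "\<omega> 0 \<le> exp K * \<omega> (lnc w)"
       using om(1)[of 0 "lnc w"] om(2)[of "lnc w"] by (meson mult_right_mono order_trans)
      moreover have "(cmod w)\<^sup>2 \<le> 2\<^sup>2" using w by (intro power_mono) auto
      ultimately have "\<omega> 0 * (cmod w)\<^sup>2 \<le> exp K * \<omega> (lnc w) * 2\<^sup>2"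
       using om(2) by (intro mult_mono) auto
      then have "\<omega> 0 / B3 \<le> log_density \<omega> w"
      proof -
       have cw: "(cmod w)\<^sup>2 > 0" using w by (intro zero_less_power) linarith
       show ?thesis
        using \<open>\<omega> 0 * (cmod w)\<^sup>2 \<le> exp K * \<omega> (lnc w) * 2\<^sup>2\<close>
        by (simp add: pos_divide_le_eq[OF pos(3)] pos_le_divide_eq[OF cw]) (simp add: B3_def mult_ac)
      qed
      then show ?thesis using True by (simp add: ennreal_leI)
     qed simp
    qed
    finally show ?thesis .
   qed
   moreover have "ennreal (B2 * \<omega> 0) * S = ennreal (?b) * (ennreal (\<omega> 0 / B3) * V)"
   proof -
    have "ennreal (B2 * \<omega> 0) * ennreal (enn2real S) = ennreal (?b) * (ennreal (\<omega> 0 / B3) * ennreal (enn2real V))"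
     using pos om(2)[of 0] Vr(2) by (simp add: ennreal_mult[symmetric] field_simps)
    then show ?thesis using Vr(1) Sr by simp
   qed
   ultimately show "ennreal (B2 * \<omega> 0) * S \<le> ennreal (?b) * I"
    by (simp add: mult_left_mono)
  qed
  also have "\<dots> = ennreal B * I"
   unfolding B_def using pos Vr(2) by (subst ennreal_plus) (auto simp: distrib_right)
  finally show ?thesis by (simp add: I_def)
 qed
 ultimately show ?thesis by blast
qed

text \<open>Scaling by \<open>r\<close> reduces to unit scale, because the measure is
  scale-invariant and shifting \<open>\<omega>\<close> by ln r keeps it slow. Uniformity in r is
  essential: the pole will sit at another integration variable.\<close>

lemma leaf_estimate:
 assumes K: "K \<ge> 0" and C: "C \<ge> 1"
 shows "\<exists>B::real. B > 0 \<and> (\<forall>\<omega> p r. slow K \<omega> \<longrightarrow> (\<forall>s. \<omega> s \<ge> 0) \<longrightarrow> \<omega> \<in> borel_measurable borel \<longrightarrow>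
   r > 0 \<longrightarrow> r / C \<le> cmod p \<longrightarrow> cmod p \<le> C * r \<longrightarrow>
   near_mass \<omega> p r
    \<le> ennreal B * log_mass \<omega>)"
proof -
 obtain B :: real where B: "B > 0" "\<And>\<omega> p. slow K \<omega> \<Longrightarrow> (\<forall>s. \<omega> s \<ge> 0) \<Longrightarrow> \<omega> \<in> borel_measurable borel \<Longrightarrow>
   1 / C \<le> cmod p \<Longrightarrow> cmod p \<le> C \<Longrightarrow>
   near_mass \<omega> p 1
    \<le> ennreal B * log_mass \<omega>"
  using leaf_estimate_unit[OF assms] by blast
 show ?thesis
 proof (intro exI[of _ B] conjI allI impI)
  fix \<omega> :: "real \<Rightarrow> real" and p :: complex and r :: real
  assume om: "slow K \<omega>" "\<forall>s. \<omega> s \<ge> 0" and m[measurable]: "\<omega> \<in> borel_measurable borel"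
   and r: "r > 0" "r / C \<le> cmod p" "cmod p \<le> C * r"
  define \<omega>' where "\<omega>' s = \<omega> (s + ln r)" for s
  have m'[measurable]: "\<omega>' \<in> borel_measurable borel" unfolding \<omega>'_def by measurable
  have sc: "\<omega> (ln (cmod (of_real r * w))) / (cmod (of_real r * w))\<^sup>2 * (r\<^sup>2) = log_density \<omega>' w" for w
  proof (cases "w = 0")
   case False
   then have "ln (cmod (of_real r * w)) = lnc w + ln r" using r by (simp add: norm_mult ln_mult)
   then show ?thesis using r by (simp add: \<omega>'_def norm_mult power_mult_distrib)
  qed simp
  have sc2: "cmod (of_real r * w - p) / max (cmod (of_real r * w)) r = cmod (w - p / of_real r) / max (cmod w) 1" for w
  proof -
   have "of_real r * w - p = of_real r * (w - p / of_real r)" using r by (simp add: algebra_simps)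
   then have "cmod (of_real r * w - p) = r * cmod (w - p / of_real r)" using r by (simp add: norm_mult)
   moreover have "max (cmod (of_real r * w)) r = r * max (cmod w) 1" using r by (simp add: norm_mult max_mult_distrib_left)
   ultimately show ?thesis using r by simp
  qed
  have e1: "near_mass \<omega> p r
   = near_mass \<omega>' (p / of_real r) 1"
  proof (subst nn_integral_lborel_mult_complex[of "of_real r"])
   show "(\<integral>\<^sup>+w. ennreal ((cmod (of_real r))\<^sup>2) * ennreal (\<omega> (ln (cmod (of_real r * w))) / (cmod (of_real r * w))\<^sup>2 * (cmod (of_real r * w - p) / max (cmod (of_real r * w)) r) powr (- 3/2)) \<partial>lborel)
    = near_mass \<omega>' (p / of_real r) 1"
    by (intro nn_integral_cong, subst ennreal_mult'[symmetric], simp, simp only: sc2 sc[symmetric]) (use r in \<open>simp add: mult_ac\<close>)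
  qed (use r in auto)
  have e2: "log_mass \<omega> = log_mass \<omega>'"
  proof (subst nn_integral_lborel_mult_complex[of "of_real r"])
   show "(\<integral>\<^sup>+w. ennreal ((cmod (of_real r))\<^sup>2) * ennreal (\<omega> (ln (cmod (of_real r * w))) / (cmod (of_real r * w))\<^sup>2) \<partial>lborel)
    = log_mass \<omega>'"
    by (intro nn_integral_cong, subst ennreal_mult'[symmetric], simp, simp only: sc[symmetric]) (use r in \<open>simp add: mult_ac\<close>)
  qed (use r in auto)
  show "near_mass \<omega> p r
    \<le> ennreal B * log_mass \<omega>"
   unfolding e1 e2
  proof (rule B(2))
   show "\<forall>s t. \<omega>' s \<le> exp (K * \<bar>s - t\<bar>) * \<omega>' t"
   proof (intro allI)
    fix s t show "\<omega>' s \<le> exp (K * \<bar>s - t\<bar>) * \<omega>' t"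
     using om(1)[rule_format, of "s + ln r" "t + ln r"] by (simp add: \<omega>'_def)
   qed
   show "\<forall>s. \<omega>' s \<ge> 0" using om(2) by (simp add: \<omega>'_def)
   show "1 / C \<le> cmod (p / of_real r)" "cmod (p / of_real r) \<le> C" using r C by (auto simp: norm_divide field_simps)
  qed (rule m')
 qed (rule B(1))
qed

text \<open>The head of the list carries a variable absent from the tail, to be integrated out
  first. Every edge thus owns a variable of its own, which excludes cycles and paths from
  \<open>z\<close> to 1.\<close>

fun forest :: "nat \<Rightarrow> graph \<Rightarrow> bool" where
 "forest n [] \<longleftrightarrow> True"
| "forest n ((u, v) # l) \<longleftrightarrow> forest n l \<and> u \<noteq> v \<and> u \<le> n + 1 \<and> v \<le> n + 1 \<and>
   (u < n \<and> u \<notin> verts l \<or> v < n \<and> v \<notin> verts l)"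

text \<open>A maximum is 1-Lipschitz in each argument. So the weight is \<open>slow\<close> in every
  logarithmic variable, with a constant that does not depend on the others, as the leaf estimate
  demands.\<close>

lemma lam_upd_le:
 assumes j: "j < n"
 shows "\<bar>lam n A E (\<rho>(j := s)) - lam n A E (\<rho>(j := t))\<bar> \<le>
  ((\<Sum>j<n. 2 * \<bar>A j\<bar>) + (\<Sum>(u, v)\<in>prs n. 2 * \<bar>E u v\<bar>)) * \<bar>s - t\<bar>"
proof -
 have 1: "\<bar>2 * A i * (\<rho>(j := s)) i - 2 * A i * (\<rho>(j := t)) i\<bar> \<le> 2 * \<bar>A i\<bar> * \<bar>s - t\<bar>" for i
  by (cases "i = j") (auto simp: abs_mult right_diff_distrib[symmetric])
 have e: "\<bar>ext n (\<rho>(j := s)) u - ext n (\<rho>(j := t)) u\<bar> \<le> \<bar>s - t\<bar>" for u by (auto simp: ext_def)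
 have 2: "\<bar>2 * E u v * max (ext n (\<rho>(j := s)) u) (ext n (\<rho>(j := s)) v) - 2 * E u v * max (ext n (\<rho>(j := t)) u) (ext n (\<rho>(j := t)) v)\<bar> \<le> 2 * \<bar>E u v\<bar> * \<bar>s - t\<bar>" for u v
 proof -
  have "\<bar>max (ext n (\<rho>(j := s)) u) (ext n (\<rho>(j := s)) v) - max (ext n (\<rho>(j := t)) u) (ext n (\<rho>(j := t)) v)\<bar> \<le> \<bar>s - t\<bar>"
   using e[of u] e[of v] by (auto simp: max_def abs_if split: if_splits)
  then have "\<bar>2 * E u v\<bar> * \<bar>max (ext n (\<rho>(j := s)) u) (ext n (\<rho>(j := s)) v) - max (ext n (\<rho>(j := t)) u) (ext n (\<rho>(j := t)) v)\<bar> \<le> \<bar>2 * E u v\<bar> * \<bar>s - t\<bar>"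
   by (intro mult_left_mono) auto
  moreover have "2 * E u v * max (ext n (\<rho>(j := s)) u) (ext n (\<rho>(j := s)) v) - 2 * E u v * max (ext n (\<rho>(j := t)) u) (ext n (\<rho>(j := t)) v)
    = (2 * E u v) * (max (ext n (\<rho>(j := s)) u) (ext n (\<rho>(j := s)) v) - max (ext n (\<rho>(j := t)) u) (ext n (\<rho>(j := t)) v))"
   by (simp only: right_diff_distrib)
  ultimately show ?thesis by (simp only: abs_mult) simp
 qed
 define X where "X i = 2 * A i * (\<rho>(j := s)) i - 2 * A i * (\<rho>(j := t)) i" for i
 define Y where "Y u v = 2 * E u v * max (ext n (\<rho>(j := s)) u) (ext n (\<rho>(j := s)) v) - 2 * E u v * max (ext n (\<rho>(j := t)) u) (ext n (\<rho>(j := t)) v)" for u v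
 have "lam n A E (\<rho>(j := s)) - lam n A E (\<rho>(j := t)) = (\<Sum>i<n. X i) + (\<Sum>(u, v)\<in>prs n. Y u v)"
  by (simp add: lam_def sum_subtractf split_beta X_def Y_def)
 moreover have "\<bar>\<Sum>i<n. X i\<bar> \<le> (\<Sum>i<n. 2 * \<bar>A i\<bar> * \<bar>s - t\<bar>)"
  using 1 unfolding X_def by (intro order_trans[OF sum_abs] sum_mono)
 moreover have "\<bar>\<Sum>(u, v)\<in>prs n. Y u v\<bar> \<le> (\<Sum>(u, v)\<in>prs n. 2 * \<bar>E u v\<bar> * \<bar>s - t\<bar>)"
  using 2 unfolding Y_def by (intro order_trans[OF sum_abs] sum_mono) (simp only: split_beta)
 moreover have "(\<Sum>i<n. 2 * \<bar>A i\<bar> * \<bar>s - t\<bar>) + (\<Sum>(u, v)\<in>prs n. 2 * \<bar>E u v\<bar> * \<bar>s - t\<bar>)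
  = ((\<Sum>j<n. 2 * \<bar>A j\<bar>) + (\<Sum>(u, v)\<in>prs n. 2 * \<bar>E u v\<bar>)) * \<bar>s - t\<bar>"
  by (simp add: sum_distrib_right distrib_right split_beta)
 ultimately show ?thesis by linarith
qed

lemma lnx_upd: "lnx (x(j := w)) = (lnx x)(j := lnc w)"
 by (auto simp: lnx_def fun_eq_iff)

lemma pt_upd: "u \<noteq> j \<Longrightarrow> pt n z (x(j := w)) u = pt n z x u" "j < n \<Longrightarrow> pt n z (x(j := w)) j = w"
 by (auto simp: pt_def)

text \<open>Leaves are removed one at a time. In the leaf variable the weight is slow and the only
  further singular factor is the edge to its neighbour, so the inner integral is bounded by the one
  without that edge.\<close>

lemma nn_integral_wt_forest:
 assumes z: "z \<noteq> 0"
 shows "\<exists>B::real. B > 0 \<and> (\<forall>l. forest n l \<longrightarrow>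
  (\<integral>\<^sup>+x. ennreal (wt n A E x * sep_prod n z l x) \<partial>config n)
   \<le> ennreal (B ^ length l) * (\<integral>\<^sup>+x. ennreal (wt n A E x) \<partial>config n))"
proof -
 interpret P: product_sigma_finite "\<lambda>_ :: nat. lborel :: complex measure"
  by (simp add: product_sigma_finite_def sigma_finite_lborel)
 define K where "K = (\<Sum>j<n. 2 * \<bar>A j\<bar>) + (\<Sum>(u, v)\<in>prs n. 2 * \<bar>E u v\<bar>)"
 have K: "K \<ge> 0" unfolding K_def by (intro add_nonneg_nonneg sum_nonneg) auto
 define C where "C = max 1 (max (cmod z) (1 / cmod z))"
 have C: "C \<ge> 1" "cmod z \<le> C" "1 / C \<le> cmod z"
 proof -
  show "C \<ge> 1" "cmod z \<le> C" by (auto simp: C_def)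
  have "1 / cmod z \<le> C" by (simp add: C_def)
  then show "1 / C \<le> cmod z" using z \<open>C \<ge> 1\<close> by (simp add: field_simps)
 qed
 obtain B :: real where B: "B > 0" "\<And>\<omega> p r. slow K \<omega> \<Longrightarrow> (\<forall>s. \<omega> s \<ge> 0) \<Longrightarrow> \<omega> \<in> borel_measurable borel \<Longrightarrow>
   r > 0 \<Longrightarrow> r / C \<le> cmod p \<Longrightarrow> cmod p \<le> C * r \<Longrightarrow>
   near_mass \<omega> p r
    \<le> ennreal B * log_mass \<omega>"
  using leaf_estimate[OF K C(1)] by blast
 define G where "G l x = sep_prod n z l x" for l x
 have G0: "G l x \<ge> 0" for l x unfolding G_def by (induction l) auto
 have Gm[measurable]: "G l \<in> borel_measurable (config n)" for l
 proof (induction l)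
  case (Cons p l)
  have "G (p # l) = (\<lambda>x. isep n z x (fst p) (snd p) * G l x)" by (auto simp: G_def split_beta)
  then show ?case using Cons by simp
 qed (simp add: G_def[abs_def])
 have wt0: "wt n A E x \<ge> 0" for x by (simp add: wt_def prod_nonneg)
 let ?F = "\<lambda>l x. ennreal (wt n A E x * G l x)"
 have leaf: "(\<integral>\<^sup>+x. ennreal (wt n A E x * (isep n z x j v * G l x)) \<partial>config n) \<le> ennreal B * (\<integral>\<^sup>+x. ?F l x \<partial>config n)"
  if j: "j < n" "j \<notin> verts l" "v \<noteq> j" "v \<le> n + 1" for j v l
 proof -
  let ?H = "\<lambda>l x. ennreal (wt n A E x * (isep n z x j v * G l x))"
  define I where "I = {..<n} - {j}"
  let ?P = "PiM I (\<lambda>_. lborel :: complex measure)"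
  have I: "finite I" "j \<notin> I" "{..<n} = insert j I" using j by (auto simp: I_def)
  have GI: "G l (x(j := w)) = G l x" for x w
  proof -
   have "sep n z (x(j := w)) u v = sep n z x u v" if "u \<noteq> j" "v \<noteq> j" for u v
    using that by (simp add: sep_def pt_upd lnx_upd ext_def)
   moreover have "fst p \<noteq> j \<and> snd p \<noteq> j" if "p \<in> set l" for p
    using that j(2) by (auto simp: verts_def)
   ultimately show ?thesis
    unfolding G_def by (intro arg_cong[where f=prod_list] map_cong) (auto simp: split_beta)
  qed
  define R where "R x = (\<Prod>i\<in>I. 1 / (cmod (x i))\<^sup>2)" for x :: conf
  have R0: "R x \<ge> 0" for x unfolding R_def by (simp add: prod_nonneg)
  define \<omega> where "\<omega> x t = exp (lam n A E ((lnx x)(j := t)))" for x t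
  have wtI: "wt n A E (x(j := w)) = R x * (log_density (\<omega> x) w)" for x w
  proof -
   have "(\<Prod>i<n. 1 / (cmod ((x(j := w)) i))\<^sup>2) = 1 / (cmod w)\<^sup>2 * R x"
   proof -
    have "(\<Prod>i\<in>I. 1 / (cmod ((x(j := w)) i))\<^sup>2) = R x"
     unfolding R_def by (rule prod.cong) (use I(2) in auto)
    then show ?thesis unfolding I(3) by (simp add: prod.insert[OF I(1,2)])
   qed
   then show ?thesis by (simp add: wt_def lnx_upd \<omega>_def)
  qed
  have om: "\<omega> x s \<le> exp (K * \<bar>s - t\<bar>) * \<omega> x t" for x s t
  proof -
   have "lam n A E ((lnx x)(j := s)) \<le> K * \<bar>s - t\<bar> + lam n A E ((lnx x)(j := t))"
    using lam_upd_le[OF j(1), of A E "lnx x" s t] unfolding K_def[symmetric] by linarith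
   then show ?thesis by (simp add: \<omega>_def exp_add[symmetric])
  qed
  have omm[measurable]: "\<omega> x \<in> borel_measurable borel" for x
  proof -
   have "K-lipschitz_on UNIV (\<lambda>t. lam n A E ((lnx x)(j := t)))"
    by (rule lipschitz_onI) (use lam_upd_le[OF j(1), of A E "lnx x"] K in \<open>simp_all add: dist_real_def K_def\<close>)
   then have "continuous_on UNIV (\<lambda>t. lam n A E ((lnx x)(j := t)))" by (rule lipschitz_on_continuous_on)
   then have "continuous_on UNIV (\<omega> x)" unfolding \<omega>_def by (intro continuous_intros)
   then show ?thesis by (rule borel_measurable_continuous_onI)
  qed
  have inner: "(\<integral>\<^sup>+w. ?H l (x(j := w)) \<partial>lborel)
    \<le> ennreal B * (\<integral>\<^sup>+w. ?F l (x(j := w)) \<partial>lborel)" if x0: "v < n \<Longrightarrow> x v \<noteq> 0" for x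
  proof -
   define r where "r = exp (ext n (lnx x) v)"
   define p where "p = pt n z x v"
   have r: "r > 0" by (simp add: r_def)
   have rp: "r / C \<le> cmod p" "cmod p \<le> C * r"
    using x0 C j(4) unfolding r_def p_def by (auto simp: ext_def pt_def lnx_def divide_le_eq mult_le_cancel_right1 mult_le_cancel_right2)
   have sepw: "sep n z (x(j := w)) j v = cmod (w - p) / max (cmod w) r" if "w \<noteq> 0" for w
   proof -
    have "ext n (lnx (x(j := w))) j = lnc w" "ext n (lnx (x(j := w))) v = ext n (lnx x) v"
     using j by (auto simp: ext_def lnx_upd)
    moreover have "exp (max (lnc w) (ext n (lnx x) v)) = max (cmod w) r"
     using that by (auto simp: max_def r_def) (metis exp_le_cancel_iff exp_ln zero_less_norm_iff)+
    ultimately show ?thesis using j by (simp add: sep_def pt_upd p_def)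
   qed
   have "(\<integral>\<^sup>+w. ?H l (x(j := w)) \<partial>lborel)
    = (\<integral>\<^sup>+w. ennreal (R x * G l x) * ennreal (near_density (\<omega> x) p r w) \<partial>lborel)"
   proof (rule nn_integral_cong)
    fix w :: complex
    show "?H l (x(j := w))
     = ennreal (R x * G l x) * ennreal (near_density (\<omega> x) p r w)"
    proof (cases "w = 0")
     case False
     have "\<omega> x t \<ge> 0" for t by (simp add: \<omega>_def)
     then show ?thesis
      unfolding wtI GI sepw[OF False] using R0 G0 by (subst ennreal_mult[symmetric]) (auto simp: mult_ac)
    qed (simp add: wtI)
   qed
   also have "\<dots> = ennreal (R x * G l x) * near_mass (\<omega> x) p r"
    by (rule nn_integral_cmult) measurable
   also have "\<dots> \<le> ennreal (R x * G l x) * (ennreal B * log_mass (\<omega> x))"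
   proof (intro mult_left_mono B(2) r rp omm allI om)
    show "\<omega> x s \<ge> 0" for s by (simp add: \<omega>_def)
   qed simp
   also have "\<dots> = ennreal B * (\<integral>\<^sup>+w. ennreal (R x * G l x) * ennreal (log_density (\<omega> x) w) \<partial>lborel)"
    by (subst nn_integral_cmult) (auto simp: mult_ac)
   also have "(\<integral>\<^sup>+w. ennreal (R x * G l x) * ennreal (log_density (\<omega> x) w) \<partial>lborel) = (\<integral>\<^sup>+w. ?F l (x(j := w)) \<partial>lborel)"
    unfolding wtI GI using R0 G0
    by (intro nn_integral_cong, subst ennreal_mult[symmetric]) (auto simp: mult_ac \<omega>_def)
   finally show ?thesis .
  qed
  \<comment> \<open>Because \<open>ln 0 = 0\<close>, the radius \<open>r\<close> is comparable with
    the modulus of the pole only if the neighbour is away from the origin; the exception is a null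
    set.\<close>
  have AE: "AE x in ?P. v < n \<longrightarrow> x v \<noteq> (0 :: complex)"
  proof (cases "v < n")
   case True
   then have "v \<in> I" using j by (auto simp: I_def)
   have "AE x in ?P. x v \<noteq> (0 :: complex)"
   proof (rule AE_I[where N="{x \<in> space (?P). x v = (0 :: complex)}"])
    have N: "{x \<in> space (?P). x v = (0 :: complex)} = Pi\<^sub>E I (\<lambda>i. if i = v then {0} else UNIV)"
     using \<open>v \<in> I\<close> by (auto simp: space_PiM PiE_iff extensional_def split: if_splits)
    show "emeasure (?P) {x \<in> space (?P). x v = (0 :: complex)} = 0"
     unfolding N using I \<open>v \<in> I\<close> by (subst P.emeasure_PiM) (auto intro!: prod_zero bexI[of _ v])
    show "{x \<in> space (?P). x v = (0 :: complex)} \<in> sets (?P)"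
     unfolding N using I by (intro sets_PiM_I_finite) auto
   qed auto
   then show ?thesis by eventually_elim simp
  qed simp
  have m1[measurable]: "(\<lambda>x. ?H l x) \<in> borel_measurable (PiM (insert j I) (\<lambda>_. lborel))"
   unfolding I(3)[symmetric] by measurable
  have m2[measurable]: "(\<lambda>x. ?F l x) \<in> borel_measurable (PiM (insert j I) (\<lambda>_. lborel))"
   unfolding I(3)[symmetric] by measurable
  have "(\<integral>\<^sup>+x. ?H l x \<partial>config n)
   = (\<integral>\<^sup>+x. \<integral>\<^sup>+w. ?H l (x(j := w)) \<partial>lborel \<partial>?P)"
   unfolding I(3) by (rule P.product_nn_integral_insert[OF I(1,2) m1])
  also have "\<dots> \<le> (\<integral>\<^sup>+x. ennreal B * (\<integral>\<^sup>+w. ?F l (x(j := w)) \<partial>lborel) \<partial>?P)"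
   by (rule nn_integral_mono_AE) (use AE in \<open>eventually_elim, use inner in blast\<close>)
  also have "\<dots> = ennreal B * (\<integral>\<^sup>+x. \<integral>\<^sup>+w. ?F l (x(j := w)) \<partial>lborel \<partial>?P)"
  proof (rule nn_integral_cmult)
   have "(\<lambda>(x, w). ?F l (x(j := w))) \<in> borel_measurable (?P \<Otimes>\<^sub>M lborel)"
    using measurable_compose[OF measurable_add_dim m2] by (simp add: split_beta)
   then show "(\<lambda>x. \<integral>\<^sup>+w. ?F l (x(j := w)) \<partial>lborel) \<in> borel_measurable (?P)"
    by (rule lborel.borel_measurable_nn_integral)
  qed
  also have "(\<integral>\<^sup>+x. \<integral>\<^sup>+w. ?F l (x(j := w)) \<partial>lborel \<partial>?P) = (\<integral>\<^sup>+x. ?F l x \<partial>config n)"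
   unfolding I(3) by (rule P.product_nn_integral_insert[OF I(1,2) m2, symmetric])
  finally show ?thesis .
 qed
 have "(\<integral>\<^sup>+x. ?F l x \<partial>config n) \<le> ennreal (B ^ length l) * (\<integral>\<^sup>+x. ennreal (wt n A E x) \<partial>config n)" if "forest n l" for l
  using that
 proof (induction l)
  case (Cons p l)
  obtain u v where p: "p = (u, v)" by (cases p)
  have Gc: "G (p # l) x = isep n z x u v * G l x" for x by (simp add: G_def p)
  have "(\<integral>\<^sup>+x. ennreal (wt n A E x * G (p # l) x) \<partial>config n) \<le> ennreal B * (\<integral>\<^sup>+x. ?F l x \<partial>config n)"
   unfolding Gc
  proof (cases "u < n \<and> u \<notin> verts l")
   case True
   then show "(\<integral>\<^sup>+x. ennreal (wt n A E x * (isep n z x u v * G l x)) \<partial>config n) \<le> ennreal B * (\<integral>\<^sup>+x. ?F l x \<partial>config n)"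
    using Cons.prems p by (intro leaf) auto
  next
   case False
   then show "(\<integral>\<^sup>+x. ennreal (wt n A E x * (isep n z x u v * G l x)) \<partial>config n) \<le> ennreal B * (\<integral>\<^sup>+x. ?F l x \<partial>config n)"
    using Cons.prems p by (subst sep_commute) (intro leaf, auto)
  qed
  also have "\<dots> \<le> ennreal B * (ennreal (B ^ length l) * (\<integral>\<^sup>+x. ennreal (wt n A E x) \<partial>config n))"
   using Cons by (intro mult_left_mono) (auto simp: p)
  also have "\<dots> = ennreal (B ^ length (p # l)) * (\<integral>\<^sup>+x. ennreal (wt n A E x) \<partial>config n)"
   using B(1) by (simp add: mult.assoc[symmetric] ennreal_mult[symmetric])
  finally show ?case .
 qed (simp add: G_def)
 then show ?thesis using B(1) by (auto simp: G_def)
qed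

section \<open>Contracting the real parts of the exponents\<close>

text \<open>Holomorphic in s and real-linear in the exponent. For real s only the real parts shrink,
  and these alone determine absolute values; the imaginary parts stay, so that s = 1 returns the
  given exponent.\<close>

definition sc :: "complex \<Rightarrow> complex \<Rightarrow> complex" where
 "sc s c = s * of_real (Re c) + \<i> * of_real (Im c)"

lemma sc_1 [simp]: "sc 1 c = c"
 by (simp add: sc_def complex_eq_iff)

lemma Re_sc: "Re (sc s c) = Re s * Re c"
 by (simp add: sc_def)

lemma sep_le:
 assumes x: "\<And>j. j < n \<Longrightarrow> x j \<noteq> 0" and C: "C \<ge> 1" "cmod z \<le> C" and uv: "u \<le> n + 1" "v \<le> n + 1"
 shows "sep n z x u v \<le> 2 * C"
proof -
 define X where "X = exp (max (ext n (lnx x) u) (ext n (lnx x) v))"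
 have X: "X > 0" "exp (ext n (lnx x) u) \<le> X" "exp (ext n (lnx x) v) \<le> X" by (auto simp: X_def)
 have e: "cmod (pt n z x w) \<le> C * exp (ext n (lnx x) w)" if "w \<le> n + 1" for w
  using x[of w] C that by (auto simp: ext_def pt_def lnx_def mult_le_cancel_right1)
 have "cmod (pt n z x u) \<le> C * X" "cmod (pt n z x v) \<le> C * X"
  using e[OF uv(1)] e[OF uv(2)] X C by (meson mult_left_mono order_trans zero_le_one)+
 then have "cmod (pt n z x u - pt n z x v) \<le> 2 * C * X"
  using norm_triangle_ineq4[of "pt n z x u" "pt n z x v"] by linarith
 then show ?thesis using X(1) by (simp add: sep_def X_def[symmetric] pos_divide_le_eq)
qed

lemma norm_edge_le:
 assumes x: "\<And>j. j < n \<Longrightarrow> x j \<noteq> 0" and C: "C \<ge> 1" "cmod z \<le> C" and u: "u \<le> n + 1"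
 shows "cmod (edge n z x u v) \<le> C / sep n z x u v"
proof -
 define X where "X = exp (max (ext n (lnx x) u) (ext n (lnx x) v))"
 have X: "X > 0" "exp (ext n (lnx x) u) \<le> X" by (auto simp: X_def)
 have "cmod (pt n z x u) \<le> C * exp (ext n (lnx x) u)"
  using x[of u] C u by (auto simp: ext_def pt_def lnx_def mult_le_cancel_right1)
 also have "\<dots> \<le> C * X" using X C by (intro mult_left_mono) auto
 finally have "cmod (pt n z x u) \<le> C * X" .
 then show ?thesis
  by (simp add: edge_def sep_def X_def[symmetric] norm_divide divide_right_mono)
qed

lemma powr_power_real: "k \<noteq> 0 \<Longrightarrow> (t powr u) ^ k = t powr (real k * u)" for t :: real
 by (cases "t = 0") (simp_all add: powr_power)

text \<open>A form of Young's inequality. The power 3/2 of a simple pole is what the forest estimate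
  accommodates, and the conjugate power 3 is left to the small powers of the separations.\<close>

lemma mult_le_powr_sum:
 fixes a b :: real
 assumes "a \<ge> 0" "b \<ge> 0"
 shows "a * b \<le> a ^ 3 + b powr (3/2)"
proof (cases "a \<le> b powr (1/2)")
 case True
 have "a * b \<le> b powr (1/2) * b" using True assms by (intro mult_right_mono) auto
 also have "b powr (1/2) * b = b powr (3/2)"
 proof (cases "b = 0")
  case False
  then have "b powr (1/2) * b powr 1 = b powr (3/2)" by (simp only: powr_add[symmetric]) simp
  moreover have "b powr 1 = b" using assms by simp
  ultimately show ?thesis by metis
 qed simp
 finally show ?thesis using assms by (smt (verit) zero_le_power)
next
 case False
 then have "b \<le> a\<^sup>2"
  using assms by (metis linorder_not_le powr_half_sqrt real_sqrt_le_iff real_sqrt_abs abs_of_nonneg less_imp_le)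
 then have "a * b \<le> a * a\<^sup>2" using assms by (intro mult_left_mono) auto
 then show ?thesis by (simp add: power3_eq_cube power2_eq_square add_increasing2)
qed

text \<open>If a factor exceeds 1, the largest factor raised to the number of factors dominates. A
  product over all pairs, which is no forest, is thereby bounded by single pairs, each of which is
  one.\<close>

lemma prod_le_1_plus_sum_power:
 fixes b :: "'i \<Rightarrow> real"
 assumes "finite I" "\<And>i. i \<in> I \<Longrightarrow> b i \<ge> 0"
 shows "prod b I \<le> 1 + (\<Sum>i\<in>I. b i ^ card I)"
proof (cases "\<forall>i\<in>I. b i \<le> 1")
 case True
 then have "prod b I \<le> 1" using assms by (intro prod_le_1) auto
 moreover have "(\<Sum>i\<in>I. b i ^ card I) \<ge> 0" using assms by (intro sum_nonneg) auto
 ultimately show ?thesis by linarith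
next
 case False
 define M where "M = Max (b ` I)"
 have I: "I \<noteq> {}" using False by auto
 obtain i where i: "i \<in> I" "b i = M" unfolding M_def using assms I by (metis (no_types, lifting) Max_in finite_imageI image_iff image_is_empty)
 have "prod b I \<le> (\<Prod>i\<in>I. M)" unfolding M_def using assms by (intro prod_mono) auto
 also have "\<dots> = b i ^ card I" using i by simp
 also have "\<dots> \<le> (\<Sum>i\<in>I. b i ^ card I)" using assms i by (intro member_le_sum) auto
 finally show ?thesis by simp
qed

text \<open>For small s the powers of the separations in \<open>psi\<close> are so weak that their
  powers of order 3 N are still no worse than the exponent -3/2. The edges themselves are covered by
  the forest estimate, and the tropical weight is integrable for every s > 0.\<close>

lemma integrable_psi_ins_small:
 assumes int: "integrable (config n) (psi n a e z1)" and z1: "z1 \<noteq> 0"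
 shows "\<exists>s0>0. \<forall>s z l. 0 < s \<longrightarrow> s \<le> s0 \<longrightarrow> z \<noteq> 0 \<longrightarrow> forest n l \<longrightarrow>
   integrable (config n) (\<lambda>x. psi n (\<lambda>j. sc (of_real s) (a j)) (\<lambda>u v. sc (of_real s) (e u v)) z x * ins n l z x)"
proof -
 let ?psi = "\<lambda>s. psi n (\<lambda>j. sc (of_real s) (a j)) (\<lambda>u v. sc (of_real s) (e u v))"
 define A where "A j = Re (a j)" for j
 define E where "E u v = Re (e u v)" for u v
 define N where "N = card (prs n)"
 define M where "M = 1 + (\<Sum>(u, v)\<in>prs n. \<bar>E u v\<bar>)"
 have M: "M \<ge> 1" "\<bar>E u v\<bar> \<le> M" if "(u, v) \<in> prs n" for u v
 proof -
  show "M \<ge> 1" unfolding M_def by (simp add: sum_nonneg split_beta)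
  have "\<bar>E u v\<bar> \<le> (\<Sum>(u, v)\<in>prs n. \<bar>E u v\<bar>)"
   using member_le_sum[OF that, of "\<lambda>(u, v). \<bar>E u v\<bar>"] by auto
  then show "\<bar>E u v\<bar> \<le> M" unfolding M_def by simp
 qed
 have M1: "M \<ge> 1" unfolding M_def by (simp add: sum_nonneg split_beta)
 \<comment> \<open>Chosen so that 3 N times 2 s |E| is at most 3/2 for every pair. Adding 1 to
   \<open>N\<close> keeps the denominator positive when there are no pairs.\<close>
 define s0 where "s0 = 1 / (4 * (real N + 1) * M)"
 have s0: "s0 > 0" using M1 by (simp add: s0_def)
 have "integrable (config n) (\<lambda>x. ?psi s z x * ins n l z x)"
  if s: "0 < s" "s \<le> s0" and z: "z \<noteq> 0" and l: "forest n l" for s z l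
 proof -
  define C where "C = max 1 (cmod z)"
  have C: "C \<ge> 1" "cmod z \<le> C" by (auto simp: C_def)
  define D where "D = 2 * C"
  have D: "D \<ge> 1" using C by (simp add: D_def)
  define q where "q u v = 2 * s * \<bar>E u v\<bar>" for u v
  have q: "q u v \<ge> 0" for u v using s by (simp add: q_def)
  have qN: "3 * q u v * real N \<le> 3 / 2" if "(u, v) \<in> prs n" for u v
  proof -
   have "s * (\<bar>E u v\<bar> * real N) \<le> s0 * (M * (real N + 1))"
    using s s0 M(2)[OF that] M1 by (intro mult_mono) auto
   also have "\<dots> = 1 / 4"
   proof -
    have "M * (real N + 1) > 0" using M1 by (intro mult_pos_pos) auto
    moreover have "s0 = 1 / (4 * (M * (real N + 1)))" by (simp add: s0_def mult_ac)
    ultimately show ?thesis using M1 by auto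
   qed
   finally show ?thesis by (simp add: q_def mult_ac)
  qed
  let ?D = "\<lambda>u v. D powr (2 * q u v)"
  define W where "W = wt n (\<lambda>j. s * A j) (\<lambda>u v. s * E u v)"
  have W0: "W x \<ge> 0" for x by (simp add: W_def wt_def prod_nonneg)
  let ?DD = "\<Prod>(u, v)\<in>prs n. ?D u v" and ?L = "\<lambda>l x. \<Prod>(u, v)\<leftarrow>l. 1 / sep n z x u v"
  let ?e = "\<lambda>x u v. sep n z x u v powr (2 * (s * E u v))"
  define B where "B = ?DD * C ^ length l"
  have B0: "B \<ge> 0" unfolding B_def using C by (intro mult_nonneg_nonneg prod_nonneg) auto
  define h where "h x = 1 + (\<Sum>(u, v)\<in>prs n. D powr (3/2) * isep n z x u v) + sep_prod n z l x" for x
  have lv: "u \<le> n + 1 \<and> v \<le> n + 1" if "(u, v) \<in> set l" for u v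
   using l that by (induction l) auto
  have bound: "cmod (?psi s z x * ins n l z x) \<le> B * (W x * h x)" for x
  proof (cases "\<forall>j<n. x j \<noteq> 0")
   case False
   then obtain j where "j < n" "x j = 0" by blast
   then have "?psi s z x = 0" by (intro psi_eq_0[of j]) auto
   moreover have "h x \<ge> 0" unfolding h_def
    by (intro add_nonneg_nonneg sum_nonneg prod_list_nonneg) auto
   ultimately show ?thesis using B0 W0 by simp
  next
   case True
   then have x0: "\<And>j. j < n \<Longrightarrow> x j \<noteq> 0" by blast
   have sD: "sep n z x u v \<le> D" if "u \<le> n + 1" "v \<le> n + 1" for u v
    unfolding D_def by (rule sep_le[OF x0 C that])
   have pw: "t powr r \<le> D powr r' * t powr (r - r')" if "0 \<le> t" "t \<le> D" "0 \<le> r'" for t r r'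
   proof (cases "t = 0")
    case False
    then have "t powr r = t powr r' * t powr (r - r')" by (simp add: powr_add[symmetric])
    also have "\<dots> \<le> D powr r' * t powr (r - r')" using that by (intro mult_right_mono powr_mono2) auto
    finally show ?thesis .
   qed simp
   \<comment> \<open>Since the separations are bounded by \<open>D\<close>, each power of a
     separation is at most a constant times the negative power \<open>- q u v\<close>, whatever the
     sign of the exponent.\<close>
   define P where "P = (\<Prod>(u, v)\<in>prs n. sep n z x u v powr (- q u v))"
   define L where "L = (?L l x)"
   have P0: "P \<ge> 0" unfolding P_def by (rule prod_nonneg) auto
   have L0: "L \<ge> 0" unfolding L_def by (rule prod_list_nonneg) (auto simp: sep_nonneg)
   have "(\<Prod>(u, v)\<in>prs n. ?e x u v) \<le> (\<Prod>(u, v)\<in>prs n. ?D u v * sep n z x u v powr (- q u v))"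
   proof (rule prod_mono, clarify)
    fix u v assume uv: "(u, v) \<in> prs n"
    then have ub: "u \<le> n + 1" "v \<le> n + 1" by (auto simp: prs_def)
    define r where "r = 2 * (s * E u v)"
    have r: "\<bar>r\<bar> = q u v" using s by (simp add: r_def q_def abs_mult)
    have "sep n z x u v powr r \<le> D powr (r + q u v) * sep n z x u v powr (r - (r + q u v))"
     using sD[OF ub] r by (intro pw sep_nonneg) linarith+
    also have "\<dots> \<le> ?D u v * sep n z x u v powr (r - (r + q u v))"
     using r D by (intro mult_right_mono powr_mono) (linarith | simp)+
    finally show "0 \<le> ?e x u v \<and> ?e x u v \<le> ?D u v * sep n z x u v powr - q u v"
     by (simp add: r_def)
   qed
   also have "\<dots> = ?DD * P" by (simp add: P_def split_beta prod.distrib)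
   finally have b1: "(\<Prod>(u, v)\<in>prs n. ?e x u v) \<le> ?DD * P" .
   have b2: "cmod (ins n l z x) \<le> C ^ length l * L"
    unfolding L_def using lv
   proof (induction l)
    case (Cons p l)
    obtain u v where p: "p = (u, v)" by (cases p)
    have "cmod (edge n z x u v) \<le> C / sep n z x u v" using Cons.prems p by (intro norm_edge_le x0 C) auto
    moreover have "cmod (ins n l z x) \<le> C ^ length l * (?L l x)" using Cons by auto
    ultimately have "cmod (edge n z x u v) * cmod (ins n l z x) \<le> C / sep n z x u v * (C ^ length l * (?L l x))"
     using C by (intro mult_mono) (auto simp: sep_nonneg)
    then show ?case by (simp add: p ins_Cons norm_mult mult_ac)
   qed simp
   have b3: "P * L \<le> h x"
   proof -
    have "P * L \<le> P ^ 3 + L powr (3/2)" by (rule mult_le_powr_sum[OF P0 L0])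
    moreover have "L powr (3/2) = sep_prod n z l x"
     unfolding L_def
    proof (induction l)
     case (Cons p l)
     have "(?L l x) \<ge> 0" by (rule prod_list_nonneg) (auto simp: sep_nonneg)
     then show ?case using Cons by (simp add: split_beta powr_divide powr_mult sep_nonneg powr_minus_divide del: times_divide_eq_left)
    qed simp
    moreover have "P ^ 3 \<le> 1 + (\<Sum>(u, v)\<in>prs n. D powr (3/2) * isep n z x u v)"
    proof -
     have "P ^ 3 = (\<Prod>p\<in>prs n. sep n z x (fst p) (snd p) powr (- 3 * q (fst p) (snd p)))"
      unfolding P_def prod_power_distrib split_beta
      by (intro prod.cong refl) (subst powr_power_real, simp_all)
     also have "\<dots> \<le> 1 + (\<Sum>p\<in>prs n. (sep n z x (fst p) (snd p) powr (- 3 * q (fst p) (snd p))) ^ N)"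
      unfolding N_def by (rule prod_le_1_plus_sum_power) auto
     also have "\<dots> \<le> 1 + (\<Sum>p\<in>prs n. D powr (3/2) * isep n z x (fst p) (snd p))"
     proof (intro add_left_mono sum_mono)
      fix p assume p: "p \<in> prs n"
      define u v where "u = fst p" and "v = snd p"
      have uv: "(u, v) \<in> prs n" "u \<le> n + 1" "v \<le> n + 1" using p by (auto simp: u_def v_def prs_def)
      define r where "r = 3 * q u v * real N"
      have r: "0 \<le> r" "r \<le> 3/2" using qN[OF uv(1)] q[of u v] by (auto simp: r_def)
      have N0: "N \<noteq> 0" using uv(1) by (auto simp: N_def card_eq_0_iff)
      have "(sep n z x u v powr (- 3 * q u v)) ^ N = sep n z x u v powr (- r)"
       using N0 by (simp add: powr_power_real r_def mult_ac)
      also have "\<dots> \<le> D powr (3/2 - r) * sep n z x u v powr (- r - (3/2 - r))"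
       using sD[OF uv(2,3)] r by (intro pw sep_nonneg) auto
      also have "\<dots> \<le> D powr (3/2) * sep n z x u v powr (- r - (3/2 - r))"
       using D r by (intro mult_right_mono powr_mono) auto
      finally show "(sep n z x (fst p) (snd p) powr (- 3 * q (fst p) (snd p))) ^ N \<le> D powr (3/2) * isep n z x (fst p) (snd p)"
       by (simp add: u_def v_def)
     qed
     finally show ?thesis by (simp add: split_beta)
    qed
    ultimately show ?thesis unfolding h_def by linarith
   qed
   have "cmod (?psi s z x * ins n l z x)
    = W x * (\<Prod>(u, v)\<in>prs n. ?e x u v) * cmod (ins n l z x)"
    unfolding norm_mult using norm_psi[OF x0, where a="\<lambda>j. sc (of_real s) (a j)" and e="\<lambda>u v. sc (of_real s) (e u v)" and z=z]
    by (simp add: Re_sc W_def A_def E_def)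
   also have "\<dots> \<le> W x * (?DD * P) * (C ^ length l * L)"
    using W0 P0 by (intro mult_mono b1 b2 mult_nonneg_nonneg prod_nonneg order_refl) auto
   also have "\<dots> = (B * W x) * (P * L)" by (simp add: B_def)
   also have "\<dots> \<le> (B * W x) * h x" using b3 B0 W0 by (intro mult_left_mono) auto
   finally show ?thesis by simp
  qed
  have Wfin: "(\<integral>\<^sup>+x. ennreal (W x) \<partial>config n) < \<infinity>"
   unfolding W_def by (rule nn_integral_wt_finite[OF _ s(1)]) (use nn_integral_exp_lam_finite[OF int z1] in \<open>simp add: A_def E_def\<close>)
  obtain B' :: real where B': "B' > 0" "\<And>l. forest n l \<Longrightarrow> (\<integral>\<^sup>+x. ennreal (W x * sep_prod n z l x) \<partial>config n)
    \<le> ennreal (B' ^ length l) * (\<integral>\<^sup>+x. ennreal (W x) \<partial>config n)"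
   using nn_integral_wt_forest[OF z, of n "\<lambda>j. s * A j" "\<lambda>u v. s * E u v"] unfolding W_def by blast
  have ffin: "(\<integral>\<^sup>+x. ennreal (W x * sep_prod n z l x) \<partial>config n) < \<infinity>" if "forest n l" for l
  proof -
   have "ennreal (B' ^ length l) * (\<integral>\<^sup>+x. ennreal (W x) \<partial>config n) < \<infinity>"
    using Wfin by (simp add: ennreal_mult_less_top)
   then show ?thesis using B'(2)[OF that] by (rule le_less_trans[rotated])
  qed
  have Wm: "W \<in> borel_measurable (config n)" unfolding W_def by measurable
  have Lm: "(\<lambda>x. sep_prod n z l x) \<in> borel_measurable (config n)" for l
  proof (induction l)
   case (Cons p l)
   then show ?case by (simp add: split_beta)
  qed simp
  have fint: "integrable (config n) (\<lambda>x. W x * sep_prod n z l x)" if "forest n l" for l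
  proof (rule integrableI_bounded)
   have "sep_prod n z l x \<ge> 0" for x by (rule prod_list_nonneg) auto
   then show "(\<integral>\<^sup>+x. ennreal (norm (W x * sep_prod n z l x)) \<partial>config n) < \<infinity>"
    using ffin[OF that] W0 by (simp add: abs_mult)
  qed (use Wm Lm in measurable)
  have f1: "integrable (config n) W" using fint[of "[]"] by simp
  have f2: "integrable (config n) (\<lambda>x. W x * isep n z x u v)" if "(u, v) \<in> prs n" for u v
   using fint[of "[(u, v)]"] that by (auto simp: prs_def)
  have "integrable (config n) (\<lambda>x. B * (W x + (\<Sum>p\<in>prs n. D powr (3/2) * (W x * isep n z x (fst p) (snd p))) + W x * sep_prod n z l x))"
   using f1 f2 fint[OF l] by (intro integrable_mult_right integrable_add integrable_sum) auto
  also have "(\<lambda>x. B * (W x + (\<Sum>p\<in>prs n. D powr (3/2) * (W x * isep n z x (fst p) (snd p))) + W x * sep_prod n z l x))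
    = (\<lambda>x. B * (W x * h x))"
   by (simp add: h_def fun_eq_iff split_beta distrib_left sum_distrib_left mult_ac)
  finally have "integrable (config n) (\<lambda>x. B * (W x * h x))" .
  then show ?thesis
   by (rule Bochner_Integration.integrable_bound) (use bound in \<open>auto intro!: AE_I2 order_trans[OF bound abs_ge_self]\<close>)
 qed
 then show ?thesis using s0 by blast
qed

section \<open>Moving all points by a cutoff translation\<close>

lemma has_field_derivative_pos_part_square:
 "((\<lambda>y::real. (max 0 y)\<^sup>2) has_field_derivative 2 * max 0 y) (at y)"
proof -
 consider "y > 0" | "y < 0" | "y = 0" by linarith
 then show ?thesis
 proof cases
  case 1
  have "((\<lambda>y::real. y\<^sup>2) has_field_derivative 2 * y) (at y)" by (auto intro!: derivative_eq_intros)
  then show ?thesis using 1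
   by (auto intro: has_field_derivative_transform_within_open[of _ _ _ "{0<..}"])
 next
  case 2
  have "((\<lambda>y::real. (max 0 y)\<^sup>2) has_field_derivative 0) (at y)"
   by (rule has_field_derivative_transform_within_open[of "\<lambda>_. 0" _ _ "{..<0}"]) (use 2 in auto)
  then show ?thesis using 2 by simp
 next
  case 3
  have "((\<lambda>h::real. (max 0 h)\<^sup>2 / h) \<longlongrightarrow> 0) (at 0)"
  proof (rule Lim_null_comparison)
   show "\<forall>\<^sub>F h in at 0. norm ((max 0 h)\<^sup>2 / h) \<le> \<bar>h\<bar>" for h :: real
    by (rule always_eventually) (auto simp: max_def power2_eq_square)
   show "((\<lambda>h::real. \<bar>h\<bar>) \<longlongrightarrow> 0) (at 0)" by (rule tendsto_eq_intros refl | simp)+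
  qed
  then show ?thesis using 3 by (simp add: has_field_derivative_iff)
 qed
qed

locale cutoff =
 fixes z0 :: complex and R :: real
 assumes R: "R > 0" and R0: "R \<le> cmod z0" and R1: "R \<le> cmod (z0 - 1)"
begin

text \<open>A bump with value 1 at \<open>z0\<close> and 0 at the points 0 and 1. The outer square
  makes it differentiable across the boundary of the disc.\<close>

definition ct :: "complex \<Rightarrow> real" where
 "ct x = (max 0 (1 - (cmod (x - z0))\<^sup>2 / R\<^sup>2))\<^sup>2"

text \<open>The Wirtinger derivative of the cutoff function.\<close>

definition dct :: "complex \<Rightarrow> complex" where
 "dct x = - of_real (2 * max 0 (1 - (cmod (x - z0))\<^sup>2 / R\<^sup>2) / R\<^sup>2) * cnj (x - z0)"

text \<open>The difference quotient of the bump. On the diagonal division by zero gives 0, and the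
  relation with \<open>mv\<close> persists because both differences vanish there.\<close>

definition dq :: "complex \<Rightarrow> complex \<Rightarrow> complex" where
 "dq a b = of_real (ct a - ct b) / (a - b)"

text \<open>As |dq| <= 4 / R and |dct| <= 2 / R, this radius keeps \<open>w * dq\<close> within 1/2
  and \<open>w * dct\<close> within 1/4. The translations are then bijective, their Jacobians
  positive, and all powers stay on the principal branch.\<close>

definition rad :: real where "rad = R / 8"

definition mv :: "complex \<Rightarrow> complex \<Rightarrow> complex" where
 "mv w x = x + w * of_real (ct x)"

lemma rad_pos: "rad > 0" using R by (simp add: rad_def)

lemma ct_values: "ct z0 = 1" "ct 0 = 0" "ct 1 = 0"
proof -
 have "R\<^sup>2 \<le> (cmod z0)\<^sup>2" "R\<^sup>2 \<le> (cmod (1 - z0))\<^sup>2"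
  using R R0 R1 by (auto intro!: power_mono simp: norm_minus_commute)
 then have "1 \<le> (cmod (0 - z0))\<^sup>2 / R\<^sup>2" "1 \<le> (cmod (1 - z0))\<^sup>2 / R\<^sup>2" using R by simp_all
 then show "ct z0 = 1" "ct 0 = 0" "ct 1 = 0" by (simp_all add: ct_def)
qed

lemma ct_has_derivative: "(ct has_derivative (\<lambda>h. 2 * Re (dct x * h))) (at x)"
proof -
 have "((\<lambda>x. 1 - inner (x - z0) (x - z0) / R\<^sup>2) has_derivative (\<lambda>h. - (2 * inner (x - z0) h) / R\<^sup>2)) (at x)"
  using R by (auto intro!: derivative_eq_intros simp: inner_commute fun_eq_iff power2_eq_square power4_eq_xxxx)
 from has_derivative_compose[OF this has_field_derivative_imp_has_derivative[OF has_field_derivative_pos_part_square]]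
 have "((\<lambda>x. (max 0 (1 - inner (x - z0) (x - z0) / R\<^sup>2))\<^sup>2) has_derivative
   (\<lambda>h. 2 * max 0 (1 - inner (x - z0) (x - z0) / R\<^sup>2) * (- (2 * inner (x - z0) h) / R\<^sup>2))) (at x)" .
 moreover have "2 * max 0 (1 - inner (x - z0) (x - z0) / R\<^sup>2) * (- (2 * inner (x - z0) h) / R\<^sup>2) = 2 * Re (dct x * h)" for h
 proof -
  have "Re (cnj (x - z0) * h) = inner (x - z0) h" by (simp add: inner_complex_def algebra_simps)
  then have "Re (dct x * h) = - (2 * max 0 (1 - (cmod (x - z0))\<^sup>2 / R\<^sup>2) / R\<^sup>2) * inner (x - z0) h"
   unfolding dct_def by (metis (no_types) Re_complex_of_real Im_complex_of_real complex_scaleR mult.assoc mult_minus_left of_real_minus scaleR_conv_of_real scaleR_complex.simps(1))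
  then show ?thesis by (simp add: power2_norm_eq_inner)
 qed
 ultimately show ?thesis by (simp add: ct_def[abs_def] power2_norm_eq_inner)
qed

lemma norm_dct_le: "cmod (dct x) \<le> 2 / R"
proof (cases "cmod (x - z0) \<le> R")
 case True
 have "max 0 (1 - (cmod (x - z0))\<^sup>2 / R\<^sup>2) \<le> 1" by simp
 then have "max 0 (1 - (cmod (x - z0))\<^sup>2 / R\<^sup>2) * cmod (x - z0) \<le> 1 * R" using True by (intro mult_mono) auto
 then have "2 * (max 0 (1 - (cmod (x - z0))\<^sup>2 / R\<^sup>2) * cmod (x - z0)) / R\<^sup>2 \<le> 2 * R / R\<^sup>2"
  using R by (intro divide_right_mono) auto
 also have "2 * R / R\<^sup>2 = 2 / R" using R by (simp add: power2_eq_square)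
 finally have "2 * max 0 (1 - (cmod (x - z0))\<^sup>2 / R\<^sup>2) / R\<^sup>2 * cmod (x - z0) \<le> 2 / R" by simp
 moreover have "cmod (dct x) = 2 * max 0 (1 - (cmod (x - z0))\<^sup>2 / R\<^sup>2) / R\<^sup>2 * cmod (x - z0)"
  unfolding dct_def norm_mult norm_minus_cancel norm_of_real complex_mod_cnj by simp
 ultimately show ?thesis by simp
next
 case False
 then have "R\<^sup>2 \<le> (cmod (x - z0))\<^sup>2" using R by (intro power_mono) auto
 then have "dct x = 0" using R by (simp add: dct_def)
 then show ?thesis using R by simp
qed

lemma ct_lipschitz: "\<bar>ct x - ct y\<bar> \<le> 4 / R * cmod (x - y)"
proof -
 have "norm (ct x - ct y) \<le> 4 / R * norm (x - y)"
 proof (rule differentiable_bound[OF convex_UNIV])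
  show "(ct has_derivative (\<lambda>h. 2 * Re (dct x * h))) (at x within UNIV)" for x
   using ct_has_derivative by simp
  show "onorm (\<lambda>h. 2 * Re (dct x * h)) \<le> 4 / R" for x
  proof (rule onorm_le)
   fix h
   have "\<bar>Re (dct x * h)\<bar> \<le> cmod (dct x) * cmod h" using abs_Re_le_cmod[of "dct x * h"] by (simp add: norm_mult)
   also have "\<dots> \<le> 2 / R * cmod h" by (intro mult_right_mono norm_dct_le) auto
   finally show "norm (2 * Re (dct x * h)) \<le> 4 / R * norm h" by simp
  qed
 qed auto
 then show ?thesis by simp
qed

lemma norm_dq_le: "cmod (dq a b) \<le> 4 / R"
 using ct_lipschitz[of a b] R
 by (cases "a = b") (auto simp: dq_def norm_divide pos_divide_le_eq abs_minus_commute simp flip: of_real_diff)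

lemma norm_mult_dq_le: "w \<in> ball 0 rad \<Longrightarrow> cmod (w * dq a b) \<le> 1 / 2"
proof -
 assume "w \<in> ball 0 rad"
 then have "cmod w * cmod (dq a b) \<le> R / 8 * (4 / R)" using norm_dq_le R by (intro mult_mono) (auto simp: rad_def)
 then show ?thesis using R by (simp add: norm_mult)
qed

text \<open>Every distance is multiplied by the modulus of a function affine in \<open>w\<close>, so
  \<open>psi\<close> acquires only bounded factors, holomorphic in \<open>w\<close> and in
  \<open>cnj w\<close>. Differentiating |x - z| under the integral would raise the order of the
  singularity instead.\<close>

lemma mv_diff: "mv w a - mv w b = (a - b) * (1 + w * dq a b)"
 by (cases "a = b") (simp_all add: mv_def dq_def field_simps)

lemma mv_0: "mv w 0 = 0" and mv_1: "mv w 1 = 1" and mv_z0: "mv w z0 = z0 + w"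
 by (simp_all add: mv_def ct_values)

lemma ct_measurable [measurable]: "ct \<in> borel_measurable borel"
 unfolding ct_def[abs_def] by measurable

lemma dct_measurable [measurable]: "dct \<in> borel_measurable borel"
proof -
 have "cnj \<in> borel_measurable borel" by (intro borel_measurable_continuous_onI continuous_intros)
 then show ?thesis unfolding dct_def[abs_def] by measurable
qed

lemma dq_measurable [measurable (raw)]:
 assumes [measurable]: "f \<in> borel_measurable M" "g \<in> borel_measurable M"
 shows "(\<lambda>x. dq (f x) (g x)) \<in> borel_measurable M"
 unfolding dq_def by measurable

lemma mv_measurable [measurable]: "mv w \<in> borel_measurable borel"
 unfolding mv_def[abs_def] by measurable

text \<open>The displacement is a contraction with constant 1/2. Injectivity is immediate, and a
  preimage of y is a fixed point of x |-> y - w ct x.\<close>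

lemma bij_mv:
 assumes w: "w \<in> ball 0 rad"
 shows "bij (mv w)"
proof -
 have lip: "cmod (w * of_real (ct x) - w * of_real (ct y)) \<le> 1 / 2 * cmod (x - y)" for x y
 proof -
  have "of_real (ct x - ct y) = dq x y * (x - y)" by (cases "x = y") (simp_all add: dq_def)
  moreover have "w * of_real (ct x) - w * of_real (ct y) = w * of_real (ct x - ct y)" by (simp add: right_diff_distrib)
  ultimately have "w * of_real (ct x) - w * of_real (ct y) = (w * dq x y) * (x - y)" by simp
  then show ?thesis using norm_mult_dq_le[OF w, of x y] by (simp only: norm_mult) (intro mult_right_mono, simp_all add: norm_mult)
 qed
 have "inj (mv w)"
 proof (rule injI)
  fix x y assume "mv w x = mv w y"
  then have "x - y = - (w * of_real (ct x) - w * of_real (ct y))" by (simp add: mv_def algebra_simps)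
  then have "cmod (x - y) \<le> 1 / 2 * cmod (x - y)" using lip[of x y] by (metis norm_minus_cancel)
  then show "x = y" by simp
 qed
 moreover have "surj (mv w)"
  unfolding surj_def
 proof
  fix y
  have "\<exists>!x. y - w * of_real (ct x) = x"
  proof (rule banach_fix_type[of "1/2"])
   show "\<forall>x xa. dist (y - w * of_real (ct x)) (y - w * of_real (ct xa)) \<le> 1 / 2 * dist x xa"
    using lip by (auto simp: dist_norm norm_minus_commute)
  qed auto
  then obtain x where "y - w * of_real (ct x) = x" by blast
  then have "y = mv w x" by (simp add: mv_def algebra_simps)
  then show "\<exists>x. y = mv w x" by blast
 qed
 ultimately show ?thesis by (rule bijI)
qed

lemma jac_pos: "w \<in> ball 0 rad \<Longrightarrow> 1 + 2 * Re (w * dct x) > 0"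
proof -
 assume "w \<in> ball 0 rad"
 then have "cmod w * cmod (dct x) \<le> R / 8 * (2 / R)" using norm_dct_le R by (intro mult_mono) (auto simp: rad_def)
 then have "cmod (w * dct x) \<le> 1 / 4" using R by (simp add: norm_mult)
 then have "\<bar>Re (w * dct x)\<bar> \<le> 1 / 4" using abs_Re_le_cmod[of "w * dct x"] by linarith
 then show ?thesis by linarith
qed

lemma distr_mv:
 assumes w: "w \<in> ball 0 rad"
 shows "distr (density lborel (\<lambda>x. ennreal (1 + 2 * Re (w * dct x)))) lborel (mv w) = lborel"
proof -
 have der: "(mv w has_derivative (\<lambda>h. (1 + w * dct x) * h + (w * cnj (dct x)) * cnj h)) (at x)" for x
 proof -
  have "(mv w has_derivative (\<lambda>h. h + w * of_real (2 * Re (dct x * h)))) (at x)"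
   unfolding mv_def[abs_def]
   by (rule derivative_eq_intros bounded_linear.has_derivative[OF bounded_linear_of_real ct_has_derivative] refl | simp)+
  moreover have "h + w * of_real (2 * Re (dct x * h)) = (1 + w * dct x) * h + (w * cnj (dct x)) * cnj h" for h
  proof -
   have "of_real (2 * Re (dct x * h)) = dct x * h + cnj (dct x * h)" by (rule complex_add_cnj[symmetric])
   then show ?thesis by (simp add: algebra_simps)
  qed
  ultimately show ?thesis by simp
 qed
 have J: "(cmod (1 + w * dct x))\<^sup>2 - (cmod (w * cnj (dct x)))\<^sup>2 = 1 + 2 * Re (w * dct x)" for x
 proof -
  have "cmod (w * cnj (dct x)) = cmod (w * dct x)" by (simp add: norm_mult)
  then show ?thesis by (simp only: cmod_power2) (simp add: power2_eq_square algebra_simps)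
 qed
 have "distr (density lborel (\<lambda>x. ennreal \<bar>(cmod (1 + w * dct x))\<^sup>2 - (cmod (w * cnj (dct x)))\<^sup>2\<bar>)) lborel (mv w) = lborel"
  by (rule distr_lborel_change_of_variables[OF der bij_mv[OF w]]) (simp only: J, measurable)
 then show ?thesis unfolding J using jac_pos[OF w] by (simp add: abs_of_pos)
qed

text \<open>At \<open>w' = cnj w\<close> this is the real Jacobian; the second argument is kept
  independent for the sake of polarisation.\<close>

definition jac :: "nat \<Rightarrow> complex \<Rightarrow> complex \<Rightarrow> conf \<Rightarrow> complex" where
 "jac n w w' x = (\<Prod>j<n. 1 + w * dct (x j) + w' * cnj (dct (x j)))"

lemma jac_cnj: "jac n w (cnj w) x = of_real (\<Prod>j<n. 1 + 2 * Re (w * dct (x j)))"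
proof -
 have "1 + w * dct y + cnj w * cnj (dct y) = of_real (1 + 2 * Re (w * dct y))" for y
  using complex_add_cnj[of "w * dct y"] by (simp add: algebra_simps)
 then show ?thesis by (simp only: jac_def of_real_prod)
qed

lemma distr_config_mv:
 assumes w: "w \<in> ball 0 rad"
 shows "distr (density (config n) (\<lambda>x. ennreal (\<Prod>j<n. 1 + 2 * Re (w * dct (x j))))) (config n) (\<lambda>x. \<lambda>j\<in>{..<n}. mv w (x j)) = config n"
proof -
 have "(\<Prod>j<n. ennreal (1 + 2 * Re (w * dct (x j)))) = ennreal (\<Prod>j<n. 1 + 2 * Re (w * dct (x j)))" for x :: conf
  by (rule prod_ennreal) (use jac_pos[OF w] in \<open>auto intro: less_imp_le\<close>)
 moreover have "distr (density (config n) (\<lambda>x. \<Prod>j<n. ennreal (1 + 2 * Re (w * dct (x j))))) (config n) (\<lambda>x. \<lambda>j\<in>{..<n}. mv w (x j)) = config n"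
 proof (rule distr_density_PiM[where J="\<lambda>_ y. ennreal (1 + 2 * Re (w * dct y))" and T="\<lambda>_. mv w"])
  show "(\<lambda>y. ennreal (1 + 2 * Re (w * dct y))) \<in> borel_measurable lborel" by measurable
  show "mv w \<in> measurable lborel lborel" by measurable
  show "distr (density lborel (\<lambda>y. ennreal (1 + 2 * Re (w * dct y)))) lborel (mv w) = lborel" by (rule distr_mv[OF w])
 qed (rule finite_lessThan sigma_finite_lborel)+
 ultimately show ?thesis by simp
qed

lemma pt_mv: "u \<le> n + 1 \<Longrightarrow> pt n (z0 + w) (\<lambda>j\<in>{..<n}. mv w (x j)) u = mv w (pt n z0 x u)"
 by (auto simp: pt_def mv_1 mv_z0)

text \<open>The holomorphic half of the factor that \<open>psi\<close> acquires. The origin does not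
  move, hence \<open>dq (x j) 0\<close> in the factors coming from |x_j|.\<close>

definition kp :: "nat \<Rightarrow> conf \<Rightarrow> pairing \<Rightarrow> complex \<Rightarrow> conf \<Rightarrow> complex" where
 "kp n a e w x = (\<Prod>j<n. (1 + w * dq (x j) 0) powr (a j - 1)) *
   (\<Prod>(u, v)\<in>prs n. (1 + w * dq (pt n z0 x u) (pt n z0 x v)) powr e u v)"

text \<open>The antiholomorphic half, with \<open>cnj w\<close> replaced by an independent variable.\<close>

definition kq :: "nat \<Rightarrow> conf \<Rightarrow> pairing \<Rightarrow> complex \<Rightarrow> conf \<Rightarrow> complex" where
 "kq n a e w x = (\<Prod>j<n. (1 + w * cnj (dq (x j) 0)) powr (a j - 1)) *
   (\<Prod>(u, v)\<in>prs n. (1 + w * cnj (dq (pt n z0 x u) (pt n z0 x v))) powr e u v)"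

definition ki :: "nat \<Rightarrow> graph \<Rightarrow> complex \<Rightarrow> conf \<Rightarrow> complex" where
 "ki n l w x = (\<Prod>(u, v)\<leftarrow>l. (1 + w * dq (pt n z0 x u) 0) / (1 + w * dq (pt n z0 x u) (pt n z0 x v)))"

definition kj :: "nat \<Rightarrow> graph \<Rightarrow> complex \<Rightarrow> conf \<Rightarrow> complex" where
 "kj n l w x = (\<Prod>(u, v)\<leftarrow>l. (1 + w * cnj (dq (pt n z0 x u) 0)) / (1 + w * cnj (dq (pt n z0 x u) (pt n z0 x v))))"

end

text \<open>For \<open>Re q > 0\<close> the principal logarithms of \<open>q\<close> and
  \<open>cnj q\<close> add up to 2 ln |q|, so a power of the modulus splits into a holomorphic and
  an antiholomorphic factor.\<close>

lemma abs_powr_mult: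
 assumes "Re q > 0"
 shows "abs_powr (d * q) (2 * c) = abs_powr d (2 * c) * (q powr c * cnj q powr c)"
proof -
 have q: "q \<noteq> 0" "q \<notin> \<real>\<^sub>\<le>\<^sub>0" using assms by (auto simp: complex_nonpos_Reals_iff)
 have "Ln q + Ln (cnj q) = of_real (2 * ln (cmod q))"
  using q by (simp add: cnj_Ln[symmetric] complex_add_cnj)
 then have "q powr c * cnj q powr c = exp (2 * c * of_real (ln (cmod q)))"
  using q by (simp add: powr_def exp_add[symmetric] distrib_left[symmetric] mult_ac)
 also have "\<dots> = of_real (cmod q) powr (2 * c)" using q by (simp add: powr_def Ln_of_real)
 finally have *: "q powr c * cnj q powr c = of_real (cmod q) powr (2 * c)" .
 show ?thesis
  unfolding abs_powr_def * by (simp add: norm_mult powr_times_real)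
qed

context cutoff begin

lemma Re_pos:
 assumes "cmod (w * d) \<le> 1 / 2"
 shows "Re (1 + w * d) > 0"
 using abs_Re_le_cmod[of "w * d"] assms by simp

lemma psi_mv:
 assumes w: "w \<in> ball 0 rad"
 shows "psi n a e (z0 + w) (\<lambda>j\<in>{..<n}. mv w (x j)) = psi n a e z0 x * (kp n a e w x * kq n a e (cnj w) x)"
proof -
 have q: "abs_powr (mv w b - mv w c) (2 * t) = abs_powr (b - c) (2 * t) * ((1 + w * dq b c) powr t * (1 + cnj w * cnj (dq b c)) powr t)" for b c t
  unfolding mv_diff using abs_powr_mult[OF Re_pos[OF norm_mult_dq_le[OF w]], of "b - c" b c t] by simp
 have "(\<Prod>j<n. abs_powr ((\<lambda>j\<in>{..<n}. mv w (x j)) j) (2 * (a j - 1))) =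
   (\<Prod>j<n. abs_powr (x j) (2 * (a j - 1)) * ((1 + w * dq (x j) 0) powr (a j - 1) * (1 + cnj w * cnj (dq (x j) 0)) powr (a j - 1)))"
  using q[of _ 0] by (intro prod.cong refl) (simp add: mv_0 del: right_diff_distrib_numeral)
 moreover have "(\<Prod>(u, v)\<in>prs n. abs_powr (pt n (z0 + w) (\<lambda>j\<in>{..<n}. mv w (x j)) u - pt n (z0 + w) (\<lambda>j\<in>{..<n}. mv w (x j)) v) (2 * e u v))
  = (\<Prod>(u, v)\<in>prs n. abs_powr (pt n z0 x u - pt n z0 x v) (2 * e u v) * ((1 + w * dq (pt n z0 x u) (pt n z0 x v)) powr e u v * (1 + cnj w * cnj (dq (pt n z0 x u) (pt n z0 x v))) powr e u v))"
  by (intro prod.cong) (auto simp: prs_def pt_mv q)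
 ultimately show ?thesis
  by (simp add: psi_def kp_def kq_def prod.distrib split_beta mult_ac)
qed

lemma ins_mv:
 assumes w: "w \<in> ball 0 rad" and l: "verts l \<subseteq> {..n + 1}"
 shows "ins n l (z0 + w) (\<lambda>j\<in>{..<n}. mv w (x j)) = ins n l z0 x * ki n l w x"
 using l
proof (induction l)
 case (Cons p l)
 obtain u v where p: "p = (u, v)" by (cases p)
 have mvb: "mv w b = b * (1 + w * dq b 0)" for b using mv_diff[of w b 0] by (simp add: mv_0)
 have "edge n (z0 + w) (\<lambda>j\<in>{..<n}. mv w (x j)) u v = mv w (pt n z0 x u) / (mv w (pt n z0 x u) - mv w (pt n z0 x v))"
  using Cons.prems p by (simp add: edge_def pt_mv)
 also have "\<dots> = edge n z0 x u v * ((1 + w * dq (pt n z0 x u) 0) / (1 + w * dq (pt n z0 x u) (pt n z0 x v)))"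
  by (subst mv_diff, subst mvb) (simp add: edge_def)
 finally have eq: "edge n (z0 + w) (\<lambda>j\<in>{..<n}. mv w (x j)) u v = \<dots>" .
 moreover have "ins n l (z0 + w) (\<lambda>j\<in>{..<n}. mv w (x j)) = ins n l z0 x * ki n l w x"
  using Cons.prems p by (intro Cons.IH) auto
 ultimately show ?case
  by (simp only: p ins_Cons) (simp add: ki_def)
qed (simp add: ki_def)

lemma cnj_ki: "cnj (ki n l w x) = kj n l (cnj w) x"
 unfolding ki_def kj_def by (induction l) (auto simp: split_beta)

lemma k_measurable [measurable]:
 "kp n a e w \<in> borel_measurable (config n)" (is ?c1) "kq n a e w \<in> borel_measurable (config n)"
 "ki n l w \<in> borel_measurable (config n)" (is ?c2) "kj n l w \<in> borel_measurable (config n)" (is ?c3)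
 "jac n w w' \<in> borel_measurable (config n)" (is ?c4)
proof -
 have cm[measurable]: "cnj \<in> borel_measurable borel" by (intro borel_measurable_continuous_onI continuous_intros)
 show ?c1 "kq n a e w \<in> borel_measurable (config n)"
  unfolding kp_def[abs_def] kq_def[abs_def] split_beta by measurable
 show ?c2
 proof (induction l)
  case (Cons p l)
  then show ?case by (simp add: ki_def[abs_def] split_beta)
 qed (simp add: ki_def[abs_def])
 show ?c3
 proof (induction l)
  case (Cons p l)
  then show ?case by (simp add: kj_def[abs_def] split_beta)
 qed (simp add: kj_def[abs_def])
 show ?c4
  unfolding jac_def[abs_def] by measurable
qed

end

section \<open>Two-variable holomorphy and bounds for the transported integrand\<close>

lemma biholo_fst:
 assumes "f holomorphic_on U"
 shows "biholo (\<lambda>w t. f w) U T"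
proof -
 have "continuous_on (U \<times> T) (\<lambda>p. f (fst p))"
  by (rule continuous_on_compose2[OF holomorphic_on_imp_continuous_on[OF assms]])
   (auto intro!: continuous_on_fst continuous_on_id)
 then show ?thesis using assms by (simp add: biholo_def split_beta)
qed

lemma biholo_snd: "f holomorphic_on T \<Longrightarrow> biholo (\<lambda>w t. f t) U T"
 by (rule biholo_swap[OF biholo_fst])

lemma biholo_mult: "biholo f U T \<Longrightarrow> biholo g U T \<Longrightarrow> biholo (\<lambda>w t. f w t * g w t) U T"
 unfolding biholo_def by (auto simp: split_beta intro!: continuous_intros holomorphic_intros)

lemma biholo_add: "biholo f U T \<Longrightarrow> biholo g U T \<Longrightarrow> biholo (\<lambda>w t. f w t + g w t) U T"
 unfolding biholo_def by (auto simp: split_beta intro!: continuous_intros holomorphic_intros)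

lemma biholo_exp: "biholo f U T \<Longrightarrow> biholo (\<lambda>w t. exp (f w t)) U T"
 unfolding biholo_def by (auto simp: split_beta intro!: continuous_intros holomorphic_intros)

lemma biholo_cong:
 assumes "\<And>w t. w \<in> U \<Longrightarrow> t \<in> T \<Longrightarrow> f w t = g w t"
 shows "biholo f U T \<longleftrightarrow> biholo g U T"
proof -
 have "continuous_on (U \<times> T) (\<lambda>(w, t). f w t) \<longleftrightarrow> continuous_on (U \<times> T) (\<lambda>(w, t). g w t)"
  by (rule continuous_on_cong) (use assms in auto)
 moreover have "(\<lambda>w. f w t) holomorphic_on U \<longleftrightarrow> (\<lambda>w. g w t) holomorphic_on U" if "t \<in> T" for t
  by (rule holomorphic_cong) (use assms that in auto)
 moreover have "f w holomorphic_on T \<longleftrightarrow> g w holomorphic_on T" if "w \<in> U" for w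
  by (rule holomorphic_cong) (use assms that in auto)
 ultimately show ?thesis by (simp add: biholo_def)
qed

lemma biholo_const: "biholo (\<lambda>w t. c) U T"
 by (rule biholo_fst) auto

lemma biholo_prod: "(\<And>i. i \<in> I \<Longrightarrow> biholo (f i) U T) \<Longrightarrow> biholo (\<lambda>w t. \<Prod>i\<in>I. f i w t) U T"
proof (induction I rule: infinite_finite_induct)
 case (insert i I)
 then show ?case by (simp add: biholo_mult)
qed (auto intro: biholo_const)

lemma holomorphic_on_prod_list:
 "(\<And>p. p \<in> set l \<Longrightarrow> f p holomorphic_on U) \<Longrightarrow> (\<lambda>w. \<Prod>p\<leftarrow>l. f p w) holomorphic_on U"
 by (induction l) (auto intro!: holomorphic_intros)

lemma norm_powr_le_near_1:
 obtains L where "L \<ge> 0" "\<And>q c. q \<in> cball 1 (1/2) \<Longrightarrow> cmod (q powr c) \<le> exp (cmod c * L)"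
proof -
 have q: "q \<notin> \<real>\<^sub>\<le>\<^sub>0" if "q \<in> cball 1 (1/2)" for q :: complex
  using that abs_Re_le_cmod[of "1 - q"] by (auto simp: dist_norm complex_nonpos_Reals_iff)
 have "continuous_on (cball 1 (1/2)) Ln" using q by (intro continuous_intros) auto
 then have "bounded (Ln ` cball 1 (1/2))" using compact_continuous_image compact_imp_bounded compact_cball by blast
 then obtain L where "\<forall>y\<in>Ln ` cball 1 (1/2). cmod y \<le> L" unfolding bounded_iff by blast
 then have L: "\<And>q. q \<in> cball 1 (1/2) \<Longrightarrow> cmod (Ln q) \<le> L" by blast
 have L0: "L \<ge> 0" using L[of 1] by simp
 show ?thesis
 proof (rule that[OF L0])
  fix q c :: complex assume qc: "q \<in> cball 1 (1/2)"
  have "Re (c * Ln q) \<le> cmod c * cmod (Ln q)" using complex_Re_le_cmod[of "c * Ln q"] by (simp add: norm_mult)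
  also have "\<dots> \<le> cmod c * L" using L[OF qc] by (intro mult_left_mono) auto
  finally show "cmod (q powr c) \<le> exp (cmod c * L)" using q[OF qc] by (auto simp: powr_def)
 qed
qed

text \<open>The second list holds conjugated edges: dilating a modulus produces an edge together
  with its conjugate.\<close>

definition psx :: "nat \<Rightarrow> conf \<Rightarrow> pairing \<Rightarrow> graph \<Rightarrow> graph \<Rightarrow>
  complex \<Rightarrow> conf \<Rightarrow> complex" where
 "psx n a e l l' z x = psi n a e z x * (ins n l z x * cnj (ins n l' z x))"

lemma psx_measurable [measurable]: "psx n a e l l' z \<in> borel_measurable (config n)"
proof -
 have cm[measurable]: "cnj \<in> borel_measurable borel" by (intro borel_measurable_continuous_onI continuous_intros)
 show ?thesis unfolding psx_def[abs_def] by measurable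
qed

context cutoff begin

definition kk where
 "kk n a e l l' w w' x = kp n a e w x * kq n a e w' x * ki n l w x * kj n l' w' x * jac n w w' x"

lemma kk_measurable [measurable]: "kk n a e l l' w w' \<in> borel_measurable (config n)"
 unfolding kk_def[abs_def] by measurable

lemma psx_mv:
 assumes w: "w \<in> ball 0 rad" and l: "verts l \<subseteq> {..n + 1}" "verts l' \<subseteq> {..n + 1}"
 shows "psx n a e l l' (z0 + w) (\<lambda>j\<in>{..<n}. mv w (x j)) * jac n w (cnj w) x = psx n a e l l' z0 x * kk n a e l l' w (cnj w) x"
 unfolding psx_def psi_mv[OF w] ins_mv[OF w l(1)] ins_mv[OF w l(2)] complex_cnj_mult cnj_ki kk_def by (simp only: mult_ac)

lemma mv_config_measurable: "(\<lambda>x. \<lambda>j\<in>{..<n}. mv w (x j)) \<in> measurable (config n) (config n)"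
 by measurable

lemma jac_real_pos: "w \<in> ball 0 rad \<Longrightarrow> (\<Prod>j<n. 1 + 2 * Re (w * dct (x j))) > 0"
 by (rule prod_pos) (use jac_pos in auto)

lemma jac_real_measurable [measurable]: "(\<lambda>x. \<Prod>j<n. 1 + 2 * Re (w * dct (x j))) \<in> borel_measurable (config n)"
 by measurable

lemma transport_integral:
 assumes w: "w \<in> ball 0 rad" and l: "verts l \<subseteq> {..n + 1}" "verts l' \<subseteq> {..n + 1}"
 shows "(\<integral>x. psx n a e l l' (z0 + w) x \<partial>config n) = (\<integral>x. psx n a e l l' z0 x * kk n a e l l' w (cnj w) x \<partial>config n)"
proof -
 define J where "J x = (\<Prod>j<n. 1 + 2 * Re (w * dct (x j)))" for x :: conf
 have Jm[measurable]: "J \<in> borel_measurable (config n)" unfolding J_def[abs_def] by measurable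
 have J0: "J x > 0" for x unfolding J_def using jac_real_pos[OF w] .
 note T = mv_config_measurable
 have "(\<integral>x. psx n a e l l' (z0 + w) x \<partial>config n)
   = (\<integral>x. psx n a e l l' (z0 + w) x \<partial>distr (density (config n) (\<lambda>x. ennreal (J x))) (config n) (\<lambda>x. \<lambda>j\<in>{..<n}. mv w (x j)))"
  unfolding J_def distr_config_mv[OF w] ..
 also have "\<dots> = (\<integral>x. psx n a e l l' (z0 + w) (\<lambda>j\<in>{..<n}. mv w (x j)) \<partial>density (config n) (\<lambda>x. ennreal (J x)))"
  by (rule integral_distr) (use T in auto)
 also have "\<dots> = (\<integral>x. J x *\<^sub>R psx n a e l l' (z0 + w) (\<lambda>j\<in>{..<n}. mv w (x j)) \<partial>config n)"
  by (rule integral_density) (use measurable_compose[OF T psx_measurable] J0 in \<open>auto intro: less_imp_le\<close>)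
 also have "\<dots> = (\<integral>x. psx n a e l l' z0 x * kk n a e l l' w (cnj w) x \<partial>config n)"
  by (rule Bochner_Integration.integral_cong) (simp_all add: psx_mv[OF w l, symmetric] jac_cnj J_def scaleR_conv_of_real mult.commute)
 finally show ?thesis .
qed

text \<open>For nonnegative integrands the substitution holds before anything is known about
  integrability at \<open>z0 + w\<close>, so it transfers absolute convergence from
  \<open>z0\<close>.\<close>

lemma transport_norm:
 assumes w: "w \<in> ball 0 rad" and l: "verts l \<subseteq> {..n + 1}" "verts l' \<subseteq> {..n + 1}"
 shows "(\<integral>\<^sup>+x. ennreal (cmod (psx n a e l l' (z0 + w) x)) \<partial>config n) = (\<integral>\<^sup>+x. ennreal (cmod (psx n a e l l' z0 x * kk n a e l l' w (cnj w) x)) \<partial>config n)"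
proof -
 define J where "J x = (\<Prod>j<n. 1 + 2 * Re (w * dct (x j)))" for x :: conf
 have Jm[measurable]: "J \<in> borel_measurable (config n)" unfolding J_def[abs_def] by measurable
 have J0: "J x > 0" for x unfolding J_def using jac_real_pos[OF w] .
 note T = mv_config_measurable
 have "(\<integral>\<^sup>+x. ennreal (cmod (psx n a e l l' (z0 + w) x)) \<partial>config n)
   = (\<integral>\<^sup>+x. ennreal (cmod (psx n a e l l' (z0 + w) x)) \<partial>distr (density (config n) (\<lambda>x. ennreal (J x))) (config n) (\<lambda>x. \<lambda>j\<in>{..<n}. mv w (x j)))"
  unfolding J_def distr_config_mv[OF w] ..
 also have "\<dots> = (\<integral>\<^sup>+x. ennreal (cmod (psx n a e l l' (z0 + w) (\<lambda>j\<in>{..<n}. mv w (x j)))) \<partial>density (config n) (\<lambda>x. ennreal (J x)))"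
  by (rule nn_integral_distr) (use T in auto)
 also have "\<dots> = (\<integral>\<^sup>+x. ennreal (J x) * ennreal (cmod (psx n a e l l' (z0 + w) (\<lambda>j\<in>{..<n}. mv w (x j)))) \<partial>config n)"
  by (rule nn_integral_density) (use measurable_compose[OF T psx_measurable] in auto)
 also have "\<dots> = (\<integral>\<^sup>+x. ennreal (cmod (psx n a e l l' z0 x * kk n a e l l' w (cnj w) x)) \<partial>config n)"
 proof (rule nn_integral_cong)
  fix x
  have e: "psx n a e l l' z0 x * kk n a e l l' w (cnj w) x = psx n a e l l' (z0 + w) (\<lambda>j\<in>{..<n}. mv w (x j)) * of_real (J x)"
   unfolding psx_mv[OF w l, symmetric] jac_cnj J_def ..
  show "ennreal (J x) * ennreal (cmod (psx n a e l l' (z0 + w) (\<lambda>j\<in>{..<n}. mv w (x j)))) = ennreal (cmod (psx n a e l l' z0 x * kk n a e l l' w (cnj w) x))"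
   unfolding e using J0[of x] by (simp add: norm_mult ennreal_mult'[symmetric] mult.commute)
 qed
 finally show ?thesis .
qed

lemma one_plus_in_cball: "cmod (w * d) \<le> 1 / 2 \<Longrightarrow> 1 + w * d \<in> cball 1 (1/2)"
 by (simp add: dist_norm)

lemma cnj_bound: "cmod (w * d) \<le> 1 / 2 \<Longrightarrow> cmod (w * cnj d) \<le> 1 / 2"
 by (simp add: norm_mult)

lemma kp_kq_bound:
 assumes L: "L \<ge> 0" "\<And>q c. q \<in> cball 1 (1/2) \<Longrightarrow> cmod (q powr c) \<le> exp (cmod c * L)" and w: "w \<in> ball 0 rad"
 shows "cmod (kp n a e w x) \<le> exp ((exp_size n a e) * L)" (is ?c1)
  and "cmod (kq n a e w x) \<le> exp ((exp_size n a e) * L)" (is ?c2)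
proof -
 have eq: "exp ((exp_size n a e) * L)
   = (\<Prod>j<n. exp (cmod (a j - 1) * L)) * (\<Prod>(u, v)\<in>prs n. exp (cmod (e u v) * L))"
  by (simp add: exp_sum distrib_right exp_add sum_distrib_right split_beta)
 show ?c1
  unfolding eq kp_def norm_mult prod_norm[symmetric] split_beta
  by (intro mult_mono prod_mono conjI L(2) one_plus_in_cball norm_mult_dq_le w) (auto simp: prod_nonneg)
 show ?c2
  unfolding eq kq_def norm_mult prod_norm[symmetric] split_beta
  by (intro mult_mono prod_mono conjI L(2) one_plus_in_cball cnj_bound norm_mult_dq_le w) (auto simp: prod_nonneg)
qed

lemma ki_kj_bound:
 assumes w: "w \<in> ball 0 rad"
 shows "cmod (ki n l w x) \<le> 3 ^ length l" "cmod (kj n l w x) \<le> 3 ^ length l"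
proof -
 have r: "cmod ((1 + p) / (1 + q)) \<le> 3" if "cmod p \<le> 1 / 2" "cmod q \<le> 1 / 2" for p q
 proof -
  have "cmod (1 + p) \<le> 3 / 2" using norm_triangle_ineq[of 1 p] that by simp
  moreover have "1 / 2 \<le> cmod (1 + q)" using norm_triangle_ineq2[of 1 "- q"] that by simp
  ultimately have "cmod (1 + p) / cmod (1 + q) \<le> (3 / 2) / (1 / 2)" by (intro frac_le) auto
  then show ?thesis by (simp add: norm_divide)
 qed
 show "cmod (ki n l w x) \<le> 3 ^ length l"
 proof (induction l)
  case (Cons p l)
  obtain u v where p: "p = (u, v)" by (cases p)
  have "cmod ((1 + w * dq (pt n z0 x u) 0) / (1 + w * dq (pt n z0 x u) (pt n z0 x v)) * ki n l w x) \<le> 3 * 3 ^ length l"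
   unfolding norm_mult using Cons r[OF norm_mult_dq_le[OF w] norm_mult_dq_le[OF w]] by (intro mult_mono) auto
  then show ?case by (simp add: p ki_def)
 qed (simp add: ki_def)
 show "cmod (kj n l w x) \<le> 3 ^ length l"
 proof (induction l)
  case (Cons p l)
  obtain u v where p: "p = (u, v)" by (cases p)
  have "cmod ((1 + w * cnj (dq (pt n z0 x u) 0)) / (1 + w * cnj (dq (pt n z0 x u) (pt n z0 x v))) * kj n l w x) \<le> 3 * 3 ^ length l"
   unfolding norm_mult using Cons r[OF cnj_bound[OF norm_mult_dq_le[OF w]] cnj_bound[OF norm_mult_dq_le[OF w]]] by (intro mult_mono) auto
  then show ?case by (simp add: p kj_def)
 qed (simp add: kj_def)
qed

lemma jac_bound:
 assumes "w \<in> ball 0 rad" "w' \<in> ball 0 rad"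
 shows "cmod (jac n w w' x) \<le> 2 ^ n"
proof -
 have "cmod (w * dct y) \<le> 1 / 2" if "w \<in> ball 0 rad" for w y
 proof -
  have "cmod w * cmod (dct y) \<le> R / 8 * (2 / R)" using that norm_dct_le R by (intro mult_mono) (auto simp: rad_def)
  then show ?thesis using R by (simp add: norm_mult)
 qed
 then have "cmod (1 + w * dct y + w' * cnj (dct y)) \<le> 2" for y
  using assms norm_triangle_ineq[of "1 + w * dct y" "w' * cnj (dct y)"] norm_triangle_ineq[of 1 "w * dct y"]
   cnj_bound[of w' "dct y"] by (smt (verit) field_sum_of_halves norm_one)
 then have "cmod (jac n w w' x) \<le> (\<Prod>j<n. 2)"
  unfolding jac_def prod_norm[symmetric] by (intro prod_mono) auto
 then show ?thesis by simp
qed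

lemma one_plus_nonpos: "cmod (w * d) \<le> 1 / 2 \<Longrightarrow> 1 + w * d \<notin> \<real>\<^sub>\<le>\<^sub>0"
 using Re_pos[of w d] by (auto simp: complex_nonpos_Reals_iff)

lemma one_plus_nz: "cmod (w * d) \<le> 1 / 2 \<Longrightarrow> 1 + w * d \<noteq> 0"
 using one_plus_nonpos[of w d] by auto

lemma kp_holomorphic: "(\<lambda>w. kp n a e w x) holomorphic_on ball 0 rad"
 and kq_holomorphic: "(\<lambda>w. kq n a e w x) holomorphic_on ball 0 rad"
 and ki_holomorphic: "(\<lambda>w. ki n l w x) holomorphic_on ball 0 rad"
 and kj_holomorphic: "(\<lambda>w. kj n l w x) holomorphic_on ball 0 rad"
 unfolding kp_def kq_def ki_def kj_def split_beta
 by (intro holomorphic_intros holomorphic_on_prod_list one_plus_nonpos one_plus_nz cnj_bound norm_mult_dq_le; assumption)+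

lemma biholo_kk: "biholo (\<lambda>w w'. kk n a e l l' w w' x) (ball 0 rad) (ball 0 rad)"
 unfolding kk_def jac_def
 by (intro biholo_mult biholo_prod biholo_add biholo_fst[OF kp_holomorphic] biholo_snd[OF kq_holomorphic]
   biholo_fst[OF ki_holomorphic] biholo_snd[OF kj_holomorphic] biholo_const
   biholo_fst[of "\<lambda>w. w * _"] biholo_snd[of "\<lambda>w. w * _"] holomorphic_intros)

lemma kk_bound: "\<exists>K\<ge>0. \<forall>w\<in>ball 0 rad. \<forall>w'\<in>ball 0 rad. \<forall>x. cmod (kk n a e l l' w w' x) \<le> K"
proof -
 obtain L where L: "L \<ge> 0" "\<And>q c. q \<in> cball 1 (1/2) \<Longrightarrow> cmod (q powr c) \<le> exp (cmod c * L)"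
  using norm_powr_le_near_1 by blast
 define S where "S = exp ((exp_size n a e) * L)"
 have "cmod (kk n a e l l' w w' x) \<le> S * S * 3 ^ length l * 3 ^ length l' * 2 ^ n"
  if "w \<in> ball 0 rad" "w' \<in> ball 0 rad" for w w' x
  unfolding kk_def norm_mult S_def
  using kp_kq_bound(1)[OF L that(1)] kp_kq_bound(2)[OF L that(2)] ki_kj_bound(1)[OF that(1)] ki_kj_bound(2)[OF that(2)] jac_bound[OF that]
  by (intro mult_mono mult_nonneg_nonneg) auto
 then show ?thesis by (intro exI[of _ "S * S * 3 ^ length l * 3 ^ length l' * 2 ^ n"]) (auto simp: S_def)
qed

text \<open>The transported integrand is the one at \<open>z0\<close> times the bounded factor
  \<open>kk\<close>, so the integrand at \<open>z0\<close> dominates uniformly in both variables.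
  All derivatives come from Cauchy's formula rather than from differentiated, more singular
  integrands.\<close>

lemma polarized_integral:
 assumes int: "integrable (config n) (psx n a e l l' z0)" and l: "verts l \<subseteq> {..n + 1}" "verts l' \<subseteq> {..n + 1}"
 shows "biholo (\<lambda>w w'. \<integral>x. psx n a e l l' z0 x * kk n a e l l' w w' x \<partial>config n) (ball 0 rad) (ball 0 rad)" (is ?c1)
  and "\<exists>K. \<forall>w\<in>ball 0 rad. integrable (config n) (psx n a e l l' (z0 + w)) \<and> (\<integral>x. cmod (psx n a e l l' (z0 + w) x) \<partial>config n) \<le> K" (is ?c2)
proof -
 obtain K where K: "K \<ge> 0" "\<And>w w' x. w \<in> ball 0 rad \<Longrightarrow> w' \<in> ball 0 rad \<Longrightarrow> cmod (kk n a e l l' w w' x) \<le> K"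
  using kk_bound[of n a e l l'] by blast
 have b: "cmod (psx n a e l l' z0 x * kk n a e l l' w w' x) \<le> K * cmod (psx n a e l l' z0 x)" if "w \<in> ball 0 rad" "w' \<in> ball 0 rad" for w w' x
  unfolding norm_mult using K(2)[OF that] by (subst mult.commute) (intro mult_right_mono, auto)
 have iB: "integrable (config n) (\<lambda>x. K * cmod (psx n a e l l' z0 x))" using int by (intro integrable_mult_right integrable_norm)
 show ?c1
 proof (rule biholo_param_integral[OF _ _ _ _ _ iB])
  show "biholo (\<lambda>w t. psx n a e l l' z0 x * kk n a e l l' w t x) (ball 0 rad) (ball 0 rad)" for x
   by (intro biholo_mult biholo_const biholo_kk)
 qed (use b in auto)
 show ?c2
 proof (intro exI ballI)
  fix w :: complex assume w: "w \<in> ball 0 rad"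
  then have cw: "cnj w \<in> ball 0 rad" by (auto simp: dist_norm)
  have i: "integrable (config n) (\<lambda>x. psx n a e l l' z0 x * kk n a e l l' w (cnj w) x)"
   by (rule Bochner_Integration.integrable_bound[OF iB]) (use b[OF w cw] K(1) in \<open>auto simp: abs_mult\<close>)
  have iw: "integrable (config n) (psx n a e l l' (z0 + w))"
   using i transport_norm[OF w l, of a e] by (simp add: integrable_iff_bounded)
  have "(\<integral>x. cmod (psx n a e l l' (z0 + w) x) \<partial>config n) = enn2real (\<integral>\<^sup>+x. ennreal (cmod (psx n a e l l' (z0 + w) x)) \<partial>config n)"
   by (rule integral_eq_nn_integral) auto
  also have "\<dots> = enn2real (\<integral>\<^sup>+x. ennreal (cmod (psx n a e l l' z0 x * kk n a e l l' w (cnj w) x)) \<partial>config n)"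
   using transport_norm[OF w l] by simp
  also have "\<dots> = (\<integral>x. cmod (psx n a e l l' z0 x * kk n a e l l' w (cnj w) x) \<partial>config n)"
   by (rule integral_eq_nn_integral[symmetric]) auto
  also have "\<dots> \<le> (\<integral>x. K * cmod (psx n a e l l' z0 x) \<partial>config n)"
   by (rule integral_mono[OF integrable_norm[OF i] iB b[OF w cw]])
  finally show "integrable (config n) (psx n a e l l' (z0 + w)) \<and> (\<integral>x. cmod (psx n a e l l' (z0 + w) x) \<partial>config n) \<le> (\<integral>x. K * cmod (psx n a e l l' z0 x) \<partial>config n)"
   using iw by blast
 qed
qed

end

lemma regular_integral:
 assumes z: "z \<notin> {0, 1}" and int: "integrable (config n) (psx n a e l l' z)" and l: "verts l \<subseteq> {..n + 1}" "verts l' \<subseteq> {..n + 1}"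
 obtains r G K where "r > 0" "biholo G (ball 0 r) (ball 0 r)"
  "\<And>w. w \<in> ball 0 r \<Longrightarrow> (\<integral>x. psx n a e l l' (z + w) x \<partial>config n) = G w (cnj w)"
  "\<And>w. w \<in> ball 0 r \<Longrightarrow> (\<integral>x. cmod (psx n a e l l' (z + w) x) \<partial>config n) \<le> K"
proof -
 interpret cutoff z "min (cmod z) (cmod (z - 1))" by unfold_locales (use z in auto)
 obtain K where K: "\<And>w. w \<in> ball 0 rad \<Longrightarrow> (\<integral>x. cmod (psx n a e l l' (z + w) x) \<partial>config n) \<le> K"
  using polarized_integral(2)[OF int l] by metis
 show ?thesis
  by (rule that[OF rad_pos polarized_integral(1)[OF int l] transport_integral[OF _ l] K])
qed

section \<open>Holomorphic dependence on the contraction parameter\<close>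

definition sca :: "complex \<Rightarrow> conf \<Rightarrow> nat \<Rightarrow> complex" where
 "sca s a j = sc s (a j)"

definition sce :: "complex \<Rightarrow> pairing \<Rightarrow> nat \<Rightarrow> nat \<Rightarrow> complex" where
 "sce s e u v = sc s (e u v)"

text \<open>The logarithm of the modulus is affine in Re s and therefore lies below the larger of
  its values at s0 and at 1. Integrability at both ends then dominates the whole strip between
  them.\<close>

lemma norm_psi_sc_le:
 assumes s: "s0 \<le> Re s" "Re s \<le> 1"
 shows "cmod (psi n (sca s a) (sce s e) z x) \<le> cmod (psi n (sca (of_real s0) a) (sce (of_real s0) e) z x) + cmod (psi n a e z x)"
proof (cases "(\<forall>j<n. x j \<noteq> 0) \<and> (\<forall>(u, v)\<in>prs n. pt n z x u \<noteq> pt n z x v)")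
 case False
 then show ?thesis using psi_eq_0[of _ n x _ _ z] by fastforce
next
 case True
 define P where "P = (\<Sum>j<n. - 2 * ln (cmod (x j)))"
 define Q where "Q = (\<Sum>j<n. 2 * Re (a j) * ln (cmod (x j))) + (\<Sum>(u, v)\<in>prs n. 2 * Re (e u v) * ln (cmod (pt n z x u - pt n z x v)))"
 have eq: "cmod (psi n (sca s a) (sce s e) z x) = exp (P + Re s * Q)" for s
 proof -
  have "cmod (psi n (sca s a) (sce s e) z x) = (\<Prod>j<n. cmod (x j) powr (2 * (Re s * Re (a j) - 1))) *
   (\<Prod>(u, v)\<in>prs n. cmod (pt n z x u - pt n z x v) powr (2 * (Re s * Re (e u v))))"
   by (simp add: psi_def norm_mult prod_norm[symmetric] norm_abs_powr split_beta sca_def sce_def Re_sc)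
  also have "(\<Prod>j<n. cmod (x j) powr (2 * (Re s * Re (a j) - 1))) = (\<Prod>j<n. exp (- 2 * ln (cmod (x j)) + Re s * (2 * Re (a j) * ln (cmod (x j)))))"
   using True by (intro prod.cong refl) (simp add: powr_def algebra_simps)
  also have "(\<Prod>(u, v)\<in>prs n. cmod (pt n z x u - pt n z x v) powr (2 * (Re s * Re (e u v)))) =
    (\<Prod>(u, v)\<in>prs n. exp (Re s * (2 * Re (e u v) * ln (cmod (pt n z x u - pt n z x v)))))"
   using True by (intro prod.cong refl) (auto simp add: powr_def algebra_simps)
  finally show ?thesis
   by (simp only: P_def Q_def case_prod_unfold exp_sum[symmetric] finite_lessThan finite_prs exp_add[symmetric] sum.distrib sum_distrib_left distrib_left add.assoc)
 qed
 have "P + Re s * Q \<le> P + s0 * Q \<or> P + Re s * Q \<le> P + 1 * Q"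
 proof (cases "Q \<ge> 0")
  case True
  then show ?thesis using s by (intro disjI2 add_left_mono mult_right_mono) auto
 next
  case False
  then show ?thesis using s by (intro disjI1 add_left_mono mult_right_mono_neg) auto
 qed
 then have "exp (P + Re s * Q) \<le> exp (P + s0 * Q) + exp (P + 1 * Q)"
  by (metis add_increasing add_increasing2 exp_ge_zero exp_le_cancel_iff)
 moreover have "sca 1 a = a" "sce 1 e = e" by (auto simp: sca_def sce_def fun_eq_iff)
 ultimately show ?thesis using eq[of s] eq[of "of_real s0"] eq[of 1] by simp
qed

lemma holomorphic_abs_powr_sc: "(\<lambda>s. abs_powr d (2 * (sc s c - k))) holomorphic_on S"
proof (cases "d = 0")
 case False
 then have "(\<lambda>s. abs_powr d (2 * (sc s c - k))) = (\<lambda>s. exp (2 * (sc s c - k) * Ln (of_real (cmod d))))"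
  by (simp add: abs_powr_def powr_def)
 then show ?thesis unfolding sc_def by (simp only:) (intro holomorphic_intros)
qed (simp add: abs_powr_def)

lemma psi_sc_holomorphic: "(\<lambda>s. psi n (sca s a) (sce s e) z x) holomorphic_on S"
 unfolding psi_def sca_def sce_def split_beta
 using holomorphic_abs_powr_sc[where k=0] by (intro holomorphic_intros holomorphic_abs_powr_sc) simp_all

context cutoff begin

lemma kq_0: "kq n a e 0 x = 1"
 by (simp add: kq_def split_beta)

lemma ki_kj_Nil: "ki n [] w x = 1" "kj n [] w x = 1"
 by (simp_all add: ki_def kj_def)

text \<open>The second variable of the polarised integral is frozen at 0, the value of
  \<open>cnj w\<close> at the centre, as only holomorphic derivatives are wanted. Its place is taken
  by \<open>s\<close>, in which joint holomorphy is required.\<close>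

definition GS :: "nat \<Rightarrow> conf \<Rightarrow> pairing \<Rightarrow> complex \<Rightarrow> complex \<Rightarrow> complex" where
 "GS n a e w s = (\<integral>x. psi n (sca s a) (sce s e) z0 x * (kp n (sca s a) (sce s e) w x * jac n w 0 x) \<partial>config n)"

lemma wirtinger_power_psi:
 assumes int: "integrable (config n) (psi n (sca s a) (sce s e) z0)"
 shows "(wirtinger ^^ k) (\<lambda>z. \<integral>x. psi n (sca s a) (sce s e) z x \<partial>config n) z0 = (deriv ^^ k) (\<lambda>w. GS n a e w s) 0"
proof -
 have p: "psi n (sca s a) (sce s e) z = psx n (sca s a) (sce s e) [] [] z" for z by (simp add: psx_def fun_eq_iff)
 have v: "verts [] \<subseteq> {..n + 1}" by simp
 have int': "integrable (config n) (psx n (sca s a) (sce s e) [] [] z0)" using int unfolding p .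
 have "(wirtinger ^^ k) (\<lambda>z. \<integral>x. psx n (sca s a) (sce s e) [] [] z x \<partial>config n) (z0 + 0)
  = (deriv ^^ k) (\<lambda>w. \<integral>x. psx n (sca s a) (sce s e) [] [] z0 x * kk n (sca s a) (sce s e) [] [] w (cnj 0) x \<partial>config n) 0"
  by (rule polarized_wirtinger_power[OF polarized_integral(1)[OF int' v v] transport_integral[OF _ v v]]) (use rad_pos in auto)
 then show ?thesis
  unfolding p GS_def by (simp add: kk_def kq_0 ki_kj_Nil)
qed

lemma norm_sc_le: "cmod s \<le> 2 \<Longrightarrow> cmod (sc s c) \<le> 3 * cmod c"
proof -
 assume s: "cmod s \<le> 2"
 have "cmod (sc s c) \<le> cmod s * \<bar>Re c\<bar> + \<bar>Im c\<bar>"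
  unfolding sc_def by (rule order_trans[OF norm_triangle_ineq]) (simp add: norm_mult)
 also have "\<dots> \<le> 2 * cmod c + cmod c"
  using s abs_Re_le_cmod[of c] abs_Im_le_cmod[of c] by (intro add_mono mult_mono) auto
 finally show ?thesis by simp
qed

lemma GS_integrand_bound:
 "\<exists>K\<ge>0. \<forall>w\<in>ball 0 rad. \<forall>s x. cmod s \<le> 2 \<longrightarrow> cmod (kp n (sca s a) (sce s e) w x * jac n w 0 x) \<le> K"
proof -
 obtain L where L: "L \<ge> 0" "\<And>q c. q \<in> cball 1 (1/2) \<Longrightarrow> cmod (q powr c) \<le> exp (cmod c * L)"
  using norm_powr_le_near_1 by blast
 define S where "S = exp (((\<Sum>j<n. 3 * cmod (a j) + 1) + (\<Sum>(u, v)\<in>prs n. 3 * cmod (e u v))) * L)"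
 have "cmod (kp n (sca s a) (sce s e) w x * jac n w 0 x) \<le> S * 2 ^ n" if w: "w \<in> ball 0 rad" and s: "cmod s \<le> 2" for w s x
  unfolding norm_mult
 proof (rule mult_mono)
  have "cmod (sca s a j - 1) \<le> 3 * cmod (a j) + 1" for j
   using norm_triangle_ineq4[of "sca s a j" 1] norm_sc_le[OF s, of "a j"] by (simp add: sca_def)
  then have "exp (((\<Sum>j<n. cmod (sca s a j - 1)) + (\<Sum>(u, v)\<in>prs n. cmod (sce s e u v))) * L) \<le> S"
   unfolding S_def sce_def split_beta using L(1)
   by (intro exp_le_cancel_iff[THEN iffD2] mult_right_mono add_mono sum_mono norm_sc_le s) auto
  then show "cmod (kp n (sca s a) (sce s e) w x) \<le> S" using kp_kq_bound(1)[OF L w] by (rule order_trans[rotated])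
  show "cmod (jac n w 0 x) \<le> 2 ^ n" using w rad_pos by (intro jac_bound) auto
 qed (auto simp: S_def)
 then show ?thesis by (intro exI[of _ "S * 2 ^ n"]) (auto simp: S_def)
qed

lemma biholo_GS_integrand: "biholo (\<lambda>w s. psi n (sca s a) (sce s e) z0 x * (kp n (sca s a) (sce s e) w x * jac n w 0 x)) (ball 0 rad) UNIV"
proof -
 have b: "biholo (\<lambda>w s. (1 + w * dq u v) powr (sc s c - k)) (ball 0 rad) UNIV" for u v c k
 proof -
  have "biholo (\<lambda>w s. exp ((sc s c - k) * Ln (1 + w * dq u v))) (ball 0 rad) UNIV"
  proof (intro biholo_exp biholo_mult biholo_fst biholo_snd)
   show "(\<lambda>s. sc s c - k) holomorphic_on UNIV" unfolding sc_def by (intro holomorphic_intros)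
   show "(\<lambda>w. Ln (1 + w * dq u v)) holomorphic_on ball 0 rad"
    by (intro holomorphic_intros one_plus_nonpos norm_mult_dq_le)
  qed
  moreover have "(1 + w * dq u v) powr (sc s c - k) = exp ((sc s c - k) * Ln (1 + w * dq u v))" if "w \<in> ball 0 rad" for w s
   using one_plus_nz[OF norm_mult_dq_le[OF that]] by (simp add: powr_def)
  ultimately show ?thesis by (subst biholo_cong)
 qed
 have "biholo (\<lambda>w s. kp n (sca s a) (sce s e) w x) (ball 0 rad) UNIV"
  unfolding kp_def split_beta sca_def sce_def using b[where k=0] by (intro biholo_mult biholo_prod b) simp_all
 moreover have "biholo (\<lambda>w s. jac n w 0 x) (ball 0 rad) UNIV"
  unfolding jac_def by (intro biholo_fst holomorphic_intros)
 moreover have "biholo (\<lambda>w s. psi n (sca s a) (sce s e) z0 x) (ball 0 rad) UNIV"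
  by (rule biholo_snd[OF psi_sc_holomorphic])
 ultimately show ?thesis by (intro biholo_mult)
qed

lemma GS_regular:
 assumes i1: "integrable (config n) (psi n a e z0)" and i0: "integrable (config n) (psi n (sca (of_real s0) a) (sce (of_real s0) e) z0)"
  and s0: "0 < s0" "s0 < 1"
 shows "(\<lambda>s. (deriv ^^ k) (\<lambda>w. GS n a e w s) 0) holomorphic_on {s. s0 < Re s \<and> Re s < 1 \<and> \<bar>Im s\<bar> < 1}"
  and "continuous_on {s0..1} (\<lambda>s. (deriv ^^ k) (\<lambda>w. GS n a e w (of_real s)) 0)" (is ?c1)
  and "s \<in> {s0..1} \<Longrightarrow> integrable (config n) (psi n (sca (of_real s) a) (sce (of_real s) e) z0)"
proof -
 obtain K where K: "K \<ge> 0" "\<And>w s x. w \<in> ball 0 rad \<Longrightarrow> cmod s \<le> 2 \<Longrightarrow> cmod (kp n (sca s a) (sce s e) w x * jac n w 0 x) \<le> K"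
  using GS_integrand_bound by metis
 define B where "B x = (cmod (psi n (sca (of_real s0) a) (sce (of_real s0) e) z0 x) + cmod (psi n a e z0 x)) * K" for x
 have iB: "integrable (config n) B" unfolding B_def using i0 i1 by (intro integrable_mult_left integrable_add' integrable_norm)
 \<comment> \<open>The open strip \<open>T\<close> yields holomorphy. The closed rectangle
   \<open>T'\<close>, still covered by the same dominating function, yields continuity up to s =
   1.\<close>
 define T where "T = {s. s0 < Re s \<and> Re s < 1 \<and> \<bar>Im s\<bar> < 1}"
 define T' where "T' = {s. s0 \<le> Re s \<and> Re s \<le> 1 \<and> \<bar>Im s\<bar> \<le> 1}"
 have TT: "T \<subseteq> T'" by (auto simp: T_def T'_def)
 have ns: "cmod s \<le> 2" if "s \<in> T'" for s
  using that cmod_le[of s] s0 by (auto simp: T'_def)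
 have bound: "cmod (psi n (sca s a) (sce s e) z0 x * (kp n (sca s a) (sce s e) w x * jac n w 0 x)) \<le> B x"
  if "w \<in> ball 0 rad" "s \<in> T'" for w s x
  unfolding B_def norm_mult[of "psi n (sca s a) (sce s e) z0 x"]
  using that norm_psi_sc_le[of s0 s] K ns by (intro mult_mono) (auto simp: T'_def)
 have meas: "(\<lambda>x. psi n (sca s a) (sce s e) z0 x * (kp n (sca s a) (sce s e) w x * jac n w 0 x)) \<in> borel_measurable (config n)" for w s
  by measurable
 have oT: "open T"
  unfolding T_def by (intro open_Collect_conj open_Collect_less continuous_intros)
 have "biholo (GS n a e) (ball 0 rad) T"
  unfolding GS_def[abs_def]
  by (rule biholo_param_integral[OF _ oT _ _ _ iB])
   (use bound TT meas biholo_mono[OF biholo_GS_integrand] in auto)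
 from biholo_higher_deriv[OF this open_ball oT, of k] rad_pos
 show "(\<lambda>s. (deriv ^^ k) (\<lambda>w. GS n a e w s) 0) holomorphic_on T" unfolding biholo_def by auto
 have c0: "continuous_on (ball 0 rad \<times> T') (\<lambda>(w, s). GS n a e w s)"
  unfolding GS_def[abs_def] split_beta
 proof (rule continuous_on_param_integral[OF _ _ _ iB])
  fix x
  have "continuous_on (ball 0 rad \<times> UNIV) (\<lambda>p. psi n (sca (snd p) a) (sce (snd p) e) z0 x * (kp n (sca (snd p) a) (sce (snd p) e) (fst p) x * jac n (fst p) 0 x))"
   using biholoD(1)[OF biholo_GS_integrand] by (simp add: split_beta)
  then show "continuous_on (ball 0 rad \<times> T') (\<lambda>p. psi n (sca (snd p) a) (sce (snd p) e) z0 x * (kp n (sca (snd p) a) (sce (snd p) e) (fst p) x * jac n (fst p) 0 x))"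
   by (rule continuous_on_subset) auto
 qed (use bound in auto)
 have hol: "(\<lambda>w. GS n a e w s) holomorphic_on ball 0 rad" if "s \<in> T'" for s
  unfolding GS_def
  by (rule holomorphic_on_param_integral[OF _ _ _ _ iB]) (use bound that biholoD(2)[OF biholo_GS_integrand] in auto)
 have "continuous_on (ball 0 rad \<times> T') (\<lambda>(w, s). (deriv ^^ k) (\<lambda>w. GS n a e w s) w) \<and>
   (\<forall>s\<in>T'. (deriv ^^ k) (\<lambda>w. GS n a e w s) holomorphic_on ball 0 rad)"
 proof (induction k)
  case (Suc k)
  have "continuous_on (ball 0 rad \<times> T') (\<lambda>(w, s). deriv (\<lambda>w. (deriv ^^ k) (\<lambda>w. GS n a e w s) w) w)"
   by (rule continuous_on_deriv_param) (use Suc in auto)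
  then show ?case using Suc by (auto intro: holomorphic_deriv)
 qed (use c0 hol in auto)
 then have c: "continuous_on (ball 0 rad \<times> T') (\<lambda>p. (deriv ^^ k) (\<lambda>w. GS n a e w (snd p)) (fst p))" by (simp add: split_beta)
 show ?c1
 proof -
  have "continuous_on {s0..1} (\<lambda>s. (0 :: complex, complex_of_real s))" by (intro continuous_intros)
  moreover have "(\<lambda>s. (0 :: complex, complex_of_real s)) ` {s0..1} \<subseteq> ball 0 rad \<times> T'"
   using rad_pos by (auto simp: T'_def)
  ultimately show ?thesis using continuous_on_compose2[OF c] by fastforce
 qed
 show "integrable (config n) (psi n (sca (of_real s) a) (sce (of_real s) e) z0)" if "s \<in> {s0..1}"
  by (rule Bochner_Integration.integrable_bound[OF integrable_add'[OF integrable_norm[OF i0] integrable_norm[OF i1]]])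
   (use norm_psi_sc_le[of s0 "of_real s"] that in auto)
qed

end

section \<open>Generic configurations\<close>

lemma AE_config_coord:
 assumes j: "j < n" and m: "{x \<in> space (config n). P x} \<in> sets (config n)"
  and AE: "\<And>x. AE c in lborel. P (x(j := c))"
 shows "AE x in config n. P x"
proof -
 interpret P: product_sigma_finite "\<lambda>_ :: nat. lborel :: complex measure"
  by (simp add: product_sigma_finite_def sigma_finite_lborel)
 define I where "I = {..<n} - {j}"
 have I: "finite I" "j \<notin> I" "{..<n} = insert j I" using j by (auto simp: I_def)
 have m': "{x \<in> space (config n). \<not> P x} \<in> sets (config n)"
 proof -
  have "{x \<in> space (config n). \<not> P x} = space (config n) - {x \<in> space (config n). P x}" by blast
  then show ?thesis using sets.compl_sets[OF m] by simp
 qed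
 define f where "f x = (indicator {x \<in> space (config n). \<not> P x} x :: ennreal)" for x
 have fm: "f \<in> borel_measurable (PiM (insert j I) (\<lambda>_. lborel))"
  unfolding f_def I(3)[symmetric] using m' by (rule borel_measurable_indicator)
 have "emeasure (config n) {x \<in> space (config n). \<not> P x} = (\<integral>\<^sup>+x. f x \<partial>config n)"
  unfolding f_def using m' by (rule nn_integral_indicator[symmetric])
 also have "\<dots> = (\<integral>\<^sup>+x. (\<integral>\<^sup>+c. f (x(j := c)) \<partial>lborel) \<partial>PiM I (\<lambda>_. lborel))"
  unfolding I(3) by (rule P.product_nn_integral_insert[OF I(1,2) fm])
 also have "\<dots> = (\<integral>\<^sup>+x. 0 \<partial>PiM I (\<lambda>_. lborel :: complex measure))"
 proof (rule nn_integral_cong)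
  fix x
  have "(\<integral>\<^sup>+c. f (x(j := c)) \<partial>lborel) = (\<integral>\<^sup>+c. 0 \<partial>(lborel :: complex measure))"
   by (rule nn_integral_cong_AE) (use AE[of x] in \<open>eventually_elim, simp add: f_def\<close>)
  then show "(\<integral>\<^sup>+c. f (x(j := c)) \<partial>lborel) = 0" by simp
 qed
 finally have "emeasure (config n) {x \<in> space (config n). \<not> P x} = 0" by simp
 then show ?thesis using m' by (intro AE_I[where N="{x \<in> space (config n). \<not> P x}"]) auto
qed

lemma AE_not_line:
 fixes q :: complex
 assumes "q \<noteq> 0"
 shows "AE c in lborel. Im (q * cnj c) \<noteq> 0"
proof -
 have "{c. Im (q * cnj c) = 0} = {c. inner (\<i> * q) c = 0}" by (auto simp: inner_complex_def algebra_simps)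
 moreover have "negligible {c. inner (\<i> * q) c = 0}" by (rule negligible_hyperplane) (use assms in simp)
 moreover have "closed {c. inner (\<i> * q) c = 0}" by (rule closed_hyperplane)
 ultimately have "{c. Im (q * cnj c) = 0} \<in> null_sets lborel"
  by (simp add: null_sets_completion_iff negligible_iff_null_sets)
 from AE_not_in[OF this] show ?thesis by simp
qed

lemma AE_not_circle: "AE c in lborel. cmod c \<noteq> r"
proof -
 have "negligible (sphere (0 :: complex) r)" by (rule negligible_sphere)
 then have "sphere (0 :: complex) r \<in> null_sets lborel"
  by (simp add: null_sets_completion_iff negligible_iff_null_sets)
 from AE_not_in[OF this] show ?thesis by (simp add: dist_norm)
qed

text \<open>Under real dilation a moved point can meet a fixed one only if both lie on one line
  through 0, under rotation only if their moduli agree. Off these null sets the orbits avoid all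
  coincidences, and \<open>psi\<close> is differentiable along them.\<close>

definition generic :: "nat \<Rightarrow> complex \<Rightarrow> conf \<Rightarrow> bool" where
 "generic n z x \<longleftrightarrow> (\<forall>j<n. x j \<noteq> 0) \<and>
   (\<forall>(u, v)\<in>prs n. Im (pt n z x v * cnj (pt n z x u)) \<noteq> 0 \<and> cmod (pt n z x u) \<noteq> cmod (pt n z x v))"

lemma cnj_measurable [measurable]: "cnj \<in> borel_measurable borel"
 by (intro borel_measurable_continuous_onI continuous_intros)

lemma AE_generic:
 assumes z: "z \<noteq> 0"
 shows "AE x in config n. generic n z x"
proof -
 have a: "AE x in config n. x j \<noteq> 0" if "j < n" for j
 proof (rule AE_config_coord[OF that])
  show "{x \<in> space (config n). x j \<noteq> 0} \<in> sets (config n)"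
   using coord_measurable[OF that] by measurable
  show "AE c in lborel. (x(j := c)) j \<noteq> (0 :: complex)" for x by (simp add: AE_lborel_singleton)
 qed
 have b: "AE x in config n. pt n z x v \<noteq> 0 \<longrightarrow> Im (pt n z x v * cnj (pt n z x u)) \<noteq> 0"
  and c: "AE x in config n. cmod (pt n z x u) \<noteq> cmod (pt n z x v)" if "(u, v) \<in> prs n" for u v
 proof -
  have u: "u < n" "v \<noteq> u" using that by (auto simp: prs_def)
  show "AE x in config n. pt n z x v \<noteq> 0 \<longrightarrow> Im (pt n z x v * cnj (pt n z x u)) \<noteq> 0"
  proof (rule AE_config_coord[OF u(1)])
   show "{x \<in> space (config n). pt n z x v \<noteq> 0 \<longrightarrow> Im (pt n z x v * cnj (pt n z x u)) \<noteq> 0} \<in> sets (config n)"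
    by measurable
   show "AE c in lborel. pt n z (x(u := c)) v \<noteq> 0 \<longrightarrow> Im (pt n z (x(u := c)) v * cnj (pt n z (x(u := c)) u)) \<noteq> 0" for x
    using AE_not_line[of "pt n z x v"] u by (cases "pt n z x v = 0") (auto simp: pt_upd)
  qed
  show "AE x in config n. cmod (pt n z x u) \<noteq> cmod (pt n z x v)"
  proof (rule AE_config_coord[OF u(1)])
   show "{x \<in> space (config n). cmod (pt n z x u) \<noteq> cmod (pt n z x v)} \<in> sets (config n)"
    by (rule borel_measurable_neq) measurable
   show "AE c in lborel. cmod (pt n z (x(u := c)) u) \<noteq> cmod (pt n z (x(u := c)) v)" for x
    using AE_not_circle[of "cmod (pt n z x v)"] u by (auto simp: pt_upd)
  qed
 qed
 have A: "AE x in config n. \<forall>j\<in>{..<n}. x j \<noteq> 0" using a by (intro AE_finite_allI) auto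
 have B: "AE x in config n. \<forall>p\<in>prs n. pt n z x (snd p) \<noteq> 0 \<longrightarrow> Im (pt n z x (snd p) * cnj (pt n z x (fst p))) \<noteq> 0"
  using b by (intro AE_finite_allI) auto
 have C: "AE x in config n. \<forall>p\<in>prs n. cmod (pt n z x (fst p)) \<noteq> cmod (pt n z x (snd p))"
  using c by (intro AE_finite_allI) auto
 show ?thesis
  using A B C
 proof eventually_elim
  case (elim x)
  have "pt n z x v \<noteq> 0" for v using elim(1) z by (auto simp: pt_def)
  then show ?case using elim unfolding generic_def by fastforce
 qed
qed

section \<open>Dilating a subset of the points\<close>

lemma abs_powr_has_vector_derivative:
 assumes P: "(P has_vector_derivative P') (at t)" and nz: "P t \<noteq> 0"
 shows "((\<lambda>t. abs_powr (P t) (2 * c)) has_vector_derivative abs_powr (P t) (2 * c) * (2 * c * of_real (Re (P' / P t)))) (at t)"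
proof -
 have "((\<lambda>t. cmod (P t)) has_derivative (\<lambda>h. inner (h *\<^sub>R P') (sgn (P t)))) (at t)"
  using has_derivative_compose[OF P[unfolded has_vector_derivative_def] has_derivative_norm[OF nz]] by simp
 moreover have "(\<lambda>h. inner (h *\<^sub>R P') (sgn (P t))) = (*) (inner P' (sgn (P t)))"
  by (auto simp: fun_eq_iff mult.commute)
 ultimately have "((\<lambda>t. cmod (P t)) has_real_derivative inner P' (sgn (P t))) (at t)"
  by (simp add: has_field_derivative_def)
 then have "((\<lambda>t. ln (cmod (P t))) has_real_derivative (1 / cmod (P t) * inner P' (sgn (P t)))) (at t)"
  using nz by (intro DERIV_chain2[where f=ln]) (auto intro!: derivative_eq_intros)
 moreover have "1 / cmod (P t) * inner P' (sgn (P t)) = Re (P' / P t)"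
 proof -
  have "P' / P t = P' * cnj (P t) / of_real ((cmod (P t))\<^sup>2)"
   by (subst complex_div_cnj) simp
  then have "Re (P' / P t) = Re (P' * cnj (P t)) / (cmod (P t))\<^sup>2" by (metis Re_divide_of_real of_real_power)
  moreover have "Re (P' * cnj (P t)) = inner P' (P t)" by (simp add: inner_complex_def)
  ultimately show ?thesis using nz by (simp add: sgn_div_norm power2_eq_square divide_inverse)
 qed
 ultimately have L: "((\<lambda>t. ln (cmod (P t))) has_real_derivative Re (P' / P t)) (at t)" by simp
 have "((\<lambda>t. 2 * c * of_real (ln (cmod (P t)))) has_vector_derivative 2 * c * of_real (Re (P' / P t))) (at t)"
  using has_vector_derivative_mult_right[OF has_vector_derivative_of_real[OF L]] .
 from field_vector_diff_chain_at[OF this, of exp "exp (2 * c * of_real (ln (cmod (P t))))"]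
 have E: "((\<lambda>t. exp (2 * c * of_real (ln (cmod (P t))))) has_vector_derivative 2 * c * of_real (Re (P' / P t)) * exp (2 * c * of_real (ln (cmod (P t))))) (at t)"
  by (simp add: o_def DERIV_exp)
 have eq: "abs_powr y (2 * c) = exp (2 * c * of_real (ln (cmod y)))" if "y \<noteq> 0" for y
  using that by (simp add: abs_powr_def powr_def Ln_of_real)
 have "continuous (at t) P" using P has_vector_derivative_continuous by blast
 then have "\<forall>\<^sub>F s in at t. P s \<noteq> 0"
  using nz by (metis continuous_within tendsto_imp_eventually_ne)
 then have "\<forall>\<^sub>F s in at t. abs_powr (P s) (2 * c) = exp (2 * c * of_real (ln (cmod (P s))))"
  by eventually_elim (rule eq)
 then show ?thesis
  using E eq[OF nz] unfolding has_vector_derivative_def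
  by (intro has_derivative_transform_eventually[OF E[unfolded has_vector_derivative_def], THEN has_derivative_eq_rhs])
   (auto simp: mult_ac elim: eventually_mono)
qed

lemma has_vector_derivative_prod_log:
 fixes f :: "'i \<Rightarrow> real \<Rightarrow> complex"
 assumes "finite I" "\<And>i. i \<in> I \<Longrightarrow> (f i has_vector_derivative f i t * q i) (at t within S)"
 shows "((\<lambda>t. \<Prod>i\<in>I. f i t) has_vector_derivative (\<Prod>i\<in>I. f i t) * (\<Sum>i\<in>I. q i)) (at t within S)"
 using assms
proof (induction I rule: finite_induct)
 case (insert i I)
 have "((\<lambda>t. f i t * (\<Prod>i\<in>I. f i t)) has_vector_derivative
   f i t * ((\<Prod>i\<in>I. f i t) * (\<Sum>i\<in>I. q i)) + f i t * q i * (\<Prod>i\<in>I. f i t)) (at t within S)"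
  using insert by (intro has_vector_derivative_mult) auto
 then show ?case using insert by (simp add: algebra_simps)
qed simp

text \<open>The point \<open>z\<close> moves in every dilation, so each choice of \<open>M\<close>
  gives a formula for the same Euler derivative.\<close>

definition moved :: "nat \<Rightarrow> nat set \<Rightarrow> nat set" where
 "moved n M = insert n M"

definition dil :: "nat \<Rightarrow> nat set \<Rightarrow> complex \<Rightarrow> conf \<Rightarrow> nat \<Rightarrow> complex" where
 "dil n M c x = (\<lambda>j\<in>{..<n}. if j \<in> M then c * x j else x j)"

text \<open>The derivative of log (p_u - p_v) along the dilation. For distinct points it is 1 if
  both move, an edge if one moves, and 0 otherwise.\<close>

definition mfr :: "nat \<Rightarrow> nat set \<Rightarrow> complex \<Rightarrow> conf \<Rightarrow> nat \<Rightarrow> nat \<Rightarrow> complex" where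
 "mfr n M z x u v = ((if u \<in> moved n M then pt n z x u else 0) - (if v \<in> moved n M then pt n z x v else 0)) / (pt n z x u - pt n z x v)"

text \<open>The Jacobian of the dilation contributes \<open>2 * Re \<omega>\<close> for each moved
  variable, which turns 2 (a_j - 1) into 2 a_j.\<close>

definition qlog :: "nat \<Rightarrow> nat set \<Rightarrow> conf \<Rightarrow> pairing \<Rightarrow> complex \<Rightarrow> complex \<Rightarrow> conf \<Rightarrow> complex" where
 "qlog n M a e \<omega> z x = (\<Sum>j\<in>M. 2 * a j * of_real (Re \<omega>)) + (\<Sum>(u, v)\<in>prs n. 2 * e u v * of_real (Re (\<omega> * mfr n M z x u v)))"

lemma pt_dil: "M \<subseteq> {..<n} \<Longrightarrow> pt n (c * z) (dil n M c x) u = (if u \<in> moved n M then c * pt n z x u else pt n z x u)"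
 by (auto simp: pt_def dil_def moved_def)

lemma dil_measurable: "dil n M c \<in> measurable (config n) (config n)"
 unfolding dil_def[abs_def] by measurable

lemma distr_config_dil:
 assumes c: "c \<noteq> 0" and M: "M \<subseteq> {..<n}"
 shows "distr (density (config n) (\<lambda>_. ennreal ((cmod c) ^ (2 * card M)))) (config n) (dil n M c) = config n"
proof -
 have fin: "finite M" using M finite_subset by blast
 have p: "(\<Prod>j<n. if j \<in> M then ennreal ((cmod c)\<^sup>2) else 1) = ennreal ((cmod c) ^ (2 * card M))"
 proof -
  have "(\<Prod>j<n. if j \<in> M then ennreal ((cmod c)\<^sup>2) else 1) = (\<Prod>j\<in>M. ennreal ((cmod c)\<^sup>2))"
   using M by (simp add: prod.If_cases Int_absorb1)
  then show ?thesis by (simp add: ennreal_power power_mult)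
 qed
 have "distr (density (config n) (\<lambda>x. \<Prod>j<n. (if j \<in> M then ennreal ((cmod c)\<^sup>2) else 1))) (config n) (\<lambda>x. \<lambda>j\<in>{..<n}. (if j \<in> M then (*) c else (\<lambda>y. y)) (x j)) = config n"
 proof (rule distr_density_PiM[where J="\<lambda>j _. if j \<in> M then ennreal ((cmod c)\<^sup>2) else 1"])
  show "distr (density lborel (\<lambda>_. if j \<in> M then ennreal ((cmod c)\<^sup>2) else 1)) lborel (if j \<in> M then (*) c else (\<lambda>y. y)) = lborel" for j
   using distr_lborel_mult_complex[OF c] by (auto simp: density_1 distr_id)
 qed (auto intro: sigma_finite_lborel)
 moreover have "(\<lambda>x. \<lambda>j\<in>{..<n}. (if j \<in> M then (*) c else (\<lambda>y. y)) (x j)) = dil n M c"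
  by (auto simp: dil_def fun_eq_iff)
 ultimately show ?thesis unfolding p by simp
qed

lemma integral_dil:
 assumes c: "c \<noteq> 0" and M: "M \<subseteq> {..<n}" and f: "f \<in> borel_measurable (config n)"
 shows "(\<integral>x. f x \<partial>config n) = (\<integral>x. of_real ((cmod c) ^ (2 * card M)) * (f (dil n M c x) :: complex) \<partial>config n)"
proof -
 have "(\<integral>x. f x \<partial>config n) = (\<integral>x. f x \<partial>distr (density (config n) (\<lambda>_. ennreal ((cmod c) ^ (2 * card M)))) (config n) (dil n M c))"
  unfolding distr_config_dil[OF c M] ..
 also have "\<dots> = (\<integral>x. f (dil n M c x) \<partial>density (config n) (\<lambda>_. ennreal ((cmod c) ^ (2 * card M))))"
  by (rule integral_distr) (use dil_measurable f in auto)
 also have "\<dots> = (\<integral>x. (cmod c) ^ (2 * card M) *\<^sub>R f (dil n M c x) \<partial>config n)"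
  by (rule integral_density) (use measurable_compose[OF dil_measurable f] in auto)
 finally show ?thesis by (simp add: scaleR_conv_of_real)
qed

lemma ins_dil:
 assumes c: "c \<noteq> 0" and M: "M \<subseteq> {..<n}" and l: "\<And>u v. (u, v) \<in> set l \<Longrightarrow> u \<in> moved n M \<longleftrightarrow> v \<in> moved n M"
 shows "ins n l (c * z) (dil n M c x) = ins n l z x"
 using l
proof (induction l)
 case (Cons p l)
 obtain u v where p: "p = (u, v)" by (cases p)
 have "u \<in> moved n M \<longleftrightarrow> v \<in> moved n M" using Cons.prems p by simp
 then have "edge n (c * z) (dil n M c x) u v = edge n z x u v"
  using c unfolding edge_def pt_dil[OF M] by (auto simp flip: right_diff_distrib)
 then show ?case using Cons p by (simp add: ins_Cons)
qed simp

lemma psi_measurable':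
 assumes [measurable]: "Z \<in> borel_measurable N" "\<And>j. j < n \<Longrightarrow> (\<lambda>m. X m j) \<in> borel_measurable N"
 shows "(\<lambda>m. psi n a e (Z m) (X m)) \<in> borel_measurable N" (is ?c1)
  and "(\<lambda>m. pt n (Z m) (X m) u) \<in> borel_measurable N"
proof -
 show p: "(\<lambda>m. pt n (Z m) (X m) u) \<in> borel_measurable N" for u
  by (cases "u < n") (auto simp: pt_def intro: assms)
 show ?c1
  unfolding psi_def split_beta
  by (intro borel_measurable_times borel_measurable_prod abs_powr_measurable borel_measurable_diff p) (auto intro: assms)
qed

lemma qlog_measurable':
 assumes [measurable]: "Z \<in> borel_measurable N" "\<And>j. j < n \<Longrightarrow> (\<lambda>m. X m j) \<in> borel_measurable N"
 shows "(\<lambda>m. qlog n M a e \<omega> (Z m) (X m)) \<in> borel_measurable N"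
proof -
 have p[measurable]: "(\<lambda>m. pt n (Z m) (X m) u) \<in> borel_measurable N" for u
  by (rule psi_measurable'(2)) (auto intro: assms)
 have "(\<lambda>m. mfr n M (Z m) (X m) u v) \<in> borel_measurable N" for u v
  unfolding mfr_def by (cases "u \<in> moved n M"; cases "v \<in> moved n M") (simp_all, measurable)
 then show ?thesis unfolding qlog_def split_beta
  by (intro borel_measurable_add borel_measurable_sum borel_measurable_times) (auto intro: measurable_compose[OF _ borel_measurable_Re] measurable_compose[OF _ borel_measurable_of_real])
qed

lemma generic_dil_ne:
 assumes g: "generic n z x" and uv: "(u, v) \<in> prs n" and M: "M \<subseteq> {..<n}" and z: "z \<noteq> 0"
  and \<omega>: "\<omega> = 1 \<or> \<omega> = \<i>" and c: "c = exp (\<omega> * of_real t)"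
 shows "pt n (c * z) (dil n M c x) u \<noteq> pt n (c * z) (dil n M c x) v"
proof -
 define p q where "p = pt n z x u" and "q = pt n z x v"
 have g': "Im (q * cnj p) \<noteq> 0" "cmod p \<noteq> cmod q" using g uv by (auto simp: generic_def p_def q_def)
 have pq: "p \<noteq> q" using g' by auto
 have c0: "c \<noteq> 0" by (simp add: c)
 have "c * p \<noteq> q \<and> p \<noteq> c * q"
  using \<omega>
 proof
  assume "\<omega> = 1"
  then have cr: "c = of_real (exp t)" by (simp add: c exp_of_real)
  have "Im (of_real r * p * cnj p) = 0" "Im (q * cnj (of_real r * q)) = 0" for r
   by (simp_all add: mult.assoc complex_mult_cnj algebra_simps flip: of_real_power of_real_add of_real_mult)
  then show ?thesis using g'(1) unfolding cr by metis
 next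
  assume "\<omega> = \<i>"
  then have "cmod c = 1" by (simp add: c norm_exp_eq_Re)
  then show ?thesis using g'(2) by (metis mult_1 norm_mult)
 qed
 then show ?thesis using pq c0 unfolding pt_dil[OF M] p_def[symmetric] q_def[symmetric] by auto
qed

lemma psi_dil_derivative:
 fixes a :: conf and e :: pairing
 assumes g: "generic n z x" and M: "M \<subseteq> {..<n}" and z: "z \<noteq> 0" and \<omega>: "\<omega> = 1 \<or> \<omega> = \<i>"
 defines "c \<equiv> \<lambda>t. exp (\<omega> * of_real t)"
 defines "K \<equiv> \<lambda>t. of_real ((cmod (c t)) ^ (2 * card M)) * psi n a e (c t * z) (dil n M (c t) x)"
 shows "(K has_vector_derivative K t * qlog n M a e \<omega> (c t * z) (dil n M (c t) x)) (at t within S)" (is ?c1)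
  and "continuous_on S (\<lambda>t. qlog n M a e \<omega> (c t * z) (dil n M (c t) x))" (is ?c2)
proof -
 have fin: "finite M" using M finite_subset by blast
 have c0: "c t \<noteq> 0" for t by (simp add: c_def)
 have cd: "(c has_vector_derivative \<omega> * c t) (at t within S)" for t S
  unfolding c_def by (rule has_vector_derivative_real_field derivative_eq_intros refl | simp)+
 define P where "P u t = pt n (c t * z) (dil n M (c t) x) u" for u t
 let ?d = "\<lambda>u t. \<omega> * (if u \<in> moved n M then P u t else 0)"
 have Pd: "(P u has_vector_derivative ?d u t) (at t within S)" for u t S
 proof (cases "u \<in> moved n M")
  case True
  then have "P u = (\<lambda>t. c t * pt n z x u)" by (simp add: P_def pt_dil[OF M] fun_eq_iff)
  then show ?thesis using True has_vector_derivative_mult_left[OF cd, of "pt n z x u"] by (simp add: mult.assoc)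
 next
  case False
  then have "P u = (\<lambda>t. pt n z x u)" by (simp add: P_def pt_dil[OF M] fun_eq_iff)
  then show ?thesis using False by simp
 qed
 have Pne: "P u t - P v t \<noteq> 0" if "(u, v) \<in> prs n" for u v t
  using generic_dil_ne[OF g that M z \<omega> refl, of t] by (simp add: P_def c_def)
 have Pj: "P j t \<noteq> 0" if "j < n" for j t
 proof -
  have "x j \<noteq> 0" using g that by (simp add: generic_def)
  then show ?thesis using that c0[of t] by (simp add: P_def pt_dil[OF M]) (simp add: pt_def)
 qed
 have dj: "P j t = dil n M (c t) x j" if "j < n" for j t using that by (simp add: P_def pt_def)
 have mf: "\<omega> * mfr n M (c t * z) (dil n M (c t) x) u v =
   (?d u t - ?d v t) / (P u t - P v t)" for u v t
  by (simp add: mfr_def P_def right_diff_distrib)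
 let ?A = "\<lambda>j t. abs_powr (P j t) (2 * (a j - 1))"
 let ?E = "\<lambda>p t. abs_powr (P (fst p) t - P (snd p) t) (2 * e (fst p) (snd p))"
 let ?C = "\<lambda>t. abs_powr (c t) (2 * of_nat (card M))"
 let ?AE = "\<lambda>t. (\<Prod>j<n. ?A j t) * (\<Prod>p\<in>prs n. ?E p t)"
 let ?a = "\<lambda>j t. 2 * (a j - 1) * of_real (Re (?d j t / P j t))"
 let ?e = "\<lambda>p t. 2 * e (fst p) (snd p) * of_real (Re ((?d (fst p) t - ?d (snd p) t) / (P (fst p) t - P (snd p) t)))"
 let ?ae = "\<lambda>t. (\<Sum>j<n. ?a j t) + (\<Sum>p\<in>prs n. ?e p t)"
 have K: "K = (\<lambda>t. ?C t * (?AE t))"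
 proof
  fix t
  have "?C t = of_real ((cmod (c t)) ^ (2 * card M))"
  proof -
   have "abs_powr (c t) (of_nat (2 * card M)) = of_real (cmod (c t)) ^ (2 * card M)"
    unfolding abs_powr_def using c0[of t] by (subst powr_nat') auto
   then show ?thesis by simp
  qed
  then show "K t = ?C t * (?AE t)"
  proof -
   have "(\<Prod>j<n. abs_powr (dil n M (c t) x j) (2 * (a j - 1))) = (\<Prod>j<n. ?A j t)"
    by (rule prod.cong) (simp_all only: dj lessThan_iff)
   then show ?thesis using \<open>?C t = _\<close> unfolding K_def psi_def by (simp only: P_def case_prod_unfold)
  qed
 qed
 have q: "qlog n M a e \<omega> (c t * z) (dil n M (c t) x) = 2 * of_nat (card M) * of_real (Re \<omega>) +
   (?ae t)" for t
 proof -
  have "(\<Sum>j<n. ?a j t) = (\<Sum>j<n. if j \<in> M then 2 * (a j - 1) * of_real (Re \<omega>) else 0)"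
   by (rule sum.cong) (auto simp: moved_def Pj)
  also have "\<dots> = (\<Sum>j\<in>M. 2 * (a j - 1) * of_real (Re \<omega>))"
   using M by (simp add: sum.If_cases Int_absorb1)
  also have "\<dots> = (\<Sum>j\<in>M. 2 * a j * of_real (Re \<omega>)) - 2 * of_nat (card M) * of_real (Re \<omega>)"
   by (simp add: algebra_simps sum_subtractf)
  finally show ?thesis unfolding qlog_def by (simp add: mf split_beta)
 qed
 have "(K has_vector_derivative K t * (2 * of_nat (card M) * of_real (Re (\<omega> * c t / c t)) +
   (?ae t))) (at t)" (is ?D)
 proof -
  have m2: "((\<lambda>t. f t * g t) has_vector_derivative (f t * g t) * (p + r)) (at t)"
   if "(f has_vector_derivative f t * p) (at t)" "(g has_vector_derivative g t * r) (at t)" for f g :: "real \<Rightarrow> complex" and p r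
   using has_vector_derivative_mult[OF that] by (simp add: algebra_simps)
  have d1: "((\<lambda>t. ?C t) has_vector_derivative ?C t * (2 * of_nat (card M) * of_real (Re (\<omega> * c t / c t)))) (at t)"
   by (rule abs_powr_has_vector_derivative[OF cd c0])
  have d2: "((\<lambda>t. \<Prod>j<n. ?A j t) has_vector_derivative
    (\<Prod>j<n. ?A j t) * (\<Sum>j<n. ?a j t)) (at t)"
  proof (rule has_vector_derivative_prod_log)
   fix j assume "j \<in> {..<n}"
   then have "P j t \<noteq> 0" using Pj by blast
   from abs_powr_has_vector_derivative[where c="a j - 1", OF Pd this]
   show "((\<lambda>t. ?A j t) has_vector_derivative ?A j t * (?a j t)) (at t)" .
  qed simp
  have d3: "((\<lambda>t. \<Prod>p\<in>prs n. ?E p t) has_vector_derivative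
    (\<Prod>p\<in>prs n. ?E p t) *
    (\<Sum>p\<in>prs n. ?e p t)) (at t)"
  proof (rule has_vector_derivative_prod_log)
   fix p assume "p \<in> prs n"
   then have "P (fst p) t - P (snd p) t \<noteq> 0" using Pne[of "fst p" "snd p"] by simp
   from abs_powr_has_vector_derivative[where c="e (fst p) (snd p)", OF has_vector_derivative_diff[OF Pd Pd] this]
   show "((\<lambda>t. ?E p t) has_vector_derivative ?E p t *
    (?e p t)) (at t)" .
  qed simp
  show ?thesis unfolding K by (rule m2[OF d1 m2[OF d2 d3]])
 qed
 note D = this
 show ?c1
 proof -
  have cc: "\<omega> * c t / c t = \<omega>" using c0[of t] by simp
  show ?thesis unfolding q using D unfolding cc by (rule has_vector_derivative_at_within)
 qed
 have Pc: "continuous_on S (P u)" for u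
  by (rule continuous_on_vector_derivative, rule Pd)
 show ?c2
 proof -
  have 1: "continuous_on S (\<lambda>t. if u \<in> moved n M then P u t else 0)" for u
   using Pc by (cases "u \<in> moved n M") auto
  show ?thesis
   unfolding qlog_def mf split_beta
   by (intro continuous_on_add continuous_on_sum continuous_on_mult continuous_on_const continuous_on_of_real
     continuous_on_Re continuous_on_divide continuous_on_diff Pc 1) (use Pne in auto)
 qed
qed

section \<open>Integration by parts along dilations\<close>

definition FI :: "nat \<Rightarrow> conf \<Rightarrow> pairing \<Rightarrow> graph \<Rightarrow> graph \<Rightarrow> complex \<Rightarrow> complex" where
 "FI n a e l l' z = (\<integral>x. psx n a e l l' z x \<partial>config n)"

lemma FI_derivative:
 assumes "z \<notin> {0, 1}" "integrable (config n) (psx n a e l l' z)" "verts l \<subseteq> {..n + 1}" "verts l' \<subseteq> {..n + 1}"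
 obtains p q where "(FI n a e l l' has_derivative (\<lambda>h. p * h + q * cnj h)) (at z)"
proof -
 from regular_integral[OF assms] obtain r G where G: "r > 0" "biholo G (ball 0 r) (ball 0 r)"
  "\<And>w. w \<in> ball 0 r \<Longrightarrow> FI n a e l l' (z + w) = G w (cnj w)" unfolding FI_def by metis
 show ?thesis using that polarized_derivative[OF G(2,3), of 0] G(1) by simp
qed

lemma FI_local_bound:
 assumes "z \<notin> {0, 1}" "integrable (config n) (psx n a e l l' z)" "verts l \<subseteq> {..n + 1}" "verts l' \<subseteq> {..n + 1}"
 shows "\<exists>K. \<forall>\<^sub>F y in nhds z. (\<integral>x. cmod (psx n a e l l' y x) \<partial>config n) \<le> K"
proof -
 from regular_integral[OF assms] obtain r K where K: "r > 0"
  "\<And>w. w \<in> ball 0 r \<Longrightarrow> (\<integral>x. cmod (psx n a e l l' (z + w) x) \<partial>config n) \<le> K" by metis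
 have "(\<integral>x. cmod (psx n a e l l' y x) \<partial>config n) \<le> K" if "dist y z < r" for y
  using K(2)[of "y - z"] that by (simp add: dist_norm norm_minus_commute)
 then show ?thesis unfolding eventually_nhds_metric using K(1) by blast
qed

definition pair_moved :: "nat \<Rightarrow> nat set \<Rightarrow> nat \<Rightarrow> nat \<Rightarrow> bool" where
 "pair_moved n M u v \<longleftrightarrow> u \<in> moved n M \<or> v \<in> moved n M"

definition mlist :: "nat \<Rightarrow> nat set \<Rightarrow> nat \<Rightarrow> nat \<Rightarrow> graph" where
 "mlist n M u v = (if u \<in> moved n M then if v \<in> moved n M then [] else [(u, v)] else [(v, u)])"

text \<open>Where p_u = p_v the fraction is 0 by division by zero while the empty product on the
  right is 1; the factor \<open>psi\<close> vanishes there and settles the case.\<close>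

lemma psi_mfr:
 assumes "(u, v) \<in> prs n"
 shows "psi n a e z x * mfr n M z x u v = (if pair_moved n M u v then psi n a e z x * ins n (mlist n M u v) z x else 0)"
proof (cases "pt n z x u = pt n z x v")
 case True
 then have "psi n a e z x = 0" using assms psi_eq_0 by blast
 then show ?thesis by simp
next
 case False
 then show ?thesis
  by (auto simp: mfr_def mlist_def pair_moved_def ins_Cons edge_def field_simps minus_divide_left divide_eq_eq)
qed

lemma psx_mfr:
 assumes "(u, v) \<in> prs n"
 shows "psx n a e l [] z x * mfr n M z x u v = (if pair_moved n M u v then psx n a e (mlist n M u v @ l) [] z x else 0)" (is ?A)
  and "psx n a e l [] z x * cnj (mfr n M z x u v) = (if pair_moved n M u v then psx n a e l (mlist n M u v) z x else 0)" (is ?B)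
proof -
 have ap: "ins n (k @ l) z x = ins n k z x * ins n l z x" for k l by (simp add: ins_def)
 show ?A using psi_mfr[OF assms, of a e z x M] by (auto simp: psx_def ap mult_ac split: if_splits)
 show ?B
 proof (cases "psi n a e z x = 0")
  case True then show ?thesis by (simp add: psx_def)
 next
  case False
  then have "mfr n M z x u v = (if pair_moved n M u v then ins n (mlist n M u v) z x else 0)"
   using psi_mfr[OF assms, of a e z x M] by (auto split: if_splits)
  then show ?thesis by (simp add: psx_def)
 qed
qed

text \<open>Writing 2 Re w as w + cnj w splits each pair into an edge with weight \<omega> and a
  conjugated edge with weight \<open>cnj \<omega>\<close>. The values 1 and \<i> of \<omega> will
  separate the two.\<close>

lemma psx_qlog:
 "psx n a e l [] z x * qlog n M a e \<omega> z x = 2 * (\<Sum>j\<in>M. a j) * of_real (Re \<omega>) * psx n a e l [] z x +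
   (\<Sum>(u, v)\<in>prs n. if pair_moved n M u v then e u v * (\<omega> * psx n a e (mlist n M u v @ l) [] z x + cnj \<omega> * psx n a e l (mlist n M u v) z x) else 0)"
proof -
 have "psx n a e l [] z x * (\<Sum>p\<in>prs n. 2 * e (fst p) (snd p) * of_real (Re (\<omega> * mfr n M z x (fst p) (snd p)))) =
  (\<Sum>p\<in>prs n. if pair_moved n M (fst p) (snd p) then e (fst p) (snd p) * (\<omega> * psx n a e (mlist n M (fst p) (snd p) @ l) [] z x + cnj \<omega> * psx n a e l (mlist n M (fst p) (snd p)) z x) else 0)"
  unfolding sum_distrib_left
 proof (rule sum.cong[OF refl])
  fix p assume "p \<in> prs n"
  then have p: "(fst p, snd p) \<in> prs n" by simp
  have r: "2 * complex_of_real (Re w) = w + cnj w" for w by (simp add: complex_add_cnj)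
  have "psx n a e l [] z x * (2 * e (fst p) (snd p) * of_real (Re (\<omega> * mfr n M z x (fst p) (snd p))))
   = psx n a e l [] z x * (e (fst p) (snd p) * (2 * of_real (Re (\<omega> * mfr n M z x (fst p) (snd p)))))" by (simp only: mult_ac)
  also have "\<dots> = e (fst p) (snd p) * (\<omega> * (psx n a e l [] z x * mfr n M z x (fst p) (snd p)) + cnj \<omega> * (psx n a e l [] z x * cnj (mfr n M z x (fst p) (snd p))))"
   unfolding r by (simp add: algebra_simps)
  finally show "psx n a e l [] z x * (2 * e (fst p) (snd p) * of_real (Re (\<omega> * mfr n M z x (fst p) (snd p)))) =
   (if pair_moved n M (fst p) (snd p) then e (fst p) (snd p) * (\<omega> * psx n a e (mlist n M (fst p) (snd p) @ l) [] z x + cnj \<omega> * psx n a e l (mlist n M (fst p) (snd p)) z x) else 0)"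
   unfolding psx_mfr[OF p] by (cases "pair_moved n M (fst p) (snd p)") (simp_all only: if_True if_False mult_zero_right add_0_left)
 qed
 then show ?thesis unfolding qlog_def split_beta by (simp add: distrib_left sum_distrib_left sum_distrib_right mult_ac)
qed

lemma integrable_dil:
 fixes f :: "conf \<Rightarrow> complex"
 assumes c: "c \<noteq> 0" and M: "M \<subseteq> {..<n}" and f: "integrable (config n) f"
 shows "integrable (config n) (\<lambda>x. of_real ((cmod c) ^ (2 * card M)) * f (dil n M c x))"
proof -
 have "integrable (distr (density (config n) (\<lambda>_. ennreal ((cmod c) ^ (2 * card M)))) (config n) (dil n M c)) f"
  unfolding distr_config_dil[OF c M] by (rule f)
 then have "integrable (density (config n) (\<lambda>_. ennreal ((cmod c) ^ (2 * card M)))) (\<lambda>x. f (dil n M c x))"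
  by (subst (asm) integrable_distr_eq) (use dil_measurable f in auto)
 then have "integrable (config n) (\<lambda>x. (cmod c) ^ (2 * card M) *\<^sub>R f (dil n M c x))"
  by (subst (asm) integrable_density) (use measurable_compose[OF dil_measurable borel_measurable_integrable[OF f]] in auto)
 then show ?thesis by (simp add: scaleR_conv_of_real)
qed

text \<open>Moving edges from one list to the other changes the integrand by a phase only.\<close>

lemma psx_swap_integrable:
 assumes "integrable (config n) (psx n a e (k @ l) [] z)"
 shows "integrable (config n) (psx n a e l k z)" (is ?c1)
  "(\<integral>x. cmod (psx n a e l k z x) \<partial>config n) = (\<integral>x. cmod (psx n a e (k @ l) [] z x) \<partial>config n)" (is ?c2)
proof -
 have n: "cmod (psx n a e l k z x) = cmod (psx n a e (k @ l) [] z x)" for x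
  by (simp add: psx_def ins_def norm_mult mult_ac)
 show ?c1
  by (rule Bochner_Integration.integrable_bound[OF assms]) (simp_all add: n)
 show ?c2
  by (simp add: n)
qed

lemma eventually_ex_sum_bound:
 fixes g :: "'i \<Rightarrow> 'a \<Rightarrow> real"
 assumes "finite S" "\<And>p. p \<in> S \<Longrightarrow> \<exists>K. \<forall>\<^sub>F y in F. g p y \<le> K"
 shows "\<exists>K. \<forall>\<^sub>F y in F. (\<Sum>p\<in>S. g p y) \<le> K"
 using assms
proof (induction S rule: finite_induct)
 case (insert p S)
 from insert.prems[of p] obtain K where K: "\<forall>\<^sub>F y in F. g p y \<le> K" by auto
 from insert obtain L where "\<forall>\<^sub>F y in F. (\<Sum>p\<in>S. g p y) \<le> L" by auto
 with K have "\<forall>\<^sub>F y in F. g p y + (\<Sum>p\<in>S. g p y) \<le> K + L" by eventually_elim linarith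
 then show ?case using insert by auto
qed (auto intro: exI[of _ 0])

text \<open>No edge of \<open>l\<close> may join a moved point to a fixed one, because the inserted
  product has to be invariant under the dilation. Edges that the derivative creates must be
  integrable unless their exponent removes them.\<close>

locale ibp =
 fixes n :: nat and a :: conf and e :: pairing and l :: graph and M :: "nat set"
 assumes M: "M \<subseteq> {..<n}" and vl: "verts l \<subseteq> {..n + 1}"
  and lM: "\<And>u v. (u, v) \<in> set l \<Longrightarrow> u \<in> moved n M \<longleftrightarrow> v \<in> moved n M"
  and i0: "\<And>z. z \<notin> {0, 1} \<Longrightarrow> integrable (config n) (psx n a e l [] z)"
  and i1: "\<And>z u v. z \<notin> {0, 1} \<Longrightarrow> (u, v) \<in> prs n \<Longrightarrow> pair_moved n M u v \<Longrightarrow> e u v \<noteq> 0 \<Longrightarrow>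
        integrable (config n) (psx n a e (mlist n M u v @ l) [] z)"
begin

definition prm where "prm = {(u, v). (u, v) \<in> prs n \<and> pair_moved n M u v \<and> e u v \<noteq> 0}"

lemma finite_prm [simp]: "finite prm"
 by (rule finite_subset[OF _ finite_prs[of n]]) (auto simp: prm_def)

lemma vm: "(u, v) \<in> prm \<Longrightarrow> verts (mlist n M u v) \<subseteq> {..n + 1} \<and> verts (mlist n M u v @ l) \<subseteq> {..n + 1}"
 using vl by (auto simp: prm_def mlist_def prs_def verts_def)

lemma iprm:
 assumes "z \<notin> {0, 1}" "(u, v) \<in> prm"
 shows "integrable (config n) (psx n a e (mlist n M u v @ l) [] z)" "integrable (config n) (psx n a e l (mlist n M u v) z)" (is ?c1)
proof -
 show 1: "integrable (config n) (psx n a e (mlist n M u v @ l) [] z)" using assms i1 by (auto simp: prm_def)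
 show ?c1 by (rule psx_swap_integrable(1)[OF 1])
qed

definition qd where "qd \<omega> z x = psx n a e l [] z x * qlog n M a e \<omega> z x"

lemma qd_eq: "qd \<omega> z x = 2 * (\<Sum>j\<in>M. a j) * of_real (Re \<omega>) * psx n a e l [] z x +
   (\<Sum>(u, v)\<in>prm. e u v * (\<omega> * psx n a e (mlist n M u v @ l) [] z x + cnj \<omega> * psx n a e l (mlist n M u v) z x))"
proof -
 have "(\<Sum>(u, v)\<in>prs n. if pair_moved n M u v then e u v * (\<omega> * psx n a e (mlist n M u v @ l) [] z x + cnj \<omega> * psx n a e l (mlist n M u v) z x) else 0)
  = (\<Sum>(u, v)\<in>prm. e u v * (\<omega> * psx n a e (mlist n M u v @ l) [] z x + cnj \<omega> * psx n a e l (mlist n M u v) z x))"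
  by (rule sum.mono_neutral_cong_right) (auto simp: prm_def split: if_splits)
 then show ?thesis unfolding qd_def psx_qlog by simp
qed

lemma integrable_qd: "z \<notin> {0, 1} \<Longrightarrow> integrable (config n) (qd \<omega> z)"
 unfolding qd_eq[abs_def] split_beta
 by (intro integrable_add' Bochner_Integration.integrable_sum integrable_mult_right i0 iprm) auto

definition QI where "QI \<omega> z = 2 * (\<Sum>j\<in>M. a j) * of_real (Re \<omega>) * FI n a e l [] z +
   (\<Sum>(u, v)\<in>prm. e u v * (\<omega> * FI n a e (mlist n M u v @ l) [] z + cnj \<omega> * FI n a e l (mlist n M u v) z))"

lemma integral_qd:
 assumes z: "z \<notin> {0, 1}"
 shows "(\<integral>x. qd \<omega> z x \<partial>config n) = QI \<omega> z"
 unfolding qd_eq[abs_def] split_beta QI_def FI_def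
 by (intro has_bochner_integral_integral_eq has_bochner_integral_add has_bochner_integral_sum has_bochner_integral_mult_right
   has_bochner_integral_integrable i0[OF z] iprm[OF z]) simp_all

lemma continuous_QI: "z \<notin> {0, 1} \<Longrightarrow> isCont (QI \<omega>) z"
proof -
 assume z: "z \<notin> {0, 1}"
 have c: "isCont (FI n a e l1 l2) z" if "integrable (config n) (psx n a e l1 l2 z)" "verts l1 \<subseteq> {..n + 1}" "verts l2 \<subseteq> {..n + 1}" for l1 l2
  using FI_derivative[OF z that] has_derivative_continuous by metis
 show ?thesis
  unfolding QI_def[abs_def] split_beta
  by (intro continuous_intros c i0[OF z] iprm[OF z]) (use vl vm in \<open>auto\<close>)
qed

lemma qd_bound: "z \<notin> {0, 1} \<Longrightarrow> \<exists>K. \<forall>\<^sub>F y in nhds z. (\<integral>x. cmod (qd \<omega> y x) \<partial>config n) \<le> K"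
proof -
 assume z: "z \<notin> {0, 1}"
 let ?C = "cmod (2 * (\<Sum>j\<in>M. a j) * of_real (Re \<omega>))" and ?e = "\<lambda>p. cmod (e (fst p) (snd p))"
 let ?f = "\<lambda>y x. cmod (psx n a e l [] y x)"
 let ?g = "\<lambda>p y x. cmod \<omega> * cmod (psx n a e (mlist n M (fst p) (snd p) @ l) [] y x) +
  cmod \<omega> * cmod (psx n a e l (mlist n M (fst p) (snd p)) y x)"
 let ?h = "\<lambda>y x. ?C * ?f y x + (\<Sum>p\<in>prm. ?e p * ?g p y x)"
 have ev: "\<forall>\<^sub>F y in nhds z. y \<notin> {0, 1}"
  using eventually_nhds_in_open[of "- {0, 1}" z] z by (simp add: open_Compl del: insert_iff)
 define B where "B p y = (\<integral>x. cmod (psx n a e (mlist n M (fst p) (snd p) @ l) [] y x) \<partial>config n)" for p y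
 obtain K0 where K0: "\<forall>\<^sub>F y in nhds z. (\<integral>x. ?f y x \<partial>config n) \<le> K0"
  using FI_local_bound[OF z i0[OF z] vl] by auto
 have bd: "\<exists>K. \<forall>\<^sub>F y in nhds z. ?e p * (2 * cmod \<omega> * B p y) \<le> K" if "p \<in> prm" for p
 proof -
  have p: "(fst p, snd p) \<in> prm" using that by simp
  obtain K where "\<forall>\<^sub>F y in nhds z. B p y \<le> K" unfolding B_def using FI_local_bound[OF z iprm(1)[OF z p]] vm[OF p] by auto
  then have "\<forall>\<^sub>F y in nhds z. ?e p * (2 * cmod \<omega> * B p y) \<le> ?e p * (2 * cmod \<omega> * K)"
   by eventually_elim (intro mult_left_mono; simp)
  then show ?thesis by blast
 qed
 from eventually_ex_sum_bound[where g="\<lambda>p y. ?e p * (2 * cmod \<omega> * B p y)", OF finite_prm bd] obtain K1 where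
  K1: "\<forall>\<^sub>F y in nhds z. (\<Sum>p\<in>prm. ?e p * (2 * cmod \<omega> * B p y)) \<le> K1" by blast
 have "\<forall>\<^sub>F y in nhds z. (\<integral>x. cmod (qd \<omega> y x) \<partial>config n) \<le> ?C * K0 + K1"
  using ev K0 K1
 proof eventually_elim
  case (elim y)
  have "(\<integral>x. cmod (qd \<omega> y x) \<partial>config n) \<le> (\<integral>x. ?h y x \<partial>config n)"
  proof (rule integral_mono)
   show "integrable (config n) (\<lambda>x. cmod (qd \<omega> y x))" using integrable_qd[OF elim(1)] by simp
   show "integrable (config n) (\<lambda>x. ?h y x)"
    by (intro integrable_add' Bochner_Integration.integrable_sum integrable_mult_right integrable_norm i0 iprm) (use elim in auto)
   show "cmod (qd \<omega> y x) \<le> ?h y x" for x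
    unfolding qd_eq split_beta
    by (intro order_trans[OF norm_triangle_ineq] add_mono sum_norm_le)
      (auto simp: norm_mult intro!: mult_left_mono order_trans[OF norm_triangle_ineq])
  qed
  also have "\<dots> = ?C * (\<integral>x. ?f y x \<partial>config n) +
    (\<Sum>p\<in>prm. ?e p * (2 * cmod \<omega> * B p y))"
  proof -
   have I: "integrable (config n) (\<lambda>x. ?g p y x)"
    and J: "(\<integral>x. ?g p y x \<partial>config n) = 2 * cmod \<omega> * B p y"
    if "p \<in> prm" for p
   proof -
    have p: "(fst p, snd p) \<in> prm" using that by simp
    note i = integrable_norm[OF iprm(1)[OF elim(1) p]] integrable_norm[OF iprm(2)[OF elim(1) p]]
    show "integrable (config n) (\<lambda>x. ?g p y x)"
     using i by simp
    show "(\<integral>x. ?g p y x \<partial>config n) = 2 * cmod \<omega> * B p y"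
     using i psx_swap_integrable(2)[OF iprm(1)[OF elim(1) p]] by (simp add: B_def)
   qed
   show ?thesis
    by (intro has_bochner_integral_integral_eq has_bochner_integral_add has_bochner_integral_sum has_bochner_integral_mult_right has_bochner_integral_integrable integrable_norm i0[OF elim(1)])
     (use I J in \<open>simp add: has_bochner_integral_iff\<close>)
  qed
  also have "\<dots> \<le> ?C * K0 + K1"
   using elim by (intro add_mono mult_left_mono) auto
  finally show ?case .
 qed
 then show ?thesis by blast
qed

lemma psi_ins_dil:
 assumes z: "z \<noteq> 0"
 shows "FI n a e l [] (exp w * z) = (\<integral>x. of_real ((cmod (exp w)) ^ (2 * card M)) * psi n a e (exp w * z) (dil n M (exp w) x) * ins n l z x \<partial>config n)" (is ?c1)
  and "(\<integral>x. qd \<omega> (exp w * z) x \<partial>config n) = (\<integral>x. (of_real ((cmod (exp w)) ^ (2 * card M)) * psi n a e (exp w * z) (dil n M (exp w) x)) * qlog n M a e \<omega> (exp w * z) (dil n M (exp w) x) * ins n l z x \<partial>config n)" (is ?c2)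
proof -
 have i: "ins n l (exp w * z) (dil n M (exp w) x) = ins n l z x" for x
  by (rule ins_dil[OF _ M]) (use lM in auto)
 have [measurable]: "(\<lambda>x. qlog n M a e \<omega> y x) \<in> borel_measurable (config n)" for y
  by (rule qlog_measurable') (auto intro: coord_measurable)
 show ?c1
  unfolding FI_def by (subst integral_dil[where c="exp w", OF exp_not_eq_zero M psx_measurable]) (simp only: psx_def i ins_Nil complex_cnj_one mult_1_right mult.assoc)
 show ?c2
  unfolding qd_def by (subst integral_dil[where c="exp w", OF exp_not_eq_zero M]) (measurable, simp only: psx_def i ins_Nil complex_cnj_one mult_1_right, simp only: mult_ac)
qed

text \<open>For almost every configuration the fundamental theorem of calculus holds along the
  orbit, and Fubini's theorem in time and configuration gives the increment of the integral. Uniform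
  bounds on the norms, at each time separately, suffice for this; the singularities move with t, so
  a pointwise dominating function would be much harder to find.\<close>

lemma FTC_average:
 assumes z: "z \<notin> {0, 1}" and \<omega>: "\<omega> = 1 \<or> \<omega> = \<i>" and T: "0 \<le> T"
  and nz: "\<And>t. t \<in> {0..T} \<Longrightarrow> exp (\<omega> * of_real t) * z \<notin> {0, 1}"
  and K: "\<And>t. t \<in> {0..T} \<Longrightarrow> (\<integral>x. cmod (qd \<omega> (exp (\<omega> * of_real t) * z) x) \<partial>config n) \<le> K"
 shows "FI n a e l [] (exp (\<omega> * of_real T) * z) - FI n a e l [] z
  = (\<integral>t. indicat_real {0..T} t *\<^sub>R QI \<omega> (exp (\<omega> * of_real t) * z) \<partial>lborel)"
proof -
 let ?LM = "lborel \<Otimes>\<^sub>M config n" and ?i = "\<lambda>t. indicat_real {0..T} t"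
 define c where "c t = exp (\<omega> * of_real t)" for t :: real
 define k where "k t x = of_real ((cmod (c t)) ^ (2 * card M)) * psi n a e (c t * z) (dil n M (c t) x)" for t x
 define g where "g t x = k t x * qlog n M a e \<omega> (c t * z) (dil n M (c t) x) * ins n l z x" for t x
 have c0: "c t \<noteq> 0" for t by (simp add: c_def)
 have z0: "z \<noteq> 0" using z by auto
 have gq: "g t x = of_real ((cmod (c t)) ^ (2 * card M)) * qd \<omega> (c t * z) (dil n M (c t) x)" for t x
 proof -
  have "ins n l (c t * z) (dil n M (c t) x) = ins n l z x" by (rule ins_dil[OF c0 M]) (use lM in auto)
  then show ?thesis by (simp add: g_def k_def qd_def psx_def mult_ac)
 qed
 have gi: "integrable (config n) (g t)" if "t \<in> {0..T}" for t
  unfolding gq[abs_def] by (rule integrable_dil[OF c0 M integrable_qd]) (use nz[OF that] in \<open>simp add: c_def\<close>)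
 have qm: "qd \<omega> y \<in> borel_measurable (config n)" for y
 proof -
  have [measurable]: "(\<lambda>x. qlog n M a e \<omega> y x) \<in> borel_measurable (config n)"
   by (rule qlog_measurable') (auto intro: coord_measurable)
  show ?thesis unfolding qd_def[abs_def] by measurable
 qed
 have gn: "(\<integral>x. cmod (g t x) \<partial>config n) \<le> K" if "t \<in> {0..T}" for t
 proof -
  have "complex_of_real (\<integral>x. cmod (qd \<omega> (c t * z) x) \<partial>config n) = (\<integral>x. complex_of_real (cmod (qd \<omega> (c t * z) x)) \<partial>config n)"
   by (rule integral_complex_of_real[symmetric])
  also have "\<dots> = (\<integral>x. complex_of_real (cmod (g t x)) \<partial>config n)"
   by (subst integral_dil[where c="c t", OF c0 M]) (use qm in \<open>simp_all add: gq norm_mult norm_power\<close>)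
  also have "\<dots> = complex_of_real (\<integral>x. cmod (g t x) \<partial>config n)" by (rule integral_complex_of_real)
  finally show ?thesis using K[OF that] by (simp add: c_def)
 qed
 have gm: "(\<lambda>(t, x). g t x) \<in> borel_measurable (?LM)"
 proof -
  have cm[measurable]: "(\<lambda>p. c (fst p)) \<in> borel_measurable (?LM)"
  proof -
   have "c \<in> borel_measurable borel"
    unfolding c_def[abs_def] by (intro borel_measurable_continuous_onI continuous_intros)
   then show ?thesis by measurable
  qed
  have xm: "(\<lambda>p. snd p j) \<in> borel_measurable (?LM)" if "j < n" for j
   using measurable_compose[OF measurable_snd coord_measurable[OF that]] .
  have dm: "(\<lambda>p. dil n M (c (fst p)) (snd p) j) \<in> borel_measurable (?LM)" if "j < n" for j
   using xm[OF that] that by (cases "j \<in> M") (simp_all add: dil_def)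
  have zm: "(\<lambda>p. c (fst p) * z) \<in> borel_measurable (?LM)" by measurable
  have [measurable]: "(\<lambda>p. psi n a e (c (fst p) * z) (dil n M (c (fst p)) (snd p))) \<in> borel_measurable (?LM)"
   "(\<lambda>p. qlog n M a e \<omega> (c (fst p) * z) (dil n M (c (fst p)) (snd p))) \<in> borel_measurable (?LM)"
   by (rule psi_measurable'(1) qlog_measurable'; fact zm dm)+
  show ?thesis unfolding g_def k_def split_beta by measurable
 qed
 interpret P: product_sigma_finite "\<lambda>_ :: nat. lborel :: complex measure"
  by (simp add: product_sigma_finite_def sigma_finite_lborel)
 interpret S: sigma_finite_measure "config n" by (rule P.sigma_finite) simp
 interpret PP: pair_sigma_finite "lborel :: real measure" "config n"
  by (simp add: pair_sigma_finite_def sigma_finite_lborel S.sigma_finite_measure_axioms)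
 define G where "G t x = ?i t *\<^sub>R g t x" for t x
 let ?G = "\<lambda>t x. case (t, x) of (t, x) \<Rightarrow> G t x"
 have Gm: "(\<lambda>(t, x). G t x) \<in> borel_measurable (?LM)"
  using gm unfolding G_def split_beta by measurable
 have GI: "integrable (?LM) (\<lambda>(t, x). G t x)"
 proof (rule PP.Fubini_integrable[OF Gm])
  show "AE t in lborel. integrable (config n) (\<lambda>x. ?G t x)"
   using gi by (intro AE_I2) (auto simp: G_def indicator_def)
  have m: "(\<lambda>t. \<integral>x. norm (?G t x) \<partial>config n) \<in> borel_measurable lborel"
   using Gm by measurable
  show "integrable lborel (\<lambda>t. \<integral>x. norm (?G t x) \<partial>config n)"
  proof (rule Bochner_Integration.integrable_bound[OF _ m])
   show "integrable lborel (\<lambda>t. ?i t * K)" by (intro integrable_mult_left) (use T in \<open>simp add: integrable_indicator_iff\<close>)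
   show "AE t in lborel. norm (\<integral>x. norm (?G t x) \<partial>config n) \<le> norm (?i t * K)"
    using gn by (intro AE_I2) (auto simp: G_def indicator_def intro: order_trans[OF _ abs_ge_self])
  qed
 qed
 let ?d = "\<lambda>x. k T x * ins n l z x - k 0 x * ins n l z x"
 have "(\<integral>x. (\<integral>t. G t x \<partial>lborel) \<partial>config n) = (\<integral>t. (\<integral>x. G t x \<partial>config n) \<partial>lborel)"
  by (rule PP.Fubini_integral[OF GI])
 also have "\<dots> = (\<integral>t. ?i t *\<^sub>R QI \<omega> (c t * z) \<partial>lborel)"
 proof (rule Bochner_Integration.integral_cong[OF refl])
  fix t
  have "(\<integral>x. g t x \<partial>config n) = QI \<omega> (c t * z)" if "t \<in> {0..T}"
   using psi_ins_dil(2)[OF z0, of \<omega> "\<omega> * of_real t"] integral_qd[OF nz[OF that]] by (simp add: g_def k_def c_def)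
  then show "(\<integral>x. G t x \<partial>config n) = ?i t *\<^sub>R QI \<omega> (c t * z)"
   unfolding G_def by (cases "t \<in> {0..T}") (simp_all add: indicator_def del: atLeastAtMost_iff)
 qed
 also have "(\<integral>x. (\<integral>t. G t x \<partial>lborel) \<partial>config n) = (\<integral>x. ?d x \<partial>config n)"
 proof (rule integral_cong_AE)
  show "(\<lambda>x. \<integral>t. G t x \<partial>lborel) \<in> borel_measurable (config n)"
  proof -
   have "(\<lambda>(x, t). G t x) \<in> borel_measurable (config n \<Otimes>\<^sub>M lborel)"
    using measurable_compose[OF measurable_pair_swap' Gm] by (simp add: split_beta)
   then show ?thesis by measurable
  qed
  have [measurable]: "(\<lambda>x. psi n a e y (dil n M d x)) \<in> borel_measurable (config n)" for y d
   using measurable_compose[OF dil_measurable psi_measurable] .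
  show "(\<lambda>x. ?d x) \<in> borel_measurable (config n)"
   unfolding k_def by measurable
  \<comment> \<open>A generic configuration has no collisions along the orbit, so \<open>k\<close>
    is differentiable in t with the continuous derivative \<open>g\<close>, up to the constant
    factor \<open>ins n l z x\<close>.\<close>
  show "AE x in config n. (\<integral>t. G t x \<partial>lborel) = ?d x"
   using AE_generic[OF z0]
  proof eventually_elim
   case (elim x)
   note D = psi_dil_derivative[OF elim M z0 \<omega>, where a=a and e=e, folded c_def, folded k_def]
   have kc: "continuous_on {0..T} (\<lambda>t. k t x)"
    by (rule continuous_on_vector_derivative, rule D(1))
   have "(\<integral>t. ?i t *\<^sub>R g t x \<partial>lborel) = ?d x"
   proof (rule integral_FTC_Icc[OF T])
    show "continuous_on {0..T} (\<lambda>t. g t x)"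
     unfolding g_def by (intro continuous_on_mult kc D(2) continuous_on_const)
    show "((\<lambda>t. k t x * ins n l z x) has_vector_derivative g t x) (at t within {0..T})" for t
     unfolding g_def by (rule has_vector_derivative_mult_left[OF D(1)])
   qed
   then show ?case by (simp add: G_def)
  qed
 qed
 also have "\<dots> = (\<integral>x. k T x * ins n l z x \<partial>config n) - (\<integral>x. k 0 x * ins n l z x \<partial>config n)"
 proof (rule Bochner_Integration.integral_diff)
  have "integrable (config n) (\<lambda>x. k t x * ins n l z x)" if "t \<in> {0..T}" for t
  proof -
   have "integrable (config n) (\<lambda>x. of_real ((cmod (c t)) ^ (2 * card M)) * psx n a e l [] (c t * z) (dil n M (c t) x))"
    by (rule integrable_dil[OF c0 M i0]) (use nz[OF that] in \<open>simp add: c_def\<close>)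
   moreover have "ins n l (c t * z) (dil n M (c t) x) = ins n l z x" for x by (rule ins_dil[OF c0 M]) (use lM in auto)
   ultimately show ?thesis by (simp add: psx_def k_def mult_ac)
  qed
  then show "integrable (config n) (\<lambda>x. k T x * ins n l z x)" "integrable (config n) (\<lambda>x. k 0 x * ins n l z x)"
   using T by auto
 qed
 also have "\<dots> = FI n a e l [] (c T * z) - FI n a e l [] (c 0 * z)"
  unfolding c_def psi_ins_dil(1)[OF z0] k_def by (simp add: c_def)
 finally show ?thesis by (simp add: c_def)
qed

end

context ibp begin

text \<open>Differentiability is already known from the cutoff translations. The averaged formula
  only has to identify the derivative along the orbit, namely as that of the integral of the
  continuous function \<open>QI\<close> at its lower end.\<close>

lemma FI_flow_derivative:
 assumes z: "z \<notin> {0, 1}" and \<omega>: "\<omega> = 1 \<or> \<omega> = \<i>"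
  and D: "(FI n a e l [] has_derivative (\<lambda>h. p * h + q * cnj h)) (at z)"
 shows "p * (\<omega> * z) + q * cnj (\<omega> * z) = QI \<omega> z"
proof -
 define c where "c t = exp (\<omega> * of_real t) * z" for t :: real
 have cc: "isCont c t" for t unfolding c_def by (intro continuous_intros)
 have c0: "c 0 = z" by (simp add: c_def)
 obtain K where K: "\<forall>\<^sub>F y in nhds z. (\<integral>x. cmod (qd \<omega> y x) \<partial>config n) \<le> K" using qd_bound[OF z] by blast
 have "\<forall>\<^sub>F y in nhds z. y \<notin> {0, 1}"
  using eventually_nhds_in_open[of "- {0, 1}" z] z by (simp add: open_Compl del: insert_iff)
 with K have "\<forall>\<^sub>F y in nhds z. y \<notin> {0, 1} \<and> (\<integral>x. cmod (qd \<omega> y x) \<partial>config n) \<le> K" by eventually_elim simp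
 moreover have "filterlim c (nhds z) (nhds 0)" using cc[of 0] by (simp add: tendsto_nhds_iff continuous_at c0)
 ultimately have "\<forall>\<^sub>F t in nhds 0. c t \<notin> {0, 1} \<and> (\<integral>x. cmod (qd \<omega> (c t) x) \<partial>config n) \<le> K"
  by (rule eventually_compose_filterlim)
 then obtain d where d: "d > 0" "\<And>t. \<bar>t\<bar> < d \<Longrightarrow> c t \<notin> {0, 1} \<and> (\<integral>x. cmod (qd \<omega> (c t) x) \<partial>config n) \<le> K"
  unfolding eventually_nhds_metric by (auto simp: dist_real_def)
 define T where "T = d / 2"
 have T: "T > 0" using d by (simp add: T_def)
 have cT: "c t \<notin> {0, 1}" "(\<integral>x. cmod (qd \<omega> (c t) x) \<partial>config n) \<le> K" if "t \<in> {0..T}" for t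
  using d(2)[of t] that d(1) by (auto simp: T_def)
 have Qc: "continuous_on {0..T} (\<lambda>t. QI \<omega> (c t))"
 proof (rule continuous_at_imp_continuous_on, rule ballI)
  fix t assume t: "t \<in> {0..T}"
  show "isCont (\<lambda>t. QI \<omega> (c t)) t" by (rule isCont_o2[OF cc continuous_QI[OF cT(1)[OF t]]])
 qed
 have E: "FI n a e l [] (c t) = z' + integral {0..t} (\<lambda>t. QI \<omega> (c t))" if "t \<in> {0..T}" and "z' = FI n a e l [] z" for t z'
 proof -
  have "FI n a e l [] (c t) - FI n a e l [] z = (\<integral>s. indicat_real {0..t} s *\<^sub>R QI \<omega> (c s) \<partial>lborel)"
   using FTC_average[OF z \<omega>, of t K] cT that unfolding c_def by auto
  also have "\<dots> = integral {0..t} (\<lambda>t. QI \<omega> (c t))"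
  proof -
   have "continuous_on {0..t} (\<lambda>t. QI \<omega> (c t))" using Qc by (rule continuous_on_subset) (use that in auto)
   then have "set_integrable lborel {0..t} (\<lambda>t. QI \<omega> (c t))" by (rule borel_integrable_atLeastAtMost')
   from set_borel_integral_eq_integral(2)[OF this] show ?thesis by (simp add: set_lebesgue_integral_def)
  qed
  finally show ?thesis using that by (simp add: algebra_simps)
 qed
 have "((\<lambda>t. FI n a e l [] z + integral {0..t} (\<lambda>t. QI \<omega> (c t))) has_vector_derivative 0 + QI \<omega> (c 0)) (at 0 within {0..T})"
  by (intro has_vector_derivative_add has_vector_derivative_const integral_has_vector_derivative[OF Qc]) (use T in auto)
 then have 1: "((\<lambda>t. FI n a e l [] (c t)) has_vector_derivative QI \<omega> z) (at 0 within {0..T})"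
  using T E by (simp add: c0) (rule has_vector_derivative_transform[of 0 "{0..T}"], auto)
 have "(c has_vector_derivative \<omega> * z) (at 0 within {0..T})"
 proof -
  have "((\<lambda>t. exp (\<omega> * of_real t)) has_vector_derivative \<omega>) (at 0 within {0..T})"
   by (rule has_vector_derivative_real_field derivative_eq_intros refl | simp)+
  from has_vector_derivative_mult_left[OF this, of z] show ?thesis by (simp add: c_def[abs_def])
 qed
 then have "(c has_derivative (\<lambda>t. t *\<^sub>R (\<omega> * z))) (at 0 within {0..T})" by (simp add: has_vector_derivative_def)
 moreover have "(FI n a e l [] has_derivative (\<lambda>h. p * h + q * cnj h)) (at (c 0) within c ` {0..T})"
  using D unfolding c0 by (rule has_derivative_at_withinI)
 ultimately have "((FI n a e l [] \<circ> c) has_derivative ((\<lambda>h. p * h + q * cnj h) \<circ> (\<lambda>t. t *\<^sub>R (\<omega> * z)))) (at 0 within {0..T})"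
  by (rule diff_chain_within)
 moreover have "((\<lambda>h. p * h + q * cnj h) \<circ> (\<lambda>t. t *\<^sub>R (\<omega> * z))) = (\<lambda>t. t *\<^sub>R (p * (\<omega> * z) + q * cnj (\<omega> * z)))"
  by (auto simp: fun_eq_iff scaleR_conv_of_real algebra_simps)
 ultimately have 2: "((\<lambda>t. FI n a e l [] (c t)) has_vector_derivative p * (\<omega> * z) + q * cnj (\<omega> * z)) (at 0 within {0..T})"
  by (simp add: has_vector_derivative_def o_def)
 show ?thesis
  by (rule vector_derivative_unique_within_closed_interval[OF _ _ 2[folded cbox_interval[of 0 T]] 1[folded cbox_interval[of 0 T]]]) (use T in auto)
qed

text \<open>Dilation gives p z + q cnj z and rotation gives \<i> (p z - q cnj z). Their combination
  removes the antiholomorphic derivative q, and with it all conjugated edges.\<close>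

theorem theta_FI:
 assumes z: "z \<notin> {0, 1}"
 shows "z * wirtinger (FI n a e l []) z = (\<Sum>j\<in>M. a j) * FI n a e l [] z
  + (\<Sum>(u, v)\<in>prs n. if pair_moved n M u v then e u v * FI n a e (mlist n M u v @ l) [] z else 0)"
proof -
 obtain p q where D: "(FI n a e l [] has_derivative (\<lambda>h. p * h + q * cnj h)) (at z)"
  using FI_derivative[OF z i0[OF z] vl] by auto
 have W: "wirtinger (FI n a e l []) z = p" by (rule wirtinger_eqI[OF D])
 define s where "s X = (\<Sum>u\<in>prm. e (fst u) (snd u) * X (fst u) (snd u))" for X :: pairing
 have eq: "QI w z = 2 * (\<Sum>j\<in>M. a j) * of_real (Re w) * FI n a e l [] z + (w * s (\<lambda>u v. FI n a e (mlist n M u v @ l) [] z) + cnj w * s (\<lambda>u v. FI n a e l (mlist n M u v) z))" for w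
  unfolding QI_def s_def by (simp add: split_beta algebra_simps sum_distrib_left sum.distrib)
 have 1: "p * z + q * cnj z = 2 * (\<Sum>j\<in>M. a j) * FI n a e l [] z + (s (\<lambda>u v. FI n a e (mlist n M u v @ l) [] z) + s (\<lambda>u v. FI n a e l (mlist n M u v) z))"
  using FI_flow_derivative[OF z _ D, of 1] eq[of 1] by simp
 have 2: "p * (\<i> * z) + q * cnj (\<i> * z) = (\<i> * s (\<lambda>u v. FI n a e (mlist n M u v @ l) [] z) - \<i> * s (\<lambda>u v. FI n a e l (mlist n M u v) z))"
  using FI_flow_derivative[OF z _ D, of \<i>] eq[of \<i>] by simp
 have 3: "\<i> * (p * z - q * cnj z) = \<i> * (s (\<lambda>u v. FI n a e (mlist n M u v @ l) [] z) - s (\<lambda>u v. FI n a e l (mlist n M u v) z))"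
  using 2 by (simp add: algebra_simps)
 then have "p * z - q * cnj z = s (\<lambda>u v. FI n a e (mlist n M u v @ l) [] z) - s (\<lambda>u v. FI n a e l (mlist n M u v) z)" by simp
 with 1 have "2 * (p * z) = 2 * ((\<Sum>j\<in>M. a j) * FI n a e l [] z + s (\<lambda>u v. FI n a e (mlist n M u v @ l) [] z))" by algebra
 then have "p * z = (\<Sum>j\<in>M. a j) * FI n a e l [] z + s (\<lambda>u v. FI n a e (mlist n M u v @ l) [] z)"
  unfolding mult_cancel_left by simp
 moreover have "s (\<lambda>u v. FI n a e (mlist n M u v @ l) [] z) = (\<Sum>(u, v)\<in>prs n. if pair_moved n M u v then e u v * FI n a e (mlist n M u v @ l) [] z else 0)"
  unfolding s_def split_beta by (rule sum.mono_neutral_cong_left) (auto simp: prm_def split: if_splits)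
 ultimately show ?thesis by (simp add: W mult.commute)
qed

end

section \<open>Euler operators\<close>

text \<open>Real differentiability of all iterated Wirtinger derivatives, without mixed derivatives:
  exactly what the product and sum rules for these derivatives require at every order.\<close>

definition wsmooth :: "complex set \<Rightarrow> (complex \<Rightarrow> complex) \<Rightarrow> bool" where
 "wsmooth S f \<longleftrightarrow> (\<forall>k. \<forall>z\<in>S. (wirtinger ^^ k) f differentiable (at z))"

lemma frechet_wirtinger:
 assumes "f differentiable (at z)"
 obtains b where "(f has_derivative (\<lambda>h. wirtinger f z * h + b * cnj h)) (at z)"
proof -
 have D: "(f has_derivative frechet_derivative f (at z)) (at z)" using assms frechet_derivative_works by blast
 then interpret linear "frechet_derivative f (at z)" by (rule has_derivative_linear)
 define b where "b = (frechet_derivative f (at z) 1 + \<i> * frechet_derivative f (at z) \<i>) / 2"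
 have "frechet_derivative f (at z) h = wirtinger f z * h + b * cnj h" for h
 proof -
  have "h = Re h *\<^sub>R 1 + Im h *\<^sub>R \<i>" by (simp add: complex_eq_iff)
  then have "frechet_derivative f (at z) h = Re h *\<^sub>R frechet_derivative f (at z) 1 + Im h *\<^sub>R frechet_derivative f (at z) \<i>"
   by (metis add scale)
  also have "\<dots> = wirtinger f z * (of_real (Re h) + \<i> * of_real (Im h)) + b * (of_real (Re h) - \<i> * of_real (Im h))"
   unfolding wirtinger_def b_def scaleR_conv_of_real by (simp add: field_simps)
  also have "of_real (Re h) - \<i> * of_real (Im h) = cnj h" by (simp add: complex_eq_iff)
  also have "of_real (Re h) + \<i> * of_real (Im h) = h" by (simp add: complex_eq_iff)
  finally show ?thesis .
 qed
 then have "frechet_derivative f (at z) = (\<lambda>h. wirtinger f z * h + b * cnj h)" by (rule ext)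
 then show ?thesis using that D by metis
qed

lemma wirtinger_rules:
 assumes "f differentiable (at z)" "g differentiable (at z)"
 shows "wirtinger (\<lambda>z. f z + g z) z = wirtinger f z + wirtinger g z" (is ?c1)
  and "wirtinger (\<lambda>z. c * f z) z = c * wirtinger f z" (is ?c2)
  and "wirtinger (\<lambda>z. z * f z) z = f z + z * wirtinger f z" (is ?c3)
proof -
 obtain b where b: "(f has_derivative (\<lambda>h. wirtinger f z * h + b * cnj h)) (at z)" by (rule frechet_wirtinger[OF assms(1)])
 obtain d where d: "(g has_derivative (\<lambda>h. wirtinger g z * h + d * cnj h)) (at z)" by (rule frechet_wirtinger[OF assms(2)])
 show ?c1
  by (rule wirtinger_eqI[where b="b + d"]) (rule has_derivative_eq_rhs[OF has_derivative_add[OF b d]], simp add: fun_eq_iff algebra_simps)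
 show ?c2
  by (rule wirtinger_eqI[where b="c * b"]) (rule has_derivative_eq_rhs[OF has_derivative_mult_right[OF b]], simp add: fun_eq_iff algebra_simps)
 show ?c3
  by (rule wirtinger_eqI[where b="z * b"]) (rule has_derivative_eq_rhs[OF has_derivative_mult[OF has_derivative_ident b]], simp add: fun_eq_iff algebra_simps)
qed

lemma wirtinger_cong_open:
 assumes "open S" "\<And>z. z \<in> S \<Longrightarrow> f z = g z" "z \<in> S"
 shows "wirtinger f z = wirtinger g z" "f differentiable (at z) \<longleftrightarrow> g differentiable (at z)"
proof -
 have "(f has_derivative D) (at z) \<longleftrightarrow> (g has_derivative D) (at z)" for D
  using has_derivative_transform_within_open[of f D z UNIV S g] has_derivative_transform_within_open[of g D z UNIV S f] assms by auto
 then show "wirtinger f z = wirtinger g z" "f differentiable (at z) \<longleftrightarrow> g differentiable (at z)"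
  by (simp_all add: wirtinger_def frechet_derivative_def differentiable_def)
qed

lemma wirtinger_power_cong:
 assumes "open S" "\<And>z. z \<in> S \<Longrightarrow> f z = g z" "z \<in> S"
 shows "(wirtinger ^^ k) f z = (wirtinger ^^ k) g z"
 using assms(3)
proof (induction k arbitrary: z)
 case (Suc k)
 show ?case using wirtinger_cong_open(1)[OF assms(1) Suc.IH Suc.prems] by simp
qed (use assms in simp)

lemma wsmooth_cong:
 assumes "open S" "\<And>z. z \<in> S \<Longrightarrow> f z = g z" "wsmooth S f"
 shows "wsmooth S g"
 using wirtinger_cong_open(2)[OF assms(1) wirtinger_power_cong[OF assms(1,2)]] assms(3) by (simp add: wsmooth_def)

lemma wsmooth_differentiable: "wsmooth S f \<Longrightarrow> z \<in> S \<Longrightarrow> f differentiable (at z)"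
 unfolding wsmooth_def by (metis funpow_0)

lemma wsmooth_wirtinger: "wsmooth S f \<Longrightarrow> wsmooth S (wirtinger f)"
 unfolding wsmooth_def by (metis funpow_Suc_right o_apply)

lemma wirtinger_power_rules:
 assumes S: "open S" and f: "wsmooth S f" and g: "wsmooth S g" and z: "z \<in> S"
 shows "(wirtinger ^^ k) (\<lambda>z. f z + g z) z = (wirtinger ^^ k) f z + (wirtinger ^^ k) g z" (is ?c1)
  and "(wirtinger ^^ k) (\<lambda>z. c * f z) z = c * (wirtinger ^^ k) f z" (is ?c2)
  and "(wirtinger ^^ k) (\<lambda>z. z * f z) z = of_nat k * (wirtinger ^^ (k - 1)) f z + z * (wirtinger ^^ k) f z" (is ?c3)
proof -
 have df: "(wirtinger ^^ k) f differentiable (at z)" if "z \<in> S" for k z using f that by (simp add: wsmooth_def)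
 have dg: "(wirtinger ^^ k) g differentiable (at z)" if "z \<in> S" for k z using g that by (simp add: wsmooth_def)
 show ?c1
  using z
 proof (induction k arbitrary: z)
  case (Suc k)
  show ?case using wirtinger_cong_open(1)[OF S Suc.IH Suc.prems] wirtinger_rules(1)[OF df[OF Suc.prems, of k] dg[OF Suc.prems, of k]] by simp
 qed simp
 show ?c2
  using z
 proof (induction k arbitrary: z)
  case (Suc k)
  show ?case using wirtinger_cong_open(1)[OF S Suc.IH Suc.prems] wirtinger_rules(2)[OF df[OF Suc.prems, of k] df[OF Suc.prems, of k]] by simp
 qed simp
 show ?c3
  using z
 proof (induction k arbitrary: z)
  case (Suc k)
  have d: "(\<lambda>z. of_nat k * (wirtinger ^^ (k - 1)) f z) differentiable (at z)" "(\<lambda>z. z * (wirtinger ^^ k) f z) differentiable (at z)"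
   using df[OF Suc.prems] by (auto intro!: differentiable_mult)
  have "wirtinger (\<lambda>z. of_nat k * (wirtinger ^^ (k - 1)) f z + z * (wirtinger ^^ k) f z) z =
    of_nat k * wirtinger ((wirtinger ^^ (k - 1)) f) z + ((wirtinger ^^ k) f z + z * wirtinger ((wirtinger ^^ k) f) z)"
   using wirtinger_rules(1)[OF d] wirtinger_rules(2,3)[OF df[OF Suc.prems] df[OF Suc.prems]] by simp
  then show ?case using wirtinger_cong_open(1)[OF S Suc.IH Suc.prems]
   by (cases k) (simp_all add: algebra_simps)
 qed simp
qed

lemma wsmooth_rules:
 assumes S: "open S" and f: "wsmooth S f" and g: "wsmooth S g"
 shows "wsmooth S (\<lambda>z. f z + g z)" and "wsmooth S (\<lambda>z. c * f z)" and "wsmooth S (\<lambda>z. z * f z)"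
proof -
 have df: "(wirtinger ^^ k) f differentiable (at z)" if "z \<in> S" for k z using f that by (simp add: wsmooth_def)
 have dg: "(wirtinger ^^ k) g differentiable (at z)" if "z \<in> S" for k z using g that by (simp add: wsmooth_def)
 note R = wirtinger_power_rules[OF S f g] and C = wirtinger_cong_open(2)[OF S]
 show "wsmooth S (\<lambda>z. f z + g z)" unfolding wsmooth_def
  using df dg by (auto simp: C[OF R(1)])
 show "wsmooth S (\<lambda>z. c * f z)" unfolding wsmooth_def
  using df by (auto simp: C[OF R(2)] intro!: differentiable_mult)
 show "wsmooth S (\<lambda>z. z * f z)" unfolding wsmooth_def
  using df by (auto simp: C[OF R(3)] intro!: differentiable_mult differentiable_add)
qed

lemma wsmooth_sum:
 assumes "open S" "finite I" "\<And>i. i \<in> I \<Longrightarrow> wsmooth S (f i)"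
 shows "wsmooth S (\<lambda>z. \<Sum>i\<in>I. f i z) \<and> (\<forall>z\<in>S. wirtinger (\<lambda>z. \<Sum>i\<in>I. f i z) z = (\<Sum>i\<in>I. wirtinger (f i) z))"
 using assms(2,3)
proof (induction I rule: finite_induct)
 case empty
 have 0: "wirtinger (\<lambda>z. 0) z = 0" for z by (simp add: wirtinger_def)
 have "(wirtinger ^^ k) (\<lambda>z. 0) = (\<lambda>z. 0)" for k by (induction k) (simp_all add: 0)
 then show ?case by (simp add: wsmooth_def 0)
next
 case (insert i I)
 then have i: "wsmooth S (f i)" and I: "wsmooth S (\<lambda>z. \<Sum>i\<in>I. f i z)" "\<forall>z\<in>S. wirtinger (\<lambda>z. \<Sum>i\<in>I. f i z) z = (\<Sum>i\<in>I. wirtinger (f i) z)" by auto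
 show ?case using insert(1,2) wsmooth_rules(1)[OF assms(1) i I(1)] I(2)
   wirtinger_rules(1)[OF wsmooth_differentiable[OF i] wsmooth_differentiable[OF I(1)]] by simp
qed

lemma wirtinger_power_holomorphic:
 assumes S: "open S" and f: "f holomorphic_on S" and z: "z \<in> S"
 shows "(wirtinger ^^ k) f z = (deriv ^^ k) f z"
 using z
proof (induction k arbitrary: z)
 case (Suc k)
 have "((deriv ^^ k) f has_field_derivative deriv ((deriv ^^ k) f) z) (at z)"
  using holomorphic_higher_deriv[OF f S] S Suc.prems holomorphic_derivI by blast
 then have "((deriv ^^ k) f has_derivative (\<lambda>h. deriv ((deriv ^^ k) f) z * h + 0 * cnj h)) (at z)"
  by (simp add: has_field_derivative_def)
 then have "wirtinger ((deriv ^^ k) f) z = deriv ((deriv ^^ k) f) z" by (rule wirtinger_eqI)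
 then show ?case using wirtinger_cong_open(1)[OF S Suc.IH Suc.prems] by simp
qed simp

lemma wsmooth_holomorphic:
 assumes S: "open S" and f: "f holomorphic_on S"
 shows "wsmooth S f"
 unfolding wsmooth_def
proof (intro allI ballI)
 fix k z assume z: "z \<in> S"
 have "(deriv ^^ k) f field_differentiable (at z)"
  using holomorphic_higher_deriv[OF f S] S z holomorphic_on_imp_differentiable_at by blast
 then have "(deriv ^^ k) f differentiable (at z)" by (rule field_differentiable_imp_differentiable)
 then show "(wirtinger ^^ k) f differentiable (at z)"
  using wirtinger_cong_open(2)[OF S wirtinger_power_holomorphic[OF S f] z] by simp
qed

definition th :: "(complex \<Rightarrow> complex) \<Rightarrow> complex \<Rightarrow> complex" where
 "th f z = z * wirtinger f z"

text \<open>Turns composition of Euler operators into multiplication of polynomials.\<close>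

definition pact :: "complex poly \<Rightarrow> (complex \<Rightarrow> complex) \<Rightarrow> complex \<Rightarrow> complex" where
 "pact P f z = (\<Sum>i\<le>degree P. coeff P i * (th ^^ i) f z)"

lemma wsmooth_th:
 assumes "open S" "wsmooth S f"
 shows "wsmooth S (th f)" "wsmooth S ((th ^^ i) f)"
proof -
 have *: "wsmooth S (th f)" if "wsmooth S f" for f
  unfolding th_def[abs_def] by (rule wsmooth_rules(3)[OF assms(1) wsmooth_wirtinger[OF that] wsmooth_wirtinger[OF that]])
 show "wsmooth S ((th ^^ i) f)" by (induction i) (use assms * in auto)
 show "wsmooth S (th f)" by (rule *) (rule assms)
qed

lemma pact_altdef:
 assumes "degree P \<le> m"
 shows "pact P f z = (\<Sum>i\<le>m. coeff P i * (th ^^ i) f z)"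
 unfolding pact_def by (rule sum.mono_neutral_left) (use assms in \<open>auto intro: coeff_eq_0\<close>)

lemma pact_rules:
 shows "pact (P + Q) f z = pact P f z + pact Q f z" (is ?c1) "pact (P - Q) f z = pact P f z - pact Q f z"
  "pact (smult c P) f z = c * pact P f z" "pact 0 f z = 0" "pact [:c:] f z = c * f z" "pact 1 f z = f z"
proof -
 define m where "m = max (degree P) (degree Q)"
 note m = pact_altdef[of _ m]
 have d: "degree P \<le> m" "degree Q \<le> m" "degree (P + Q) \<le> m" "degree (P - Q) \<le> m"
  by (auto simp: m_def intro: order_trans[OF degree_add_le_max] order_trans[OF degree_diff_le_max])
 show ?c1 "pact (P - Q) f z = pact P f z - pact Q f z"
  using d by (simp_all add: m sum.distrib sum_subtractf algebra_simps)
 show "pact (smult c P) f z = c * pact P f z"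
  by (simp add: pact_altdef[of _ "degree P"] degree_smult_le sum_distrib_left mult.assoc)
qed (simp_all add: pact_def)

lemma wsmooth_pact:
 assumes "open S" "wsmooth S f"
 shows "wsmooth S (pact P f)"
proof -
 have "wsmooth S (\<lambda>z. coeff P i * (th ^^ i) f z)" for i
  by (rule wsmooth_rules(2)[OF assms(1) wsmooth_th(2)[OF assms] wsmooth_th(2)[OF assms]])
 then show ?thesis unfolding pact_def[abs_def] using wsmooth_sum[OF assms(1), of "{..degree P}" "\<lambda>i z. coeff P i * (th ^^ i) f z"] by auto
qed

lemma pact_pCons_0:
 assumes "open S" "wsmooth S f" "z \<in> S"
 shows "pact (pCons 0 P) f z = th (pact P f) z"
proof -
 have sm: "wsmooth S (\<lambda>z. coeff P i * (th ^^ i) f z)" for i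
  by (rule wsmooth_rules(2)[OF assms(1) wsmooth_th(2)[OF assms(1,2)] wsmooth_th(2)[OF assms(1,2)]])
 have w: "wirtinger (\<lambda>z. coeff P i * (th ^^ i) f z) z = coeff P i * wirtinger ((th ^^ i) f) z" for i
  by (rule wirtinger_rules(2)) (use wsmooth_differentiable[OF wsmooth_th(2)[OF assms(1,2)] assms(3)] in auto)
 have "th (pact P f) z = (\<Sum>i\<le>degree P. coeff P i * (th ^^ Suc i) f z)"
  unfolding th_def[of "pact P f"] pact_def[abs_def]
  using wsmooth_sum[OF assms(1), of "{..degree P}" "\<lambda>i z. coeff P i * (th ^^ i) f z"] sm assms(3)
  by (simp add: w sum_distrib_left th_def mult_ac)
 also have "\<dots> = pact (pCons 0 P) f z"
  by (subst pact_altdef[of _ "Suc (degree P)"]) (auto simp: degree_pCons_le sum.atMost_Suc_shift simp del: sum.atMost_Suc)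
 finally show ?thesis ..
qed

lemma th_cong:
 assumes "open S" "\<And>z. z \<in> S \<Longrightarrow> f z = g z" "z \<in> S"
 shows "th f z = th g z"
 using wirtinger_cong_open(1)[OF assms] by (simp add: th_def)

lemma th_rules:
 assumes "f differentiable (at z)" "g differentiable (at z)"
 shows "th (\<lambda>z. f z + g z) z = th f z + th g z" "th (\<lambda>z. c * f z) z = c * th f z" "th (\<lambda>z. z * f z) z = z * f z + z * th f z"
 using wirtinger_rules[OF assms] by (simp_all add: th_def algebra_simps)

lemma euler_op_pact:
 assumes "open S" "wsmooth S f" and g: "\<And>z. z \<in> S \<Longrightarrow> g z = pact P f z" and z: "z \<in> S"
 shows "euler_op c g z = pact ([:c, 1:] * P) f z"
proof -
 have "euler_op c g z = th (pact P f) z + c * pact P f z"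
  unfolding euler_op_def using th_cong[OF assms(1) g z] g[OF z] by (simp add: th_def)
 also have "\<dots> = pact (smult c P + pCons 0 P) f z"
  unfolding pact_rules pact_pCons_0[OF assms(1,2) z] by simp
 finally show ?thesis by simp
qed

lemma euler_prod_pact:
 assumes "open S" "wsmooth S f" "z \<in> S"
 shows "euler_prod a f z = pact ([:a 1, 1:] * ([:a 2, 1:] * ([:a 3, 1:] * [:a 4, 1:]))) f z"
proof -
 have 0: "f z = pact 1 f z" for z by (simp add: pact_rules)
 note E = euler_op_pact[OF assms(1,2)]
 show ?thesis unfolding euler_prod_def o_apply
  by (rule E[OF E[OF E[OF E[OF 0, THEN trans]]]]) (use assms(3) in auto)
qed

section \<open>Brackets\<close>

definition fr :: "complex \<Rightarrow> complex \<Rightarrow> complex" where "fr a b = a / (a - b)"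

lemma fr_swap: "a \<noteq> b \<Longrightarrow> fr b a = 1 - fr a b"
 by (simp add: fr_def divide_simps) (auto simp: algebra_simps)

text \<open>This relation of Arnold type and \<open>fr_swap\<close> generate all later identities
  between edges; each of them follows by elimination from instances of these two.\<close>

lemma fr_mult:
 assumes "a \<noteq> b" "b \<noteq> c" "a \<noteq> c"
 shows "fr a b * fr b c = fr a c * (fr a b + fr b c - 1)"
 using assms by (simp add: fr_def divide_simps) (auto simp: algebra_simps)

lemmas fr_eq = fr_swap fr_mult

lemma fr_antisym:
 assumes "a \<noteq> b" "b \<noteq> c" "a \<noteq> c"
 shows "fr a b * fr b c + fr b a * fr a c = fr a c * fr b c" (is ?c1) "fr c a * fr a b + fr c b * fr b a = fr c a * fr c b"
proof -
 have "fr b a = 1 - fr a b" "fr a b * fr b c = fr a c * (fr a b + fr b c - 1)" "fr c a * fr a b = fr c b * (fr c a + fr a b - 1)"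
  using assms by (auto intro: fr_eq)
 then show ?c1 "fr c a * fr a b + fr c b * fr b a = fr c a * fr c b" by algebra+
qed

lemma fr3:
 assumes "k \<noteq> i" "k \<noteq> j" "i \<noteq> j"
 shows "fr k i * (fr j k - 2 * fr j i) + fr k j * (fr i k - 2 * fr i j) = - fr k i - fr k j"
proof -
 have "fr k i * fr i j = fr k j * (fr k i + fr i j - 1)" "fr j i = 1 - fr i j" "fr j k = 1 - fr k j" "fr i k = 1 - fr k i"
  using assms by (auto intro: fr_eq)
 then show ?thesis by algebra
qed

text \<open>The expression is symmetrised in \<open>k\<close> and \<open>l\<close>, two variables of
  one kind of which only one lies on the path from \<open>z\<close> to \<open>i\<close>. The
  identities \<open>frB\<close> and \<open>frC\<close> play the same part for other graphs.\<close>

lemma frA: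
 assumes "z \<noteq> k" "z \<noteq> l" "k \<noteq> l" "i \<noteq> k" "i \<noteq> l" "i \<noteq> z"
 shows "fr z k * fr k i * (fr i l - 2 * fr k l + fr z l) + fr z l * fr l i * (fr i k - 2 * fr l k + fr z k) = 0"
proof -
 have 1: "fr z k * fr k l = fr z l * (fr z k + fr k l - 1)" "fr l k = 1 - fr k l" "fr k i * fr i l = fr k l * (fr k i + fr i l - 1)"
  "fr l i * fr i k = fr l k * (fr l i + fr i k - 1)"
  "fr l i * fr i k = fr l k * (fr l i + fr i k - 1)" "fr i k = 1 - fr k i" "fr i l = 1 - fr l i"
  using assms by (auto intro: fr_eq)
 show ?thesis using 1 by algebra
qed

lemma frB:
 assumes "k \<noteq> i" "k \<noteq> j" "k \<noteq> l" "i \<noteq> j" "i \<noteq> l" "j \<noteq> l"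
 shows "fr k i * fr i l * (fr k j + fr l j - 2 * fr i j) + fr k j * fr j l * (fr k i + fr l i - 2 * fr j i) = 0"
proof -
 have 1: "fr k i * fr i l = fr k l * (fr k i + fr i l - 1)" "fr k j * fr j l = fr k l * (fr k j + fr j l - 1)"
  "fr k i * fr i j = fr k j * (fr k i + fr i j - 1)" "fr j i = 1 - fr i j" "fr l j = 1 - fr j l" "fr l i = 1 - fr i l"
  "fr i j * fr j l = fr i l * (fr i j + fr j l - 1)"
  using assms by (auto intro: fr_eq)
 show ?thesis using 1 by algebra
qed
lemma frC:
 assumes "k \<noteq> i" "k \<noteq> j" "k \<noteq> l" "i \<noteq> j" "i \<noteq> l" "j \<noteq> l"
 shows "fr k i * fr i l * (fr j k + fr j l - 2 * fr j i) + fr k j * fr j l * (fr i k + fr i l - 2 * fr i j) = 0"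
proof -
 have 1: "fr k i * fr i l = fr k l * (fr k i + fr i l - 1)" "fr k j * fr j l = fr k l * (fr k j + fr j l - 1)"
  "fr k i * fr i j = fr k j * (fr k i + fr i j - 1)" "fr j i = 1 - fr i j" "fr j k = 1 - fr k j" "fr i k = 1 - fr k i"
  "fr i j * fr j l = fr i l * (fr i j + fr j l - 1)"
  using assms by (auto intro: fr_eq)
 show ?thesis using 1 by algebra
qed
text \<open>Collapses a path into its chord \<open>fr z w\<close> times products with fewer edges.
  For w = 1 the chord is z / (z - 1), a constant for the integration.\<close>

lemma frK:
 assumes "z \<noteq> k" "z \<noteq> i" "z \<noteq> w" "k \<noteq> i" "k \<noteq> w" "i \<noteq> w"
 shows "fr z k * fr k i * fr i w = fr z w * (fr k i * fr i w + (fr z k - 1) * fr i w + (fr z k - 1) * (fr k i - 1))"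
proof -
 have "fr k i * fr i w = fr k w * (fr k i + fr i w - 1)" "fr z k * fr k w = fr z w * (fr z k + fr k w - 1)"
  using assms by (auto intro: fr_eq)
 then show ?thesis by algebra
qed

section \<open>Brackets as integrals of functions of the edges\<close>

definition mon :: "graph \<Rightarrow> pairing \<Rightarrow> complex" where
 "mon l p = (\<Prod>(u, v)\<leftarrow>l. p u v)"

lemma mon_simps [simp]: "mon [] p = 1" "mon ((u, v) # l) p = p u v * mon l p"
 by (simp_all add: mon_def)

lemma ins_mon: "ins n l z x = mon l (edge n z x)"
 by (simp add: ins_def mon_def)

text \<open>The edge values of pairwise distinct points. Brackets integrate functions of these
  values alone, so identities between integrands have to be checked only on such families.\<close>

definition points :: "nat \<Rightarrow> complex \<Rightarrow> pairing \<Rightarrow> bool" where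
 "points n z p \<longleftrightarrow> (\<exists>x. inj_on x {..n + 1} \<and> x n = z \<and> x (n + 1) = 1 \<and> p = (\<lambda>u v. fr (x u) (x v)))"

text \<open>The pair of \<open>z\<close> and 1 carries no factor in \<open>psi\<close>, so the
  distinctness of these two points enters as a hypothesis.\<close>

lemma psi_ne_0_points:
 assumes "psi n a e z x \<noteq> 0" "z \<noteq> 1"
 shows "points n z (edge n z x)"
proof -
 have *: "pt n z x u \<noteq> pt n z x v" if "u < v" "v \<le> n + 1" for u v
 proof (cases "u < n")
  case True
  then have "(u, v) \<in> prs n" using that by (simp add: prs_def)
  then show ?thesis using psi_eq_0 assms by blast
 next
  case False
  then have "u = n" "v = n + 1" using that by auto
  then show ?thesis using assms by (simp add: pt_def)
 qed
 have "inj_on (pt n z x) {..n + 1}"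
 proof (rule inj_onI, rule ccontr)
  fix u v assume uv: "u \<in> {..n + 1}" "v \<in> {..n + 1}" "pt n z x u = pt n z x v" "u \<noteq> v"
  then consider "u < v" | "v < u" by linarith
  then show False using *[of u v] *[of v u] uv by cases auto
 qed
 moreover have "pt n z x n = z" "pt n z x (n + 1) = 1" by (simp_all add: pt_def)
 ultimately show ?thesis unfolding points_def by (intro exI[of _ "pt n z x"]) (simp add: edge_def fr_def fun_eq_iff)
qed

abbreviation Om :: "complex set" where "Om \<equiv> - {0, 1}"

lemma open_Om: "open Om" by (intro open_Compl finite_imp_closed) auto

text \<open>As \<open>prs\<close> omits the pair of \<open>z\<close> and 1, giving it the exponent 0
  lets the sums over a moved and a fixed endpoint run over all indices.\<close>

locale brackets =
 fixes n :: nat and a :: conf and e :: pairing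
 assumes e_sym: "e u v = e v u" and e_z1: "e n (Suc n) = 0"
begin

definition good :: "graph \<Rightarrow> bool" where
 "good l \<longleftrightarrow> verts l \<subseteq> {..n + 1} \<and> (\<forall>z\<in>Om. integrable (config n) (psx n a e l [] z))"

definition br :: "(pairing \<Rightarrow> complex) \<Rightarrow> complex \<Rightarrow> complex" where
 "br F z = (\<integral>x. psi n a e z x * F (edge n z x) \<partial>config n)"

definition gd :: "(pairing \<Rightarrow> complex) \<Rightarrow> bool" where
 "gd F \<longleftrightarrow> (\<forall>z\<in>Om. integrable (config n) (\<lambda>x. psi n a e z x * F (edge n z x)))"

lemma psx_mon: "psx n a e l [] z = (\<lambda>x. psi n a e z x * mon l (edge n z x))"
 by (simp add: psx_def ins_mon fun_eq_iff)

lemma gd_mon: "good l \<Longrightarrow> gd (mon l)"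
 by (simp add: good_def gd_def psx_mon)

lemma br_mon: "br (mon l) z = FI n a e l [] z"
 by (simp add: br_def FI_def psx_mon)

lemma gd_add [intro, simp]: "gd F \<Longrightarrow> gd G \<Longrightarrow> gd (\<lambda>p. F p + G p)"
 and gd_diff [intro, simp]: "gd F \<Longrightarrow> gd G \<Longrightarrow> gd (\<lambda>p. F p - G p)"
 and gd_mult [intro, simp]: "gd F \<Longrightarrow> gd (\<lambda>p. c * F p)"
 by (simp_all add: gd_def distrib_left right_diff_distrib mult.left_commute[of _ c])

lemma gd_sum [intro]: "(\<And>i. i \<in> I \<Longrightarrow> gd (F i)) \<Longrightarrow> gd (\<lambda>p. \<Sum>i\<in>I. F i p)"
 unfolding gd_def by (auto simp: sum_distrib_left intro!: Bochner_Integration.integrable_sum)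

lemma br_add: "gd F \<Longrightarrow> gd G \<Longrightarrow> z \<in> Om \<Longrightarrow> br (\<lambda>p. F p + G p) z = br F z + br G z"
 and br_diff: "gd F \<Longrightarrow> gd G \<Longrightarrow> z \<in> Om \<Longrightarrow> br (\<lambda>p. F p - G p) z = br F z - br G z"
 and br_mult: "br (\<lambda>p. c * F p) z = c * br F z"
 unfolding br_def gd_def by (simp_all add: distrib_left right_diff_distrib mult.left_commute[of _ c] del: Compl_iff insert_iff)

lemma br_sum: "finite I \<Longrightarrow> (\<And>i. i \<in> I \<Longrightarrow> gd (F i)) \<Longrightarrow> z \<in> Om \<Longrightarrow> br (\<lambda>p. \<Sum>i\<in>I. F i p) z = (\<Sum>i\<in>I. br (F i) z)"
 unfolding br_def gd_def by (simp add: sum_distrib_left Bochner_Integration.integral_sum del: Compl_iff insert_iff)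

lemma br_cong:
 assumes "z \<in> Om" "\<And>p. points n z p \<Longrightarrow> F p = G p"
 shows "br F z = br G z" "integrable (config n) (\<lambda>x. psi n a e z x * F (edge n z x)) \<longleftrightarrow> integrable (config n) (\<lambda>x. psi n a e z x * G (edge n z x))"
proof -
 have "psi n a e z x * F (edge n z x) = psi n a e z x * G (edge n z x)" for x
  using psi_ne_0_points[of n a e z x] assms by (cases "psi n a e z x = 0") auto
 then show "br F z = br G z" "integrable (config n) (\<lambda>x. psi n a e z x * F (edge n z x)) \<longleftrightarrow> integrable (config n) (\<lambda>x. psi n a e z x * G (edge n z x))"
  by (simp_all only: br_def)
qed

text \<open>Transports integrability along identities that hold up to a factor depending on z only.
  Paths from \<open>z\<close> to 1, which the forest estimate does not reach, are covered in this
  way.\<close>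

lemma gd_cong:
 assumes "\<And>z p. z \<in> Om \<Longrightarrow> points n z p \<Longrightarrow> F p = c z * G p" "gd G"
 shows "gd F"
 unfolding gd_def
proof
 fix z :: complex assume z: "z \<in> Om"
 have "integrable (config n) (\<lambda>x. c z * (psi n a e z x * G (edge n z x)))"
  by (rule integrable_mult_right) (use assms(2) z in \<open>unfold gd_def, blast\<close>)
 then have "integrable (config n) (\<lambda>x. psi n a e z x * (c z * G (edge n z x)))" by (simp add: mult.left_commute)
 then show "integrable (config n) (\<lambda>x. psi n a e z x * F (edge n z x))"
  using br_cong(2)[OF z, of F "\<lambda>p. c z * G p"] assms(1)[OF z] by simp
qed

lemma good_wsmooth: "good l \<Longrightarrow> wsmooth Om (FI n a e l [])"
 unfolding wsmooth_def
proof (intro allI ballI)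
 fix k z assume l: "good l" and z: "z \<in> Om"
 have i: "integrable (config n) (psx n a e l [] z)" "verts l \<subseteq> {..n + 1}" "verts [] \<subseteq> {..n + 1}" and z': "z \<notin> {0, 1}"
  using l z by (auto simp: good_def)
 from regular_integral[OF z' i] obtain r G where G: "r > 0" "biholo G (ball 0 r) (ball 0 r)"
  "\<And>w. w \<in> ball 0 r \<Longrightarrow> FI n a e l [] (z + w) = G w (cnj w)" unfolding FI_def by metis
 show "(wirtinger ^^ k) (FI n a e l []) differentiable (at z)"
  using polarized_wirtinger_differentiable[OF G(2,3), of 0 k] G(1) by simp
qed

text \<open>The degree of homogeneity, in its holomorphic half, of the part of the integrand that
  lives on \<open>M\<close>, \<open>z\<close> and the origin.\<close>

definition kap :: "nat set \<Rightarrow> complex" where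
 "kap M = (\<Sum>j\<in>M. a j) + (\<Sum>(u, v)\<in>{p \<in> prs n. fst p \<in> moved n M \<and> snd p \<in> moved n M}. e u v)"

definition cross :: "nat set \<Rightarrow> pairing \<Rightarrow> complex" where
 "cross M p = (\<Sum>u\<in>moved n M. \<Sum>v\<in>{..n + 1} - moved n M. e u v * p u v)"

abbreviation "kcr M p \<equiv> kap M + cross M p"

text \<open>Pairs are sorted by the number of moved endpoints. Two moved endpoints contribute a
  constant, collected in \<open>kap\<close>; one moved endpoint contributes an edge oriented away
  from it, and these make up \<open>cross\<close>.\<close>

lemma pair_sum:
 assumes M: "M \<subseteq> {..<n}"
 shows "(\<Sum>(u, v)\<in>prs n. if pair_moved n M u v then e u v * mon (mlist n M u v @ l) p else 0) + (\<Sum>j\<in>M. a j) * mon l p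
  = mon l p * kcr M p"
proof -
 define S where "S = moved n M"
 define A where "A = {p \<in> prs n. fst p \<in> S \<and> snd p \<in> S}"
 define B where "B = {p \<in> prs n. fst p \<in> S \<and> snd p \<notin> S}"
 define C where "C = {p \<in> prs n. fst p \<notin> S \<and> snd p \<in> S}"
 let ?P = "{(u, v). u \<in> S \<and> v \<in> {..n + 1} - S \<and> u < v}" and ?Q = "{(u, v). u \<in> S \<and> v \<in> {..n + 1} - S \<and> v < u}"
 have S: "S \<subseteq> {..n}" "finite S" using M by (auto simp: S_def moved_def intro: finite_subset[of M "{..<n}"])
 have fin: "finite A" "finite B" "finite C" by (auto simp: A_def B_def C_def)
 have mapp: "mon (k @ l) p = mon k p * mon l p" for k by (simp add: mon_def)
 define f where "f q = (if pair_moved n M (fst q) (snd q) then e (fst q) (snd q) * mon (mlist n M (fst q) (snd q)) p else 0)" for q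
 have "(\<Sum>q\<in>prs n. f q) = (\<Sum>q\<in>A \<union> (B \<union> C). f q)"
  by (rule sum.mono_neutral_right) (auto simp: A_def B_def C_def f_def pair_moved_def S_def)
 also have "\<dots> = (\<Sum>q\<in>A. f q) + ((\<Sum>q\<in>B. f q) + (\<Sum>q\<in>C. f q))"
  using fin by (subst sum.union_disjoint, simp, simp, (auto simp: A_def B_def C_def)[1], subst sum.union_disjoint) (auto simp: A_def B_def C_def)
 also have "(\<Sum>q\<in>A. f q) = (\<Sum>(u, v)\<in>A. e u v)"
  by (rule sum.cong) (auto simp: A_def f_def pair_moved_def mlist_def S_def)
 also have "(\<Sum>q\<in>B. f q) = (\<Sum>(u, v)\<in>?P. e u v * p u v)"
 proof (rule sum.mono_neutral_cong_left)
  show "finite ?P"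
   by (rule finite_subset[of _ "S \<times> {..n + 1}"]) (use S in auto)
  show "B \<subseteq> ?P" by (auto simp: B_def prs_def)
  show "\<forall>q\<in>?P - B. (case q of (u, v) \<Rightarrow> e u v * p u v) = 0"
  proof (clarify)
   fix u v assume h: "u \<in> S" "v \<le> n + 1" "v \<notin> S" "u < v" "(u, v) \<notin> B"
   then have "\<not> u < n" by (auto simp: B_def prs_def)
   then have "u = n" "v = Suc n" using h S by auto
   then show "e u v * p u v = 0" using e_z1 by simp
  qed
  show "f q = (case q of (u, v) \<Rightarrow> e u v * p u v)" if "q \<in> B" for q
   using that by (cases q) (auto simp: B_def f_def pair_moved_def mlist_def S_def)
 qed
 also have "(\<Sum>q\<in>C. f q) = (\<Sum>(u, v)\<in>?Q. e u v * p u v)"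
 proof (rule sum.reindex_bij_witness[of _ prod.swap prod.swap])
  show "prod.swap q \<in> C" if "q \<in> ?Q" for q
   using that S by (auto simp: C_def prs_def)
 qed (auto simp: C_def prs_def f_def pair_moved_def mlist_def S_def[symmetric] e_sym)
 also have "(\<Sum>(u, v)\<in>?P. e u v * p u v) + (\<Sum>(u, v)\<in>?Q. e u v * p u v)
   = (\<Sum>(u, v)\<in>S \<times> ({..n + 1} - S). e u v * p u v)"
 proof -
  define P where "P = ?P"
  define Q where "Q = ?Q"
  have eq: "S \<times> ({..n + 1} - S) = P \<union> Q"
  proof (intro equalityI subsetI)
   fix q assume q: "q \<in> S \<times> ({..n + 1} - S)"
   obtain u v where uv: "q = (u, v)" by (cases q)
   have "u \<noteq> v" using q uv by blast
   then consider "u < v" | "v < u" by linarith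
   then show "q \<in> P \<union> Q" using q uv by cases (simp_all add: P_def Q_def)
  next
   fix q assume "q \<in> P \<union> Q"
   then show "q \<in> S \<times> ({..n + 1} - S)" by (cases q) (simp add: P_def Q_def, blast)
  qed
  have "finite (S \<times> ({..n + 1} - S))" using S by simp
  then have "finite P" "finite Q" unfolding eq by simp_all
  moreover have "P \<inter> Q = {}" by (auto simp: P_def Q_def)
  ultimately show ?thesis unfolding eq P_def[symmetric] Q_def[symmetric] by (rule sum.union_disjoint[symmetric])
 qed
 also have "\<dots> = cross M p" by (simp add: cross_def S_def sum.cartesian_product)
 finally have "(\<Sum>q\<in>prs n. f q) = (\<Sum>(u, v)\<in>A. e u v) + cross M p" .
 then have "mon l p * (\<Sum>q\<in>prs n. f q) + (\<Sum>j\<in>M. a j) * mon l p = mon l p * kcr M p"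
  by (simp add: kap_def A_def S_def algebra_simps)
 moreover have "mon l p * (\<Sum>q\<in>prs n. f q) = (\<Sum>(u, v)\<in>prs n. if pair_moved n M u v then e u v * mon (mlist n M u v @ l) p else 0)"
  unfolding sum_distrib_left f_def split_beta by (rule sum.cong) (auto simp: mapp)
 ultimately show ?thesis by simp
qed

end

context brackets begin

text \<open>The finite sum of brackets is repacked into the bracket of one function of the edges, so
  that identities can be applied under the integral before it is split again in a different
  way.\<close>

lemma theta_br1:
 assumes M: "M \<subseteq> {..<n}" and l: "good l"
  and lM: "\<And>u v. (u, v) \<in> set l \<Longrightarrow> u \<in> moved n M \<longleftrightarrow> v \<in> moved n M"
  and cl: "\<And>u v. u \<in> moved n M \<Longrightarrow> v \<le> n + 1 \<Longrightarrow> v \<notin> moved n M \<Longrightarrow> e u v \<noteq> 0 \<Longrightarrow> good ((u, v) # l)"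
  and z: "z \<in> Om"
 shows "th (FI n a e l []) z = br (\<lambda>p. mon l p * kcr M p) z" (is ?c1) "gd (\<lambda>p. mon l p * kcr M p)" (is ?c2)
proof -
 have g: "good (mlist n M u v @ l)" if "(u, v) \<in> prs n" "pair_moved n M u v" "e u v \<noteq> 0" for u v
  using that cl[of u v] cl[of v u] l by (auto simp: mlist_def pair_moved_def prs_def e_sym)
 interpret ibp n a e l M
 proof
  show "integrable (config n) (psx n a e l [] z)" if "z \<notin> {0, 1}" for z using l that by (simp add: good_def)
  show "integrable (config n) (psx n a e (mlist n M u v @ l) [] z)"
   if "z \<notin> {0, 1}" "(u, v) \<in> prs n" "pair_moved n M u v" "e u v \<noteq> 0" for z u v using g[OF that(2-4)] that(1) by (simp add: good_def)
 qed (use M l lM in \<open>auto simp: good_def\<close>)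
 define G where "G q p = (case q of (u, v) \<Rightarrow> if pair_moved n M u v then e u v * mon (mlist n M u v @ l) p else 0)" for q p
 have G: "gd (G q) \<and> br (G q) z = (case q of (u, v) \<Rightarrow> if pair_moved n M u v then e u v * FI n a e (mlist n M u v @ l) [] z else 0)" if "q \<in> prs n" for q
 proof -
  obtain u v where q: "q = (u, v)" by (cases q)
  have 0: "gd (\<lambda>p. 0)" "br (\<lambda>p. 0) z = 0" by (simp_all add: gd_def br_def)
  show ?thesis
  proof (cases "pair_moved n M u v \<and> e u v \<noteq> 0")
   case True
   have *: "G q = (\<lambda>p. e u v * mon (mlist n M u v @ l) p)" using True by (simp add: G_def q fun_eq_iff)
   show ?thesis unfolding * using True gd_mult[OF gd_mon[OF g[of u v]]] that by (simp add: br_mult br_mon q)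
  next
   case False
   then have "G q = (\<lambda>p. 0)" by (auto simp: G_def q fun_eq_iff)
   then show ?thesis using 0 False by (auto simp: q)
  qed
 qed
 have ps: "(\<lambda>p. mon l p * kcr M p) = (\<lambda>p. (\<Sum>q\<in>prs n. G q p) + (\<Sum>j\<in>M. a j) * mon l p)"
  unfolding G_def using pair_sum[OF M] by (simp add: fun_eq_iff)
 show ?c2
  unfolding ps using G gd_mon[OF l] by (intro gd_add gd_sum gd_mult) auto
 have "br (\<lambda>p. mon l p * kcr M p) z = (\<Sum>q\<in>prs n. br (G q) z) + (\<Sum>j\<in>M. a j) * br (mon l) z"
  unfolding ps using G gd_mon[OF l] z by (subst br_add) (auto intro!: gd_sum simp: br_mult br_sum simp del: Compl_iff insert_iff)
 also have "\<dots> = z * wirtinger (FI n a e l []) z"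
  using G theta_FI[of z] z by (simp add: br_mon cong: sum.cong)
 finally show ?c1 by (simp add: th_def)
qed

text \<open>Since every dilation moves \<open>z\<close>, the graphs of one sum may be dilated along
  different sets. This freedom is what lets the surplus terms of different graphs cancel.\<close>

lemma theta_br:
 assumes I: "finite I" and M: "\<And>i. i \<in> I \<Longrightarrow> M i \<subseteq> {..<n}" and l: "\<And>i. i \<in> I \<Longrightarrow> good (l i)"
  and lM: "\<And>i u v. i \<in> I \<Longrightarrow> (u, v) \<in> set (l i) \<Longrightarrow> u \<in> moved n (M i) \<longleftrightarrow> v \<in> moved n (M i)"
  and cl: "\<And>i u v. i \<in> I \<Longrightarrow> u \<in> moved n (M i) \<Longrightarrow> v \<le> n + 1 \<Longrightarrow> v \<notin> moved n (M i) \<Longrightarrow> e u v \<noteq> 0 \<Longrightarrow> good ((u, v) # l i)"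
  and F: "F = (\<lambda>p. \<Sum>i\<in>I. mon (l i) p)"
  and G: "\<And>z p. z \<in> Om \<Longrightarrow> points n z p \<Longrightarrow> (\<Sum>i\<in>I. mon (l i) p * kcr (M i) p) = G p"
  and z: "z \<in> Om"
 shows "th (br F) z = br G z"
proof -
 have eq: "br F z = (\<Sum>i\<in>I. FI n a e (l i) [] z)" if "z \<in> Om" for z
  unfolding F using br_sum[OF I _ that, of "\<lambda>i. mon (l i)"] gd_mon[OF l] by (simp add: br_mon)
 have "th (br F) z = th (\<lambda>z. \<Sum>i\<in>I. FI n a e (l i) [] z) z"
  by (rule th_cong[OF open_Om eq z])
 also have "\<dots> = (\<Sum>i\<in>I. th (FI n a e (l i) []) z)"
 proof -
  have "wirtinger (\<lambda>z. \<Sum>i\<in>I. FI n a e (l i) [] z) z = (\<Sum>i\<in>I. wirtinger (FI n a e (l i) []) z)"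
   using wsmooth_sum[where f="\<lambda>i. FI n a e (l i) []", OF open_Om I good_wsmooth[OF l]] z by blast
  then show ?thesis by (simp add: th_def sum_distrib_left)
 qed
 also have "\<dots> = (\<Sum>i\<in>I. br (\<lambda>p. mon (l i) p * kcr (M i) p) z)"
  by (rule sum.cong[OF refl]) (rule theta_br1(1)[OF M l lM cl z])
 also have "\<dots> = br (\<lambda>p. \<Sum>i\<in>I. mon (l i) p * kcr (M i) p) z"
  by (rule br_sum[OF I _ z, symmetric]) (rule theta_br1(2)[OF M l lM cl z])
 also have "\<dots> = br G z" by (rule br_cong(1)[OF z G[OF z]])
 finally show ?thesis .
qed

lemma br_wsmooth:
 assumes I: "finite I" and l: "\<And>i. i \<in> I \<Longrightarrow> good (l i)" and F: "F = (\<lambda>p. \<Sum>i\<in>I. mon (l i) p)"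
 shows "wsmooth Om (br F)"
proof (rule wsmooth_cong[OF open_Om])
 show "wsmooth Om (\<lambda>z. \<Sum>i\<in>I. FI n a e (l i) [] z)" using wsmooth_sum[where f="\<lambda>i. FI n a e (l i) []", OF open_Om I good_wsmooth[OF l]] by blast
 show "(\<Sum>i\<in>I. FI n a e (l i) [] z) = br F z" if "z \<in> Om" for z
  unfolding F using br_sum[OF I _ that, of "\<lambda>i. mon (l i)"] gd_mon[OF l] by (simp add: br_mon)
qed

lemma kap_empty: "kap {} = 0"
proof -
 have "{p \<in> prs n. fst p \<in> moved n {} \<and> snd p \<in> moved n {}} = {}" by (auto simp: prs_def moved_def)
 then show ?thesis unfolding kap_def by (simp only: sum.empty add_0_left)
qed

lemma kap_insert:
 assumes j: "j < n" "j \<notin> M" "M \<subseteq> {..<n}"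
 shows "kap (insert j M) = kap M + a j + (\<Sum>u\<in>moved n M. e j u)"
proof -
 define S where "S = moved n M"
 have S: "finite S" "j \<notin> S" "S \<subseteq> {..n}" "moved n (insert j M) = insert j S"
  using j by (auto simp: S_def moved_def intro: finite_subset[of M "{..<n}"])
 define P where "P T = {p \<in> prs n. fst p \<in> T \<and> snd p \<in> T}" for T
 \<comment> \<open>The set \<open>prs\<close> stores every pair in increasing order.\<close>
 define q where "q u = (min j u, max j u)" for u
 have inj: "inj_on q S"
 proof (rule inj_onI)
  fix x y assume "x \<in> S" "y \<in> S" "q x = q y"
  then have "min j x = min j y" "max j x = max j y" by (auto simp: q_def)
  then show "x = y" by (auto simp: min_def max_def split: if_splits)
 qed
 have un: "P (insert j S) = P S \<union> q ` S"
 proof (intro equalityI subsetI)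
  fix r assume "r \<in> P (insert j S)"
  then obtain u v where r: "r = (u, v)" "u < v" "u < n" "v \<le> n + 1" "u \<in> insert j S" "v \<in> insert j S" by (auto simp: P_def prs_def)
  show "r \<in> P S \<union> q ` S"
  proof (cases "u = j \<or> v = j")
   case True
   then have "r = q (if u = j then v else u)" "(if u = j then v else u) \<in> S" using r by (auto simp: q_def)
   then show ?thesis by blast
  next
   case False
   then show ?thesis using r by (auto simp: P_def prs_def)
  qed
 next
  fix r assume r: "r \<in> P S \<union> q ` S"
  show "r \<in> P (insert j S)"
  proof (cases "r \<in> P S")
   case False
   then obtain u where u: "u \<in> S" "r = q u" using r by blast
   then have "u \<noteq> j" "u \<le> n" using S by auto
   then show ?thesis using u j(1) by (auto simp: P_def prs_def q_def min_def max_def)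
  qed (auto simp: P_def)
 qed
 have disj: "P S \<inter> q ` S = {}" using S(2) by (auto simp: P_def q_def min_def max_def split: if_splits)
 have finP: "finite (P S)" by (simp add: P_def)
 have "(\<Sum>(u, v)\<in>P (insert j S). e u v) = (\<Sum>(u, v)\<in>P S. e u v) + (\<Sum>(u, v)\<in>q ` S. e u v)"
  unfolding un using finP S disj by (intro sum.union_disjoint) auto
 also have "(\<Sum>(u, v)\<in>q ` S. e u v) = (\<Sum>u\<in>S. e j u)"
  using inj by (subst sum.reindex) (auto intro!: sum.cong simp: q_def min_def max_def e_sym)
 finally show ?thesis using j finite_subset[OF j(3)] by (simp add: kap_def S(4) S_def[symmetric] P_def)
qed

end

section \<open>The exponents of the B2 integral\<close>

definition lexp :: "nat \<Rightarrow> nat \<Rightarrow> complex \<Rightarrow> nat \<Rightarrow> nat \<Rightarrow> complex" where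
 "lexp n1 n h u v = (let k = (\<lambda>u. if u < n1 then 0 else if u < n then 1 else if u = n then 2 else 3 :: nat);
   c = (\<lambda>i j. if i = 0 \<and> j = 0 then - 2 * h else if i = 1 \<and> j = 1 then - h else if i = 0 \<and> j = 1 then h
      else if i = 1 \<and> j = 2 then h / 2 else if i = 0 \<and> j = 3 then h else 0)
  in c (min (k u) (k v)) (max (k u) (k v)))"

definition lcoef :: "nat \<Rightarrow> complex \<Rightarrow> complex \<Rightarrow> nat \<Rightarrow> complex" where
 "lcoef n1 \<alpha> \<beta> j = (if j < n1 then \<alpha> else \<beta>)"

text \<open>The value of \<open>kap\<close> on x variables of the first kind and y of the second:
  each of the latter has exponent h / 2 with \<open>z\<close>, and the pairs among the variables
  contribute -2 h, -h and h.\<close>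

definition cL :: "complex \<Rightarrow> complex \<Rightarrow> complex \<Rightarrow> complex \<Rightarrow> complex \<Rightarrow> complex" where
 "cL \<alpha> \<beta> h x y = x * \<alpha> + y * \<beta> + h * (y / 2 - x * (x - 1) - y * (y - 1) / 2 + x * y)"

text \<open>Integrability of all forests is postulated here. It will hold for contracted exponents,
  whereas at s = 1 only \<open>psi\<close> itself is known to be integrable.\<close>

locale ladder =
 fixes n1 n2 N :: nat and \<alpha> \<beta> h :: complex
 assumes N: "N = n1 + n2"
  and reg: "\<And>l z. forest N l \<Longrightarrow> verts l \<subseteq> {..N + 1} \<Longrightarrow> z \<in> Om \<Longrightarrow> integrable (config N) (psx N (lcoef n1 \<alpha> \<beta>) (lexp n1 N h) l [] z)"
begin

abbreviation X where "X \<equiv> {..<n1}"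
abbreviation Y where "Y \<equiv> {n1..<N}"
abbreviation "co i k \<equiv> (X - {i}) \<union> (Y - {k})"

lemma lexp_simps:
 "i \<in> X \<Longrightarrow> j \<in> X \<Longrightarrow> lexp n1 N h i j = - 2 * h"
 "k \<in> Y \<Longrightarrow> l \<in> Y \<Longrightarrow> lexp n1 N h k l = - h"
 "i \<in> X \<Longrightarrow> k \<in> Y \<Longrightarrow> lexp n1 N h i k = h"
 "i \<in> X \<Longrightarrow> k \<in> Y \<Longrightarrow> lexp n1 N h k i = h"
 "i \<in> X \<Longrightarrow> lexp n1 N h i N = 0"
 "i \<in> X \<Longrightarrow> lexp n1 N h N i = 0"
 "k \<in> Y \<Longrightarrow> lexp n1 N h k N = h / 2"
 "k \<in> Y \<Longrightarrow> lexp n1 N h N k = h / 2"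
 "i \<in> X \<Longrightarrow> lexp n1 N h i (Suc N) = h"
 "k \<in> Y \<Longrightarrow> lexp n1 N h k (Suc N) = 0"
 "lexp n1 N h N (Suc N) = 0"
 by (auto simp: lexp_def Let_def N)

sublocale brackets N "lcoef n1 \<alpha> \<beta>" "lexp n1 N h"
proof
 show "lexp n1 N h N (Suc N) = 0" by (rule lexp_simps)
 show "lexp n1 N h u v = lexp n1 N h v u" for u v by (simp add: lexp_def Let_def min.commute max.commute)
qed

lemma kap_eq:
 assumes "M \<subseteq> {..<N}"
 shows "kap M = cL \<alpha> \<beta> h (of_nat (card (M \<inter> X))) (of_nat (card (M \<inter> Y)))"
proof -
 have "finite M" using assms finite_subset by blast
 then show ?thesis using assms
 proof (induction M rule: finite_induct)
  case empty
  show ?case by (simp add: kap_empty cL_def)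
 next
  case (insert j M)
  then have M: "M \<subseteq> {..<N}" "j < N" "j \<notin> M" by auto
  have fin: "finite (M \<inter> X)" "finite (M \<inter> Y)" using insert by auto
  have Mu: "moved N M = insert N ((M \<inter> X) \<union> (M \<inter> Y))" using M N by (auto simp: moved_def)
  have s: "(\<Sum>u\<in>moved N M. lexp n1 N h j u) = lexp n1 N h j N + ((\<Sum>u\<in>M \<inter> X. lexp n1 N h j u) + (\<Sum>u\<in>M \<inter> Y. lexp n1 N h j u))"
   unfolding Mu using fin by (subst sum.insert) (auto simp: N sum.union_disjoint intro!: sum.union_disjoint)
  note IH = insert.IH[OF M(1)]
  show ?case
  proof (cases "j \<in> X")
   case True
   then have "insert j M \<inter> X = insert j (M \<inter> X)" "insert j M \<inter> Y = M \<inter> Y" by auto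
   moreover have "j \<notin> M \<inter> X" using M by simp
   ultimately show ?thesis using fin True
    unfolding kap_insert[OF M(2,3,1)] s IH cL_def by (simp add: lexp_simps lcoef_def field_simps)
  next
   case False
   then have j: "j \<in> Y" using M by simp
   then have "insert j M \<inter> X = M \<inter> X" "insert j M \<inter> Y = insert j (M \<inter> Y)" by auto
   moreover have "j \<notin> M \<inter> Y" using M by simp
   ultimately show ?thesis using fin j
    unfolding kap_insert[OF M(2,3,1)] s IH cL_def by (simp add: lexp_simps lcoef_def field_simps)
  qed
 qed
qed

lemma cross_eq:
 assumes "A \<subseteq> X" "B \<subseteq> Y"
 shows "cross (A \<union> B) p = h * ((\<Sum>i\<in>A. (\<Sum>l\<in>Y - B. p i l) - 2 * (\<Sum>j\<in>X - A. p i j) + p i (Suc N))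
   + (\<Sum>k\<in>B. (\<Sum>j\<in>X - A. p k j) - (\<Sum>l\<in>Y - B. p k l)) + (\<Sum>l\<in>Y - B. p N l) / 2)"
proof -
 have fin: "finite A" "finite B" using assms finite_subset by blast+
 have m: "moved N (A \<union> B) = insert N (A \<union> B)" by (simp add: moved_def)
 let ?C = "insert (Suc N) ((X - A) \<union> (Y - B))"
 have c: "{..N + 1} - insert N (A \<union> B) = insert (Suc N) ((X - A) \<union> (Y - B))" using assms N by (auto simp: le_Suc_eq)
 have nN: "N \<notin> A" "N \<notin> B" "A \<inter> B = {}" using assms N by fastforce+
 have inner: "(\<Sum>v\<in>?C. f v) = f (Suc N) + ((\<Sum>j\<in>X - A. f j) + (\<Sum>l\<in>Y - B. f l))" for f :: conf
 proof -
  have "Suc N \<notin> (X - A) \<union> (Y - B)" "(X - A) \<inter> (Y - B) = {}" by (auto simp: N)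
  then show ?thesis by (simp add: sum.union_disjoint)
 qed
 have A: "(\<Sum>v\<in>?C. lexp n1 N h i v * p i v) = h * ((\<Sum>l\<in>Y - B. p i l) - 2 * (\<Sum>j\<in>X - A. p i j) + p i (Suc N))" if "i \<in> A" for i
 proof -
  have i: "i \<in> X" using that assms by blast
  have "(\<Sum>j\<in>X - A. lexp n1 N h i j * p i j) = (- 2 * h) * (\<Sum>j\<in>X - A. p i j)" "(\<Sum>l\<in>Y - B. lexp n1 N h i l * p i l) = h * (\<Sum>l\<in>Y - B. p i l)"
   unfolding sum_distrib_left by (rule sum.cong; use i lexp_simps in auto)+
  then show ?thesis unfolding inner lexp_simps(9)[OF i] by (simp add: algebra_simps)
 qed
 have B: "(\<Sum>v\<in>?C. lexp n1 N h k v * p k v) = h * ((\<Sum>j\<in>X - A. p k j) - (\<Sum>l\<in>Y - B. p k l))" if "k \<in> B" for k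
 proof -
  have k: "k \<in> Y" using that assms by blast
  have "(\<Sum>j\<in>X - A. lexp n1 N h k j * p k j) = h * (\<Sum>j\<in>X - A. p k j)" "(\<Sum>l\<in>Y - B. lexp n1 N h k l * p k l) = (- h) * (\<Sum>l\<in>Y - B. p k l)"
   unfolding sum_distrib_left by (rule sum.cong; use k lexp_simps in auto)+
  then show ?thesis unfolding inner lexp_simps(10)[OF k] by (simp add: algebra_simps)
 qed
 have C: "(\<Sum>v\<in>?C. lexp n1 N h N v * p N v) = h * (\<Sum>l\<in>Y - B. p N l) / 2"
 proof -
  have "(\<Sum>j\<in>X - A. lexp n1 N h N j * p N j) = 0 * (\<Sum>j\<in>X - A. p N j)" "(\<Sum>l\<in>Y - B. lexp n1 N h N l * p N l) = (h / 2) * (\<Sum>l\<in>Y - B. p N l)"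
   unfolding sum_distrib_left by (rule sum.cong; use lexp_simps in auto)+
  then show ?thesis unfolding inner lexp_simps(11) by simp
 qed
 have "cross (A \<union> B) p = (\<Sum>v\<in>?C. lexp n1 N h N v * p N v) +
   ((\<Sum>i\<in>A. \<Sum>v\<in>?C. lexp n1 N h i v * p i v) + (\<Sum>k\<in>B. \<Sum>v\<in>?C. lexp n1 N h k v * p k v))"
  unfolding cross_def m c using fin nN by (subst sum.insert) (auto simp: sum.union_disjoint)
 also have "\<dots> = h * (\<Sum>l\<in>Y - B. p N l) / 2 + ((\<Sum>i\<in>A. h * ((\<Sum>l\<in>Y - B. p i l) - 2 * (\<Sum>j\<in>X - A. p i j) + p i (Suc N))) + (\<Sum>k\<in>B. h * ((\<Sum>j\<in>X - A. p k j) - (\<Sum>l\<in>Y - B. p k l))))"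
  using A B C by simp
 finally show ?thesis unfolding sum_distrib_left[symmetric] by (simp add: distrib_left)
qed

end

section \<open>The ladder of brackets\<close>

lemma off_swap:
 fixes f :: "'a \<Rightarrow> 'a \<Rightarrow> complex"
 assumes "finite A"
 shows "(\<Sum>i\<in>A. \<Sum>j\<in>A - {i}. f i j) = (\<Sum>i\<in>A. \<Sum>j\<in>A - {i}. f j i)"
proof -
 have *: "(\<Sum>j\<in>A - {i}. g j) = (\<Sum>j\<in>A. if i = j then 0 else g j)" if "i \<in> A" for i and g :: "'a \<Rightarrow> complex"
  by (rule sum.mono_neutral_cong_left) (use assms in auto)
 have "(\<Sum>i\<in>A. \<Sum>j\<in>A - {i}. f i j) = (\<Sum>i\<in>A. \<Sum>j\<in>A. if i = j then 0 else f i j)" by (simp add: *)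
 also have "\<dots> = (\<Sum>j\<in>A. \<Sum>i\<in>A. if i = j then 0 else f i j)" by (rule sum.swap)
 also have "\<dots> = (\<Sum>i\<in>A. \<Sum>j\<in>A - {i}. f j i)" by (simp add: * eq_commute)
 finally show ?thesis .
qed

text \<open>A sum over ordered pairs of distinct indices sees only the symmetrised summand. This is
  how the surplus terms of an integration by parts disappear.\<close>

lemma off_cong:
 fixes f :: "'a \<Rightarrow> 'a \<Rightarrow> complex"
 assumes "finite A" "\<And>i j. i \<in> A \<Longrightarrow> j \<in> A \<Longrightarrow> i \<noteq> j \<Longrightarrow> f i j + f j i = g i j + g j i"
 shows "(\<Sum>i\<in>A. \<Sum>j\<in>A - {i}. f i j) = (\<Sum>i\<in>A. \<Sum>j\<in>A - {i}. g i j)"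
proof -
 have "(\<Sum>i\<in>A. \<Sum>j\<in>A - {i}. f i j) + (\<Sum>i\<in>A. \<Sum>j\<in>A - {i}. f j i) = (\<Sum>i\<in>A. \<Sum>j\<in>A - {i}. g i j) + (\<Sum>i\<in>A. \<Sum>j\<in>A - {i}. g j i)"
  unfolding sum.distrib[symmetric] by (intro sum.cong refl assms(2)) auto
 then show ?thesis unfolding off_swap[OF assms(1), of f, symmetric] off_swap[OF assms(1), of g, symmetric] by simp
qed

lemma off_0:
 fixes f :: "'a \<Rightarrow> 'a \<Rightarrow> complex"
 assumes "finite A" "\<And>i j. i \<in> A \<Longrightarrow> j \<in> A \<Longrightarrow> i \<noteq> j \<Longrightarrow> f i j + f j i = 0"
 shows "(\<Sum>i\<in>A. \<Sum>j\<in>A - {i}. f i j) = 0"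
 using off_cong[OF assms(1), of f "\<lambda>_ _. 0"] assms(2) by simp

lemma points_fr:
 assumes "points n z p"
 obtains x where "\<And>u v. u \<le> Suc n \<Longrightarrow> v \<le> Suc n \<Longrightarrow> x u = x v \<longleftrightarrow> u = v" "p = (\<lambda>u v. fr (x u) (x v))"
 using assms unfolding points_def inj_on_def by (metis Suc_eq_plus1 atMost_iff)

lemma points_rules:
 assumes p: "points n z p" and "i \<le> Suc n" "j \<le> Suc n" "k \<le> Suc n" "i \<noteq> j" "i \<noteq> k" "j \<noteq> k"
 shows "p i j * p j k + p j i * p i k = p i k * p j k" (is ?c1)
  and "p k i * p i j + p k j * p j i = p k i * p k j" (is ?c2)
  and "p k i * (p j k - 2 * p j i) + p k j * (p i k - 2 * p i j) = - p k i - p k j" (is ?c3)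
  and "p i j = 1 - p j i"
proof -
 obtain x where x: "\<And>u v. u \<le> Suc n \<Longrightarrow> v \<le> Suc n \<Longrightarrow> x u = x v \<longleftrightarrow> u = v" "p = (\<lambda>u v. fr (x u) (x v))"
  using points_fr[OF p] by blast
 have d: "x i \<noteq> x j" "x i \<noteq> x k" "x j \<noteq> x k" using x(1) assms by auto
 show ?c1 unfolding x(2) by (rule fr_antisym(1)) (use d in auto)
 show ?c2 unfolding x(2) by (rule fr_antisym(2)) (use d in auto)
 show ?c3 unfolding x(2) by (rule fr3) (use d in auto)
 show "p i j = 1 - p j i" unfolding x(2) by (rule fr_swap) (use d in auto)
qed

lemma points_rules4:
 assumes p: "points n z p" and "i \<le> Suc n" "j \<le> Suc n" "k \<le> Suc n" "l \<le> Suc n"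
  "i \<noteq> j" "i \<noteq> k" "j \<noteq> k" "l \<noteq> i" "l \<noteq> j" "l \<noteq> k"
 shows "p l i * p i k * (p k j - 2 * p i j + p l j) + p l j * p j k * (p k i - 2 * p j i + p l i) = 0" (is ?c1)
  and "p k i * p i l * (p k j + p l j - 2 * p i j) + p k j * p j l * (p k i + p l i - 2 * p j i) = 0" (is ?c2)
  and "p k i * p i l * (p j k + p j l - 2 * p j i) + p k j * p j l * (p i k + p i l - 2 * p i j) = 0" (is ?c3)
  and "p i j * p j k * p k l = p i l * (p j k * p k l + (p i j - 1) * p k l + (p i j - 1) * (p j k - 1))" (is ?c4)
proof -
 obtain x where x: "\<And>u v. u \<le> Suc n \<Longrightarrow> v \<le> Suc n \<Longrightarrow> x u = x v \<longleftrightarrow> u = v" "p = (\<lambda>u v. fr (x u) (x v))"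
  using points_fr[OF p] by blast
 have d: "x i \<noteq> x j" "x i \<noteq> x k" "x j \<noteq> x k" "x l \<noteq> x i" "x l \<noteq> x j" "x l \<noteq> x k" using x(1) assms by auto
 show ?c1
  unfolding x(2) by (rule frA) (use d in auto)
 show ?c2
  unfolding x(2) by (rule frB) (use d in auto)
 show ?c3
  unfolding x(2) by (rule frC) (use d in auto)
 show ?c4
  unfolding x(2) by (rule frK) (use d in auto)
qed

lemma points_z1: "points n z p \<Longrightarrow> p n (Suc n) = z / (z - 1)"
 by (auto simp: points_def fr_def)

context brackets begin

definition ok :: "graph \<Rightarrow> nat set \<Rightarrow> bool" where
 "ok l M \<longleftrightarrow> M \<subseteq> {..<n} \<and> good l \<and> (\<forall>(u, v)\<in>set l. u \<in> moved n M \<longleftrightarrow> v \<in> moved n M) \<and>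
   (\<forall>u v. u \<in> moved n M \<longrightarrow> v \<le> n + 1 \<longrightarrow> v \<notin> moved n M \<longrightarrow> e u v \<noteq> 0 \<longrightarrow> good ((u, v) # l))"

lemma theta_ok:
 assumes I: "finite I" and ok: "\<And>i. i \<in> I \<Longrightarrow> ok (l i) (M i)" and z: "z \<in> Om"
  and F: "\<And>p. F p = (\<Sum>i\<in>I. mon (l i) p)"
  and G: "\<And>p. points n z p \<Longrightarrow> (\<Sum>i\<in>I. mon (l i) p * kcr (M i) p) = G p"
 shows "th (br F) z = br G z"
proof -
 have "th (br F) z = br (\<lambda>p. \<Sum>i\<in>I. mon (l i) p * kcr (M i) p) z"
  by (rule theta_br[OF I _ _ _ _ _ _ z]) (use ok F in \<open>auto simp: ok_def\<close>)
 also have "\<dots> = br G z" by (rule br_cong(1)[OF z G])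
 finally show ?thesis .
qed

lemma theta_ok2:
 assumes "finite A" "finite B" and ok: "\<And>k i. k \<in> A \<Longrightarrow> i \<in> B \<Longrightarrow> ok (l k i) (M k i)" and z: "z \<in> Om"
  and F: "\<And>p. F p = (\<Sum>k\<in>A. \<Sum>i\<in>B. mon (l k i) p)"
  and G: "\<And>p. points n z p \<Longrightarrow> (\<Sum>k\<in>A. \<Sum>i\<in>B. mon (l k i) p * kcr (M k i) p) = G p"
 shows "th (br F) z = br G z"
 by (rule theta_ok[of "A \<times> B" "\<lambda>(k, i). l k i" "\<lambda>(k, i). M k i"])
  (use assms in \<open>auto simp: sum.cartesian_product split_beta\<close>)

lemma theta_ok3:
 assumes "finite A" "finite B" and ok: "\<And>k i j. k \<in> A \<Longrightarrow> i \<in> B \<Longrightarrow> j \<in> A - {k} \<Longrightarrow> ok (l k i j) (M k i j)" and z: "z \<in> Om"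
  and F: "\<And>p. F p = (\<Sum>k\<in>A. \<Sum>i\<in>B. \<Sum>j\<in>A - {k}. mon (l k i j) p)"
  and G: "\<And>p. points n z p \<Longrightarrow> (\<Sum>k\<in>A. \<Sum>i\<in>B. \<Sum>j\<in>A - {k}. mon (l k i j) p * kcr (M k i j) p) = G p"
 shows "th (br F) z = br G z"
proof (rule theta_ok[of "Sigma A (\<lambda>k. B \<times> (A - {k}))" "\<lambda>(k, i, j). l k i j" "\<lambda>(k, i, j). M k i j"])
 have s: "(\<Sum>q\<in>Sigma A (\<lambda>k. B \<times> (A - {k})). f (fst q) (fst (snd q)) (snd (snd q))) = (\<Sum>k\<in>A. \<Sum>i\<in>B. \<Sum>j\<in>A - {k}. f k i j)" for f :: "_ \<Rightarrow> _ \<Rightarrow> _ \<Rightarrow> complex"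
  using assms(1,2) by (simp add: sum.cartesian_product sum.Sigma split_beta)
 show "F p = (\<Sum>i\<in>Sigma A (\<lambda>k. B \<times> (A - {k})). mon (case i of (k, i, j) \<Rightarrow> l k i j) p)" for p
  using F[of p] s[of "\<lambda>k i j. mon (l k i j) p"] by (simp add: split_beta)
 show "(\<Sum>i\<in>Sigma A (\<lambda>k. B \<times> (A - {k})). mon (case i of (k, i, j) \<Rightarrow> l k i j) p * kcr (case i of (k, i, j) \<Rightarrow> M k i j) p) = G p"
  if "points n z p" for p
  using G[OF that] s[of "\<lambda>k i j. mon (l k i j) p * kcr (M k i j) p"] by (simp add: split_beta)
qed (use assms in auto)

lemma gd_monI: "good l \<Longrightarrow> (\<And>p. F p = mon l p) \<Longrightarrow> gd F"
 using gd_mon[of l] by (simp add: gd_def)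

lemma goodI: "verts l \<subseteq> {..n + 1} \<Longrightarrow> gd (mon l) \<Longrightarrow> good l"
 by (simp add: good_def gd_def psx_mon)

lemma good_perm: "good l \<Longrightarrow> mset l' = mset l \<Longrightarrow> good l'"
proof -
 assume l: "good l" and m: "mset l' = mset l"
 have "prod_mset (image_mset (\<lambda>(u, v). p u v) (mset l')) = prod_mset (image_mset (\<lambda>(u, v). p u v) (mset l))" for p :: pairing
  using m by simp
 then have "mon l' p = mon l p" for p unfolding mon_def by (simp add: prod_mset_prod_list flip: mset_map)
 moreover have "verts l' = verts l" using mset_eq_setD[OF m] by (simp add: verts_def)
 ultimately show "good l'" using l by (simp add: good_def psx_mon)
qed

end

context ladder begin

lemma forest_good: "forest N l \<Longrightarrow> good l"
proof -
 assume f: "forest N l"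
 have "verts l \<subseteq> {..N + 1}" using f by (induction N l rule: forest.induct) auto
 then show ?thesis using reg[OF f] by (simp add: good_def)
qed

lemma YX: "k \<in> Y \<Longrightarrow> k < N" "i \<in> X \<Longrightarrow> i < N" "k \<in> Y \<Longrightarrow> i \<in> X \<Longrightarrow> k \<noteq> i" "k \<in> Y \<Longrightarrow> i \<in> X \<Longrightarrow> i \<noteq> k" "k \<in> Y \<Longrightarrow> k \<noteq> N" "i \<in> X \<Longrightarrow> i \<noteq> N"
 by (auto simp: N)

text \<open>This graph joins the fixed points \<open>z\<close> and 1 and is no forest, but
  \<open>frK\<close> writes it as z / (z - 1) times a combination of forests.\<close>

lemma good_path:
 assumes k: "k \<in> Y" and i: "i \<in> X"
 shows "good [(N, k), (k, i), (i, Suc N)]"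
proof (rule goodI)
 note d = YX(1)[OF k] YX(2)[OF i] YX(3,4)[OF k i] YX(5)[OF k] YX(6)[OF i]
 show "verts [(N, k), (k, i), (i, Suc N)] \<subseteq> {..N + 1}" using d by simp
 show "gd (mon [(N, k), (k, i), (i, Suc N)])"
 proof (rule gd_cong[of _ "\<lambda>z. z / (z - 1)"])
  show "mon [(N, k), (k, i), (i, Suc N)] p = z / (z - 1) * (mon [(k, i), (i, Suc N)] p + mon [(N, k), (i, Suc N)] p - mon [(i, Suc N)] p
    + mon [(N, k), (k, i)] p - mon [(N, k)] p - mon [(k, i)] p + mon [] p)" if "points N z p" for z p
   using points_rules4(4)[OF that, of N k i "Suc N"] d points_z1[OF that] by (simp add: algebra_simps)
  show "gd (\<lambda>p. mon [(k, i), (i, Suc N)] p + mon [(N, k), (i, Suc N)] p - mon [(i, Suc N)] p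
    + mon [(N, k), (k, i)] p - mon [(N, k)] p - mon [(k, i)] p + mon [] p)"
   by (intro gd_add gd_diff gd_mon good_perm[OF forest_good[of "[(k, i), (N, k)]"], of "[(N, k), (k, i)]"] forest_good) (use d in auto)
 qed
qed

text \<open>The same rewriting, with the extra leaf at \<open>i\<close> carried along as a common
  factor.\<close>

lemma good_path_leaf:
 assumes k: "k \<in> Y" and i: "i \<in> X" and l: "l \<in> Y - {k}"
 shows "good [(i, l), (N, k), (k, i), (i, Suc N)]"
proof (rule goodI)
 note d = YX(1)[OF k] YX(2)[OF i] YX(3,4)[OF k i] YX(5)[OF k] YX(6)[OF i]
 have d': "l < N" "l \<noteq> k" "l \<noteq> i" "i \<noteq> l" "l \<noteq> N" "k \<noteq> l" "n1 \<le> l" using l i by (auto simp: N)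
 show "verts [(i, l), (N, k), (k, i), (i, Suc N)] \<subseteq> {..N + 1}" using d d' by simp
 show "gd (mon [(i, l), (N, k), (k, i), (i, Suc N)])"
 proof (rule gd_cong[of _ "\<lambda>z. z / (z - 1)"])
  show "mon [(i, l), (N, k), (k, i), (i, Suc N)] p = z / (z - 1) * (mon [(i, l), (k, i), (i, Suc N)] p + mon [(i, l), (N, k), (i, Suc N)] p - mon [(i, l), (i, Suc N)] p
    + mon [(i, l), (k, i), (N, k)] p - mon [(i, l), (N, k)] p - mon [(i, l), (k, i)] p + mon [(i, l)] p)" if "points N z p" for z p
  proof -
   have "p N k * p k i * p i (Suc N) = z / (z - 1) * (p k i * p i (Suc N) + (p N k - 1) * p i (Suc N) + (p N k - 1) * (p k i - 1))"
    using points_rules4(4)[OF that, of N k i "Suc N"] d points_z1[OF that] by simp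
   then have "p i l * (p N k * p k i * p i (Suc N)) = p i l * (z / (z - 1) * (p k i * p i (Suc N) + (p N k - 1) * p i (Suc N) + (p N k - 1) * (p k i - 1)))"
    by (simp only:)
   then show ?thesis by (simp add: algebra_simps)
  qed
  show "gd (\<lambda>p. mon [(i, l), (k, i), (i, Suc N)] p + mon [(i, l), (N, k), (i, Suc N)] p - mon [(i, l), (i, Suc N)] p
    + mon [(i, l), (k, i), (N, k)] p - mon [(i, l), (N, k)] p - mon [(i, l), (k, i)] p + mon [(i, l)] p)"
   by (intro gd_add gd_diff gd_mon forest_good) (use d d' in auto)
 qed
qed

text \<open>A new edge with an endpoint outside \<open>l\<close>, \<open>z\<close> and 1 brings a
  fresh variable and yields a forest again. Only edges between the vertices of \<open>l\<close> and
  the two fixed points have to be examined.\<close>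

lemma okI:
 assumes f: "forest N l" and M: "M \<subseteq> {..<N}" and lM: "\<forall>(u, v)\<in>set l. u \<in> moved N M \<longleftrightarrow> v \<in> moved N M"
  and sp: "\<And>u v. u \<in> moved N M \<Longrightarrow> v \<notin> moved N M \<Longrightarrow> u \<in> insert N (verts l) \<Longrightarrow> v \<in> insert (Suc N) (verts l) \<Longrightarrow>
    lexp n1 N h u v \<noteq> 0 \<Longrightarrow> good ((u, v) # l)"
 shows "ok l M"
 unfolding ok_def
proof (intro conjI allI impI)
 show "good l" by (rule forest_good[OF f])
 fix u v assume h: "u \<in> moved N M" "v \<le> N + 1" "v \<notin> moved N M" "lexp n1 N h u v \<noteq> 0"
 have Nm: "N \<in> moved N M" by (simp add: moved_def)
 show "good ((u, v) # l)"
 proof (cases "u \<in> insert N (verts l) \<and> v \<in> insert (Suc N) (verts l)")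
  case True
  then show ?thesis using sp h by blast
 next
  case False
  have "u \<noteq> v" "u \<le> N" "v \<noteq> N" using h M Nm by (auto simp: moved_def)
  then have "forest N ((u, v) # l)" using False h f by auto
  then show ?thesis by (rule forest_good)
 qed
qed (use M lM in auto)

end

section \<open>The brackets of the ladder and the Euler derivative of the integral itself\<close>

context ladder begin

lemmas pull = sum.distrib sum_distrib_left[symmetric, where r=h] sum_distrib_left[symmetric, where r="h / 2"]

abbreviation o1 where "o1 \<equiv> Suc N"

text \<open>Read as graphs, with k, l of kind \<open>root2\<close> and i, j of kind
  \<open>root1\<close>: the F descend from \<open>z\<close>, the E hang on 1, the K join
  \<open>z\<close> to 1, without or with a further leaf, \<open>Q2\<close> and \<open>N3\<close>
  have one tree at each fixed point, and \<open>U1\<close>, \<open>D2\<close> touch neither. In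
  \<open>V2\<close> and \<open>T2\<close> the indices may coincide, so these products contain
  \<open>F2\<close> and \<open>E2\<close>.\<close>

definition "F1 p = (\<Sum>k\<in>Y. p N k)"
definition "F2 p = (\<Sum>k\<in>Y. \<Sum>i\<in>X. p N k * p k i)"
definition "F3 p = (\<Sum>k\<in>Y. \<Sum>i\<in>X. \<Sum>l\<in>Y - {k}. p N k * p k i * p i l)"
definition "K2 p = (\<Sum>k\<in>Y. \<Sum>i\<in>X. p N k * p k i * p i o1)"
definition "K3 p = (\<Sum>k\<in>Y. \<Sum>i\<in>X. \<Sum>l\<in>Y - {k}. p N k * p k i * p i l * p i o1)"
definition "E1 p = (\<Sum>i\<in>X. p i o1)"
definition "E2 p = (\<Sum>k\<in>Y. \<Sum>i\<in>X. p k i * p i o1)"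
definition "E3 p = (\<Sum>k\<in>Y. \<Sum>i\<in>X. \<Sum>l\<in>Y - {k}. p k i * p l i * p i o1)"
definition "Q2 p = (\<Sum>k\<in>Y. \<Sum>i\<in>X. p N k * p i o1)"
definition "N3 p = (\<Sum>k\<in>Y. \<Sum>i\<in>X. \<Sum>l\<in>Y - {k}. p N k * p l i * p i o1)"
definition "U1 p = (\<Sum>k\<in>Y. \<Sum>i\<in>X. p k i)"
definition "V2 p = (\<Sum>k\<in>Y. \<Sum>i\<in>X. \<Sum>l\<in>Y. p N k * p l i)"
definition "T2 p = (\<Sum>k\<in>Y. \<Sum>i\<in>X. \<Sum>j\<in>X. p k i * p j o1)"
definition "D2 p = (\<Sum>k\<in>Y. \<Sum>i\<in>X. \<Sum>l\<in>Y - {k}. p k i * p l i)"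

lemma XY_simps [simp]: "X \<subseteq> {..<N}" "Y \<subseteq> {..<N}" "card Y = n2" "(X \<union> Y) \<inter> X = X" "(X \<union> Y) \<inter> Y = Y" "Y \<inter> X = {}" "X \<inter> Y = {}" "n1 \<le> N"
  "complex_of_nat N - of_nat n1 = of_nat n2" "N - n1 = n2" "\<not> N < n1" "\<not> Suc N < n1" "n1 \<le> Suc N"
 by (auto simp: N)

lemma gd_brackets [simp, intro]:
 "gd (\<lambda>p. c)" "gd F1" "gd F2" "gd F3" "gd K2" "gd K3" "gd E1" "gd E2" "gd E3" "gd Q2" "gd N3" "gd U1" "gd V2" "gd T2" "gd D2"
proof -
 have g: "gd F" if "forest N l" "\<And>p. F p = mon l p" for l F
  using gd_monI[OF forest_good[OF that(1)] that(2)] by blast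
 have 1: "gd (\<lambda>p. 1)" by (rule g[of "[]"]) simp_all
 show "gd (\<lambda>p. c)" using gd_mult[OF 1, of c] by simp
 show "gd F1" unfolding F1_def
 proof (intro gd_sum)
  fix k assume h: "k \<in> Y"
  show "gd (\<lambda>p. p N k)" by (rule g[of "[(N, k)]"]) (use h in \<open>auto simp: N\<close>)
 qed
 show "gd F2" unfolding F2_def
 proof (intro gd_sum)
  fix k i assume h: "k \<in> Y" "i \<in> X"
  show "gd (\<lambda>p. p N k * p k i)" by (rule g[of "[(k, i), (N, k)]"]) (use h in \<open>auto simp: N\<close>)
 qed
 show "gd F3" unfolding F3_def
 proof (intro gd_sum)
  fix k i l assume h: "k \<in> Y" "i \<in> X" "l \<in> Y - {k}"
  show "gd (\<lambda>p. p N k * p k i * p i l)" by (rule g[of "[(i, l), (k, i), (N, k)]"]) (use h in \<open>auto simp: N\<close>)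
 qed
 show "gd E1" unfolding E1_def
 proof (intro gd_sum)
  fix i assume h: "i \<in> X"
  show "gd (\<lambda>p. p i o1)" by (rule g[of "[(i, o1)]"]) (use h in \<open>auto simp: N\<close>)
 qed
 show "gd E2" unfolding E2_def
 proof (intro gd_sum)
  fix k i assume h: "k \<in> Y" "i \<in> X"
  show "gd (\<lambda>p. p k i * p i o1)" by (rule g[of "[(k, i), (i, o1)]"]) (use h in \<open>auto simp: N\<close>)
 qed
 show "gd E3" unfolding E3_def
 proof (intro gd_sum)
  fix k i l assume h: "k \<in> Y" "i \<in> X" "l \<in> Y - {k}"
  show "gd (\<lambda>p. p k i * p l i * p i o1)" by (rule g[of "[(k, i), (l, i), (i, o1)]"]) (use h in \<open>auto simp: N\<close>)
 qed
 show "gd Q2" unfolding Q2_def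
 proof (intro gd_sum)
  fix k i assume h: "k \<in> Y" "i \<in> X"
  show "gd (\<lambda>p. p N k * p i o1)" by (rule g[of "[(N, k), (i, o1)]"]) (use h in \<open>auto simp: N\<close>)
 qed
 show "gd N3" unfolding N3_def
 proof (intro gd_sum)
  fix k i l assume h: "k \<in> Y" "i \<in> X" "l \<in> Y - {k}"
  show "gd (\<lambda>p. p N k * p l i * p i o1)" by (rule g[of "[(N, k), (l, i), (i, o1)]"]) (use h in \<open>auto simp: N\<close>)
 qed
 show "gd U1" unfolding U1_def
 proof (intro gd_sum)
  fix k i assume h: "k \<in> Y" "i \<in> X"
  show "gd (\<lambda>p. p k i)" by (rule g[of "[(k, i)]"]) (use h in \<open>auto simp: N\<close>)
 qed
 show "gd V2" unfolding V2_def
 proof (intro gd_sum)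
  fix k i l assume h: "k \<in> Y" "i \<in> X" "l \<in> Y"
  show "gd (\<lambda>p. p N k * p l i)" by (rule g[of "[(l, i), (N, k)]"]) (use h in \<open>auto simp: N\<close>)
 qed
 show "gd T2" unfolding T2_def
 proof (intro gd_sum)
  fix k i j assume h: "k \<in> Y" "i \<in> X" "j \<in> X"
  show "gd (\<lambda>p. p k i * p j o1)" by (rule g[of "[(k, i), (j, o1)]"]) (use h in \<open>auto simp: N\<close>)
 qed
 show "gd D2" unfolding D2_def
 proof (intro gd_sum)
  fix k i l assume h: "k \<in> Y" "i \<in> X" "l \<in> Y - {k}"
  show "gd (\<lambda>p. p k i * p l i)" by (rule g[of "[(k, i), (l, i)]"]) (use h in \<open>auto simp: N\<close>)
 qed
 show "gd K2" unfolding K2_def by (intro gd_sum gd_monI[OF good_path]) auto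
 show "gd K3" unfolding K3_def by (intro gd_sum gd_monI[OF good_path_leaf]) auto
qed

text \<open>Three dilations of one integral: of \<open>z\<close> alone, of \<open>z\<close> with all
  variables, and of \<open>z\<close> with \<open>Y\<close>. They express \<open>F1\<close>,
  \<open>E1\<close> and \<open>U1\<close> through the integral.\<close>

lemma theta_H:
 assumes z: "z \<in> Om"
 shows "th (br (\<lambda>p. 1)) z = h / 2 * br F1 z" (is ?c1)
  and "th (br (\<lambda>p. 1)) z = cL \<alpha> \<beta> h (of_nat n1) (of_nat n2) * br (\<lambda>p. 1) z + h * br E1 z" (is ?c2)
  and "th (br (\<lambda>p. 1)) z = cL \<alpha> \<beta> h 0 (of_nat n2) * br (\<lambda>p. 1) z + h * br U1 z" (is ?c3)
proof -
 have t: "th (br (\<lambda>p. 1)) z = br G z" if "A \<subseteq> X" "B \<subseteq> Y" "\<And>p. kcr (A \<union> B) p = G p" for G A B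
 proof (rule theta_ok[of "{()}" "\<lambda>_. []" "\<lambda>_. A \<union> B"])
  show "ok [] (A \<union> B)"
  proof (rule okI)
   show "A \<union> B \<subseteq> {..<N}" by (rule Un_least[OF order_trans[OF that(1) XY_simps(1)] order_trans[OF that(2) XY_simps(2)]])
  qed (auto simp: lexp_simps)
 qed (use that z in auto)
 have "th (br (\<lambda>p. 1)) z = br (\<lambda>p. h / 2 * F1 p) z"
  by (rule t[of "{}" "{}"]) (use cross_eq[of "{}" "{}"] in \<open>simp_all add: kap_empty F1_def\<close>)
 then show ?c1 by (simp only: br_mult)
 have "th (br (\<lambda>p. 1)) z = br (\<lambda>p. cL \<alpha> \<beta> h (of_nat n1) (of_nat n2) * 1 + h * E1 p) z"
  by (rule t[of X Y]) (use kap_eq[of "X \<union> Y"] cross_eq[of X Y] in \<open>simp_all add: E1_def\<close>)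
 also have "\<dots> = cL \<alpha> \<beta> h (of_nat n1) (of_nat n2) * br (\<lambda>p. 1) z + h * br E1 z"
  using z by (subst br_add) (auto simp only: br_mult intro!: gd_mult gd_brackets)
 finally show ?c2 .
 have "th (br (\<lambda>p. 1)) z = br (\<lambda>p. cL \<alpha> \<beta> h 0 (of_nat n2) * 1 + h * U1 p) z"
  by (rule t[of "{}" Y]) (use kap_eq[of Y] cross_eq[of "{}" Y] in \<open>simp_all add: U1_def\<close>)
 also have "\<dots> = cL \<alpha> \<beta> h 0 (of_nat n2) * br (\<lambda>p. 1) z + h * br U1 z"
  using z by (subst br_add) (auto simp only: br_mult intro!: gd_mult gd_brackets)
 finally show ?c3 .
qed

end

context brackets begin

lemma br_lin2:
 assumes "gd A" "gd B" "z \<in> Om"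
 shows "br (\<lambda>p. r * A p + s * B p) z = r * br A z + s * br B z"
 using br_add[OF gd_mult[OF assms(1), of r] gd_mult[OF assms(2), of s] assms(3)] by (simp only: br_mult)

lemma br_lin3:
 assumes "gd A" "gd B" "gd C" "z \<in> Om"
 shows "br (\<lambda>p. r * A p + s * B p + t * C p) z = r * br A z + s * br B z + t * br C z"
 using br_add[OF gd_add[OF gd_mult[OF assms(1), of r] gd_mult[OF assms(2), of s]] gd_mult[OF assms(3), of t] assms(4)]
 by (simp only: br_mult br_lin2[OF assms(1,2,4)])

end

context ladder begin

abbreviation "n1' \<equiv> complex_of_nat n1"
abbreviation "n2' \<equiv> complex_of_nat n2"
abbreviation "\<Lambda> \<equiv> cL \<alpha> \<beta> h"

lemma YXd: "k \<in> Y \<Longrightarrow> i \<in> X \<Longrightarrow> k < N \<and> i < N \<and> k \<noteq> i \<and> i \<noteq> k \<and> k \<noteq> N \<and> i \<noteq> N"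
 by (auto simp: N)

lemma kap_Un:
 assumes "A \<subseteq> X" "B \<subseteq> Y"
 shows "kap (A \<union> B) = \<Lambda> (of_nat (card A)) (of_nat (card B))"
proof -
 have "(A \<union> B) \<inter> X = A" "(A \<union> B) \<inter> Y = B" using assms by fastforce+
 moreover have "A \<union> B \<subseteq> {..<N}" by (rule Un_least[OF order_trans[OF assms(1) XY_simps(1)] order_trans[OF assms(2) XY_simps(2)]])
 ultimately show ?thesis using kap_eq[of "A \<union> B"] by simp
qed

lemma card_minus: "i \<in> X \<Longrightarrow> complex_of_nat (card (X - {i})) = n1' - 1" "k \<in> Y \<Longrightarrow> complex_of_nat (card (Y - {k})) = n2' - 1"
 by (auto simp: card_Diff_singleton of_nat_diff N)

lemma okI':
 assumes "forest N l" "A \<subseteq> X" "B \<subseteq> Y" "\<forall>(u, v)\<in>set l. u \<in> insert N (A \<union> B) \<longleftrightarrow> v \<in> insert N (A \<union> B)"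
  "\<And>u v. u \<in> insert N (A \<union> B) \<Longrightarrow> v \<notin> insert N (A \<union> B) \<Longrightarrow> u \<in> insert N (verts l) \<Longrightarrow> v \<in> insert (Suc N) (verts l) \<Longrightarrow>
    lexp n1 N h u v \<noteq> 0 \<Longrightarrow> good ((u, v) # l)"
 shows "ok l (A \<union> B)"
proof (rule okI)
 show "A \<union> B \<subseteq> {..<N}" by (rule Un_least[OF order_trans[OF assms(2) XY_simps(1)] order_trans[OF assms(3) XY_simps(2)]])
qed (use assms in \<open>simp_all only: moved_def\<close>)

text \<open>An edge between \<open>z\<close> and k forces k to move along. Moving just k,
  everything, or all of \<open>Y\<close> leads to \<open>F2\<close>, \<open>Q2\<close> and
  \<open>V2\<close>.\<close>

lemma theta_F1:
 assumes z: "z \<in> Om"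
 shows "th (br F1) z = \<Lambda> 0 1 * br F1 z + h * br F2 z" (is ?c1)
  and "th (br F1) z = \<Lambda> n1' n2' * br F1 z + h * br Q2 z" (is ?c2)
  and "th (br F1) z = \<Lambda> 0 n2' * br F1 z + h * br V2 z" (is ?c3)
proof -
 have F: "F1 p = (\<Sum>k\<in>Y. mon [(N, k)] p)" for p by (simp add: F1_def)
 have ok: "ok [(N, k)] (A \<union> B)" if "A \<subseteq> X" "B \<subseteq> Y" "k \<in> B" for A B k
  by (rule okI') (use that YX(1,5)[of k] in \<open>auto simp: lexp_simps\<close>)
 have t: "th (br F1) z = br G z" if "\<And>k. k \<in> Y \<Longrightarrow> A \<subseteq> X \<and> B k \<subseteq> Y \<and> k \<in> B k"
  "\<And>p. points N z p \<Longrightarrow> (\<Sum>k\<in>Y. p N k * kcr (A \<union> B k) p) = G p" for A B G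
  by (rule theta_ok[of Y "\<lambda>k. [(N, k)]" "\<lambda>k. A \<union> B k", OF _ _ z F]) (use ok that in auto)
 have "th (br F1) z = br (\<lambda>p. \<Lambda> 0 1 * F1 p + h * F2 p) z"
 proof (rule t[of "{}" "\<lambda>k. {k}"])
  fix p assume p: "points N z p"
  \<comment> \<open>The exponents h / 2 towards \<open>z\<close> and -h between variables of the
    second kind combine to p N l - 2 p k l, whose product with p N k vanishes after symmetrisation
    in k and l.\<close>
  have Z: "(\<Sum>k\<in>Y. \<Sum>l\<in>Y - {k}. p N k * (p N l - 2 * p k l)) = 0"
  proof (rule off_0)
   fix k l assume "k \<in> Y" "l \<in> Y" "k \<noteq> l"
   then have "p N k * p k l + p N l * p l k = p N k * p N l"
    using YX(1,5)[of k] YX(1,5)[of l] by (intro points_rules(2)[OF p]) auto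
   then show "p N k * (p N l - 2 * p k l) + p N l * (p N k - 2 * p l k) = 0" by algebra
  qed simp
  let ?R = "\<lambda>k. \<Lambda> 0 1 * p N k + h * (\<Sum>i\<in>X. p N k * p k i) + h / 2 * (\<Sum>l\<in>Y - {k}. p N k * (p N l - 2 * p k l))"
  have "p N k * kcr ({} \<union> {k}) p = ?R k" if "k \<in> Y" for k
  proof -
   have c: "cross ({} \<union> {k}) p = h * ((\<Sum>j\<in>X. p k j) - (\<Sum>l\<in>Y - {k}. p k l) + (\<Sum>l\<in>Y - {k}. p N l) / 2)"
    using that by (subst cross_eq) simp_all
   have kk: "kap ({} \<union> {k}) = \<Lambda> 0 1" using that kap_Un[of "{}" "{k}"] by simp
   have s: "(\<Sum>l\<in>Y - {k}. p N k * (p N l - 2 * p k l)) = p N k * ((\<Sum>l\<in>Y - {k}. p N l) - 2 * (\<Sum>l\<in>Y - {k}. p k l))"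
    by (simp add: sum_distrib_left sum_subtractf right_diff_distrib)
   have s2: "(\<Sum>i\<in>X. p N k * p k i) = p N k * (\<Sum>i\<in>X. p k i)" by (simp only: sum_distrib_left)
   show ?thesis unfolding c kk s s2 by (simp add: field_simps)
  qed
  then have "(\<Sum>k\<in>Y. p N k * kcr ({} \<union> {k}) p) = (\<Sum>k\<in>Y. ?R k)"
   by (rule sum.cong[OF refl])
  also have "\<dots> = \<Lambda> 0 1 * F1 p + h * F2 p"
   unfolding pull sum_distrib_left[symmetric, where r="\<Lambda> 0 1"] Z F1_def F2_def by simp
  finally show "(\<Sum>k\<in>Y. p N k * kcr ({} \<union> {k}) p) = \<Lambda> 0 1 * F1 p + h * F2 p" .
 qed auto
 then show ?c1 using z by (simp only: br_lin2 gd_brackets)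
 have "th (br F1) z = br (\<lambda>p. \<Lambda> n1' n2' * F1 p + h * Q2 p) z"
  by (rule t[of X "\<lambda>_. Y"]) (use kap_Un[of X Y] cross_eq[of X Y] in \<open>auto simp: F1_def Q2_def sum_distrib_left sum_distrib_right sum.distrib algebra_simps\<close>)
 then show ?c2 using z by (simp only: br_lin2 gd_brackets)
 have "th (br F1) z = br (\<lambda>p. \<Lambda> 0 n2' * F1 p + h * V2 p) z"
 proof (rule t[of "{}" "\<lambda>_. Y"])
  fix p :: pairing
  have "(\<Sum>i\<in>X. \<Sum>l\<in>Y. p N k * p l i) = p N k * (\<Sum>l\<in>Y. \<Sum>i\<in>X. p l i)" for k
   unfolding sum_distrib_left by (rule sum.swap)
  then have v: "V2 p = (\<Sum>k\<in>Y. p N k) * (\<Sum>l\<in>Y. \<Sum>i\<in>X. p l i)" by (simp only: V2_def sum_distrib_right)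
  have c: "cross ({} \<union> Y) p = h * (\<Sum>l\<in>Y. \<Sum>i\<in>X. p l i)" by (subst cross_eq) simp_all
  have kk: "kap ({} \<union> Y) = \<Lambda> 0 n2'" using kap_Un[of "{}" Y] by simp
  show "(\<Sum>k\<in>Y. p N k * kcr ({} \<union> Y) p) = \<Lambda> 0 n2' * F1 p + h * V2 p"
   unfolding c kk v F1_def sum_distrib_right[symmetric] by (simp add: algebra_simps)
 qed auto
 then show ?c3 using z by (simp only: br_lin2 gd_brackets)
qed

lemma cross_X_off:
 assumes "points N z p" "i \<in> X"
 shows "p i o1 * cross ((X - {i}) \<union> Y) p = h * (\<Sum>k\<in>Y. p k i * p i o1) + h * (\<Sum>j\<in>X - {i}. p i o1 * (p j o1 - 2 * p j i))"
proof -
 have e: "X - (X - {i}) = {i}" using assms by auto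
 have "cross ((X - {i}) \<union> Y) p = h * ((\<Sum>j\<in>X - {i}. p j o1 - 2 * p j i) + (\<Sum>k\<in>Y. p k i))"
  by (subst cross_eq) (simp_all add: e)
 then show ?thesis by (simp only:) (simp add: sum_distrib_left sum.distrib sum_subtractf algebra_simps)
qed

text \<open>The same cancellation seen from the point 1, with exponent h towards 1 and -2 h between
  variables of the first kind.\<close>

lemma off_X_zero:
 assumes p: "points N z p"
 shows "(\<Sum>i\<in>X. \<Sum>j\<in>X - {i}. p i o1 * (p j o1 - 2 * p j i)) = 0"
proof (rule off_0)
 fix i j assume "i \<in> X" "j \<in> X" "i \<noteq> j"
 then have "p j i * p i o1 + p i j * p j o1 = p j o1 * p i o1"
  using YX(2)[of i] YX(2)[of j] by (intro points_rules(1)[OF p]) auto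
 then show "p i o1 * (p j o1 - 2 * p j i) + p j o1 * (p i o1 - 2 * p i j) = 0" by algebra
qed simp

text \<open>An edge between i and 1 forces i to stay. With all other variables moving, every new
  edge ends at i or at 1.\<close>

lemma theta_E1:
 assumes z: "z \<in> Om"
 shows "th (br E1) z = \<Lambda> (n1' - 1) n2' * br E1 z + h * br E2 z"
proof -
 have "th (br E1) z = br (\<lambda>p. \<Lambda> (n1' - 1) n2' * E1 p + h * E2 p) z"
 proof (rule theta_ok[of X "\<lambda>i. [(i, o1)]" "\<lambda>i. (X - {i}) \<union> Y", OF _ _ z])
  show "ok [(i, o1)] ((X - {i}) \<union> Y)" if "i \<in> X" for i
   by (rule okI') (use that YX(2)[of i] in \<open>auto simp: lexp_simps\<close>)
  fix p assume p: "points N z p"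
  let ?R = "\<lambda>i. \<Lambda> (n1' - 1) n2' * p i o1 + h * (\<Sum>k\<in>Y. p k i * p i o1) + h * (\<Sum>j\<in>X - {i}. p i o1 * (p j o1 - 2 * p j i))"
  have "p i o1 * kcr ((X - {i}) \<union> Y) p = ?R i" if "i \<in> X" for i
   using kap_Un[of "X - {i}" Y] cross_X_off[OF p that] by (simp add: card_minus(1)[OF that] distrib_left)
  then have "(\<Sum>i\<in>X. p i o1 * kcr ((X - {i}) \<union> Y) p) = (\<Sum>i\<in>X. ?R i)"
   by (rule sum.cong[OF refl])
  also have "\<dots> = \<Lambda> (n1' - 1) n2' * E1 p + h * (\<Sum>i\<in>X. \<Sum>k\<in>Y. p k i * p i o1)"
   unfolding pull sum_distrib_left[symmetric, where r="\<Lambda> (n1' - 1) n2'"] off_X_zero[OF p] E1_def by simp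
  also have "(\<Sum>i\<in>X. \<Sum>k\<in>Y. p k i * p i o1) = E2 p" unfolding E2_def by (rule sum.swap)
  finally show "(\<Sum>i\<in>X. mon [(i, o1)] p * kcr ((X - {i}) \<union> Y) p) = \<Lambda> (n1' - 1) n2' * E1 p + h * E2 p" by simp
 qed (auto simp: E1_def)
 then show ?thesis using z by (simp only: br_lin2 gd_brackets)
qed

text \<open>Among the new edges into i, the one from k completes a path from \<open>z\<close> to 1
  and gives \<open>K2\<close>; those from other variables of the second kind give \<open>N3\<close>.
  Only the sum of the two brackets is determined here.\<close>

lemma theta_Q2:
 assumes z: "z \<in> Om"
 shows "th (br Q2) z = \<Lambda> (n1' - 1) n2' * br Q2 z + h * br K2 z + h * br N3 z"
proof -
 have "th (br Q2) z = br (\<lambda>p. \<Lambda> (n1' - 1) n2' * Q2 p + h * K2 p + h * N3 p) z"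
 proof (rule theta_ok2[of Y X "\<lambda>k i. [(N, k), (i, o1)]" "\<lambda>k i. (X - {i}) \<union> Y", OF _ _ _ z])
  show "ok [(N, k), (i, o1)] ((X - {i}) \<union> Y)" if k: "k \<in> Y" and i: "i \<in> X" for k i
  proof (rule okI')
   have g: "good [(k, i), (N, k), (i, o1)]" by (rule good_perm[OF good_path[OF k i]]) simp
   show "good ((u, v) # [(N, k), (i, o1)])" if "u \<in> insert N ((X - {i}) \<union> Y)" "v \<notin> insert N ((X - {i}) \<union> Y)"
    "u \<in> insert N (verts [(N, k), (i, o1)])" "v \<in> insert o1 (verts [(N, k), (i, o1)])" "lexp n1 N h u v \<noteq> 0" for u v
    using that g k i YXd[of k i] by (auto simp: lexp_simps)
  qed (use k i YXd[of k i] in auto)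
  fix p assume p: "points N z p"
  let ?R = "\<lambda>k i. \<Lambda> (n1' - 1) n2' * (p N k * p i o1) + h * (p N k * p k i * p i o1) + h * (\<Sum>l\<in>Y - {k}. p N k * p l i * p i o1)
    + h * p N k * (\<Sum>j\<in>X - {i}. p i o1 * (p j o1 - 2 * p j i))"
  have "p N k * p i o1 * kcr ((X - {i}) \<union> Y) p = ?R k i" if "i \<in> X" "k \<in> Y" for k i
  proof -
   have "p N k * (p i o1 * cross ((X - {i}) \<union> Y) p) = p N k * (h * (\<Sum>k\<in>Y. p k i * p i o1) + h * (\<Sum>j\<in>X - {i}. p i o1 * (p j o1 - 2 * p j i)))"
    unfolding cross_X_off[OF p that(1)] ..
   moreover have "(\<Sum>k\<in>Y. p k i * p i o1) = p k i * p i o1 + (\<Sum>l\<in>Y - {k}. p l i * p i o1)"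
    using that by (simp add: sum.remove)
   moreover have "(\<Sum>l\<in>Y - {k}. p N k * p l i * p i o1) = p N k * (\<Sum>l\<in>Y - {k}. p l i * p i o1)"
    by (simp only: sum_distrib_left mult.assoc)
   moreover have "kap ((X - {i}) \<union> Y) = \<Lambda> (n1' - 1) n2'" using kap_Un[of "X - {i}" Y] by (simp add: card_minus(1)[OF that(1)])
   ultimately show ?thesis by algebra
  qed
  then have "(\<Sum>k\<in>Y. \<Sum>i\<in>X. p N k * p i o1 * kcr ((X - {i}) \<union> Y) p) =
    (\<Sum>k\<in>Y. \<Sum>i\<in>X. ?R k i)"
   by (intro sum.cong refl) auto
  also have "\<dots> = \<Lambda> (n1' - 1) n2' * Q2 p + h * K2 p + h * N3 p"
   unfolding sum.distrib sum_distrib_left[symmetric, where r="h * p N _"] sum_distrib_left[symmetric, where r=h] sum_distrib_left[symmetric, where r="\<Lambda> (n1' - 1) n2'"] off_X_zero[OF p] Q2_def K2_def N3_def by simp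
  finally show "(\<Sum>k\<in>Y. \<Sum>i\<in>X. mon [(N, k), (i, o1)] p * kcr ((X - {i}) \<union> Y) p) = \<Lambda> (n1' - 1) n2' * Q2 p + h * K2 p + h * N3 p"
   by (simp add: mult.assoc)
 qed (auto simp: Q2_def)
 then show ?thesis using z by (simp only: br_lin3 gd_brackets)
qed

lemma theta_U1:
 assumes z: "z \<in> Om"
 shows "th (br U1) z = \<Lambda> n1' n2' * br U1 z + h * br T2 z"
proof -
 have "th (br U1) z = br (\<lambda>p. \<Lambda> n1' n2' * U1 p + h * T2 p) z"
 proof (rule theta_ok2[of Y X "\<lambda>k i. [(k, i)]" "\<lambda>k i. X \<union> Y", OF _ _ _ z])
  show "ok [(k, i)] (X \<union> Y)" if k: "k \<in> Y" and i: "i \<in> X" for k i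
  proof (rule okI')
   have g: "good [(i, o1), (k, i)]" by (rule good_perm[of "[(k, i), (i, o1)]"], rule forest_good) (use k i YXd[of k i] in auto)
   show "good ((u, v) # [(k, i)])" if "u \<in> insert N (X \<union> Y)" "v \<notin> insert N (X \<union> Y)"
    "u \<in> insert N (verts [(k, i)])" "v \<in> insert o1 (verts [(k, i)])" "lexp n1 N h u v \<noteq> 0" for u v
    using that g k i YXd[of k i] by (auto simp: lexp_simps)
  qed (use k i YXd[of k i] in auto)
  fix p
  show "(\<Sum>k\<in>Y. \<Sum>i\<in>X. mon [(k, i)] p * kcr (X \<union> Y) p) = \<Lambda> n1' n2' * U1 p + h * T2 p"
  proof -
   have c: "cross (X \<union> Y) p = h * (\<Sum>j\<in>X. p j o1)" by (subst cross_eq) simp_all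
   have kk: "kap (X \<union> Y) = \<Lambda> n1' n2'" using kap_Un[of X Y] by simp
   show ?thesis unfolding c kk U1_def T2_def sum_distrib_left sum.distrib[symmetric]
    by (intro sum.cong refl) (simp add: distrib_left sum_distrib_left mult_ac)
  qed
 qed (auto simp: U1_def)
 then show ?thesis using z by (simp only: br_lin2 gd_brackets)
qed

end

section \<open>Dilations of graphs with two edges, and the relation for paths from z to 1\<close>

context ladder begin

lemma sum_swap_mid:
 fixes f :: "nat \<Rightarrow> nat \<Rightarrow> nat \<Rightarrow> complex"
 shows "(\<Sum>k\<in>A. \<Sum>i\<in>B. \<Sum>l\<in>A - {k}. f k i l) = (\<Sum>i\<in>B. \<Sum>k\<in>A. \<Sum>l\<in>A - {k}. f k i l)"
 by (rule sum.swap)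

text \<open>Half of the terms h p i l is set aside to form \<open>F3\<close>. With this split the
  remaining terms in l are antisymmetric under the exchange of k and l, and those in j cancel
  because their exponents are h and -2 h.\<close>

lemma theta_F2:
 assumes z: "z \<in> Om"
 shows "th (br F2) z = \<Lambda> 1 1 * br F2 z + h * br K2 z + h / 2 * br F3 z"
proof -
 have "th (br F2) z = br (\<lambda>p. \<Lambda> 1 1 * F2 p + h * K2 p + h / 2 * F3 p) z"
 proof (rule theta_ok2[of Y X "\<lambda>k i. [(k, i), (N, k)]" "\<lambda>k i. {i} \<union> {k}", OF _ _ _ z])
  show "ok [(k, i), (N, k)] ({i} \<union> {k})" if k: "k \<in> Y" and i: "i \<in> X" for k i
  proof (rule okI')
   have g: "good [(i, o1), (k, i), (N, k)]" by (rule good_perm[OF good_path[OF k i]]) simp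
   show "good ((u, v) # [(k, i), (N, k)])" if "u \<in> insert N ({i} \<union> {k})" "v \<notin> insert N ({i} \<union> {k})"
    "u \<in> insert N (verts [(k, i), (N, k)])" "v \<in> insert o1 (verts [(k, i), (N, k)])" "lexp n1 N h u v \<noteq> 0" for u v
    using that g k i YXd[of k i] by (auto simp: lexp_simps)
  qed (use k i YXd[of k i] in auto)
  fix p assume p: "points N z p"
  define A where "A k i l = p N k * p k i * (p i l - 2 * p k l + p N l)" for k i l
  define B where "B k i j = p N k * (p k i * (p k j - 2 * p i j))" for k i j
  have ZA: "(\<Sum>k\<in>Y. \<Sum>i\<in>X. \<Sum>l\<in>Y - {k}. A k i l) = 0"
   unfolding sum_swap_mid
  proof (rule sum.neutral, rule ballI, rule off_0)
   fix i k l assume h: "i \<in> X" "k \<in> Y" "l \<in> Y" "k \<noteq> l"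
   show "A k i l + A l i k = 0"
    unfolding A_def by (rule points_rules4(1)[OF p]) (use h YXd[OF h(2,1)] YXd[OF h(3,1)] in linarith)+
  qed simp
  have ZB: "(\<Sum>k\<in>Y. \<Sum>i\<in>X. \<Sum>j\<in>X - {i}. B k i j) = 0"
  proof (rule sum.neutral, rule ballI, rule off_0)
   fix k i j assume h: "k \<in> Y" "i \<in> X" "j \<in> X" "i \<noteq> j"
   have "p k i * p i j + p k j * p j i = p k i * p k j"
    by (rule points_rules(2)[OF p]) (use h YXd[OF h(1,2)] YXd[OF h(1,3)] in linarith)+
   then show "B k i j + B k j i = 0" unfolding B_def by algebra
  qed simp
  let ?R = "\<lambda>k i. \<Lambda> 1 1 * (p N k * p k i) + h * (p N k * p k i * p i o1)
    + h / 2 * (\<Sum>l\<in>Y - {k}. p N k * p k i * p i l) + h / 2 * (\<Sum>l\<in>Y - {k}. A k i l) + h * (\<Sum>j\<in>X - {i}. B k i j)"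
  have "p N k * p k i * kcr ({i} \<union> {k}) p = ?R k i"
   if "k \<in> Y" "i \<in> X" for k i
  proof -
   have c: "cross ({i} \<union> {k}) p = h * ((\<Sum>l\<in>Y - {k}. p i l) - 2 * (\<Sum>j\<in>X - {i}. p i j) + p i o1
     + ((\<Sum>j\<in>X - {i}. p k j) - (\<Sum>l\<in>Y - {k}. p k l)) + (\<Sum>l\<in>Y - {k}. p N l) / 2)"
    using that by (subst cross_eq) simp_all
   have kk: "kap ({i} \<union> {k}) = \<Lambda> 1 1" using that by (subst kap_Un) simp_all
   have s1: "(\<Sum>l\<in>Y - {k}. p N k * p k i * p i l) = p N k * p k i * (\<Sum>l\<in>Y - {k}. p i l)" by (simp only: sum_distrib_left)
   have s2: "(\<Sum>l\<in>Y - {k}. A k i l) = p N k * p k i * ((\<Sum>l\<in>Y - {k}. p i l) - 2 * (\<Sum>l\<in>Y - {k}. p k l) + (\<Sum>l\<in>Y - {k}. p N l))"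
    unfolding A_def by (simp only: sum_distrib_left[symmetric] sum.distrib sum_subtractf)
   have s3: "(\<Sum>j\<in>X - {i}. B k i j) = p N k * (p k i * ((\<Sum>j\<in>X - {i}. p k j) - 2 * (\<Sum>j\<in>X - {i}. p i j)))"
    unfolding B_def by (simp only: sum_distrib_left[symmetric] sum_subtractf)
   show ?thesis unfolding c kk s1 s2 s3 by (simp add: field_simps)
  qed
  then have "(\<Sum>k\<in>Y. \<Sum>i\<in>X. p N k * p k i * kcr ({i} \<union> {k}) p) = (\<Sum>k\<in>Y. \<Sum>i\<in>X. ?R k i)"
   by (intro sum.cong refl) auto
  also have "\<dots> = \<Lambda> 1 1 * F2 p + h * K2 p + h / 2 * F3 p"
   unfolding pull sum_distrib_left[symmetric, where r="\<Lambda> 1 1"] ZA ZB F2_def K2_def F3_def by simp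
  finally show "(\<Sum>k\<in>Y. \<Sum>i\<in>X. mon [(k, i), (N, k)] p * kcr ({i} \<union> {k}) p) = \<Lambda> 1 1 * F2 p + h * K2 p + h / 2 * F3 p"
   by (simp add: mult_ac)
 qed (auto simp: F2_def mult_ac)
 then show ?thesis using z by (simp only: br_lin3 gd_brackets)
qed

lemma cross_XY:
 assumes "k \<in> Y" "i \<in> X"
 shows "cross (co i k) p = h * ((\<Sum>j\<in>X - {i}. p j k - 2 * p j i + p j o1) + (\<Sum>l\<in>Y - {k}. p l i - p l k) + p N k / 2)"
proof -
 have e: "X - (X - {i}) = {i}" "Y - (Y - {k}) = {k}" using assms by auto
 show ?thesis by (subst cross_eq) (auto simp: e)
qed

lemma kap_XY:
 assumes "k \<in> Y" "i \<in> X"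
 shows "kap (co i k) = \<Lambda> (n1' - 1) (n2' - 1)"
 using kap_Un[of "X - {i}" "Y - {k}"] card_minus(1)[OF assms(2)] card_minus(2)[OF assms(1)] by auto

lemma off_Y_zero:
 assumes p: "points N z p" and i: "i \<in> X"
 shows "(\<Sum>k\<in>Y. \<Sum>l\<in>Y - {k}. c * (p k i * (p l i - 2 * p l k))) = 0"
proof (rule off_0)
 fix k l assume h: "k \<in> Y" "l \<in> Y" "k \<noteq> l"
 have "p l k * p k i + p k l * p l i = p l i * p k i"
  by (rule points_rules(1)[OF p]) (use h YXd[OF h(1) i] YXd[OF h(2) i] in linarith)+
 then show "c * (p k i * (p l i - 2 * p l k)) + c * (p l i * (p k i - 2 * p k l)) = 0" by algebra
qed simp

text \<open>The mirror image of \<open>theta_F2\<close>, with 1 in the place of \<open>z\<close> and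
  with k and i staying behind. The edge from \<open>z\<close> to k gives \<open>K2\<close>, and half
  of the terms p l i forms \<open>E3\<close>.\<close>

lemma theta_E2:
 assumes z: "z \<in> Om"
 shows "th (br E2) z = \<Lambda> (n1' - 1) (n2' - 1) * br E2 z + h / 2 * br K2 z + h / 2 * br E3 z"
proof -
 have "th (br E2) z = br (\<lambda>p. \<Lambda> (n1' - 1) (n2' - 1) * E2 p + h / 2 * K2 p + h / 2 * E3 p) z"
 proof (rule theta_ok2[of Y X "\<lambda>k i. [(k, i), (i, o1)]" "\<lambda>k i. co i k", OF _ _ _ z])
  show "ok [(k, i), (i, o1)] (co i k)" if k: "k \<in> Y" and i: "i \<in> X" for k i
  proof (rule okI')
   show "good ((u, v) # [(k, i), (i, o1)])" if "u \<in> insert N (co i k)" "v \<notin> insert N (co i k)"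
    "u \<in> insert N (verts [(k, i), (i, o1)])" "v \<in> insert o1 (verts [(k, i), (i, o1)])" "lexp n1 N h u v \<noteq> 0" for u v
    using that good_path[OF k i] k i YXd[of k i] by (auto simp: lexp_simps)
  qed (use k i YXd[of k i] in auto)
  fix p assume p: "points N z p"
  define A where "A k i l = p i o1 * (p k i * (p l i - 2 * p l k))" for k i l
  define B where "B k i j = p k i * p i o1 * (p j k + p j o1 - 2 * p j i)" for k i j
  have ZA: "(\<Sum>k\<in>Y. \<Sum>i\<in>X. \<Sum>l\<in>Y - {k}. A k i l) = 0"
   unfolding sum_swap_mid A_def by (rule sum.neutral, rule ballI, rule off_Y_zero[OF p])
  have ZB: "(\<Sum>k\<in>Y. \<Sum>i\<in>X. \<Sum>j\<in>X - {i}. B k i j) = 0"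
  proof (rule sum.neutral, rule ballI, rule off_0)
   fix k i j assume h: "k \<in> Y" "i \<in> X" "j \<in> X" "i \<noteq> j"
   show "B k i j + B k j i = 0"
    unfolding B_def by (rule points_rules4(3)[OF p]) (use h YXd[OF h(1,2)] YXd[OF h(1,3)] in auto)
  qed simp
  let ?R = "\<lambda>k i. \<Lambda> (n1' - 1) (n2' - 1) * (p k i * p i o1) + h / 2 * (p N k * p k i * p i o1)
    + h / 2 * (\<Sum>l\<in>Y - {k}. p k i * p l i * p i o1) + h / 2 * (\<Sum>l\<in>Y - {k}. A k i l) + h * (\<Sum>j\<in>X - {i}. B k i j)"
  have "p k i * p i o1 * kcr (co i k) p = ?R k i"
   if ki: "k \<in> Y" "i \<in> X" for k i
  proof -
   have s1: "(\<Sum>l\<in>Y - {k}. p k i * p l i * p i o1) = p k i * (\<Sum>l\<in>Y - {k}. p l i) * p i o1" by (simp only: sum_distrib_left sum_distrib_right)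
   have s2: "(\<Sum>l\<in>Y - {k}. A k i l) = p i o1 * (p k i * ((\<Sum>l\<in>Y - {k}. p l i) - 2 * (\<Sum>l\<in>Y - {k}. p l k)))"
    unfolding A_def by (simp only: sum_distrib_left[symmetric] sum_subtractf)
   have s3: "(\<Sum>j\<in>X - {i}. B k i j) = p k i * p i o1 * ((\<Sum>j\<in>X - {i}. p j k) + (\<Sum>j\<in>X - {i}. p j o1) - 2 * (\<Sum>j\<in>X - {i}. p j i))"
    unfolding B_def by (simp only: sum_distrib_left[symmetric] sum.distrib sum_subtractf)
   have s4: "(\<Sum>j\<in>X - {i}. p j k - 2 * p j i + p j o1) = (\<Sum>j\<in>X - {i}. p j k) - 2 * (\<Sum>j\<in>X - {i}. p j i) + (\<Sum>j\<in>X - {i}. p j o1)"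
    "(\<Sum>l\<in>Y - {k}. p l i - p l k) = (\<Sum>l\<in>Y - {k}. p l i) - (\<Sum>l\<in>Y - {k}. p l k)"
    by (simp_all only: sum_distrib_left[symmetric] sum.distrib sum_subtractf)
   show ?thesis unfolding cross_XY[OF ki] kap_XY[OF ki] s1 s2 s3 s4 by (simp add: field_simps)
  qed
  then have "(\<Sum>k\<in>Y. \<Sum>i\<in>X. p k i * p i o1 * kcr (co i k) p) = (\<Sum>k\<in>Y. \<Sum>i\<in>X. ?R k i)"
   by (intro sum.cong refl) auto
  also have "\<dots> = \<Lambda> (n1' - 1) (n2' - 1) * E2 p + h / 2 * K2 p + h / 2 * E3 p"
   unfolding pull sum_distrib_left[symmetric, where r="\<Lambda> (n1' - 1) (n2' - 1)"] ZA ZB E2_def K2_def E3_def by simp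
  finally show "(\<Sum>k\<in>Y. \<Sum>i\<in>X. mon [(k, i), (i, o1)] p * kcr (co i k) p) = \<Lambda> (n1' - 1) (n2' - 1) * E2 p + h / 2 * K2 p + h / 2 * E3 p"
   by (simp add: mult_ac)
 qed (auto simp: E2_def mult_ac)
 then show ?thesis using z by (simp only: br_lin3 gd_brackets)
qed

text \<open>A second expression for the Euler derivative of \<open>U1\<close>, from moving
  everything except k and i; comparison with \<open>theta_U1\<close> yields \<open>D2\<close>. The
  correction - h (n1 - 1) arises because the symmetrised terms in the first kind add up to - p k i -
  p k j instead of 0.\<close>

lemma theta_U1':
 assumes z: "z \<in> Om"
 shows "th (br U1) z = (\<Lambda> (n1' - 1) (n2' - 1) - h * (n1' - 1)) * br U1 z + h * (br T2 z - br E2 z) + h / 2 * (br D2 z + br F2 z)"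
proof -
 have "th (br U1) z = br (\<lambda>p. (\<Lambda> (n1' - 1) (n2' - 1) - h * (n1' - 1)) * U1 p + h * (T2 p - E2 p) + h / 2 * (D2 p + F2 p)) z"
 proof (rule theta_ok2[of Y X "\<lambda>k i. [(k, i)]" "\<lambda>k i. co i k", OF _ _ _ z])
  show "ok [(k, i)] (co i k)" if k: "k \<in> Y" and i: "i \<in> X" for k i
  proof (rule okI')
   have g: "good [(N, k), (k, i)]" by (rule good_perm[of "[(k, i), (N, k)]"], rule forest_good) (use k i YXd[of k i] in auto)
   show "good ((u, v) # [(k, i)])" if "u \<in> insert N (co i k)" "v \<notin> insert N (co i k)"
    "u \<in> insert N (verts [(k, i)])" "v \<in> insert o1 (verts [(k, i)])" "lexp n1 N h u v \<noteq> 0" for u v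
    using that g k i YXd[of k i] by (auto simp: lexp_simps)
  qed (use k i YXd[of k i] in auto)
  fix p assume p: "points N z p"
  define A where "A k i l = 1 * (p k i * (p l i - 2 * p l k))" for k i l
  define B where "B k i j = p k i * (p j k - 2 * p j i)" for k i j
  have ZA: "(\<Sum>k\<in>Y. \<Sum>i\<in>X. \<Sum>l\<in>Y - {k}. A k i l) = 0"
   unfolding sum_swap_mid A_def by (rule sum.neutral, rule ballI, rule off_Y_zero[OF p])
  have ZB: "(\<Sum>k\<in>Y. \<Sum>i\<in>X. \<Sum>j\<in>X - {i}. B k i j) = - (n1' - 1) * U1 p"
  proof -
   have "(\<Sum>i\<in>X. \<Sum>j\<in>X - {i}. B k i j) = (\<Sum>i\<in>X. \<Sum>j\<in>X - {i}. - p k i)" if k: "k \<in> Y" for k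
   proof (rule off_cong)
    fix i j assume h: "i \<in> X" "j \<in> X" "i \<noteq> j"
    have "B k i j + B k j i = - p k i - p k j"
     unfolding B_def by (rule points_rules(3)[OF p]) (use h YXd[OF k h(1)] YXd[OF k h(2)] in linarith)+
    then show "B k i j + B k j i = - p k i + - p k j" by simp
   qed simp
   moreover have "(\<Sum>i\<in>X. \<Sum>j\<in>X - {i}. - p k i) = - (n1' - 1) * (\<Sum>i\<in>X. p k i)" for k
    unfolding sum_distrib_left by (rule sum.cong[OF refl]) (use card_minus(1) in \<open>simp only: sum_constant, simp add: algebra_simps\<close>)
   ultimately have "(\<Sum>k\<in>Y. \<Sum>i\<in>X. \<Sum>j\<in>X - {i}. B k i j) = (\<Sum>k\<in>Y. - (n1' - 1) * (\<Sum>i\<in>X. p k i))" by (intro sum.cong) auto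
   then show ?thesis unfolding U1_def sum_distrib_left .
  qed
  have TE: "T2 p - E2 p = (\<Sum>k\<in>Y. \<Sum>i\<in>X. \<Sum>j\<in>X - {i}. p k i * p j o1)"
   unfolding T2_def E2_def by (simp add: sum_subtractf[symmetric] sum_diff1)
  let ?R = "\<lambda>k i. \<Lambda> (n1' - 1) (n2' - 1) * p k i + h / 2 * (p N k * p k i)
    + h / 2 * (\<Sum>l\<in>Y - {k}. p k i * p l i) + h / 2 * (\<Sum>l\<in>Y - {k}. A k i l) + h * (\<Sum>j\<in>X - {i}. B k i j) + h * (\<Sum>j\<in>X - {i}. p k i * p j o1)"
  have "p k i * kcr (co i k) p = ?R k i"
   if ki: "k \<in> Y" "i \<in> X" for k i
  proof -
   have s1: "(\<Sum>l\<in>Y - {k}. p k i * p l i) = p k i * (\<Sum>l\<in>Y - {k}. p l i)" "(\<Sum>j\<in>X - {i}. p k i * p j o1) = p k i * (\<Sum>j\<in>X - {i}. p j o1)"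
    by (simp_all only: sum_distrib_left)
   have s2: "(\<Sum>l\<in>Y - {k}. A k i l) = p k i * ((\<Sum>l\<in>Y - {k}. p l i) - 2 * (\<Sum>l\<in>Y - {k}. p l k))"
    unfolding A_def by (simp only: sum_distrib_left[symmetric] sum_subtractf mult_1_left)
   have s3: "(\<Sum>j\<in>X - {i}. B k i j) = p k i * ((\<Sum>j\<in>X - {i}. p j k) - 2 * (\<Sum>j\<in>X - {i}. p j i))"
    unfolding B_def by (simp only: sum_distrib_left[symmetric] sum_subtractf)
   have s4: "(\<Sum>j\<in>X - {i}. p j k - 2 * p j i + p j o1) = (\<Sum>j\<in>X - {i}. p j k) - 2 * (\<Sum>j\<in>X - {i}. p j i) + (\<Sum>j\<in>X - {i}. p j o1)"
    "(\<Sum>l\<in>Y - {k}. p l i - p l k) = (\<Sum>l\<in>Y - {k}. p l i) - (\<Sum>l\<in>Y - {k}. p l k)"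
    by (simp_all only: sum_distrib_left[symmetric] sum.distrib sum_subtractf)
   show ?thesis unfolding cross_XY[OF ki] kap_XY[OF ki] s1 s2 s3 s4 by (simp add: field_simps)
  qed
  then have "(\<Sum>k\<in>Y. \<Sum>i\<in>X. p k i * kcr (co i k) p) = (\<Sum>k\<in>Y. \<Sum>i\<in>X. ?R k i)"
   by (intro sum.cong refl) auto
  also have "\<dots> = (\<Lambda> (n1' - 1) (n2' - 1) - h * (n1' - 1)) * U1 p + h * (T2 p - E2 p) + h / 2 * (D2 p + F2 p)"
   unfolding pull sum_distrib_left[symmetric, where r="\<Lambda> (n1' - 1) (n2' - 1)"]
    ZA ZB TE[symmetric] U1_def F2_def D2_def by (simp add: algebra_simps)
  finally show "(\<Sum>k\<in>Y. \<Sum>i\<in>X. mon [(k, i)] p * kcr (co i k) p) = (\<Lambda> (n1' - 1) (n2' - 1) - h * (n1' - 1)) * U1 p + h * (T2 p - E2 p) + h / 2 * (D2 p + F2 p)"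
   by simp
 qed (auto simp: U1_def)
 then show ?thesis using z br_diff[of T2 E2 z] br_add[of D2 F2 z] by (simp only: br_lin3 gd_brackets gd_add gd_diff)
qed

text \<open>The chord identity summed over k and i. Terms in which an index no longer occurs produce
  the counts n1 and n2, and the factor z - 1 clears the denominator of the chord.\<close>

lemma path_relation:
 assumes z: "z \<in> Om"
 shows "(z - 1) * br K2 z = z * (br E2 z + br Q2 z - n2' * br E1 z + br F2 z - n1' * br F1 z - br U1 z + n1' * n2' * br (\<lambda>p. 1) z)"
proof -
 have z1: "z \<noteq> 1" using z by auto
 have "br K2 z = br (\<lambda>p. z / (z - 1) * (E2 p + Q2 p - n2' * E1 p + F2 p - n1' * F1 p - U1 p + n1' * n2' * 1)) z"
 proof (rule br_cong(1)[OF z])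
  fix p assume p: "points N z p"
  have "p N k * p k i * p i o1 = z / (z - 1) * (p k i * p i o1 + p N k * p i o1 - p i o1 + p N k * p k i - p N k - p k i + 1)" if "k \<in> Y" "i \<in> X" for k i
   using points_rules4(4)[OF p, of N k i o1] YXd[OF that] points_z1[OF p] by (simp add: algebra_simps)
  then have "K2 p = (\<Sum>k\<in>Y. \<Sum>i\<in>X. z / (z - 1) * (p k i * p i o1 + p N k * p i o1 - p i o1 + p N k * p k i - p N k - p k i + 1))"
   unfolding K2_def by (intro sum.cong refl) auto
  also have "\<dots> = z / (z - 1) * (E2 p + Q2 p - n2' * E1 p + F2 p - n1' * F1 p - U1 p + n1' * n2' * 1)"
   unfolding sum_distrib_left[symmetric] sum.distrib sum_subtractf E2_def Q2_def E1_def F2_def F1_def U1_def by (simp add: sum_distrib_left)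
  finally show "K2 p = z / (z - 1) * (E2 p + Q2 p - n2' * E1 p + F2 p - n1' * F1 p - U1 p + n1' * n2' * 1)" .
 qed
 also have "\<dots> = z / (z - 1) * (br E2 z + br Q2 z - n2' * br E1 z + br F2 z - n1' * br F1 z - br U1 z + n1' * n2' * br (\<lambda>p. 1) z)"
  using z by (simp only: br_mult br_add br_diff gd_brackets gd_mult gd_add gd_diff)
 finally show ?thesis using z1 by (simp add: divide_simps mult.commute[of "z - 1"])
qed

end

section \<open>The last rung and the paths with a further leaf\<close>

context ladder begin

text \<open>The ladder ends here. Surplus terms in a further variable m of the second kind fall into
  two groups, one antisymmetric in k and m, the other in l and m, so only the edge from i to 1
  survives.\<close>

lemma theta_F3:
 assumes z: "z \<in> Om"
 shows "th (br F3) z = \<Lambda> 1 2 * br F3 z + h * br K3 z"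
proof -
 have "th (br F3) z = br (\<lambda>p. \<Lambda> 1 2 * F3 p + h * K3 p) z"
 proof (rule theta_ok3[of Y X "\<lambda>k i l. [(i, l), (k, i), (N, k)]" "\<lambda>k i l. {i} \<union> {k, l}", OF _ _ _ z])
  show "ok [(i, l), (k, i), (N, k)] ({i} \<union> {k, l})" if k: "k \<in> Y" and i: "i \<in> X" and l: "l \<in> Y - {k}" for k i l
  proof (rule okI')
   have l': "l \<in> Y" "l \<noteq> k" using l by auto
   have g: "good [(i, o1), (i, l), (k, i), (N, k)]" by (rule good_perm[OF good_path_leaf[OF k i l]]) simp
   show "good ((u, v) # [(i, l), (k, i), (N, k)])" if "u \<in> insert N ({i} \<union> {k, l})" "v \<notin> insert N ({i} \<union> {k, l})"
    "u \<in> insert N (verts [(i, l), (k, i), (N, k)])" "v \<in> insert o1 (verts [(i, l), (k, i), (N, k)])" "lexp n1 N h u v \<noteq> 0" for u v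
   proof -
    have v: "v = o1" using that by auto
    have "u = N \<or> u = i \<or> u = k \<or> u = l" using that by auto
    then show ?thesis using that(5) g unfolding v using lexp_simps(10)[OF k] lexp_simps(10)[OF l'(1)] lexp_simps(11) by auto
   qed
   show "forest N [(i, l), (k, i), (N, k)]" using YXd[OF k i] YXd[OF l'(1) i] l' by auto
   show "\<forall>(u, v)\<in>set [(i, l), (k, i), (N, k)]. (u \<in> insert N ({i} \<union> {k, l})) = (v \<in> insert N ({i} \<union> {k, l}))" by auto
  qed (use k i l in auto)
  fix p assume p: "points N z p"
  define A where "A k i l m = p N k * p k i * p i l * (p i m - 2 * p k m + p N m)" for k i l m
  define A' where "A' k i l m = p N k * p k i * (p i l * (p i m - 2 * p l m))" for k i l m
  define B where "B k i l j = p N k * (p k i * p i l * (p k j + p l j - 2 * p i j))" for k i l j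
  \<comment> \<open>The summation over l is brought outside the one over k, so that k and m range
    over the same set \<open>Y - {l}\<close> and can be exchanged.\<close>
  have ZA: "(\<Sum>k\<in>Y. \<Sum>i\<in>X. \<Sum>l\<in>Y - {k}. \<Sum>m\<in>Y - {k} - {l}. A k i l m) = 0"
   unfolding sum_swap_mid
  proof (rule sum.neutral, rule ballI)
   fix i assume i: "i \<in> X"
   have "(\<Sum>k\<in>Y. \<Sum>l\<in>Y - {k}. \<Sum>m\<in>Y - {k} - {l}. A k i l m) = (\<Sum>l\<in>Y. \<Sum>k\<in>Y - {l}. \<Sum>m\<in>Y - {k} - {l}. A k i l m)"
    by (rule off_swap) simp
   also have "\<dots> = 0"
   proof (rule sum.neutral, rule ballI)
    fix l assume l: "l \<in> Y"
    have "(\<Sum>k\<in>Y - {l}. \<Sum>m\<in>Y - {k} - {l}. A k i l m) = (\<Sum>k\<in>Y - {l}. \<Sum>m\<in>Y - {l} - {k}. A k i l m)"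
     by (simp only: Diff_insert[symmetric] insert_commute)
    also have "\<dots> = 0"
    proof (rule off_0)
     fix k m assume h: "k \<in> Y - {l}" "m \<in> Y - {l}" "k \<noteq> m"
     then have km: "k \<in> Y" "m \<in> Y" by auto
     have "p N k * p k i * (p i m - 2 * p k m + p N m) + p N m * p m i * (p i k - 2 * p m k + p N k) = 0"
      by (rule points_rules4(1)[OF p]) (use h(3) YXd[OF km(1) i] YXd[OF km(2) i] in auto)
     then show "A k i l m + A m i l k = 0"
      unfolding A_def by algebra
    qed simp
    finally show "(\<Sum>k\<in>Y - {l}. \<Sum>m\<in>Y - {k} - {l}. A k i l m) = 0" .
   qed
   finally show "(\<Sum>k\<in>Y. \<Sum>l\<in>Y - {k}. \<Sum>m\<in>Y - {k} - {l}. A k i l m) = 0" .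
  qed
  have ZA': "(\<Sum>k\<in>Y. \<Sum>i\<in>X. \<Sum>l\<in>Y - {k}. \<Sum>m\<in>Y - {k} - {l}. A' k i l m) = 0"
  proof (rule sum.neutral, rule ballI, rule sum.neutral, rule ballI, rule off_0)
   fix k i l m assume k: "k \<in> Y" and i: "i \<in> X" and h: "l \<in> Y - {k}" "m \<in> Y - {k}" "l \<noteq> m"
   then have lm: "l \<in> Y" "m \<in> Y" by auto
   have "p i l * p l m + p i m * p m l = p i l * p i m"
    by (rule points_rules(2)[OF p]) (use h(3) YXd[OF lm(1) i] YXd[OF lm(2) i] in auto)
   then show "A' k i l m + A' k i m l = 0" unfolding A'_def by algebra
  qed simp
  have ZB: "(\<Sum>k\<in>Y. \<Sum>i\<in>X. \<Sum>l\<in>Y - {k}. \<Sum>j\<in>X - {i}. B k i l j) = 0"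
  proof (rule sum.neutral, rule ballI)
   fix k assume k: "k \<in> Y"
   have "(\<Sum>i\<in>X. \<Sum>l\<in>Y - {k}. \<Sum>j\<in>X - {i}. B k i l j) = (\<Sum>l\<in>Y - {k}. \<Sum>i\<in>X. \<Sum>j\<in>X - {i}. B k i l j)" by (rule sum.swap)
   also have "\<dots> = 0"
   proof (rule sum.neutral, rule ballI, rule off_0)
    fix l i j assume h: "l \<in> Y - {k}" "i \<in> X" "j \<in> X" "i \<noteq> j"
    then have l: "l \<in> Y" "l \<noteq> k" "k \<noteq> l" by auto
    have "p k i * p i l * (p k j + p l j - 2 * p i j) + p k j * p j l * (p k i + p l i - 2 * p j i) = 0"
     by (rule points_rules4(2)[OF p]) (use h(4) l(2,3) YXd[OF k h(2)] YXd[OF k h(3)] YXd[OF l(1) h(2)] YXd[OF l(1) h(3)] in auto)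
    then show "B k i l j + B k j l i = 0" unfolding B_def by algebra
   qed simp
   finally show "(\<Sum>i\<in>X. \<Sum>l\<in>Y - {k}. \<Sum>j\<in>X - {i}. B k i l j) = 0" .
  qed
  let ?R = "\<lambda>k i l. \<Lambda> 1 2 * (p N k * p k i * p i l) + h * (p N k * p k i * p i l * p i o1)
    + h / 2 * (\<Sum>m\<in>Y - {k} - {l}. A k i l m) + h / 2 * (\<Sum>m\<in>Y - {k} - {l}. A' k i l m) + h * (\<Sum>j\<in>X - {i}. B k i l j)"
  have "p N k * p k i * p i l * kcr ({i} \<union> {k, l}) p = ?R k i l"
   if k: "k \<in> Y" and i: "i \<in> X" and l: "l \<in> Y - {k}" for k i l
  proof -
   have kl: "{k, l} \<subseteq> Y" "k \<noteq> l" "Y - {k, l} = Y - {k} - {l}" using k l by auto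
   have c: "cross ({i} \<union> {k, l}) p = h * ((\<Sum>m\<in>Y - {k} - {l}. p i m) - 2 * (\<Sum>j\<in>X - {i}. p i j) + p i o1
     + (((\<Sum>j\<in>X - {i}. p k j) - (\<Sum>m\<in>Y - {k} - {l}. p k m)) + ((\<Sum>j\<in>X - {i}. p l j) - (\<Sum>m\<in>Y - {k} - {l}. p l m))) + (\<Sum>m\<in>Y - {k} - {l}. p N m) / 2)"
    using i kl by (subst cross_eq) simp_all
   have kk: "kap ({i} \<union> {k, l}) = \<Lambda> 1 2" using i kl(1,2) by (subst kap_Un) simp_all
   have s1: "(\<Sum>m\<in>Y - {k} - {l}. A k i l m) = p N k * p k i * p i l * ((\<Sum>m\<in>Y - {k} - {l}. p i m) - 2 * (\<Sum>m\<in>Y - {k} - {l}. p k m) + (\<Sum>m\<in>Y - {k} - {l}. p N m))"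
    unfolding A_def by (simp only: sum_distrib_left[symmetric] sum.distrib sum_subtractf)
   have s2: "(\<Sum>m\<in>Y - {k} - {l}. A' k i l m) = p N k * p k i * (p i l * ((\<Sum>m\<in>Y - {k} - {l}. p i m) - 2 * (\<Sum>m\<in>Y - {k} - {l}. p l m)))"
    unfolding A'_def by (simp only: sum_distrib_left[symmetric] sum_subtractf)
   have s3: "(\<Sum>j\<in>X - {i}. B k i l j) = p N k * (p k i * p i l * ((\<Sum>j\<in>X - {i}. p k j) + (\<Sum>j\<in>X - {i}. p l j) - 2 * (\<Sum>j\<in>X - {i}. p i j)))"
    unfolding B_def by (simp only: sum_distrib_left[symmetric] sum.distrib sum_subtractf)
   show ?thesis unfolding c kk s1 s2 s3 by (simp add: field_simps)
  qed
  then have "(\<Sum>k\<in>Y. \<Sum>i\<in>X. \<Sum>l\<in>Y - {k}. p N k * p k i * p i l * kcr ({i} \<union> {k, l}) p) = (\<Sum>k\<in>Y. \<Sum>i\<in>X. \<Sum>l\<in>Y - {k}. ?R k i l)"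
   by (intro sum.cong refl) auto
  also have "\<dots> = \<Lambda> 1 2 * F3 p + h * K3 p"
   unfolding pull sum_distrib_left[symmetric, where r="\<Lambda> 1 2"] ZA ZA' ZB F3_def K3_def by simp
  finally show "(\<Sum>k\<in>Y. \<Sum>i\<in>X. \<Sum>l\<in>Y - {k}. mon [(i, l), (k, i), (N, k)] p * kcr ({i} \<union> {k, l}) p) = \<Lambda> 1 2 * F3 p + h * K3 p"
   by (simp add: mult_ac)
 qed (auto simp: F3_def mult_ac)
 then show ?thesis using z by (simp only: br_lin2 gd_brackets)
qed

text \<open>The chord identity multiplied by the leaf p i l = 1 - p l i. The leaf is reversed in
  every term except the one that forms \<open>F3\<close>, because the reversed graphs are the ones
  that the integrations by parts provide.\<close>

lemma path_leaf_relation: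
 assumes z: "z \<in> Om"
 shows "(z - 1) * br K3 z = z * (((n2' - 1) * br E2 z - br E3 z) + ((n2' - 1) * br Q2 z - br N3 z) - (n2' - 1) * (n2' * br E1 z - br E2 z)
   + br F3 z - ((n2' - 1) * n1' * br F1 z - (br V2 z - br F2 z)) - ((n2' - 1) * br U1 z - br D2 z) + (n2' - 1) * (n1' * n2' * br (\<lambda>p. 1) z - br U1 z))"
proof -
 have z1: "z \<noteq> 1" using z by auto
 have "br K3 z = br (\<lambda>p. z / (z - 1) * (((n2' - 1) * E2 p - E3 p) + ((n2' - 1) * Q2 p - N3 p) - (n2' - 1) * (n2' * E1 p - E2 p)
   + F3 p - ((n2' - 1) * n1' * F1 p - (V2 p - F2 p)) - ((n2' - 1) * U1 p - D2 p) + (n2' - 1) * (n1' * n2' * 1 - U1 p))) z"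
 proof (rule br_cong(1)[OF z])
  fix p assume p: "points N z p"
  have t: "p N k * p k i * p i l * p i o1 = z / (z - 1) * ((p k i * p i o1 - p k i * p l i * p i o1) + (p N k * p i o1 - p N k * p l i * p i o1) - (p i o1 - p l i * p i o1)
    + p N k * p k i * p i l - (p N k - p N k * p l i) - (p k i - p k i * p l i) + (1 - p l i))" if k: "k \<in> Y" and i: "i \<in> X" and l: "l \<in> Y - {k}" for k i l
  proof -
   have l': "l \<in> Y" using l by auto
   have a: "p N k * p k i * p i o1 = p N o1 * (p k i * p i o1 + (p N k - 1) * p i o1 + (p N k - 1) * (p k i - 1))"
    by (rule points_rules4(4)[OF p]) (use YXd[OF k i] in auto)
   have b: "p i l = 1 - p l i" by (rule points_rules(4)[OF p, where k=N]) (use YXd[OF l' i] in auto)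
   show ?thesis using a unfolding points_z1[OF p, symmetric] b by algebra
  qed
  have c: "(\<Sum>l\<in>Y - {k}. c) = (n2' - 1) * c" if "k \<in> Y" for k and c :: complex
   using card_minus(2)[OF that] by simp
  have s1: "(\<Sum>k\<in>Y. \<Sum>i\<in>X. \<Sum>l\<in>Y - {k}. f k i) = (n2' - 1) * (\<Sum>k\<in>Y. \<Sum>i\<in>X. f k i)" for f :: pairing
   unfolding sum_distrib_left by (intro sum.cong refl c)
  have s2: "(\<Sum>k\<in>Y. \<Sum>i\<in>X. \<Sum>l\<in>Y - {k}. f l i) = (n2' - 1) * (\<Sum>k\<in>Y. \<Sum>i\<in>X. f k i)" for f :: pairing
  proof -
   have "(\<Sum>k\<in>Y. \<Sum>i\<in>X. \<Sum>l\<in>Y - {k}. f l i) = (\<Sum>i\<in>X. \<Sum>k\<in>Y. \<Sum>l\<in>Y - {k}. f k i)"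
    unfolding sum_swap_mid by (rule sum.cong[OF refl], rule off_swap) simp
   also have "\<dots> = (n2' - 1) * (\<Sum>k\<in>Y. \<Sum>i\<in>X. f k i)" unfolding sum_swap_mid[symmetric] by (rule s1)
   finally show ?thesis .
  qed
  have V: "V2 p = (\<Sum>k\<in>Y. \<Sum>i\<in>X. \<Sum>l\<in>Y - {k}. p N k * p l i) + F2 p"
   unfolding V2_def F2_def sum.distrib[symmetric] by (intro sum.cong refl) (simp add: sum_diff1)
  have "K3 p = (\<Sum>k\<in>Y. \<Sum>i\<in>X. \<Sum>l\<in>Y - {k}. z / (z - 1) * ((p k i * p i o1 - p k i * p l i * p i o1) + (p N k * p i o1 - p N k * p l i * p i o1) - (p i o1 - p l i * p i o1)
    + p N k * p k i * p i l - (p N k - p N k * p l i) - (p k i - p k i * p l i) + (1 - p l i)))"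
   unfolding K3_def by (intro sum.cong refl t) auto
  also have "\<dots> = z / (z - 1) * (((n2' - 1) * E2 p - E3 p) + ((n2' - 1) * Q2 p - N3 p) - ((n2' - 1) * (\<Sum>k\<in>Y. \<Sum>i\<in>X. p i o1) - (n2' - 1) * E2 p)
   + F3 p - ((n2' - 1) * (\<Sum>k\<in>Y. \<Sum>i\<in>X. p N k) - (V2 p - F2 p)) - ((n2' - 1) * U1 p - D2 p) + ((n2' - 1) * (\<Sum>k\<in>Y. \<Sum>i\<in>X. 1) - (n2' - 1) * U1 p))"
   unfolding sum_distrib_left[symmetric, where r="z / (z - 1)"] sum.distrib sum_subtractf s1 s2[of "\<lambda>k i. p k i"] s2[of "\<lambda>k i. p k i * p i o1"] V
    E2_def E3_def Q2_def N3_def F3_def U1_def D2_def by simp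
  also have "(\<Sum>k\<in>Y. \<Sum>i\<in>X. p i o1) = n2' * E1 p" by (simp add: E1_def)
  also have "(\<Sum>k\<in>Y. \<Sum>i\<in>X. p N k) = n1' * F1 p" by (simp add: F1_def sum_distrib_left)
  also have "(\<Sum>k\<in>Y. \<Sum>i\<in>X. 1 :: complex) = n1' * n2' * 1" by simp
  finally show "K3 p = z / (z - 1) * (((n2' - 1) * E2 p - E3 p) + ((n2' - 1) * Q2 p - N3 p) - (n2' - 1) * (n2' * E1 p - E2 p)
   + F3 p - ((n2' - 1) * n1' * F1 p - (V2 p - F2 p)) - ((n2' - 1) * U1 p - D2 p) + (n2' - 1) * (n1' * n2' * 1 - U1 p))"
   by (simp only: right_diff_distrib mult.assoc)
 qed
 also have "\<dots> = z / (z - 1) * (((n2' - 1) * br E2 z - br E3 z) + ((n2' - 1) * br Q2 z - br N3 z) - (n2' - 1) * (n2' * br E1 z - br E2 z)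
   + br F3 z - ((n2' - 1) * n1' * br F1 z - (br V2 z - br F2 z)) - ((n2' - 1) * br U1 z - br D2 z) + (n2' - 1) * (n1' * n2' * br (\<lambda>p. 1) z - br U1 z))"
  using z by (simp only: br_mult br_add br_diff gd_brackets gd_mult gd_add gd_diff)
 finally show ?thesis using z1 by (simp add: divide_simps mult.commute[of "z - 1"])
qed

end

section \<open>Elimination\<close>

text \<open>Multiplication by X - c, matching the passage from f to
  \<open>th f - c * f\<close>.\<close>

definition tm :: "complex \<Rightarrow> complex poly \<Rightarrow> complex poly" where
 "tm c P = pCons 0 P - smult c P"

locale ladder_polys =
 fixes \<alpha> \<beta> h m n :: complex
begin

abbreviation "L \<equiv> cL \<alpha> \<beta> h"
text \<open>Each polynomial in \<open>th\<close>, applied to the integral, gives a bracket up to a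
  power of h: \<open>pf1\<close>, \<open>pf2\<close> give h/2 F1 and h^2/2 F2; \<open>pe1\<close>,
  \<open>pe2\<close> give h E1 and h^2 E2; \<open>pq\<close>, \<open>pv\<close> give h^2/2 Q2 and
  h^2/2 V2; \<open>pu\<close>, \<open>ptt\<close> give h U1 and h^2 T2; \<open>pr\<close> gives
  h^3/2 (K2 + N3), \<open>pg\<close> gives h^3/2 K2 + h^3/4 F3, and \<open>pd\<close> gives h^3/2
  D2. \<open>pb\<close> and \<open>ps\<close> are the right sides of the two path relations without
  their factor z, times h^2 and h^3.\<close>

definition "pf1 = pCons (0 :: complex) 1"
definition "pf2 = tm (L 0 1) pf1"
definition "pe1 = tm (L m n) 1"
definition "pe2 = tm (L (m - 1) n) pe1"
definition "pq = tm (L m n) pf1"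
definition "pr = tm (L (m - 1) n) pq"
definition "pu = tm (L 0 n) 1"
definition "pv = tm (L 0 n) pf1"
definition "ptt = tm (L m n) pu"
definition "pb = pe2 + smult 2 pq - smult (h * n) pe1 + smult 2 pf2 - smult (2 * h * m) pf1 - smult h pu + smult (h^2 * m * n) 1"
definition "pg = tm (L 1 1) pf2"
definition "pd = smult h (tm (L (m - 1) (n - 1)) pu - ptt + pe2 + smult (h * (m - 1)) pu - pf2)"
definition "ps = smult ((n - 1) * h) pe2 - smult 2 (tm (L (m - 1) (n - 1)) pe2) + smult (2 * h * (n - 1)) pq - smult 2 pr
 - smult (n - 1) (smult (h^2 * n) pe1 - smult h pe2) + smult 4 pg - (smult (2 * h^2 * (n - 1) * m) pf1 - smult (2 * h) pv + smult (2 * h) pf2)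
 - (smult (h^2 * (n - 1)) pu - smult 2 pd) + smult (n - 1) (smult (h^3 * m * n) 1 - smult (h^2) pu)"
text \<open>The product of X, X - L 0 1, X - L 1 1 and X - L 1 2. Its roots, the exponents at z = 0,
  are the values of \<open>kap\<close> on the variables of the successive paths from
  \<open>z\<close>.\<close>

definition "P0 = tm (L 1 2) pg"
definition "PW = smult (h / 2) (tm (L 1 2) pb) + smult (h / 4) ps"
definition "P2 = P0 - PW"
definition "P1 = P0 - smult (1/2) PW - smult (h / 4) pb"

end

context brackets begin

lemma br_wsmooth3:
 assumes "finite A" "finite B" "\<And>k i j. k \<in> A \<Longrightarrow> i \<in> B \<Longrightarrow> j \<in> A - {k} \<Longrightarrow> good (l k i j)"
  and F: "\<And>p. F p = (\<Sum>k\<in>A. \<Sum>i\<in>B. \<Sum>j\<in>A - {k}. mon (l k i j) p)"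
 shows "wsmooth Om (br F)"
proof (rule br_wsmooth[of "Sigma A (\<lambda>k. B \<times> (A - {k}))" "\<lambda>(k, i, j). l k i j"])
 show "F = (\<lambda>p. \<Sum>i\<in>Sigma A (\<lambda>k. B \<times> (A - {k})). mon (case i of (k, i, j) \<Rightarrow> l k i j) p)"
  using assms(1,2) unfolding F[abs_def] by (simp add: sum.cartesian_product sum.Sigma split_beta)
qed (use assms in auto)

end

lemma rep_th:
 assumes "wsmooth Om H" and c: "c \<noteq> 0" and f: "\<And>z. z \<in> Om \<Longrightarrow> c * f z = pact P H z" and z: "z \<in> Om"
 shows "c * th f z = pact (pCons 0 P) H z" "c * (th f z - k * f z) = pact (tm k P) H z" (is ?c1)
proof -
 have "th f z = th (pact (smult (1 / c) P) H) z"
  by (rule th_cong[OF open_Om _ z]) (use f c in \<open>simp add: pact_rules field_simps del: Compl_iff insert_iff\<close>)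
 also have "\<dots> = pact (smult (1 / c) (pCons 0 P)) H z"
  using pact_pCons_0[OF open_Om assms(1) z, of "smult (1 / c) P"] by simp
 finally have "th f z = 1 / c * pact (pCons 0 P) H z" by (simp only: pact_rules)
 then show 1: "c * th f z = pact (pCons 0 P) H z" using c by simp
 show ?c1
  using 1 f[OF z] by (simp add: tm_def pact_rules right_diff_distrib mult.left_commute[of c])
qed

context ladder begin

sublocale LP: ladder_polys \<alpha> \<beta> h n1' n2' .

abbreviation H0 where "H0 \<equiv> br (\<lambda>p. 1)"

lemma wsmooth_H0: "wsmooth Om H0"
proof -
 have "H0 = br (\<lambda>p. \<Sum>i\<in>{()}. mon [] p)" by simp
 moreover have "wsmooth Om (br (\<lambda>p. \<Sum>i\<in>{()}. mon [] p))" by (rule br_wsmooth[of "{()}" "\<lambda>_. []"]) (auto intro: forest_good)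
 ultimately show ?thesis by simp
qed

lemma wsmooth_F3: "wsmooth Om (br F3)"
proof (rule br_wsmooth3[of Y X "\<lambda>k i l. [(i, l), (k, i), (N, k)]"])
 show "good [(i, l), (k, i), (N, k)]" if "k \<in> Y" "i \<in> X" "l \<in> Y - {k}" for k i l
  by (rule forest_good) (use that YXd[of k i] YXd[of l i] in auto)
qed (auto simp: F3_def mult_ac)

theorem ladder_ode:
 assumes h: "h \<noteq> 0" and z: "z \<in> Om"
 shows "z^2 * pact LP.P2 H0 z - 2 * z * pact LP.P1 H0 z + pact LP.P0 H0 z = 0"
proof -
 let ?p = "\<lambda>P. pact P H0"
 let ?L = "\<Lambda> (n1' - 1) (n2' - 1)"
 note R = rep_th[OF wsmooth_H0]
 have H1: "1 * H0 z = ?p 1 z" for z by (simp add: pact_rules)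
 have one: "(1 :: complex) \<noteq> 0" by simp
 have h2: "h / 2 \<noteq> 0" "h^2 \<noteq> 0" "h^2 / 2 \<noteq> 0" "h^3 / 2 \<noteq> 0" using h by auto
 have f1: "h / 2 * br F1 z = ?p LP.pf1 z" if z: "z \<in> Om" for z
  using R(1)[OF one H1 z] theta_H(1)[OF z] by (simp add: LP.pf1_def)
 have e1: "h * br E1 z = ?p LP.pe1 z" if z: "z \<in> Om" for z
  using R(2)[OF one H1 z, of "\<Lambda> n1' n2'"] theta_H(2)[OF z] by (simp add: LP.pe1_def)
 have u: "h * br U1 z = ?p LP.pu z" if z: "z \<in> Om" for z
  using R(2)[OF one H1 z, of "\<Lambda> 0 n2'"] theta_H(3)[OF z] by (simp add: LP.pu_def)
 have f2: "h^2 / 2 * br F2 z = ?p LP.pf2 z" if z: "z \<in> Om" for z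
  using R(2)[OF h2(1) f1 z, of "\<Lambda> 0 1"] unfolding theta_F1(1)[OF z] LP.pf2_def[symmetric] by (simp add: power2_eq_square mult.assoc)
 have q: "h^2 / 2 * br Q2 z = ?p LP.pq z" if z: "z \<in> Om" for z
  using R(2)[OF h2(1) f1 z, of "\<Lambda> n1' n2'"] unfolding theta_F1(2)[OF z] LP.pq_def[symmetric] by (simp add: power2_eq_square mult.assoc)
 have v: "h^2 / 2 * br V2 z = ?p LP.pv z" if z: "z \<in> Om" for z
  using R(2)[OF h2(1) f1 z, of "\<Lambda> 0 n2'"] unfolding theta_F1(3)[OF z] LP.pv_def[symmetric] by (simp add: power2_eq_square mult.assoc)
 have e2: "h^2 * br E2 z = ?p LP.pe2 z" if z: "z \<in> Om" for z
  using R(2)[OF h e1 z, of "\<Lambda> (n1' - 1) n2'"] unfolding theta_E1[OF z] LP.pe2_def[symmetric] by (simp add: power2_eq_square mult.assoc)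
 have t: "h^2 * br T2 z = ?p LP.ptt z" if z: "z \<in> Om" for z
  using R(2)[OF h u z, of "\<Lambda> n1' n2'"] unfolding theta_U1[OF z] LP.ptt_def[symmetric] by (simp add: power2_eq_square mult.assoc)
 have r: "h^3 / 2 * (br K2 z + br N3 z) = ?p LP.pr z" if z: "z \<in> Om" for z
  using R(2)[OF h2(3) q z, of "\<Lambda> (n1' - 1) n2'"] unfolding theta_Q2[OF z] LP.pr_def[symmetric]
  by (simp add: power2_eq_square power3_eq_cube algebra_simps)
 have g: "h^3 / 2 * br K2 z + h^3 / 4 * br F3 z = ?p LP.pg z" if z: "z \<in> Om" for z
  using R(2)[OF h2(3) f2 z, of "\<Lambda> 1 1"] unfolding theta_F2[OF z] LP.pg_def[symmetric]
  by (simp add: power2_eq_square power3_eq_cube algebra_simps)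
 have e3: "h^3 / 2 * (br K2 z + br E3 z) = ?p (tm ?L LP.pe2) z" if z: "z \<in> Om" for z
  using R(2)[OF h2(2) e2 z, of "?L"] unfolding theta_E2[OF z]
  by (simp add: power2_eq_square power3_eq_cube algebra_simps)
 have d: "h^3 / 2 * br D2 z = ?p LP.pd z" if z: "z \<in> Om" for z
 proof -
  have "?p (tm ?L LP.pu) z = h * (th (br U1) z - ?L * br U1 z)"
   using R(2)[OF h u z] by simp
  also have "\<dots> = - h * (n1' - 1) * (h * br U1 z) + (h^2 * br T2 z - h^2 * br E2 z) + h^2 / 2 * br D2 z + h^2 / 2 * br F2 z"
   unfolding theta_U1'[OF z] by (simp add: power2_eq_square field_simps)
  finally have "h^2 / 2 * br D2 z = ?p (tm ?L LP.pu) z - ?p LP.ptt z + ?p LP.pe2 z + h * (n1' - 1) * ?p LP.pu z - ?p LP.pf2 z"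
   unfolding u[OF z] t[OF z] e2[OF z] f2[OF z] by (simp add: algebra_simps)
  moreover have "h^3 / 2 * br D2 z = h * (h^2 / 2 * br D2 z)" by (simp add: power2_eq_square power3_eq_cube)
  ultimately show ?thesis unfolding LP.pd_def pact_rules by simp
 qed
 have b: "h^2 * (br E2 z + br Q2 z - n2' * br E1 z + br F2 z - n1' * br F1 z - br U1 z + n1' * n2' * H0 z) = ?p LP.pb z" if z: "z \<in> Om" for z
  unfolding LP.pb_def pact_rules f1[OF z, symmetric] e1[OF z, symmetric] u[OF z, symmetric] f2[OF z, symmetric] q[OF z, symmetric] e2[OF z, symmetric]
  by (simp add: power2_eq_square field_simps)
 \<comment> \<open>Only (z - 1) K2 is a combination of polynomials in \<open>th\<close> applied to
   the integral; through \<open>g\<close> the same is true of F3.\<close>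
 have K: "(z - 1) * (h^3 / 2 * br K2 z) = h / 2 * z * ?p LP.pb z" if z: "z \<in> Om" for z
 proof -
  have "(z - 1) * (h^3 / 2 * br K2 z) = h^3 / 2 * ((z - 1) * br K2 z)" by simp
  then show ?thesis unfolding path_relation[OF z] b[OF z, symmetric] by (simp add: power2_eq_square power3_eq_cube)
 qed
 have eq1: "(z - 1) * (h^3 / 4 * br F3 z) = (z - 1) * ?p LP.pg z - h / 2 * (z * ?p LP.pb z)" if z: "z \<in> Om" for z
  unfolding g[OF z, symmetric] distrib_left K[OF z] by simp
 \<comment> \<open>F3 is known only up to the factor z - 1. Its equation and the Euler derivative of
   that equation are therefore kept side by side, and F3 is eliminated with the help of the last
   rung.\<close>
 define \<phi> where "\<phi> z = h^3 / 4 * br F3 z" for z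
 have sm: "wsmooth Om \<phi>" unfolding \<phi>_def[abs_def] by (rule wsmooth_rules(2)[OF open_Om wsmooth_F3 wsmooth_F3])
 note df = wsmooth_differentiable[OF sm] and dp = wsmooth_differentiable[OF wsmooth_pact[OF open_Om wsmooth_H0]]
 have thm1: "th (\<lambda>z. (z - 1) * f z) z = z * f z + (z - 1) * th f z" if "f differentiable (at z)" for f
 proof -
  have "(\<lambda>z. (z - 1) * f z) = (\<lambda>z. z * f z + (- 1) * f z)" by (simp add: fun_eq_iff algebra_simps)
  moreover have "(\<lambda>z. z * f z) differentiable (at z)" "(\<lambda>z. (- 1) * f z) differentiable (at z)"
   by (rule differentiable_mult[OF differentiable_ident that], rule differentiable_mult[OF differentiable_const that])
  note th_rules(1)[OF this]
  ultimately show ?thesis by (simp only: th_rules(2,3)[OF that that]) (simp add: algebra_simps)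
 qed
 have eq2: "z * \<phi> z + (z - 1) * th \<phi> z = z * ?p LP.pg z + (z - 1) * ?p (pCons 0 LP.pg) z - h / 2 * (z * ?p LP.pb z + z * ?p (pCons 0 LP.pb) z)"
 proof -
  have "th (\<lambda>z. (z - 1) * \<phi> z) z = th (\<lambda>z. (z - 1) * ?p LP.pg z + (- h / 2) * (z * ?p LP.pb z)) z"
   by (rule th_cong[OF open_Om _ z]) (use eq1 in \<open>simp add: \<phi>_def del: Compl_iff insert_iff\<close>)
  moreover have "(\<lambda>z. (z - 1) * ?p LP.pg z) differentiable (at z)" "(\<lambda>z. (- h / 2) * (z * ?p LP.pb z)) differentiable (at z)" "(\<lambda>z. z * ?p LP.pb z) differentiable (at z)"
   using dp[OF z] by (auto intro!: differentiable_mult differentiable_diff)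
  ultimately show ?thesis
   using thm1[OF df[OF z]] thm1[OF dp[OF z], of LP.pg] th_rules(1)[of "\<lambda>z. (z - 1) * ?p LP.pg z" z "\<lambda>z. (- h / 2) * (z * ?p LP.pb z)"]
    th_rules(2)[of "\<lambda>z. z * ?p LP.pb z" z "\<lambda>z. z * ?p LP.pb z" "- h / 2"] th_rules(3)[OF dp[OF z] dp[OF z], of LP.pb]
    pact_pCons_0[OF open_Om wsmooth_H0 z] by simp
 qed
 have eq3: "th \<phi> z = \<Lambda> 1 2 * \<phi> z + h / 4 * (h^3 * br K3 z)"
  using th_rules(2)[OF wsmooth_differentiable[OF wsmooth_F3 z] wsmooth_differentiable[OF wsmooth_F3 z], of "h^3 / 4"]
  unfolding \<phi>_def[abs_def] theta_F3[OF z] by (simp add: algebra_simps)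
 have s: "?p LP.ps z = (n2' - 1) * h * ?p LP.pe2 z - 2 * ?p (tm ?L LP.pe2) z + 2 * h * (n2' - 1) * ?p LP.pq z - 2 * ?p LP.pr z
  - (n2' - 1) * (h^2 * n2' * ?p LP.pe1 z - h * ?p LP.pe2 z) + 4 * ?p LP.pg z - (2 * h^2 * (n2' - 1) * n1' * ?p LP.pf1 z - 2 * h * ?p LP.pv z + 2 * h * ?p LP.pf2 z)
  - (h^2 * (n2' - 1) * ?p LP.pu z - 2 * ?p LP.pd z) + (n2' - 1) * (h^3 * n1' * n2' * H0 z - h^2 * ?p LP.pu z)"
  unfolding LP.ps_def pact_rules ..
 have "h^3 * ((z - 1) * br K3 z) = z * ?p LP.ps z"
  unfolding path_leaf_relation[OF z] s f1[OF z, symmetric] e1[OF z, symmetric] u[OF z, symmetric] f2[OF z, symmetric] q[OF z, symmetric] e2[OF z, symmetric]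
   v[OF z, symmetric] r[OF z, symmetric] g[OF z, symmetric] e3[OF z, symmetric] d[OF z, symmetric]
  by (simp add: power2_eq_square power3_eq_cube field_simps)
 then have eq4: "(z - 1) * (h^3 * br K3 z) = z * ?p LP.ps z" by (simp add: mult.left_commute)
 have P0: "?p LP.P0 z = ?p (pCons 0 LP.pg) z - \<Lambda> 1 2 * ?p LP.pg z"
  unfolding LP.P0_def tm_def pact_rules ..
 have PW: "?p LP.PW z = h / 2 * (?p (pCons 0 LP.pb) z - \<Lambda> 1 2 * ?p LP.pb z) + h / 4 * ?p LP.ps z"
  unfolding LP.PW_def tm_def pact_rules ..
 have 1: "(z - 1) * \<phi> z = (z - 1) * ?p LP.pg z - h / 2 * (z * ?p LP.pb z)" using eq1[OF z] by (simp add: \<phi>_def)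
 \<comment> \<open>Eliminates \<open>F\<close>, \<open>F'\<close> and \<open>KK\<close>: the given
   equations are added with the multipliers z + c (z - 1), -(z - 1), (z - 1)^2 and (z - 1) h / 4.
   The two denominators z - 1, of K2 and of K3, make the result quadratic in z.\<close>
 have comb: "z^2 * (X0 - XW) - 2 * z * (X0 - 1/2 * XW - h / 4 * B) + X0 = 0"
  if "(z - 1) * F = (z - 1) * G - h / 2 * (z * B)" "z * F + (z - 1) * F' = z * G + (z - 1) * G' - h / 2 * (z * B + z * B')"
   "F' = c * F + h / 4 * KK" "(z - 1) * KK = z * S" "X0 = G' - c * G" "XW = h / 2 * (B' - c * B) + h / 4 * S"
  for X0 XW B F F' G G' B' KK S c :: complex
 proof -
  have "z^2 * (X0 - XW) - 2 * z * (X0 - 1/2 * XW - h / 4 * B) + X0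
    = (z * (z - 1) + c * (z - 1) * (z - 1) - (z - 1) * z - c * (z - 1)^2) * 0
     - (z - 1) * (z * F + (z - 1) * F' - (z * G + (z - 1) * G' - h / 2 * (z * B + z * B')))
     + (z - 1) * (z - 1) * (F' - (c * F + h / 4 * KK)) + (z + c * (z - 1)) * ((z - 1) * F - ((z - 1) * G - h / 2 * (z * B)))
     + (z - 1) * (h / 4) * ((z - 1) * KK - z * S)"
   unfolding that(5,6) by (simp add: field_simps power2_eq_square)
  then show ?thesis using that by simp
 qed
 show ?thesis
  unfolding LP.P2_def LP.P1_def pact_rules by (rule comb[OF 1 eq2 eq3 eq4 P0 PW])
qed

end

section \<open>Fuchsian operators\<close>

lemma th_power_mult:
 assumes "f differentiable (at z)"
 shows "(\<lambda>z. z ^ k * f z) differentiable (at z)" "th (\<lambda>z. z ^ k * f z) z = z ^ k * (of_nat k * f z + th f z)" (is ?c1)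
proof -
 show d: "(\<lambda>z. z ^ k * f z) differentiable (at z)" for k
  using assms by (intro differentiable_mult differentiable_power differentiable_ident)
 show ?c1
 proof (induction k)
  case (Suc k)
  have "(\<lambda>z. z ^ Suc k * f z) = (\<lambda>z. z * (z ^ k * f z))" by (simp add: mult.assoc)
  then show ?case using th_rules(3)[OF d d, of k] Suc by (simp add: algebra_simps)
 qed simp
qed

text \<open>One more Euler operator acts on z^k d^k by the recursion of the Stirling numbers of the
  second kind: it multiplies by k and adds the term of order k + 1.\<close>

lemma th_power_expand:
 assumes "open S" "wsmooth S f" "z \<in> S"
 shows "(th ^^ i) f z = (\<Sum>k\<le>i. of_nat (Stirling i k) * z ^ k * (wirtinger ^^ k) f z)"
 using assms(3)
proof (induction i arbitrary: z)
 case (Suc i)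
 define g where "g k z = of_nat (Stirling i k) * (z ^ k * (wirtinger ^^ k) f z)" for k z
 have d: "(wirtinger ^^ k) f differentiable (at z)" for k using assms(2) Suc.prems by (simp add: wsmooth_def)
 have gd: "g k differentiable (at z)" for k
  unfolding g_def[abs_def] by (intro differentiable_mult differentiable_const th_power_mult d)
 have gt: "th (g k) z = of_nat (Stirling i k) * (z ^ k * (of_nat k * (wirtinger ^^ k) f z + z * (wirtinger ^^ Suc k) f z))" for k
  unfolding g_def[abs_def] th_rules(2)[OF th_power_mult(1)[OF d] th_power_mult(1)[OF d]] th_power_mult(2)[OF d] by (simp add: th_def)
 have sum: "(\<lambda>z. \<Sum>k\<in>I. g k z) differentiable (at z) \<and> th (\<lambda>z. \<Sum>k\<in>I. g k z) z = (\<Sum>k\<in>I. th (g k) z)" if "finite I" for I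
  using that
 proof (induction I rule: finite_induct)
  case (insert k I)
  then show ?case using th_rules(1)[of "g k" z "\<lambda>z. \<Sum>k\<in>I. g k z"] gd[of k] by (auto intro!: differentiable_add)
 qed (simp add: th_def wirtinger_def)
 have "(th ^^ Suc i) f z = th (\<lambda>z. \<Sum>k\<le>i. g k z) z"
  using th_cong[OF assms(1) Suc.IH Suc.prems] by (simp add: g_def mult.assoc)
 also have "\<dots> = (\<Sum>k\<le>i. of_nat (Stirling i k * k) * z ^ k * (wirtinger ^^ k) f z) + (\<Sum>k\<le>i. of_nat (Stirling i k) * z ^ Suc k * (wirtinger ^^ Suc k) f z)"
  using sum[of "{..i}"] by (simp add: gt sum.distrib[symmetric] algebra_simps)
 also have "(\<Sum>k\<le>i. of_nat (Stirling i k * k) * z ^ k * (wirtinger ^^ k) f z) = (\<Sum>k\<le>Suc i. of_nat (Stirling i k * k) * z ^ k * (wirtinger ^^ k) f z)"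
  by simp
 also have "\<dots> = (\<Sum>k\<le>i. of_nat (Stirling i (Suc k) * Suc k) * z ^ Suc k * (wirtinger ^^ Suc k) f z)"
  unfolding sum.atMost_Suc_shift by simp
 also have "\<dots> + (\<Sum>k\<le>i. of_nat (Stirling i k) * z ^ Suc k * (wirtinger ^^ Suc k) f z) = (\<Sum>k\<le>i. of_nat (Stirling (Suc i) (Suc k)) * z ^ Suc k * (wirtinger ^^ Suc k) f z)"
  unfolding sum.distrib[symmetric] by (rule sum.cong) (simp_all add: algebra_simps)
 also have "\<dots> = (\<Sum>k\<le>Suc i. of_nat (Stirling (Suc i) k) * z ^ k * (wirtinger ^^ k) f z)"
  unfolding sum.atMost_Suc_shift by simp
 finally show ?case .
qed simp

definition pst :: "complex poly \<Rightarrow> nat \<Rightarrow> complex" where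
 "pst P k = (\<Sum>i\<le>4. coeff P i * of_nat (Stirling i k))"

lemma pact_expand:
 assumes "open S" "wsmooth S f" "z \<in> S" "degree P \<le> 4"
 shows "pact P f z = (\<Sum>k\<le>4. pst P k * z ^ k * (wirtinger ^^ k) f z)"
proof -
 have "pact P f z = (\<Sum>i\<le>4. \<Sum>k\<le>4. coeff P i * (of_nat (Stirling i k) * z ^ k * (wirtinger ^^ k) f z))"
  unfolding pact_altdef[OF assms(4)] th_power_expand[OF assms(1-3)] sum_distrib_left
  by (intro sum.cong refl sum.mono_neutral_left) auto
 also have "\<dots> = (\<Sum>k\<le>4. pst P k * z ^ k * (wirtinger ^^ k) f z)"
  by (subst sum.swap) (simp add: pst_def sum_distrib_right mult.assoc)
 finally show ?thesis .
qed

definition quad_op :: "complex poly \<Rightarrow> complex poly \<Rightarrow> complex poly \<Rightarrow> (complex \<Rightarrow> complex) \<Rightarrow> complex \<Rightarrow> complex" where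
 "quad_op P Q R f z = z^2 * pact P f z - 2 * z * pact Q f z + pact R f z"

definition qc :: "complex poly \<Rightarrow> complex poly \<Rightarrow> complex poly \<Rightarrow> nat \<Rightarrow> complex \<Rightarrow> complex" where
 "qc P Q R k z = z^2 * pst P k - 2 * z * pst Q k + pst R k"

lemma quad_op_expand:
 assumes "open S" "wsmooth S f" "z \<in> S" "degree P \<le> 4" "degree Q \<le> 4" "degree R \<le> 4"
 shows "quad_op P Q R f z = (\<Sum>k\<le>4. qc P Q R k z * z ^ k * (wirtinger ^^ k) f z)"
 unfolding quad_op_def qc_def pact_expand[OF assms(1-4)] pact_expand[OF assms(1-3,5)] pact_expand[OF assms(1-3,6)]
 by (simp add: sum_distrib_left sum.distrib[symmetric] sum_subtractf[symmetric] algebra_simps)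

text \<open>The condition on the subleading coefficients is what makes the point \<open>1\<close>, where the leading
 coefficient \<open>z\<^sup>4 (z - 1)\<^sup>2\<close> vanishes, a regular singular point.\<close>

locale quartic_triple =
 fixes P Q R :: "complex poly"
 assumes deg: "degree P = 4" "degree Q = 4" "degree R = 4"
  and monic: "coeff P 4 = 1" "coeff Q 4 = 1" "coeff R 4 = 1"
  and sub: "coeff P 3 + coeff R 3 = 2 * coeff Q 3"
begin

lemma qc_4: "qc P Q R 4 z = (z - 1)^2"
proof -
 have "{..4 :: nat} = insert 4 {..3}" by auto
 then have "pst T 4 = coeff T 4" for T unfolding pst_def by simp
 then show ?thesis by (simp add: qc_def monic power2_eq_square algebra_simps)
qed

text \<open>Since \<open>pst T 3\<close> is the coefficient of X^3 plus a fixed multiple of the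
  leading one, the condition \<open>sub\<close> makes this quadratic polynomial vanish at 1.\<close>

lemma qc_3: "qc P Q R 3 z = (z - 1) * (pst P 3 * z - pst R 3)"
proof -
 have "{..4 :: nat} = insert 4 (insert 3 {..2})" by auto
 then have p: "pst T 3 = coeff T 4 * of_nat (Stirling 4 3) + coeff T 3" for T unfolding pst_def by simp
 have "pst P 3 + pst R 3 = 2 * pst Q 3" using sub by (simp add: p monic algebra_simps)
 then show ?thesis unfolding qc_def by (simp add: power2_eq_square algebra_simps) algebra
qed

lemma quad_op_eq:
 assumes "open S" "wsmooth S f" "z \<in> S" "z \<notin> {0, 1}"
 shows "quad_op P Q R f z = z^4 * (z - 1)^2 * ((wirtinger ^^ 4) f z + (\<Sum>k<4. qc P Q R k z / (z ^ (4 - k) * (z - 1)^2) * (wirtinger ^^ k) f z))"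
proof -
 have z: "z \<noteq> 0" "z - 1 \<noteq> 0" using assms(4) by auto
 have "qc P Q R k z * z ^ k * w = z^4 * (z - 1)^2 * (qc P Q R k z / (z ^ (4 - k) * (z - 1)^2) * w)" if "k < 4" for k w
 proof -
  have "z ^ 4 = z ^ k * z ^ (4 - k)" using that by (simp add: power_add[symmetric])
  then show ?thesis using z by simp
 qed
 then have "(\<Sum>k<4. qc P Q R k z * z ^ k * (wirtinger ^^ k) f z) = z^4 * (z - 1)^2 * (\<Sum>k<4. qc P Q R k z / (z ^ (4 - k) * (z - 1)^2) * (wirtinger ^^ k) f z)"
  unfolding sum_distrib_left by (intro sum.cong) auto
 moreover have "{..4 :: nat} = insert 4 {..<4}" by auto
 ultimately show ?thesis
  using quad_op_expand[OF assms(1-3), of P Q R] deg by (simp add: qc_4 distrib_left mult.commute)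
qed

lemma qc_holomorphic [holomorphic_intros]: "qc P Q R k holomorphic_on S"
 unfolding qc_def[abs_def] by (intro holomorphic_intros)

text \<open>At 0 the powers of z have exactly the orders allowed. At 1 the quotient by (z - 1)^2
  exceeds the allowed order 4 - k only for k = 3, where \<open>qc_3\<close> supplies a zero. The
  free factor \<open>\<kappa>\<close> admits the operator in the coordinate at infinity.\<close>

lemma regular_singular:
 assumes D: "\<And>S f z. open S \<Longrightarrow> S \<subseteq> ball a 1 - {a} \<Longrightarrow> f holomorphic_on S \<Longrightarrow> z \<in> S \<Longrightarrow> D f z = \<kappa> z * quad_op P Q R f z"
  and \<kappa>: "\<kappa> holomorphic_on ball a 1 - {a}" "\<And>z. z \<in> ball a 1 - {a} \<Longrightarrow> \<kappa> z \<noteq> 0"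
 shows "at_most_regular_singular 4 D a"
proof -
 define r where "r = (if a = 0 \<or> a = 1 then 1 else min 1 (min (dist a 0) (dist a 1)))"
 have r: "r > 0" "ball a r - {a} \<subseteq> ball a 1 - {a}" by (auto simp: r_def)
 have nz: "z \<notin> {0, 1}" if "z \<in> ball a r - {a}" for z
  using that by (auto simp: r_def dist_commute split: if_splits)
 define q where "q k z = (if a = 0 then qc P Q R k z / (z - 1)^2 else if a = 1 then
   (if k = 3 then (pst P 3 * z - pst R 3) / z else qc P Q R k z * (z - 1) ^ (2 - k) / z ^ (4 - k))
   else qc P Q R k z * (z - a) ^ (4 - k) / (z ^ (4 - k) * (z - 1)^2))" for k z
 have qh: "q k holomorphic_on ball a r" for k
 proof -
  consider "a = 0" | "a = 1" "k = 3" | "a = 1" "k \<noteq> 3" | "a \<noteq> 0" "a \<noteq> 1" by blast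
  then show ?thesis
  proof cases
   case 1
   then have "\<forall>z\<in>ball a r. z - 1 \<noteq> 0" by (auto simp: r_def)
   then show ?thesis unfolding q_def[abs_def] using 1 by (auto intro!: holomorphic_intros)
  next
   case 2
   then have "\<forall>z\<in>ball a r. z \<noteq> 0" by (auto simp: r_def)
   then show ?thesis unfolding q_def[abs_def] using 2 by (auto intro!: holomorphic_intros)
  next
   case 3
   then have "\<forall>z\<in>ball a r. z \<noteq> 0" by (auto simp: r_def)
   then show ?thesis unfolding q_def[abs_def] using 3 by (auto intro!: holomorphic_intros)
  next
   case 4
   then have "\<forall>z\<in>ball a r. z \<noteq> 0 \<and> z - 1 \<noteq> 0" by (auto simp: r_def dist_commute)
   then show ?thesis unfolding q_def[abs_def] using 4 by (auto intro!: holomorphic_intros)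
  qed
 qed
 have eq: "qc P Q R k z / (z ^ (4 - k) * (z - 1)^2) = q k z / (z - a) ^ (4 - k)" if z: "z \<in> ball a r - {a}" and k: "k < 4" for z k
 proof -
  have z': "z \<noteq> 0" "z - 1 \<noteq> 0" "z - a \<noteq> 0" using nz[OF z] z by auto
  consider "a = 0" | "a = 1" "k = 3" | "a = 1" "k \<noteq> 3" | "a \<noteq> 0" "a \<noteq> 1" by blast
  then show ?thesis
  proof cases
   case 1
   then show ?thesis by (simp add: q_def mult.commute)
  next
   case 2
   then show ?thesis using z' by (simp add: q_def qc_3 power2_eq_square)
  next
   case 3
   then have "4 - k = 2 + (2 - k)" using k by auto
   then have "(z - 1) ^ (4 - k) = (z - 1)^2 * (z - 1) ^ (2 - k)" by (simp only: power_add)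
   then show ?thesis using z' 3 by (simp add: q_def)
  next
   case 4
   then show ?thesis using z' by (simp add: q_def)
  qed
 qed
 show ?thesis
  unfolding at_most_regular_singular_def
 proof (intro exI[of _ r] conjI exI[of _ "\<lambda>z. \<kappa> z * (z^4 * (z - 1)^2)"] exI[of _ q] allI impI ballI)
  show "(\<lambda>z. \<kappa> z * (z^4 * (z - 1)^2)) holomorphic_on ball a r - {a}"
   using holomorphic_on_subset[OF \<kappa>(1) r(2)] by (intro holomorphic_intros)
  show "\<kappa> z * (z^4 * (z - 1)^2) \<noteq> 0" if "z \<in> ball a r - {a}" for z using nz[OF that] \<kappa>(2)[of z] r(2) that by auto
  fix f z assume f: "f holomorphic_on ball a r - {a}" and z: "z \<in> ball a r - {a}"
  have S: "open (ball a r - {a})" by (simp add: open_delete)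
  have w: "(wirtinger ^^ k) f z = (deriv ^^ k) f z" for k by (rule wirtinger_power_holomorphic[OF S f z])
  show "D f z = \<kappa> z * (z^4 * (z - 1)^2) * ((deriv ^^ 4) f z + (\<Sum>i<4. q i z / (z - a) ^ (4 - i) * (deriv ^^ i) f z))"
   unfolding D[OF S r(2) f z] quad_op_eq[OF S wsmooth_holomorphic[OF S f] z nz[OF z]] w
   using eq[OF z] by (simp add: mult.assoc)
 qed (use r qh in auto)
qed

end

lemma wirtinger_compose:
 assumes "G differentiable (at (\<phi> z))" "(\<phi> has_field_derivative d) (at z)"
 shows "wirtinger (\<lambda>z. G (\<phi> z)) z = wirtinger G (\<phi> z) * d" (is ?c1) "(\<lambda>z. G (\<phi> z)) differentiable (at z)" (is ?c2)
proof -
 obtain b where b: "(G has_derivative (\<lambda>h. wirtinger G (\<phi> z) * h + b * cnj h)) (at (\<phi> z))" by (rule frechet_wirtinger[OF assms(1)])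
 have "(\<phi> has_derivative (\<lambda>h. d * h)) (at z)" using assms(2) by (simp add: has_field_derivative_def)
 from diff_chain_at[OF this b] have D: "((\<lambda>z. G (\<phi> z)) has_derivative (\<lambda>h. (wirtinger G (\<phi> z) * d) * h + (b * cnj d) * cnj h)) (at z)"
  by (simp add: o_def mult.assoc)
 show ?c1 by (rule wirtinger_eqI[OF D])
 show ?c2 using D by (auto simp: differentiable_def)
qed

text \<open>The Euler operator only changes sign under z |-> 1/z, so infinity can be treated like
  0.\<close>

lemma th_inversion:
 assumes "open S" "0 \<notin> S" "wsmooth S g" "z \<noteq> 0" "1 / z \<in> S"
 shows "(\<lambda>z. (th ^^ i) g (1 / z)) differentiable (at z)" (is ?c1) "(th ^^ i) (\<lambda>z. g (1 / z)) z = (- 1) ^ i * (th ^^ i) g (1 / z)" (is ?c2)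
proof -
 have der: "((\<lambda>z. 1 / z) has_field_derivative - (1 / z^2)) (at z)" if "z \<noteq> 0" for z :: complex
  using that by (auto intro!: derivative_eq_intros simp: power2_eq_square)
 define T where "T = - {0} \<inter> (\<lambda>z :: complex. 1 / z) -` S"
 have T: "open T" unfolding T_def
  by (rule continuous_open_preimage[OF _ _ assms(1)]) (auto intro!: continuous_intros)
 have d: "(th ^^ i) g differentiable (at (1 / z))" if "z \<in> T" for i z
  using wsmooth_differentiable[OF wsmooth_th(2)[OF assms(1,3)]] that by (auto simp: T_def)
 have dd: "(\<lambda>z. (th ^^ i) g (1 / z)) differentiable (at z)" if "z \<in> T" for i z
  by (rule wirtinger_compose(2)[OF d[OF that] der]) (use that in \<open>auto simp: T_def\<close>)
 have z: "z \<in> T" using assms by (auto simp: T_def)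
 show ?c1 by (rule dd[OF z])
 show ?c2
  using z
 proof (induction i arbitrary: z)
  case (Suc i)
  then have z: "z \<noteq> 0" by (auto simp: T_def)
  have "(th ^^ Suc i) (\<lambda>z. g (1 / z)) z = th (\<lambda>z. (- 1) ^ i * (th ^^ i) g (1 / z)) z"
   using th_cong[OF T Suc.IH Suc.prems] by simp
  also have "\<dots> = (- 1) ^ i * th (\<lambda>z. (th ^^ i) g (1 / z)) z" by (rule th_rules(2)[OF dd dd]; fact Suc.prems)
  also have "th (\<lambda>z. (th ^^ i) g (1 / z)) z = - th ((th ^^ i) g) (1 / z)"
   unfolding th_def[of "\<lambda>z. (th ^^ i) g (1 / z)"] th_def[of "(th ^^ i) g"] wirtinger_compose(1)[OF d[OF Suc.prems] der[OF z]]
   using z by (simp add: power2_eq_square)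
  finally show ?case by simp
 qed simp
qed

lemma wsmooth_inversion:
 assumes "open S" "0 \<notin> S" "g holomorphic_on S"
 shows "open {z. z \<noteq> 0 \<and> 1 / z \<in> S}" "wsmooth {z. z \<noteq> 0 \<and> 1 / z \<in> S} (\<lambda>z. g (1 / z))" (is ?c1)
proof -
 have "open (- {0} \<inter> (\<lambda>z :: complex. 1 / z) -` S)"
  by (rule continuous_open_preimage[OF _ _ assms(1)]) (auto intro!: continuous_intros)
 moreover have "- {0} \<inter> (\<lambda>z :: complex. 1 / z) -` S = {z. z \<noteq> 0 \<and> 1 / z \<in> S}" by auto
 ultimately show o: "open {z. z \<noteq> 0 \<and> 1 / z \<in> S}" by simp
 show ?c1
 proof (rule wsmooth_holomorphic[OF o])
  have "g \<circ> (\<lambda>z. 1 / z) holomorphic_on {z. z \<noteq> 0 \<and> 1 / z \<in> S}"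
   by (rule holomorphic_on_compose_gen[OF _ assms(3)]) (auto intro!: holomorphic_intros)
  then show "(\<lambda>z. g (1 / z)) holomorphic_on {z. z \<noteq> 0 \<and> 1 / z \<in> S}" by (simp add: o_def)
 qed
qed

definition negp :: "complex poly \<Rightarrow> complex poly" where
 "negp P = pcompose P [:0, - 1:]"

lemma coeff_negp: "coeff (negp P) i = (- 1) ^ i * coeff P i"
 unfolding negp_def by (simp add: coeff_pcompose_linear)

lemma degree_negp: "degree (negp P) = degree P"
 unfolding negp_def by (simp add: degree_pcompose)

lemma pact_inversion:
 assumes "open S" "0 \<notin> S" "wsmooth S g" "w \<in> S"
 shows "pact P (\<lambda>z. g (1 / z)) (1 / w) = pact (negp P) g w"
proof -
 have w: "1 / w \<noteq> 0" "1 / (1 / w) \<in> S" "1 / (1 / w) = w" using assms by auto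
 show ?thesis
  unfolding pact_def degree_negp coeff_negp th_inversion(2)[OF assms(1-3) w(1,2)] w(3) by (simp add: mult_ac)
qed

context quartic_triple begin

text \<open>In the coordinate w = 1/z the operator is w^(-2) times one of the same kind, with the
  outer polynomials exchanged and X replaced by -X throughout. The monic quartics stay monic, and
  the condition on the cubic coefficients is preserved.\<close>

lemma fuchsian_quad:
 assumes D: "\<And>S f z. open S \<Longrightarrow> wsmooth S f \<Longrightarrow> z \<in> S \<Longrightarrow> D f z = quad_op P Q R f z"
 shows "fuchsian 4 D"
 unfolding fuchsian_def
proof (intro conjI allI)
 show "at_most_regular_singular 4 D a" for a
  by (rule regular_singular[of a D "\<lambda>_. 1"]) (use D wsmooth_holomorphic in auto)
 interpret inf: quartic_triple "negp R" "negp Q" "negp P"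
  by unfold_locales (use sub in \<open>simp_all add: degree_negp coeff_negp deg monic, simp add: add_eq_0_iff algebra_simps\<close>)
 show "at_most_regular_singular 4 (op_at_infinity D) 0"
 proof (rule inf.regular_singular)
  show "(\<lambda>w. 1 / w^2) holomorphic_on ball 0 1 - {0}" by (intro holomorphic_intros) auto
  fix S f z assume S: "open S" "S \<subseteq> ball 0 1 - {0 :: complex}" and f: "f holomorphic_on S" and z: "z \<in> S"
  have S0: "0 \<notin> S" using S by auto
  have z0: "z \<noteq> 0" using S0 z by auto
  note p = pact_inversion[OF S(1) S0 wsmooth_holomorphic[OF S(1) f] z]
  have "D (\<lambda>z. f (1 / z)) (1 / z) = quad_op P Q R (\<lambda>z. f (1 / z)) (1 / z)"
   by (rule D[OF wsmooth_inversion[OF S(1) S0 f]]) (use z z0 in simp)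
  then show "op_at_infinity D f z = 1 / z^2 * quad_op (negp R) (negp Q) (negp P) f z"
   unfolding op_at_infinity_def quad_op_def p using z0 by (simp add: field_simps power2_eq_square)
 qed auto
qed

end

section \<open>Factored form of the operator\<close>

lemma monic_quartic_factor:
 fixes P :: "complex poly"
 assumes "degree P = 4" "coeff P 4 = 1"
 obtains a :: conf where "P = [:a 1, 1:] * ([:a 2, 1:] * ([:a 3, 1:] * [:a 4, 1:]))"
proof -
 have "P \<noteq> 0" using assms by auto
 then obtain A where A: "size A = 4" "P = smult (coeff P 4) (\<Prod>x\<in>#A. [:-x, 1:])"
  using alg_closed_imp_factorization[of P] assms by auto
 obtain xs where xs: "mset xs = A" using ex_mset by blast
 have "length xs = 4" using A(1) xs by auto
 then obtain x1 x2 x3 x4 where "xs = [x1, x2, x3, x4]" by (auto simp: numeral_eq_Suc length_Suc_conv)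
 then have "A = {#x1, x2, x3, x4#}" using xs by auto
 then have "P = [:- x1, 1:] * ([:- x2, 1:] * ([:- x3, 1:] * [:- x4, 1:]))"
  using A(2) assms(2) by (simp only: image_mset_add_mset prod_mset.add_mset image_mset_empty prod_mset_empty smult_1_left mult_1_right)
 then show ?thesis
  by (intro that[of "\<lambda>k. if k = 1 then - x1 else if k = 2 then - x2 else if k = 3 then - x3 else - x4"]) simp
qed

text \<open>Over the complex numbers the three monic quartics split into linear factors. The middle
  term is twice one quartic, so the two products in it are taken equal, and the shift by 1 in
  \<open>B\<close> and \<open>Bt\<close> is undone by adding 1 to the factors.\<close>

lemma (in quartic_triple) BPZ_operator_exists:
 "\<exists>A B At Bt. fuchsian 4 (BPZ_operator A B At Bt) \<and>
   (\<forall>S f z. open S \<longrightarrow> wsmooth S f \<longrightarrow> z \<in> S \<longrightarrow> BPZ_operator A B At Bt f z = quad_op P Q R f z)"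
proof -
 obtain A :: conf where A: "P = [:A 1, 1:] * ([:A 2, 1:] * ([:A 3, 1:] * [:A 4, 1:]))" using monic_quartic_factor[OF deg(1) monic(1)] .
 obtain B :: conf where B: "R = [:B 1, 1:] * ([:B 2, 1:] * ([:B 3, 1:] * [:B 4, 1:]))" using monic_quartic_factor[OF deg(3) monic(3)] .
 obtain C :: conf where C: "Q = [:C 1, 1:] * ([:C 2, 1:] * ([:C 3, 1:] * [:C 4, 1:]))" using monic_quartic_factor[OF deg(2) monic(2)] .
 have eq: "BPZ_operator A (\<lambda>k. B k + 1) C (\<lambda>k. C k + 1) f z = quad_op P Q R f z" if "open S" "wsmooth S f" "z \<in> S" for S f z
  unfolding BPZ_operator_def quad_op_def add_diff_cancel euler_prod_pact[OF that] A[symmetric] B[symmetric] C[symmetric]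
  by (simp add: algebra_simps)
 have "fuchsian 4 (BPZ_operator A (\<lambda>k. B k + 1) C (\<lambda>k. C k + 1))" by (rule fuchsian_quad) (rule eq)
 then show ?thesis using eq by blast
qed

lemma degree_tm_le: "degree P \<le> d \<Longrightarrow> degree (tm c P) \<le> Suc d"
 unfolding tm_def by (intro degree_diff_le) (auto intro: order_trans[OF degree_pCons_le] order_trans[OF degree_smult_le])

lemma monic_tm:
 assumes "degree P \<le> d" "coeff P d = 1"
 shows "degree (tm c P) \<le> Suc d \<and> coeff (tm c P) (Suc d) = 1"
 using degree_tm_le[OF assms(1), of c] assms coeff_eq_0[of P "Suc d"] by (simp add: tm_def)

text \<open>The corrections \<open>PW\<close> and \<open>pb\<close> have degree at most 3 and 2. So
  all three polynomials are monic of degree 4, and the cubic coefficients match because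
  \<open>P1\<close> contains just half of \<open>PW\<close>.\<close>

lemma (in ladder_polys) quartic_triple_ladder: "quartic_triple P2 P1 P0"
proof -
 have p1: "degree (1 :: complex poly) \<le> 0 \<and> coeff (1 :: complex poly) 0 = 1" by simp
 note t = degree_tm_le
 have f1: "degree pf1 \<le> 1" "coeff pf1 1 = 1" by (simp_all add: pf1_def)
 have f2: "degree pf2 \<le> 2" "coeff pf2 2 = 1" using monic_tm[OF f1, of "L 0 1"] by (simp_all add: pf2_def numeral_2_eq_2)
 have g: "degree pg \<le> 3" "coeff pg 3 = 1" using monic_tm[OF f2, of "L 1 1"] by (simp_all add: pg_def numeral_3_eq_3 numeral_2_eq_2)
 have P0: "degree P0 \<le> 4" "coeff P0 4 = 1" using monic_tm[OF g, of "L 1 2"] by (simp_all add: P0_def numeral_3_eq_3 eval_nat_numeral)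
 have f1': "degree pf1 \<le> 2" using f1(1) by linarith
 have d: "degree pe1 \<le> 1" "degree pe2 \<le> 2" "degree pq \<le> 2" "degree pr \<le> 3" "degree pu \<le> 1" "degree pv \<le> 2" "degree ptt \<le> 2"
  unfolding pe2_def ptt_def pr_def unfolding pe1_def pq_def pu_def pv_def
  using t[of 1 0] t[of pf1 1] f1 t[OF t[of 1 0]] t[OF t[of pf1 1]] by (simp_all add: numeral_2_eq_2 numeral_3_eq_3)
 have sl: "degree (smult c T) \<le> k" if "degree T \<le> k" for c k and T :: "complex poly" using that degree_smult_le order_trans by blast
 have tm2: "degree (tm c pu) \<le> 2" "degree (tm c pe2) \<le> 3" for c using t[OF d(5)] t[OF d(2)] by (simp_all add: numeral_2_eq_2 numeral_3_eq_3)
 have b: "degree pb \<le> 2" unfolding pb_def by (intro degree_add_le degree_diff_le sl) (use d f1' f2 in auto)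
 have dd: "degree pd \<le> 3" unfolding pd_def by (intro degree_add_le degree_diff_le sl) (use d f1 f2 tm2[of "L (m - 1) (n - 1)"] in auto)
 have s: "degree ps \<le> 3" unfolding ps_def by (intro degree_add_le degree_diff_le sl) (use d f1 f2 g dd tm2[of "L (m - 1) (n - 1)"] in auto)
 have W: "degree PW \<le> 3" unfolding PW_def using t[OF b, of "L 1 2"] s by (intro degree_add_le sl) simp_all
 have c: "coeff PW 4 = 0" "coeff pb 4 = 0" "coeff pb 3 = 0" using W b by (auto intro: coeff_eq_0)
 have c4: "coeff P2 4 = 1" "coeff P1 4 = 1" using P0 c by (simp_all add: P2_def P1_def)
 have d4: "degree P2 \<le> 4" "degree P1 \<le> 4"
  unfolding P2_def P1_def by (intro degree_diff_le sl; use P0 W b in simp)+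
 have e: "degree T = 4" if "degree T \<le> 4" "coeff T 4 = 1" for T :: "complex poly"
  using that le_degree[of T 4] by simp
 show ?thesis
  by unfold_locales (use e P0 c4 d4 c in \<open>auto simp: P2_def P1_def\<close>)
qed

section \<open>Analytic continuation\<close>

lemma prs_Sigma: "prs n = Sigma {..<n} (\<lambda>u. {u<..Suc n})"
 by (auto simp: prs_def)

lemma prod_prs:
 fixes f :: pairing
 shows "(\<Prod>(u, v)\<in>prs n. f u v) = (\<Prod>j<n. f j n * f j (Suc n)) * (\<Prod>j<n. \<Prod>i<j. f i j)"
proof -
 have "(\<Prod>(u, v)\<in>prs n. f u v) = (\<Prod>u<n. \<Prod>v\<in>{u<..Suc n}. f u v)"
  unfolding prs_Sigma by (rule prod.Sigma[symmetric]) auto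
 also have "\<dots> = (\<Prod>u<n. f u n * f u (Suc n) * (\<Prod>v\<in>{u<..<n}. f u v))"
 proof (rule prod.cong[OF refl])
  fix u assume "u \<in> {..<n}"
  then have "{u<..Suc n} = insert n (insert (Suc n) {u<..<n})" by auto
  then show "(\<Prod>v\<in>{u<..Suc n}. f u v) = f u n * f u (Suc n) * (\<Prod>v\<in>{u<..<n}. f u v)" by (simp add: mult.assoc)
 qed
 also have "\<dots> = (\<Prod>j<n. f j n * f j (Suc n)) * (\<Prod>u<n. \<Prod>v\<in>{u<..<n}. f u v)" by (rule prod.distrib)
 also have "(\<Prod>u<n. \<Prod>v\<in>{u<..<n}. f u v) = (\<Prod>(u, v)\<in>Sigma {..<n} (\<lambda>u. {u<..<n}). f u v)"
  by (rule prod.Sigma) auto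
 also have "\<dots> = (\<Prod>(j, i)\<in>Sigma {..<n} (\<lambda>j. {..<j}). f i j)"
  by (rule prod.reindex_bij_witness[of _ prod.swap prod.swap]) auto
 also have "\<dots> = (\<Prod>j<n. \<Prod>i<j. f i j)" by (rule prod.Sigma[symmetric]) auto
 finally show ?thesis .
qed

text \<open>With h = \<gamma>^2 / 2 the charges give the ladder exponents. The coweights are dual to
  the roots, so \<open>z\<close> interacts only with the variables of kind \<open>root2\<close> and
  the point 1 only with those of kind \<open>root1\<close>.\<close>

lemma DF_integrand_psi:
 assumes \<alpha>s: "\<alpha>s = - ((\<gamma> / 2) *s coweight2)" and \<alpha>2: "\<alpha>2 = - (\<gamma> *s coweight1)"
 shows "DF_integrand \<gamma> \<alpha>s \<alpha>1 \<alpha>2 n1 n2 z x =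
   psi (n1 + n2) (lcoef n1 (1 - \<gamma> * form \<alpha>1 root1 / 2) (1 - \<gamma> * form \<alpha>1 root2 / 2)) (lexp n1 (n1 + n2) (\<gamma>^2 / 2)) z x"
proof -
 define N where "N = n1 + n2"
 have fs: "form (c *s u) v = c * form u v" "form v (c *s u) = c * form v u" "form (- u) v = - form u v" for c u v
  by (simp_all add: form_def sum_2 algebra_simps)
 have e: "lexp n1 N (\<gamma>^2 / 2) j N = - form \<alpha>s (\<gamma> *s screening_root n1 j) / 2"
  "lexp n1 N (\<gamma>^2 / 2) j (Suc N) = - form \<alpha>2 (\<gamma> *s screening_root n1 j) / 2" if "j < N" for j
  using that unfolding \<alpha>s \<alpha>2 by (simp_all add: fs screening_root_def form_coweights_roots lexp_def Let_def N_def power2_eq_square)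
 have e2: "lexp n1 N (\<gamma>^2 / 2) i j = - form (\<gamma> *s screening_root n1 i) (\<gamma> *s screening_root n1 j) / 2" if "i < j" "j < N" for i j
  using that by (simp add: fs screening_root_def form_roots lexp_def Let_def N_def power2_eq_square)
 have a: "2 * (lcoef n1 (1 - \<gamma> * form \<alpha>1 root1 / 2) (1 - \<gamma> * form \<alpha>1 root2 / 2) j - 1) = - form \<alpha>1 (\<gamma> *s screening_root n1 j)" for j
  by (simp add: lcoef_def screening_root_def fs)
 have "psi N (lcoef n1 (1 - \<gamma> * form \<alpha>1 root1 / 2) (1 - \<gamma> * form \<alpha>1 root2 / 2)) (lexp n1 N (\<gamma>^2 / 2)) z x =
   (\<Prod>j<N. abs_powr (x j) (- form \<alpha>1 (\<gamma> *s screening_root n1 j))) *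
   ((\<Prod>j<N. abs_powr (x j - z) (- form \<alpha>s (\<gamma> *s screening_root n1 j)) * abs_powr (x j - 1) (- form \<alpha>2 (\<gamma> *s screening_root n1 j))) *
   (\<Prod>j<N. \<Prod>i<j. abs_powr (x i - x j) (- form (\<gamma> *s screening_root n1 i) (\<gamma> *s screening_root n1 j))))"
  unfolding psi_def a prod_prs
  by (intro arg_cong2[where f="(*)"] prod.cong refl) (auto simp: e e2 pt_def)
 also have "\<dots> = DF_integrand \<gamma> \<alpha>s \<alpha>1 \<alpha>2 n1 n2 z x"
  unfolding DF_integrand_def N_def by (simp add: prod.distrib mult_ac)
 finally show ?thesis by (simp add: N_def)
qed

lemma sc_real_mult: "sc s (of_real r * c) = of_real r * sc s c"
 by (simp add: sc_def algebra_simps)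

lemma sca_lcoef: "sca s (lcoef n1 \<alpha> \<beta>) = lcoef n1 (sc s \<alpha>) (sc s \<beta>)"
 by (simp add: sca_def lcoef_def fun_eq_iff)

text \<open>All these exponents are real multiples of h and \<open>sc\<close> is real-linear in the
  exponent, so the contracted exponents form again a ladder, with \<open>sc s h\<close> in place of
  h.\<close>

lemma sce_lexp: "sce s (lexp n1 N h) = lexp n1 N (sc s h)"
proof -
 have "sc s (- 2 * h) = - 2 * sc s h" "sc s (- h) = - sc s h" "sc s (h / 2) = sc s h / 2" "sc s 0 = 0"
  using sc_real_mult[of s "- 2" h] sc_real_mult[of s "- 1" h] sc_real_mult[of s "1 / 2" h] sc_real_mult[of s 0 h] by simp_all
 then show ?thesis unfolding sce_def[abs_def] lexp_def Let_def if_distrib[of "sc s"] by (simp only:)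
qed

lemma brackets_lexp: "N = n1 + n2 \<Longrightarrow> brackets N (lexp n1 N h)"
 by unfold_locales (simp_all add: lexp_def Let_def min.commute max.commute)

section \<open>Holomorphic dependence of the operator on the contraction parameter\<close>

definition hol_poly :: "(complex \<Rightarrow> complex poly) \<Rightarrow> bool" where
 "hol_poly P \<longleftrightarrow> (\<forall>i. (\<lambda>s. coeff (P s) i) holomorphic_on UNIV)"

lemma hol_poly_add: "hol_poly P \<Longrightarrow> hol_poly Q \<Longrightarrow> hol_poly (\<lambda>s. P s + Q s)"
 and hol_poly_diff: "hol_poly P \<Longrightarrow> hol_poly Q \<Longrightarrow> hol_poly (\<lambda>s. P s - Q s)"
 and hol_poly_smult: "c holomorphic_on UNIV \<Longrightarrow> hol_poly P \<Longrightarrow> hol_poly (\<lambda>s. smult (c s) (P s))"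
 unfolding hol_poly_def by (auto intro!: holomorphic_intros)

lemma hol_poly_tm:
 assumes "c holomorphic_on UNIV" "hol_poly P"
 shows "hol_poly (\<lambda>s. tm (c s) (P s))"
 unfolding hol_poly_def
proof
 show "(\<lambda>s. coeff (tm (c s) (P s)) i) holomorphic_on UNIV" for i
  using assms unfolding hol_poly_def tm_def by (cases i) (auto intro!: holomorphic_intros)
qed

lemma hol_poly_const: "hol_poly (\<lambda>s. P)"
 unfolding hol_poly_def by (auto intro!: holomorphic_intros)

lemma sc_holomorphic: "(\<lambda>s. sc s c) holomorphic_on S"
 unfolding sc_def by (intro holomorphic_intros)

lemma cL_holomorphic: "(\<lambda>s. cL (sc s \<alpha>) (sc s \<beta>) (sc s h) x y) holomorphic_on S"
 unfolding cL_def by (intro holomorphic_intros sc_holomorphic) auto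

lemmas ladder_polys_defs = ladder_polys.P2_def ladder_polys.P1_def ladder_polys.P0_def ladder_polys.PW_def ladder_polys.ps_def
 ladder_polys.pd_def ladder_polys.pg_def ladder_polys.pb_def ladder_polys.ptt_def ladder_polys.pv_def ladder_polys.pu_def
 ladder_polys.pr_def ladder_polys.pq_def ladder_polys.pe2_def ladder_polys.pe1_def ladder_polys.pf2_def ladder_polys.pf1_def

lemmas hol_poly_intros = hol_poly_add hol_poly_diff hol_poly_smult hol_poly_tm hol_poly_const cL_holomorphic sc_holomorphic

lemma hol_poly_ladder:
 "hol_poly (\<lambda>s. ladder_polys.P2 (sc s \<alpha>) (sc s \<beta>) (sc s h) m n)" (is ?c1)
 "hol_poly (\<lambda>s. ladder_polys.P1 (sc s \<alpha>) (sc s \<beta>) (sc s h) m n)" (is ?c2)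
 "hol_poly (\<lambda>s. ladder_polys.P0 (sc s \<alpha>) (sc s \<beta>) (sc s h))" (is ?c3)
proof -
 show ?c1
  unfolding ladder_polys_defs by (intro hol_poly_intros holomorphic_intros) simp_all
 show ?c2
  unfolding ladder_polys_defs by (intro hol_poly_intros holomorphic_intros) simp_all
 show ?c3
  unfolding ladder_polys_defs by (intro hol_poly_intros holomorphic_intros)
qed

lemma qc_hol:
 assumes "hol_poly P" "hol_poly Q" "hol_poly R"
 shows "(\<lambda>s. qc (P s) (Q s) (R s) k z) holomorphic_on UNIV"
proof -
 have "(\<lambda>s. pst (T s) k) holomorphic_on UNIV" if "hol_poly T" for T
  using that unfolding pst_def hol_poly_def by (auto intro!: holomorphic_intros)
 then show ?thesis using assms unfolding qc_def by (auto intro!: holomorphic_intros)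
qed

lemma reduced_correlation_eq:
 assumes "z \<notin> {0, 1}"
 shows "reduced_correlation \<gamma> \<alpha>s \<alpha>1 \<alpha>2 n1 n2 z = (\<integral>x. DF_integrand \<gamma> \<alpha>s \<alpha>1 \<alpha>2 n1 n2 z x \<partial>config (n1 + n2))"
proof -
 have "abs_powr w c * abs_powr w (- c) = 1" if "w \<noteq> 0" for w c
  using that by (simp add: abs_powr_def powr_minus)
 from this[of z] this[of "z - 1"] have "abs_powr z c * abs_powr (z - 1) d * (abs_powr z (- c) * abs_powr (z - 1) (- d) * w) = w" for c d w
  using assms by (simp add: mult_ac)
 then show ?thesis unfolding reduced_correlation_def correlation_def DF_measure_def .
qed

lemma psx_Nil: "psx n a e [] [] z = psi n a e z"
 by (simp add: psx_def fun_eq_iff)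

locale dotsenko_fateev =
 fixes n1 n2 N :: nat and \<alpha> \<beta> h :: complex
 assumes N: "N = n1 + n2" and h: "h \<noteq> 0"
  and int: "\<And>z. z \<in> Om \<Longrightarrow> integrable (config N) (psi N (lcoef n1 \<alpha> \<beta>) (lexp n1 N h) z)"
begin

abbreviation "a \<equiv> lcoef n1 \<alpha> \<beta>"
abbreviation "e \<equiv> lexp n1 N h"

definition Hs :: "complex \<Rightarrow> complex \<Rightarrow> complex" where
 "Hs s z = (\<integral>x. psi N (sca s a) (sce s e) z x \<partial>config N)"

text \<open>Smoothness asks only for the integrability of \<open>psi\<close>, not for that of
  forests, and is therefore available at s = 1.\<close>

lemma wsmooth_Hs:
 assumes "\<And>z. z \<in> Om \<Longrightarrow> integrable (config N) (psi N (sca s a) (sce s e) z)"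
 shows "wsmooth Om (Hs s)"
proof -
 interpret brackets N "sca s a" "sce s e" unfolding sce_lexp by (rule brackets_lexp[OF N])
 have "wsmooth Om (FI N (sca s a) (sce s e) [] [])" by (rule good_wsmooth) (use assms in \<open>simp add: good_def psx_Nil\<close>)
 moreover have "FI N (sca s a) (sce s e) [] [] = Hs s" by (rule ext) (simp add: FI_def psx_Nil Hs_def)
 ultimately show ?thesis by simp
qed

abbreviation "PP s \<equiv> ladder_polys.P2 (sc s \<alpha>) (sc s \<beta>) (sc s h) (of_nat n1) (of_nat n2)"
abbreviation "QQ s \<equiv> ladder_polys.P1 (sc s \<alpha>) (sc s \<beta>) (sc s h) (of_nat n1) (of_nat n2)"
abbreviation "RR s \<equiv> ladder_polys.P0 (sc s \<alpha>) (sc s \<beta>) (sc s h)"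

lemma quartic_PP: "quartic_triple (PP s) (QQ s) (RR s)"
 by (rule ladder_polys.quartic_triple_ladder)

lemma small_ode:
 obtains s1 where "s1 > 0" "\<And>s z. 0 < s \<Longrightarrow> s \<le> s1 \<Longrightarrow> z \<in> Om \<Longrightarrow> integrable (config N) (psi N (sca (of_real s) a) (sce (of_real s) e) z)"
  "\<And>s z. 0 < s \<Longrightarrow> s \<le> s1 \<Longrightarrow> z \<in> Om \<Longrightarrow> quad_op (PP (of_real s)) (QQ (of_real s)) (RR (of_real s)) (Hs (of_real s)) z = 0"
proof -
 \<comment> \<open>Any point of \<open>Om\<close> would serve: the tropical integral does not
   involve z, and one bound on s is valid for all z.\<close>
 have "integrable (config N) (psi N a e 2)" by (rule int) simp
 from integrable_psi_ins_small[OF this] obtain s1 where s1: "s1 > 0"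
  "\<And>s z l. 0 < s \<Longrightarrow> s \<le> s1 \<Longrightarrow> z \<noteq> 0 \<Longrightarrow> forest N l \<Longrightarrow>
   integrable (config N) (\<lambda>x. psi N (\<lambda>j. sc (of_real s) (a j)) (\<lambda>u v. sc (of_real s) (e u v)) z x * ins N l z x)"
  by auto
 have i: "integrable (config N) (psx N (sca (of_real s) a) (sce (of_real s) e) l [] z)" if "0 < s" "s \<le> s1" "z \<in> Om" "forest N l" for s z l
  using s1(2)[OF that(1,2) _ that(4)] that(3) by (simp add: psx_def[abs_def] sca_def[abs_def] sce_def[abs_def])
 have i': "integrable (config N) (psi N (sca (of_real s) a) (sce (of_real s) e) z)" if "0 < s" "s \<le> s1" "z \<in> Om" for s z
  using i[OF that, of "[]"] by (simp add: psx_Nil)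
 show ?thesis
 proof (rule that[OF s1(1) i'])
  fix s z assume s: "0 < s" "s \<le> s1" and z: "z \<in> Om"
  interpret ladder n1 n2 N "sc (of_real s) \<alpha>" "sc (of_real s) \<beta>" "sc (of_real s) h"
   by unfold_locales (use N i[OF s] in \<open>simp_all add: sca_lcoef sce_lexp\<close>)
  have hs: "sc (of_real s) h \<noteq> 0" using h s(1) by (simp add: sc_def complex_eq_iff)
  have "Hs (of_real s) = br (\<lambda>p. 1)" by (simp add: Hs_def[abs_def] br_def[abs_def] sca_lcoef sce_lexp)
  then show "quad_op (PP (of_real s)) (QQ (of_real s)) (RR (of_real s)) (Hs (of_real s)) z = 0"
   unfolding quad_op_def using ladder_ode[OF hs z] by simp
 qed
qed

text \<open>For fixed z the left side is a function of s that vanishes on a real interval near 0 and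
  is holomorphic on a strip ending at Re s = 1. The given exponents sit on the boundary of this
  strip, so the identity theorem is followed by a limit along the real axis.\<close>

lemma full_ode:
 assumes z: "z \<in> Om"
 shows "quad_op (PP 1) (QQ 1) (RR 1) (Hs 1) z = 0"
proof -
 interpret cutoff z "min (cmod z) (cmod (z - 1))" by unfold_locales (use z in auto)
 obtain s1 where s1: "s1 > 0" "\<And>s z. 0 < s \<Longrightarrow> s \<le> s1 \<Longrightarrow> z \<in> Om \<Longrightarrow> integrable (config N) (psi N (sca (of_real s) a) (sce (of_real s) e) z)"
  "\<And>s z. 0 < s \<Longrightarrow> s \<le> s1 \<Longrightarrow> z \<in> Om \<Longrightarrow> quad_op (PP (of_real s)) (QQ (of_real s)) (RR (of_real s)) (Hs (of_real s)) z = 0"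
  by (rule small_ode) blast
 \<comment> \<open>Strictly below both s1 and 1, so that the equation is known on a whole interval
   of real parameters inside the strip.\<close>
 define s0 where "s0 = min s1 1 / 2"
 have s0: "0 < s0" "s0 < 1" "s0 < s1" using s1(1) by (auto simp: s0_def)
 note GR = GS_regular[OF int[OF z] s1(2)[OF s0(1) less_imp_le[OF s0(3)] z] s0(1,2)]
 define g where "g s = (\<Sum>k\<le>4. qc (PP s) (QQ s) (RR s) k z * z ^ k * (deriv ^^ k) (\<lambda>w. GS N a e w s) 0)" for s
 have eq: "quad_op (PP (of_real s)) (QQ (of_real s)) (RR (of_real s)) (Hs (of_real s)) z = g (of_real s)"
  if s: "s \<in> {s0..1}" and i: "\<And>z. z \<in> Om \<Longrightarrow> integrable (config N) (psi N (sca (of_real s) a) (sce (of_real s) e) z)" for s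
 proof -
  interpret q: quartic_triple "PP (of_real s)" "QQ (of_real s)" "RR (of_real s)" by (rule quartic_PP)
  have "(wirtinger ^^ k) (Hs (of_real s)) z = (deriv ^^ k) (\<lambda>w. GS N a e w (of_real s)) 0" for k
   unfolding Hs_def[abs_def] by (rule wirtinger_power_psi[OF i[OF z]])
  then show ?thesis
   using quad_op_expand[OF open_Om wsmooth_Hs[OF i] z, of "PP (of_real s)" "QQ (of_real s)" "RR (of_real s)"] q.deg by (simp add: g_def)
 qed
 define S where "S = {s. s0 < Re s \<and> Re s < 1 \<and> \<bar>Im s\<bar> < 1}"
 have S_eq: "S = {s. s0 < Re s} \<inter> {s. Re s < 1} \<inter> {s. Im s < 1} \<inter> {s. - 1 < Im s}" by (auto simp: S_def)
 have S: "open S" "convex S"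
  unfolding S_eq by (auto intro!: open_Int convex_Int open_halfspace_Re_gt open_halfspace_Re_lt open_halfspace_Im_lt open_halfspace_Im_gt
    convex_halfspace_Re_gt convex_halfspace_Re_lt convex_halfspace_Im_lt convex_halfspace_Im_gt)
 have gS: "g holomorphic_on S"
  unfolding g_def by (intro holomorphic_intros GR(1)[folded S_def] holomorphic_on_subset[OF qc_hol[OF hol_poly_ladder]]) auto
 have g0: "g (of_real s) = 0" if "s0 < s" "s < 1" for s
 proof (rule analytic_continuation[OF gS S(1) convex_connected[OF S(2)]])
  define t where "t = min s1 1"
  have t: "s0 < t" "t \<le> s1" "t \<le> 1" using s0 by (auto simp: t_def)
  define U where "U = complex_of_real ` {s0<..<t}"
  show "U \<subseteq> S" using t by (auto simp: U_def S_def)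
  show "of_real ((s0 + t) / 2) \<in> S" using t by (auto simp: S_def)
  show "complex_of_real ((s0 + t) / 2) islimpt U"
   unfolding U_def islimpt_approachable
  proof (intro allI impI)
   fix \<epsilon> :: real assume e: "0 < \<epsilon>"
   define y where "y = (s0 + t) / 2 + min (\<epsilon> / 2) ((t - s0) / 4)"
   have y: "y \<in> {s0<..<t}" "y \<noteq> (s0 + t) / 2" "\<bar>y - (s0 + t) / 2\<bar> < \<epsilon>" using e t(1) by (auto simp: y_def min_def field_simps)
   have "dist (complex_of_real y) (of_real ((s0 + t) / 2)) < \<epsilon>" using y(3) by (simp only: dist_of_real dist_real_def)
   moreover have "complex_of_real y \<noteq> of_real ((s0 + t) / 2)" using y(2) of_real_eq_iff by blast
   ultimately show "\<exists>x'\<in>complex_of_real ` {s0<..<t}. x' \<noteq> of_real ((s0 + t) / 2) \<and> dist x' (of_real ((s0 + t) / 2)) < \<epsilon>" using y(1) by blast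
  qed
  show "g u = 0" if u: "u \<in> U" for u
  proof -
   obtain r where r: "u = of_real r" "r \<in> {s0<..<t}" using u unfolding U_def by blast
   then have rr: "0 < r" "r \<le> s1" "r \<in> {s0..1}" using s0 t by auto
   show ?thesis using eq[OF rr(3) s1(2)[OF rr(1,2)]] s1(3)[OF rr(1,2) z] r(1) by simp
  qed
  show "of_real s \<in> S" using that by (simp add: S_def)
 qed
 have cont: "continuous_on {s0..1} (\<lambda>s. g (of_real s))"
  unfolding g_def
  by (intro continuous_intros GR(2) continuous_on_compose2[OF holomorphic_on_imp_continuous_on[OF qc_hol[OF hol_poly_ladder]]]) auto
 have "g (of_real 1) = 0"
 proof (rule continuous_constant_on_closure[where S="{s0<..<1}" and f="\<lambda>s. g (of_real s)"])
  show "continuous_on (closure {s0<..<1}) (\<lambda>s. g (of_real s))" using cont s0 by simp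
  show "g (of_real s) = 0" if "s \<in> {s0<..<1}" for s using g0 that by simp
  show "1 \<in> closure {s0<..<1}" using s0 by simp
 qed
 moreover have "sca 1 a = a" "sce 1 e = e" by (simp_all add: sca_def[abs_def] sce_def[abs_def])
 ultimately show ?thesis using eq[of 1] int s0 by simp
qed

end

theorem theorem1p3:
  fixes \<gamma> :: complex and \<alpha>s \<alpha>1 \<alpha>2 \<alpha>3 :: "complex^2" and n1 n2 :: nat
    and H :: "complex \<Rightarrow> complex"
  assumes "\<gamma> \<noteq> 0"
    and "\<alpha>s = - ((\<gamma> / 2) *s coweight2)"
    and "\<alpha>2 = - (\<gamma> *s coweight1)"
    and "\<alpha>s + \<alpha>1 + \<alpha>2 + \<alpha>3 - 2 *s background_charge \<gamma>
           = - (\<gamma> *s (of_nat n1 *s root1 + of_nat n2 *s root2))"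
    and "\<And>z. z \<notin> {0, 1} \<Longrightarrow> correlation_well_defined \<gamma> \<alpha>s \<alpha>1 \<alpha>2 n1 n2 z"
    and "H = reduced_correlation \<gamma> \<alpha>s \<alpha>1 \<alpha>2 n1 n2"
  shows "(\<forall>k<4. \<forall>z. z \<notin> {0, 1} \<longrightarrow> (wirtinger ^^ k) H differentiable (at z)) \<and>
         (\<exists>A B At Bt :: nat \<Rightarrow> complex.
            fuchsian 4 (BPZ_operator A B At Bt) \<and>
            (\<forall>z. z \<notin> {0, 1} \<longrightarrow> BPZ_operator A B At Bt H z = 0))"
proof -
  define a where "a = lcoef n1 (1 - \<gamma> * form \<alpha>1 root1 / 2) (1 - \<gamma> * form \<alpha>1 root2 / 2)"
  define e where "e = lexp n1 (n1 + n2) (\<gamma>^2 / 2)"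
  have DF: "DF_integrand \<gamma> \<alpha>s \<alpha>1 \<alpha>2 n1 n2 z = psi (n1 + n2) a e z" for z
    unfolding a_def e_def by (rule ext) (rule DF_integrand_psi[OF assms(2,3)])
  interpret dotsenko_fateev n1 n2 "n1 + n2" "1 - \<gamma> * form \<alpha>1 root1 / 2" "1 - \<gamma> * form \<alpha>1 root2 / 2" "\<gamma>^2 / 2"
  proof
    show "\<gamma>^2 / 2 \<noteq> 0" using assms(1) by simp
    show "integrable (config (n1 + n2)) (psi (n1 + n2) (lcoef n1 (1 - \<gamma> * form \<alpha>1 root1 / 2) (1 - \<gamma> * form \<alpha>1 root2 / 2)) (lexp n1 (n1 + n2) (\<gamma>^2 / 2)) z)"
      if "z \<in> Om" for z
      using assms(5)[of z] that unfolding correlation_well_defined_def DF DF_measure_def a_def e_def by simp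
  qed simp
  have one: "sca 1 b = b" "sce 1 f = f" for b f by (simp_all add: sca_def[abs_def] sce_def[abs_def])
  \<comment> \<open>The prefactors cancel only away from 0 and 1, where \<open>abs_powr\<close>
    vanishes. As \<open>Om\<close> is open, the Wirtinger derivatives there are unaffected.\<close>
  have H: "Hs 1 z = H z" if "z \<in> Om" for z
    using that unfolding assms(6) Hs_def one by (simp add: reduced_correlation_eq DF a_def e_def)
  have sm1: "wsmooth Om (Hs 1)" by (rule wsmooth_Hs) (simp only: one int)
  have sm: "wsmooth Om H" by (rule wsmooth_cong[OF open_Om H sm1])
  interpret q: quartic_triple "PP 1" "QQ 1" "RR 1" by (rule quartic_PP)
  from q.BPZ_operator_exists obtain A B At Bt where BPZ: "fuchsian 4 (BPZ_operator A B At Bt)"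
    "\<And>S f z. open S \<Longrightarrow> wsmooth S f \<Longrightarrow> z \<in> S \<Longrightarrow> BPZ_operator A B At Bt f z = quad_op (PP 1) (QQ 1) (RR 1) f z" by blast
  have "BPZ_operator A B At Bt H z = 0" if z: "z \<in> Om" for z
  proof -
    have d: "degree (PP 1) \<le> 4" "degree (QQ 1) \<le> 4" "degree (RR 1) \<le> 4" using q.deg by simp_all
    have "(wirtinger ^^ k) H z = (wirtinger ^^ k) (Hs 1) z" for k
      by (rule wirtinger_power_cong[OF open_Om H[symmetric] z])
    then have "quad_op (PP 1) (QQ 1) (RR 1) H z = quad_op (PP 1) (QQ 1) (RR 1) (Hs 1) z"
      unfolding quad_op_expand[OF open_Om sm z d] quad_op_expand[OF open_Om sm1 z d] by simp
    then show ?thesis unfolding BPZ(2)[OF open_Om sm z] full_ode[OF z] .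
  qed
  moreover have "(wirtinger ^^ k) H differentiable (at z)" if "z \<in> Om" for k z
    using sm that by (simp add: wsmooth_def)
  ultimately show ?thesis using BPZ(1) by auto
qed

end
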